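(* Let $p$ be an odd prime and $s\ge0$. Given an unstable module $M$ over the mod $p$ Steenrod algebra, the set $$\mathscr{S}=\left\{Q^I\otimes\ell=\beta^{\epsilon_1}Q^{i_1}\cdots\beta^{\epsilon_s}Q^{i_s}\otimes\ell:\ \ell\in M^\#,\ I\in\mathscr{I}_{|\ell|}\right\}$$ (with $\ell$ running over a homogeneous basis of $M^\#$) represents an $\mathbb{F}_p$-basis of $(\mathscr{R}_sM)^\#$.
   Context: $A$ is the mod $p$ Steenrod algebra, $\#$ the graded linear dual; $P_s=H^*(B(\mathbb{Z}/p)^s;\mathbb{F}_p)=E(x_1,\dots,x_s)\otimes\mathbb{F}_p[y_1,\dots,y_s]$, $|x_i|=1$, $y_i=\beta x_i$. $M$ is unstable if $\beta^\epsilon P^ix=0$ whenever $\epsilon+2i>\deg x$. **Lambda and Dyer-Lashof algebras.** $\Lambda$ is the graded associative unital $\mathbb{F}_p$-algebra generated by $\lambda^1_{i-1}=\lambda_{i-1}$ ($i\ge1$) of degree $2i(p-1)-1$ and $\lambda^0_{i-1}=\mu_{i-1}$ ($i\ge0$) of degree $2i(p-1)$, with relations, for $n\ge0$: for $m\ge1$, $\sum_{i+j=n}\binom{n}{i}\lambda_{i-1+pm}\lambda_{j-1+m}=0$ and $\sum_{i+j=n}\binom{n}{i}(\lambda_{i-1+pm}\mu_{j-1+m}-\mu_{i-1+pm}\lambda_{j-1+m})=0$; for $m\ge0$, $\sum_{i+j=n}\binom{n}{i}\lambda_{i+pm}\mu_{j-1+m}=0$ and $\sum_{i+j=n}\binom{n}{i}\mu_{i+pm}\mu_{j-1+m}=0$.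 For $I=(\epsilon_1,i_1,\dots,\epsilon_s,i_s)$ write $\lambda_I=\lambda^{\epsilon_1}_{i_1-1}\cdots\lambda^{\epsilon_s}_{i_s-1}$; $\Lambda_s$ is the span of these. $I$ is admissible if $pi_k-\epsilon_k\ge i_{k-1}$ for $2\le k\le s$; its excess is $e(I)=2i_1-\epsilon_1-\sum_{k=2}^s2(p-1)i_k+\sum_{k=2}^s\epsilon_k$. $\mathscr{I}_n$ is the set of admissible $I$ (of length $s$) with $e(I)\ge n$. $R$ is the quotient of $\Lambda$ by the two-sided ideal generated by monomials of negative excess, $Q^I=\beta^{\epsilon_1}Q^{i_1}\cdots\beta^{\epsilon_s}Q^{i_s}$ is the image of $\lambda_I$, $R_s$ the span of length-$s$ monomials. **Singer construction.** $[r_1,\dots,r_s]=\det(y_i^{p^{r_j}})$, $L_{s,i}=[0,\dots,\hat i,\dots,s]$, $L_s=L_{s,s}$, $L_0=1$, $q_{s,i}=L_{s,i}/L_s$, $V_s=L_s/L_{s-1}$, $D[s]=\mathbb{F}_p[q_{s,0},\dots,q_{s,s-1}]$; $[k;r_{k+1},\dots,r_s]=\frac1{k!}\sum_{\sigma\in S_s}\operatorname{sgn}(\sigma)x_{\sigma(1)}\cdots x_{\sigma(k)}y_{\sigma(k+1)}^{p^{r_{k+1}}}\cdots y_{\sigma(s)}^{p^{r_s}}$; $M_{s;i_1,\dots,i_k}=[k;0,\dots,\hat i_1,\dots,\hat i_k,\dots,s-1]$ for $0\le i_1<\dots<i_k\le s-1$. In $P_s[L_s^{-1}]$ put $u_i=M_{i;i-1}/L_{i-1}$,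 $v_i=V_i/q_{i-1,0}$ ($q_{0,0}=1$). $\mathscr{B}[s]$ is the free $D[s]$-module on $1$ and all $M_{s;i_1,\dots,i_k}L_s^{p-2+(p-1)[\frac{k-1}2]}$; $\mathcal{B}[s]$ is the free $D[s]$-module on $L_s^{\frac{p-1}2}$ and all $M_{s;i_1,\dots,i_k}L_s^{\frac{p-3}2+(p-1)[\frac k2]}$. For $m\in M$, $$S_s(m)=\sum_{\epsilon_j\in\{0,1\},i_j\ge0}(-1)^{\sum(\epsilon_j+i_j)}u_s^{\epsilon_s}\cdots u_1^{\epsilon_1}v_1^{-(p-1)i_1-\epsilon_1}\cdots v_s^{-(p-1)i_s-\epsilon_s}\otimes\beta^{\epsilon_1}P^{i_1}\cdots\beta^{\epsilon_s}P^{i_s}m,$$ $St_s(m)=(-1)^{s[|m|/2]}L_s^{\frac{p-1}2|m|}S_s(m)$, and $\mathscr{R}_sM=\mathscr{B}[s]\cdot St_s(M^+)\oplus\mathcal{B}[s]\cdot St_s(M^-)\subset P_s\otimes M$ ($M^\pm$ = even/odd degree part). One has $\mathscr{R}_sM\subset\mathscr{B}[s]\cdot S_s(M)$. **Identification.** For $f\in\mathscr{B}[s]$ let $\nu_s(f)$ be the functional on $\Lambda_s$ whose value on $\lambda_I$ is $(-1)^{i_1+\dots+i_s+\sum_{l<k}\epsilon_l\epsilon_k}$ times the coefficient of $u_1^{\epsilon_1}v_1^{(p-1)i_1-\epsilon_1}\cdots u_s^{\epsilon_s}v_s^{(p-1)i_s-\epsilon_s}$ in $f$; this factors through $R_s$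 and gives $\mathscr{B}[s]\cong R_s^\#$. An element $Q^I\otimes\ell\in R_s\otimes M^\#$ represents the functional on $\mathscr{R}_sM$ obtained by restricting $fS_s(m)\mapsto\nu_s(f)(\lambda_I)\,\ell(m)$; in this way $(\mathscr{R}_sM)^\#$ is regarded as a quotient of $R_s\otimes M^\#$. *)

theory Defs
  imports
    "HOL-Library.Poly_Mapping"
    "HOL-Library.Function_Algebras"
    "HOL-Library.FSet"
    "HOL-Library.Cardinality"
    "HOL-Computational_Algebra.Fraction_Field"
    "HOL-Combinatorics.Permutations"
    "Jordan_Normal_Form.Determinant"
begin

text \<open>
  Throughout, \<open>'k\<close> is a field with \<open>p = CARD('k)\<close> elements, \<open>p\<close> an odd prime; so \<open>'k\<close> is the prime
  field of order \<open>p\<close>. Sequences \<open>(\<epsilon>\<^sub>1, i\<^sub>1, \<dots>, \<epsilon>\<^sub>s, i\<^sub>s)\<close> are lists of pairs \<open>(\<epsilon>\<^sub>k, i\<^sub>k)\<close>.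
\<close>

section \<open>Linear algebra\<close>

definition linear_on ::
  "('k::field \<Rightarrow> 'v::ab_group_add \<Rightarrow> 'v) \<Rightarrow> ('k \<Rightarrow> 'w::ab_group_add \<Rightarrow> 'w) \<Rightarrow> 'v set \<Rightarrow> ('v \<Rightarrow> 'w) \<Rightarrow> bool" where
  "linear_on sc1 sc2 W f \<longleftrightarrow>
     (\<forall>x\<in>W. \<forall>y\<in>W. f (x + y) = f x + f y) \<and> (\<forall>c. \<forall>x\<in>W. f (sc1 c x) = sc2 c (f x))"

definition scale_fun :: "'k::field \<Rightarrow> ('v \<Rightarrow> 'k) \<Rightarrow> 'v \<Rightarrow> 'k" where
  "scale_fun c f = (\<lambda>x. c * f x)"

definition is_basis :: "('k::field \<Rightarrow> 'v::ab_group_add \<Rightarrow> 'v) \<Rightarrow> 'v set \<Rightarrow> 'v set \<Rightarrow> bool" where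
  "is_basis sc V B \<longleftrightarrow> \<not> module.dependent sc B \<and> module.span sc B = V"

text \<open>
  The graded dual of a graded subspace \<open>W\<close> with homogeneous parts \<open>W \<inter> C n\<close>: the functionals on \<open>W\<close>
  that vanish on all but finitely many of these parts. A functional on \<open>W\<close> is a function that is
  extended by 0 outside \<open>W\<close>.
\<close>

definition graded_dual ::
  "('k::field \<Rightarrow> 'v::ab_group_add \<Rightarrow> 'v) \<Rightarrow> 'v set \<Rightarrow> (int \<Rightarrow> 'v set) \<Rightarrow> ('v \<Rightarrow> 'k) set" where
  "graded_dual sc W C =
     {\<phi>. linear_on sc (*) W \<phi> \<and> (\<forall>z. z \<notin> W \<longrightarrow> \<phi> z = 0) \<and> finite {n. \<exists>z \<in> W \<inter> C n. \<phi> z \<noteq> 0}}"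

definition dual_degree :: "('v \<Rightarrow> 'k::field) set \<Rightarrow> (int \<Rightarrow> 'v set) \<Rightarrow> int \<Rightarrow> ('v \<Rightarrow> 'k) set" where
  "dual_degree D C n = {\<phi> \<in> D. \<forall>j. j \<noteq> n \<longrightarrow> (\<forall>z \<in> C j. \<phi> z = 0)}"

definition homogeneous_basis ::
  "('k::field \<Rightarrow> 'v::ab_group_add \<Rightarrow> 'v) \<Rightarrow> (int \<Rightarrow> 'v set) \<Rightarrow> ('v \<Rightarrow> 'k) set \<Rightarrow> bool" where
  "homogeneous_basis sc C B \<longleftrightarrow>
     is_basis scale_fun (graded_dual sc UNIV C) B \<and>
     B \<subseteq> (\<Union>n. dual_degree (graded_dual sc UNIV C) C n)"

section \<open>Tensor products\<close>

text \<open>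
  The tensor product of abelian groups. It is only applied to vector spaces over a prime field
  \<open>'k\<close>, where every scalar is a multiple of 1; so it is the tensor product over \<open>'k\<close>.
\<close>

inductive_set tensor_relations :: "(('a::ab_group_add \<times> 'b::ab_group_add) \<Rightarrow>\<^sub>0 int) set" where
  zero: "0 \<in> tensor_relations"
| left: "frag_of (a + a', b) - frag_of (a, b) - frag_of (a', b) \<in> tensor_relations"
| right: "frag_of (a, b + b') - frag_of (a, b) - frag_of (a, b') \<in> tensor_relations"
| diff: "x \<in> tensor_relations \<Longrightarrow> y \<in> tensor_relations \<Longrightarrow> x - y \<in> tensor_relations"

lemma tensor_relations_uminus: "x \<in> tensor_relations \<Longrightarrow> - x \<in> tensor_relations"
  using tensor_relations.diff[OF tensor_relations.zero, of x] by simp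

lemma tensor_relations_add:
  "x \<in> tensor_relations \<Longrightarrow> y \<in> tensor_relations \<Longrightarrow> x + y \<in> tensor_relations"
  using tensor_relations.diff[OF _ tensor_relations_uminus, of x y] by simp

quotient_type (overloaded) ('a, 'b) tensor =
  "('a::ab_group_add \<times> 'b::ab_group_add) \<Rightarrow>\<^sub>0 int" / "\<lambda>x y. x - y \<in> tensor_relations"
proof (rule equivpI)
  show "reflp (\<lambda>x y :: ('a \<times> 'b) \<Rightarrow>\<^sub>0 int. x - y \<in> tensor_relations)"
    by (auto intro!: reflpI tensor_relations.zero)
  show "symp (\<lambda>x y :: ('a \<times> 'b) \<Rightarrow>\<^sub>0 int. x - y \<in> tensor_relations)"
    by (rule sympI) (metis minus_diff_eq tensor_relations_uminus)
  show "transp (\<lambda>x y :: ('a \<times> 'b) \<Rightarrow>\<^sub>0 int. x - y \<in> tensor_relations)"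
    by (rule transpI) (drule (1) tensor_relations_add, simp)
qed

instantiation tensor :: (ab_group_add, ab_group_add) ab_group_add
begin

lift_definition zero_tensor :: "('a, 'b) tensor" is 0 .
lift_definition plus_tensor :: "('a, 'b) tensor \<Rightarrow> ('a, 'b) tensor \<Rightarrow> ('a, 'b) tensor" is "(+)"
  by (metis add_diff_add tensor_relations_add)
lift_definition uminus_tensor :: "('a, 'b) tensor \<Rightarrow> ('a, 'b) tensor" is uminus
  by (metis minus_diff_minus tensor_relations_uminus)
lift_definition minus_tensor :: "('a, 'b) tensor \<Rightarrow> ('a, 'b) tensor \<Rightarrow> ('a, 'b) tensor" is "(-)"
proof -
  fix a b c d :: "('a \<times> 'b) \<Rightarrow>\<^sub>0 int"
  assume "a - b \<in> tensor_relations" "c - d \<in> tensor_relations"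
  moreover have "a - c - (b - d) = (a - b) - (c - d)" by simp
  ultimately show "a - c - (b - d) \<in> tensor_relations" by (metis tensor_relations.diff)
qed

instance
  by standard (transfer; simp add: algebra_simps tensor_relations.zero)+

end

lift_definition tens :: "'a::ab_group_add \<Rightarrow> 'b::ab_group_add \<Rightarrow> ('a, 'b) tensor"
  is "\<lambda>a b. frag_of (a, b)" .

lemma frag_extend_tensor_relations:
  fixes r :: "'r::ring" and x :: "('r \<times> 'b::ab_group_add) \<Rightarrow>\<^sub>0 int"
  assumes "x \<in> tensor_relations"
  shows "frag_extend (\<lambda>(a, b). frag_of (r * a, b)) x \<in> tensor_relations"
  using assms
  by induction
    (auto simp: frag_extend_diff frag_extend_of distrib_left intro: tensor_relations.intros)

text \<open>The module structure \<open>r (a \<otimes> b) = (r a) \<otimes> b\<close> over a ring containing \<open>'k\<close>.\<close>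

lift_definition act :: "'r::ring \<Rightarrow> ('r, 'b::ab_group_add) tensor \<Rightarrow> ('r, 'b) tensor"
  is "\<lambda>r. frag_extend (\<lambda>(a, b). frag_of (r * a, b))"
  by (metis frag_extend_diff frag_extend_tensor_relations)

section \<open>Exterior algebras\<close>

text \<open>
  The exterior algebra over a commutative ring on generators indexed by the natural numbers. The
  element with coefficients \<open>c A\<close> is the sum of the \<open>c A x\<^sub>A\<close>, where \<open>x\<^sub>A\<close> is the product of the
  generators \<open>x\<^sub>a\<close>, \<open>a \<in> A\<close>, in increasing order.
\<close>

typedef (overloaded) 'a ext = "UNIV :: (nat fset \<Rightarrow>\<^sub>0 'a::zero) set"
  morphisms ext_coeffs Ext ..

setup_lifting type_definition_ext

definition ext_sign :: "nat fset \<Rightarrow> nat fset \<Rightarrow> 'a::ring_1" where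
  "ext_sign A B = (-1) ^ card {(a, b). a |\<in>| A \<and> b |\<in>| B \<and> b < a}"

definition ext_mult ::
  "(nat fset \<Rightarrow>\<^sub>0 'a::comm_ring_1) \<Rightarrow> (nat fset \<Rightarrow>\<^sub>0 'a) \<Rightarrow> (nat fset \<Rightarrow>\<^sub>0 'a)" where
  "ext_mult f g =
     (\<Sum>A\<in>Poly_Mapping.keys f. \<Sum>B\<in>Poly_Mapping.keys g.
        if A |\<inter>| B = {||}
        then Poly_Mapping.single (A |\<union>| B)
               (ext_sign A B * Poly_Mapping.lookup f A * Poly_Mapping.lookup g B)
        else 0)"

lemma ext_mult_superset:
  assumes "finite S" "finite T" "Poly_Mapping.keys f \<subseteq> S" "Poly_Mapping.keys g \<subseteq> T"
  shows "ext_mult f g =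
     (\<Sum>A\<in>S. \<Sum>B\<in>T.
        if A |\<inter>| B = {||}
        then Poly_Mapping.single (A |\<union>| B)
               (ext_sign A B * Poly_Mapping.lookup f A * Poly_Mapping.lookup g B)
        else 0)"
  unfolding ext_mult_def
proof (rule sum.mono_neutral_cong_left)
  show "\<forall>A\<in>S - Poly_Mapping.keys f. (\<Sum>B\<in>T. if A |\<inter>| B = {||}
        then Poly_Mapping.single (A |\<union>| B)
               (ext_sign A B * Poly_Mapping.lookup f A * Poly_Mapping.lookup g B)
        else 0) = 0"
    by (auto simp: in_keys_iff intro!: sum.neutral)
next
  fix A
  show "(\<Sum>B\<in>Poly_Mapping.keys g. if A |\<inter>| B = {||}
        then Poly_Mapping.single (A |\<union>| B)
               (ext_sign A B * Poly_Mapping.lookup f A * Poly_Mapping.lookup g B)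
        else 0) = (\<Sum>B\<in>T. if A |\<inter>| B = {||}
        then Poly_Mapping.single (A |\<union>| B)
               (ext_sign A B * Poly_Mapping.lookup f A * Poly_Mapping.lookup g B)
        else 0)"
    using assms by (intro sum.mono_neutral_left) (auto simp: in_keys_iff)
qed (use assms in auto)

lemma ext_mult_add_left: "ext_mult (f + f') g = ext_mult f g + ext_mult f' g"
proof -
  let ?S = "Poly_Mapping.keys f \<union> Poly_Mapping.keys f'"
  let ?T = "Poly_Mapping.keys g"
  show ?thesis
    using Poly_Mapping.keys_add[of f f']
    by (subst (1 2 3) ext_mult_superset[of ?S ?T])
      (auto simp: lookup_add distrib_left distrib_right single_add
        simp flip: sum.distrib intro!: sum.cong)
qed

lemma ext_mult_add_right: "ext_mult g (f + f') = ext_mult g f + ext_mult g f'"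
proof -
  let ?S = "Poly_Mapping.keys f \<union> Poly_Mapping.keys f'"
  let ?T = "Poly_Mapping.keys g"
  show ?thesis
    using Poly_Mapping.keys_add[of f f']
    by (subst (1 2 3) ext_mult_superset[of ?T ?S])
      (auto simp: lookup_add distrib_left distrib_right single_add
        simp flip: sum.distrib intro!: sum.cong)
qed

lemma ext_mult_0_left [simp]: "ext_mult 0 g = 0"
  and ext_mult_0_right [simp]: "ext_mult g 0 = 0"
  by (simp_all add: ext_mult_def)

lemma ext_mult_sum_left: "ext_mult (sum f S) g = (\<Sum>i\<in>S. ext_mult (f i) g)"
  by (induction S rule: infinite_finite_induct) (simp_all add: ext_mult_add_left)

lemma ext_mult_sum_right: "ext_mult g (sum f S) = (\<Sum>i\<in>S. ext_mult g (f i))"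
  by (induction S rule: infinite_finite_induct) (simp_all add: ext_mult_add_right)

lemma ext_mult_single:
  "ext_mult (Poly_Mapping.single A a) (Poly_Mapping.single B b) =
     (if A |\<inter>| B = {||} then Poly_Mapping.single (A |\<union>| B) (ext_sign A B * a * b) else 0)"
  by (subst ext_mult_superset[of "{A}" "{B}"]) auto

lemma finite_inversions [simp]: "finite {(a::nat, b::nat). a |\<in>| A \<and> b |\<in>| B \<and> b < a}"
  by (rule finite_subset[of _ "fset A \<times> fset B"]) auto

lemma ext_sign_union_left:
  assumes "A |\<inter>| B = {||}"
  shows "ext_sign (A |\<union>| B) C = ext_sign A C * (ext_sign B C :: 'a::ring_1)"
proof -
  have "{(a, b). a |\<in>| A |\<union>| B \<and> b |\<in>| C \<and> b < a} =
        {(a, b). a |\<in>| A \<and> b |\<in>| C \<and> b < a} \<union> {(a, b). a |\<in>| B \<and> b |\<in>| C \<and> b < a}"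
    by auto
  moreover have "{(a, b). a |\<in>| A \<and> b |\<in>| C \<and> b < a} \<inter> {(a, b). a |\<in>| B \<and> b |\<in>| C \<and> b < a} = {}"
    using assms by (auto simp: fset_eq_iff)
  ultimately show ?thesis
    by (simp add: ext_sign_def card_Un_disjoint power_add)
qed

lemma ext_sign_union_right:
  assumes "B |\<inter>| C = {||}"
  shows "ext_sign A (B |\<union>| C) = ext_sign A B * (ext_sign A C :: 'a::ring_1)"
proof -
  have "{(a, b). a |\<in>| A \<and> b |\<in>| B |\<union>| C \<and> b < a} =
        {(a, b). a |\<in>| A \<and> b |\<in>| B \<and> b < a} \<union> {(a, b). a |\<in>| A \<and> b |\<in>| C \<and> b < a}"
    by auto
  moreover have "{(a, b). a |\<in>| A \<and> b |\<in>| B \<and> b < a} \<inter> {(a, b). a |\<in>| A \<and> b |\<in>| C \<and> b < a} = {}"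
    using assms by (auto simp: fset_eq_iff)
  ultimately show ?thesis
    by (simp add: ext_sign_def card_Un_disjoint power_add)
qed

lemma ext_mult_assoc_single:
  "ext_mult (ext_mult (Poly_Mapping.single A a) (Poly_Mapping.single B b)) (Poly_Mapping.single C c) =
   ext_mult (Poly_Mapping.single A a) (ext_mult (Poly_Mapping.single B b) (Poly_Mapping.single C c))"
proof (cases "A |\<inter>| B = {||} \<and> A |\<inter>| C = {||} \<and> B |\<inter>| C = {||}")
  case True
  then have "(A |\<union>| B) |\<inter>| C = {||}" "A |\<inter>| (B |\<union>| C) = {||}"
    by (auto simp: fset_eq_iff)
  with True show ?thesis
    by (simp add: ext_mult_single ext_sign_union_left ext_sign_union_right sup_assoc mult_ac)
next
  case False
  then show ?thesis
    by (auto simp: ext_mult_single inf_sup_distrib1 inf_sup_distrib2)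
qed

lemma sum_of_singles:
  "f = (\<Sum>A\<in>Poly_Mapping.keys f. Poly_Mapping.single A (Poly_Mapping.lookup f A))"
  by (rule poly_mapping_eqI) (auto simp: lookup_sum lookup_single when_def in_keys_iff)

lemma ext_mult_assoc: "ext_mult (ext_mult f g) h = ext_mult f (ext_mult g h)"
  by (subst (1 2) sum_of_singles[of f], subst (1 2) sum_of_singles[of g],
      subst (1 2) sum_of_singles[of h])
    (simp add: ext_mult_sum_left ext_mult_sum_right ext_mult_assoc_single)

lemma ext_sign_empty [simp]: "ext_sign {||} A = 1" "ext_sign A {||} = 1"
  by (simp_all add: ext_sign_def)

lemma ext_mult_one_left: "ext_mult (Poly_Mapping.single {||} 1) f = f"
  by (subst (1 2) sum_of_singles[of f]) (simp add: ext_mult_sum_right ext_mult_single)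

lemma ext_mult_one_right: "ext_mult f (Poly_Mapping.single {||} 1) = f"
  by (subst (1 2) sum_of_singles[of f]) (simp add: ext_mult_sum_left ext_mult_single)

instantiation ext :: (comm_ring_1) ring_1
begin

lift_definition zero_ext :: "'a ext" is 0 .
lift_definition one_ext :: "'a ext" is "Poly_Mapping.single {||} 1" .
lift_definition plus_ext :: "'a ext \<Rightarrow> 'a ext \<Rightarrow> 'a ext" is "(+)" .
lift_definition uminus_ext :: "'a ext \<Rightarrow> 'a ext" is uminus .
lift_definition minus_ext :: "'a ext \<Rightarrow> 'a ext \<Rightarrow> 'a ext" is "(-)" .
lift_definition times_ext :: "'a ext \<Rightarrow> 'a ext \<Rightarrow> 'a ext" is ext_mult .

instance
proof
  show "(0::'a ext) \<noteq> 1"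
    by transfer (metis lookup_single_eq lookup_zero zero_neq_one)
qed (transfer; simp add: ext_mult_assoc ext_mult_one_left ext_mult_one_right
       ext_mult_add_left ext_mult_add_right algebra_simps)+

end

lift_definition ext_const :: "'a::comm_ring_1 \<Rightarrow> 'a ext" is "\<lambda>c. Poly_Mapping.single {||} c" .
lift_definition ext_gen :: "nat \<Rightarrow> 'a::comm_ring_1 ext" is "\<lambda>i. Poly_Mapping.single {|i|} 1" .

section \<open>Unstable modules over the Steenrod algebra\<close>

locale graded_space = vector_space scale
  for scale :: "'k::field \<Rightarrow> 'm::ab_group_add \<Rightarrow> 'm" +
  fixes M :: "int \<Rightarrow> 'm set"
  assumes homogeneous_subspace: "subspace (M n)"
    and direct_sum:
      "\<exists>!c :: int \<Rightarrow>\<^sub>0 'm. (\<forall>n. Poly_Mapping.lookup c n \<in> M n) \<and>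
         x = (\<Sum>n\<in>Poly_Mapping.keys c. Poly_Mapping.lookup c n)"

text \<open>
  A module over the Steenrod algebra, which is generated by the Bockstein and the reduced powers
  subject to the Adem relations, is a graded space with such operations satisfying these relations.
\<close>

locale steenrod_module = graded_space scale M
  for scale :: "'k::field \<Rightarrow> 'm::ab_group_add \<Rightarrow> 'm" and M :: "int \<Rightarrow> 'm set" +
  fixes bock :: "'m \<Rightarrow> 'm" and P :: "nat \<Rightarrow> 'm \<Rightarrow> 'm"
  assumes bock_linear: "Vector_Spaces.linear scale scale bock"
    and P_linear: "Vector_Spaces.linear scale scale (P i)"
    and bock_degree: "x \<in> M n \<Longrightarrow> bock x \<in> M (n + 1)"
    and P_degree: "x \<in> M n \<Longrightarrow> P i x \<in> M (n + 2 * int i * (int CARD('k) - 1))"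
    and P_0: "P 0 x = x"
    and bock_bock: "bock (bock x) = 0"
    and adem: "a < CARD('k) * b \<Longrightarrow>
      P a (P b x) =
        (\<Sum>t\<in>{t. CARD('k) * t \<le> a}.
           scale ((-1) ^ (a + t) * of_nat (((CARD('k) - 1) * (b - t) - 1) choose (a - CARD('k) * t)))
             (P (a + b - t) (P t x)))"
    and adem_bock: "a \<le> CARD('k) * b \<Longrightarrow>
      P a (bock (P b x)) =
        (\<Sum>t\<in>{t. CARD('k) * t \<le> a}.
           scale ((-1) ^ (a + t) * of_nat (((CARD('k) - 1) * (b - t)) choose (a - CARD('k) * t)))
             (bock (P (a + b - t) (P t x)))) +
        (\<Sum>t\<in>{t. CARD('k) * t + 1 \<le> a}.
           scale ((-1) ^ (a + t - 1) *
               of_nat (((CARD('k) - 1) * (b - t) - 1) choose (a - CARD('k) * t - 1)))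
             (P (a + b - t) (bock (P t x))))"

definition steenrod_letter :: "('m \<Rightarrow> 'm) \<Rightarrow> (nat \<Rightarrow> 'm \<Rightarrow> 'm) \<Rightarrow> bool \<times> nat \<Rightarrow> 'm \<Rightarrow> 'm" where
  "steenrod_letter bock P = (\<lambda>(e, i) x. if e then bock (P i x) else P i x)"

definition steenrod_word :: "('m \<Rightarrow> 'm) \<Rightarrow> (nat \<Rightarrow> 'm \<Rightarrow> 'm) \<Rightarrow> (bool \<times> nat) list \<Rightarrow> 'm \<Rightarrow> 'm" where
  "steenrod_word bock P I = foldr (steenrod_letter bock P) I"

locale unstable_module = steenrod_module +
  assumes unstable:
    "x \<in> M n \<Longrightarrow> of_bool e + 2 * int i > n \<Longrightarrow> steenrod_letter bock P (e, i) x = 0"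

section \<open>The algebras \<open>\<Lambda>\<close> and \<open>R\<close>\<close>

inductive_set two_sided_ideal :: "'a::ring set \<Rightarrow> 'a set" for G where
  zero: "0 \<in> two_sided_ideal G"
| generator: "g \<in> G \<Longrightarrow> g \<in> two_sided_ideal G"
| diff: "x \<in> two_sided_ideal G \<Longrightarrow> y \<in> two_sided_ideal G \<Longrightarrow> x - y \<in> two_sided_ideal G"
| mult_left: "x \<in> two_sided_ideal G \<Longrightarrow> a * x \<in> two_sided_ideal G"
| mult_right: "x \<in> two_sided_ideal G \<Longrightarrow> x * a \<in> two_sided_ideal G"

lemma two_sided_ideal_uminus: "x \<in> two_sided_ideal G \<Longrightarrow> - x \<in> two_sided_ideal G"
  using two_sided_ideal.diff[OF two_sided_ideal.zero, of x] by simp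

lemma two_sided_ideal_add:
  "x \<in> two_sided_ideal G \<Longrightarrow> y \<in> two_sided_ideal G \<Longrightarrow> x + y \<in> two_sided_ideal G"
  using two_sided_ideal.diff[OF _ two_sided_ideal_uminus, of x G y] by simp

lemma two_sided_ideal_equivp: "equivp (\<lambda>x y. x - y \<in> two_sided_ideal G)"
proof (rule equivpI)
  show "reflp (\<lambda>x y. x - y \<in> two_sided_ideal G)"
    by (auto intro!: reflpI two_sided_ideal.zero)
  show "symp (\<lambda>x y. x - y \<in> two_sided_ideal G)"
    by (rule sympI) (metis minus_diff_eq two_sided_ideal_uminus)
  show "transp (\<lambda>x y. x - y \<in> two_sided_ideal G)"
    by (rule transpI) (drule (1) two_sided_ideal_add, simp)
qed

lemma two_sided_ideal_cong:
  assumes "a - b \<in> two_sided_ideal G" "c - d \<in> two_sided_ideal G"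
  shows "a + c - (b + d) \<in> two_sided_ideal G"
    and "a - c - (b - d) \<in> two_sided_ideal G"
    and "- a - - b \<in> two_sided_ideal G"
    and "a * c - b * d \<in> two_sided_ideal G"
proof -
  show "a + c - (b + d) \<in> two_sided_ideal G"
    using two_sided_ideal_add[OF assms] by (simp add: algebra_simps)
  show "a - c - (b - d) \<in> two_sided_ideal G"
    using two_sided_ideal_add[OF assms(1) two_sided_ideal_uminus[OF assms(2)]]
    by (simp add: algebra_simps)
  show "- a - - b \<in> two_sided_ideal G"
    using two_sided_ideal_uminus[OF assms(1)] by (simp add: algebra_simps)
  show "a * c - b * d \<in> two_sided_ideal G"
    using two_sided_ideal_add[OF two_sided_ideal.mult_right[OF assms(1), of c]
        two_sided_ideal.mult_left[OF assms(2), of b]]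
    by (simp add: algebra_simps)
qed

text \<open>\<open>Lam n\<close> is \<open>\<lambda>\<^sub>n\<close> and \<open>Mu n\<close> is \<open>\<mu>\<^bsub>n-1\<^esub>\<close>, so that every value is one of the generators.\<close>

datatype generator = Lam nat | Mu nat

text \<open>Finitely supported functions on the free monoid form the free associative algebra.\<close>

datatype word = Word "generator list"

instantiation word :: monoid_add
begin
definition zero_word :: word where "zero_word = Word []"
fun plus_word :: "word \<Rightarrow> word \<Rightarrow> word" where "plus_word (Word v) (Word w) = Word (v @ w)"
instance
proof
  fix a b c :: word
  show "a + b + c = a + (b + c)" by (cases a; cases b; cases c) simp
  show "0 + a = a" by (cases a) (simp add: zero_word_def)
  show "a + 0 = a" by (cases a) (simp add: zero_word_def)
qed
end

type_synonym 'k free_algebra = "word \<Rightarrow>\<^sub>0 'k"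

text \<open>
  \<open>letter (\<epsilon>, i)\<close> is \<open>\<lambda>\<^sup>\<epsilon>\<close> with subscript \<open>i - 1\<close>. There is no generator for \<open>\<epsilon> = 1\<close>, \<open>i = 0\<close>; such
  pairs are excluded by \<open>lambda_sequence\<close>.
\<close>

definition letter :: "bool \<times> nat \<Rightarrow> generator" where
  "letter = (\<lambda>(e, i). if e then Lam (i - 1) else Mu i)"

definition lambda_sequence :: "(bool \<times> nat) list \<Rightarrow> bool" where
  "lambda_sequence I \<longleftrightarrow> (\<forall>(e, i) \<in> set I. e \<longrightarrow> i \<ge> 1)"

definition free_monomial :: "(bool \<times> nat) list \<Rightarrow> 'k::field free_algebra" where
  "free_monomial I = Poly_Mapping.single (Word (map letter I)) 1"

definition lambda_relations :: "'k::field free_algebra set" where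
  "lambda_relations =
     {\<Sum>i\<le>n. of_nat (n choose i) *
         free_monomial [(True, i + CARD('k) * m), (True, n - i + m)] | n m. m \<ge> 1} \<union>
     {\<Sum>i\<le>n. of_nat (n choose i) *
         (free_monomial [(True, i + CARD('k) * m), (False, n - i + m)] -
          free_monomial [(False, i + CARD('k) * m), (True, n - i + m)]) | n m. m \<ge> 1} \<union>
     {\<Sum>i\<le>n. of_nat (n choose i) *
         free_monomial [(True, i + CARD('k) * m + 1), (False, n - i + m)] | n m. True} \<union>
     {\<Sum>i\<le>n. of_nat (n choose i) *
         free_monomial [(False, i + CARD('k) * m + 1), (False, n - i + m)] | n m. True}"

quotient_type (overloaded) 'k lambda_algebra =
  "'k::field free_algebra" / "\<lambda>x y. x - y \<in> two_sided_ideal lambda_relations"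
  by (rule two_sided_ideal_equivp)

instantiation lambda_algebra :: (field) ring
begin
lift_definition zero_lambda_algebra :: "'a lambda_algebra" is 0 .
lift_definition plus_lambda_algebra :: "'a lambda_algebra \<Rightarrow> 'a lambda_algebra \<Rightarrow> 'a lambda_algebra" is "(+)"
  by (rule two_sided_ideal_cong)
lift_definition uminus_lambda_algebra :: "'a lambda_algebra \<Rightarrow> 'a lambda_algebra" is uminus
  by (rule two_sided_ideal_cong)
lift_definition minus_lambda_algebra :: "'a lambda_algebra \<Rightarrow> 'a lambda_algebra \<Rightarrow> 'a lambda_algebra" is "(-)"
  by (rule two_sided_ideal_cong)
lift_definition times_lambda_algebra :: "'a lambda_algebra \<Rightarrow> 'a lambda_algebra \<Rightarrow> 'a lambda_algebra" is "(*)"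
  by (rule two_sided_ideal_cong)
instance
  by standard (transfer; simp add: algebra_simps two_sided_ideal.zero)+
end

lift_definition lambda_const :: "'k::field \<Rightarrow> 'k lambda_algebra" is "\<lambda>c. Poly_Mapping.single 0 c" .
lift_definition lambda_monomial :: "(bool \<times> nat) list \<Rightarrow> 'k::field lambda_algebra" is free_monomial .

text \<open>The excess of a nonempty sequence.\<close>

definition excess :: "nat \<Rightarrow> (bool \<times> nat) list \<Rightarrow> int" where
  "excess p I =
     2 * int (snd (hd I)) - of_bool (fst (hd I))
     - (\<Sum>(e, i)\<leftarrow>tl I. 2 * (int p - 1) * int i) + (\<Sum>(e, i)\<leftarrow>tl I. of_bool e)"

quotient_type (overloaded) 'k dyer_lashof =
  "'k::field lambda_algebra" / "\<lambda>x y. x - y \<in> two_sided_ideal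
     {lambda_monomial I | I. I \<noteq> [] \<and> lambda_sequence I \<and> excess CARD('k) I < 0}"
  by (rule two_sided_ideal_equivp)

instantiation dyer_lashof :: (field) ring
begin
lift_definition zero_dyer_lashof :: "'a dyer_lashof" is 0 .
lift_definition plus_dyer_lashof :: "'a dyer_lashof \<Rightarrow> 'a dyer_lashof \<Rightarrow> 'a dyer_lashof" is "(+)"
  by (rule two_sided_ideal_cong)
lift_definition uminus_dyer_lashof :: "'a dyer_lashof \<Rightarrow> 'a dyer_lashof" is uminus
  by (rule two_sided_ideal_cong)
lift_definition minus_dyer_lashof :: "'a dyer_lashof \<Rightarrow> 'a dyer_lashof \<Rightarrow> 'a dyer_lashof" is "(-)"
  by (rule two_sided_ideal_cong)
lift_definition times_dyer_lashof :: "'a dyer_lashof \<Rightarrow> 'a dyer_lashof \<Rightarrow> 'a dyer_lashof" is "(*)"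
  by (rule two_sided_ideal_cong)
instance
  by standard (transfer; simp add: algebra_simps two_sided_ideal.zero)+
end

lift_definition dyer_lashof_const :: "'k::field \<Rightarrow> 'k dyer_lashof" is lambda_const .
lift_definition Q_monomial :: "(bool \<times> nat) list \<Rightarrow> 'k::field dyer_lashof" is lambda_monomial .

definition admissible :: "nat \<Rightarrow> (bool \<times> nat) list \<Rightarrow> bool" where
  "admissible p I \<longleftrightarrow>
     (\<forall>k. k + 1 < length I \<longrightarrow>
        int p * int (snd (I ! (k + 1))) - of_bool (fst (I ! (k + 1))) \<ge> int (snd (I ! k)))"

text \<open>
  The empty sequence has infinite excess: for \<open>s = 0\<close> it belongs to \<open>admissible_sequences p 0 n\<close> for
  all \<open>n\<close>.
\<close>

definition admissible_sequences :: "nat \<Rightarrow> nat \<Rightarrow> int \<Rightarrow> (bool \<times> nat) list set" where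
  "admissible_sequences p s n =
     {I. length I = s \<and> lambda_sequence I \<and> admissible p I \<and> (I = [] \<or> excess p I \<ge> n)}"

section \<open>Dickson and Mui invariants\<close>

text \<open>
  All the localizations \<open>P\<^sub>s[L\<^sub>s\<^sup>-\<^sup>1]\<close> are subrings of the exterior algebra on \<open>x\<^sub>1, x\<^sub>2, \<dots>\<close> over the field
  of rational functions in \<open>y\<^sub>1, y\<^sub>2, \<dots>\<close> (the variables with index 0 are not used).
\<close>

type_synonym 'k ratfun = "((nat \<Rightarrow>\<^sub>0 nat) \<Rightarrow>\<^sub>0 'k) fract"
type_synonym 'k ambient = "'k ratfun ext"

definition rconst :: "'k::field \<Rightarrow> 'k ratfun" where
  "rconst c = Fract (Poly_Mapping.single 0 c) 1"

definition yvar :: "nat \<Rightarrow> 'k::field ratfun" where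
  "yvar i = Fract (Poly_Mapping.single (Poly_Mapping.single i 1) 1) 1"

definition scale_ambient :: "'k::field \<Rightarrow> 'k ambient \<Rightarrow> 'k ambient" where
  "scale_ambient c f = ext_const (rconst c) * f"

text \<open>\<open>P_degree s a\<close> is the part of degree \<open>a\<close> of \<open>P\<^sub>s\<close>.\<close>

definition P_degree :: "nat \<Rightarrow> int \<Rightarrow> 'k::field ambient set" where
  "P_degree s a = module.span scale_ambient
     {prod_list (map ext_gen (sorted_list_of_set A)) * ext_const (\<Prod>i=1..s. yvar i ^ e i) | A e.
        A \<subseteq> {1..s} \<and> int (card A) + 2 * int (\<Sum>i=1..s. e i) = a}"

definition bracket :: "nat list \<Rightarrow> 'k::field ratfun" where
  "bracket rs = det (mat (length rs) (length rs) (\<lambda>(i, j). yvar (i + 1) ^ (CARD('k) ^ (rs ! j))))"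

text \<open>
  \<open>[k; r\<^bsub>k+1\<^esub>, \<dots>, r\<^sub>s]\<close>. The \<open>k!\<close> summands whose permutations differ by a permutation of \<open>{1..k}\<close>
  coincide. So division by \<open>k!\<close>, which also has to make sense for \<open>k \<ge> p\<close>, amounts to summing over the
  permutations that are increasing on \<open>{1..k}\<close>.
\<close>

definition mixed_bracket :: "nat \<Rightarrow> nat list \<Rightarrow> 'k::field ambient" where
  "mixed_bracket k rs =
     (\<Sum>\<sigma>\<in>{\<sigma>. \<sigma> permutes {1..k + length rs} \<and> strict_mono_on {1..k} \<sigma>}.
        of_int (sign \<sigma>) * prod_list (map (\<lambda>j. ext_gen (\<sigma> j)) [1..<k + 1]) *
        ext_const (\<Prod>j<length rs. yvar (\<sigma> (k + 1 + j)) ^ (CARD('k) ^ (rs ! j))))"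

definition mui_L_omit :: "nat \<Rightarrow> nat \<Rightarrow> 'k::field ratfun" where
  "mui_L_omit s i = bracket (filter (\<lambda>j. j \<noteq> i) [0..<s + 1])"

definition mui_L :: "nat \<Rightarrow> 'k::field ratfun" where
  "mui_L s = mui_L_omit s s"

definition dickson_q :: "nat \<Rightarrow> nat \<Rightarrow> 'k::field ratfun" where
  "dickson_q s i = mui_L_omit s i / mui_L s"

text \<open>\<open>mui_M s {i\<^sub>1, \<dots>, i\<^sub>k}\<close> is \<open>M\<^bsub>s;i\<^sub>1,\<dots>,i\<^sub>k\<^esub>\<close>.\<close>

definition mui_M :: "nat \<Rightarrow> nat set \<Rightarrow> 'k::field ambient" where
  "mui_M s J = mixed_bracket (card J) (filter (\<lambda>j. j \<notin> J) [0..<s])"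

definition mui_V :: "nat \<Rightarrow> 'k::field ratfun" where
  "mui_V s = mui_L s / mui_L (s - 1)"

definition mui_u :: "nat \<Rightarrow> 'k::field ambient" where
  "mui_u i = mui_M i {i - 1} * ext_const (inverse (mui_L (i - 1)))"

definition mui_v :: "nat \<Rightarrow> 'k::field ratfun" where
  "mui_v i = mui_V i / dickson_q (i - 1) 0"

inductive_set Dickson :: "nat \<Rightarrow> 'k::field ratfun set" for s where
  const: "rconst c \<in> Dickson s"
| q: "i < s \<Longrightarrow> dickson_q s i \<in> Dickson s"
| add: "f \<in> Dickson s \<Longrightarrow> g \<in> Dickson s \<Longrightarrow> f + g \<in> Dickson s"
| mult: "f \<in> Dickson s \<Longrightarrow> g \<in> Dickson s \<Longrightarrow> f * g \<in> Dickson s"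

definition Dickson_span :: "nat \<Rightarrow> (nat set \<Rightarrow> 'k::field ambient) \<Rightarrow> 'k ambient set" where
  "Dickson_span s g = {\<Sum>J\<in>Pow {..<s}. ext_const (d J) * g J | d. \<forall>J. d J \<in> Dickson s}"

text \<open>\<open>B_even s\<close> and \<open>B_odd s\<close> are the \<open>D[s]\<close>-modules by which \<open>St\<^sub>s\<close> of even and odd elements is
  multiplied; the index \<open>{}\<close> is for the first of the generators.\<close>

definition B_even :: "nat \<Rightarrow> 'k::field ambient set" where
  "B_even s = Dickson_span s (\<lambda>J.
     if J = {} then 1
     else mui_M s J *
       ext_const (mui_L s ^ (CARD('k) - 2 + (CARD('k) - 1) * ((card J - 1) div 2))))"

definition B_odd :: "nat \<Rightarrow> 'k::field ambient set" where
  "B_odd s = Dickson_span s (\<lambda>J.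
     if J = {} then ext_const (mui_L s ^ ((CARD('k) - 1) div 2))
     else mui_M s J *
       ext_const (mui_L s ^ ((CARD('k) - 3) div 2 + (CARD('k) - 1) * (card J div 2))))"

section \<open>The Singer construction\<close>

definition scale_tensor ::
  "'k::field \<Rightarrow> ('k ambient, 'm::ab_group_add) tensor \<Rightarrow> ('k ambient, 'm) tensor" where
  "scale_tensor c z = act (ext_const (rconst c)) z"

definition singer ::
  "('m \<Rightarrow> 'm) \<Rightarrow> (nat \<Rightarrow> 'm \<Rightarrow> 'm) \<Rightarrow> nat \<Rightarrow> 'm \<Rightarrow> ('k::field ambient, 'm::ab_group_add) tensor" where
  "singer bock P s m =
     (\<Sum>I\<in>{I. length I = s \<and> steenrod_word bock P I m \<noteq> 0}.
        tens
          ((-1) ^ (\<Sum>(e, i)\<leftarrow>I. of_bool e + i) *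
           prod_list (map (\<lambda>k. mui_u k ^ of_bool (fst (I ! (k - 1)))) (rev [1..<s + 1])) *
           ext_const (\<Prod>k=1..s. mui_v k powi
             (- (int CARD('k) - 1) * int (snd (I ! (k - 1))) - of_bool (fst (I ! (k - 1))))))
          (steenrod_word bock P I m))"

text \<open>\<open>St bock P s n m\<close> is \<open>St\<^sub>s(m)\<close> for \<open>m\<close> of degree \<open>n\<close>.\<close>

definition St ::
  "('m \<Rightarrow> 'm) \<Rightarrow> (nat \<Rightarrow> 'm \<Rightarrow> 'm) \<Rightarrow> nat \<Rightarrow> int \<Rightarrow> 'm \<Rightarrow> ('k::field ambient, 'm::ab_group_add) tensor"
  where
  "St bock P s n m =
     act (ext_const ((-1) powi (int s * (n div 2)) * mui_L s powi (int ((CARD('k) - 1) div 2) * n)))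
       (singer bock P s m)"

definition singer_module ::
  "('m \<Rightarrow> 'm) \<Rightarrow> (nat \<Rightarrow> 'm \<Rightarrow> 'm) \<Rightarrow> (int \<Rightarrow> 'm set) \<Rightarrow> nat \<Rightarrow>
     ('k::field ambient, 'm::ab_group_add) tensor set" where
  "singer_module bock P M s =
     {a + b | a b.
        a \<in> module.span scale_tensor
          {act f (St bock P s n m) | f n m. f \<in> B_even s \<and> even n \<and> m \<in> M n} \<and>
        b \<in> module.span scale_tensor
          {act f (St bock P s n m) | f n m. f \<in> B_odd s \<and> odd n \<and> m \<in> M n}}"

definition tensor_degree ::
  "(int \<Rightarrow> 'm set) \<Rightarrow> nat \<Rightarrow> int \<Rightarrow> ('k::field ambient, 'm::ab_group_add) tensor set" where
  "tensor_degree M s n = module.span scale_tensor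
     {tens f m | f m a b. f \<in> P_degree s a \<and> m \<in> M b \<and> a + b = n}"

definition singer_dual ::
  "('m \<Rightarrow> 'm) \<Rightarrow> (nat \<Rightarrow> 'm \<Rightarrow> 'm) \<Rightarrow> (int \<Rightarrow> 'm set) \<Rightarrow> nat \<Rightarrow>
     (('k::field ambient, 'm::ab_group_add) tensor \<Rightarrow> 'k) set" where
  "singer_dual bock P M s =
     graded_dual scale_tensor (singer_module bock P M s) (tensor_degree M s)"

section \<open>The identification with quotients of tensor products with \<open>R\<close>\<close>

text \<open>The monomial \<open>u\<^sub>1\<^sup>\<epsilon>\<^sup>1 v\<^sub>1\<^sup>a\<^sup>1 \<dots> u\<^sub>s\<^sup>\<epsilon>\<^sup>s v\<^sub>s\<^sup>a\<^sup>s\<close> is encoded by the list of the pairs \<open>(\<epsilon>\<^sub>k, a\<^sub>k)\<close>.\<close>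

definition uv_monomial :: "(bool \<times> int) list \<Rightarrow> 'k::field ambient" where
  "uv_monomial w = prod_list (map
     (\<lambda>k. mui_u k ^ of_bool (fst (w ! (k - 1))) * ext_const (mui_v k powi snd (w ! (k - 1))))
     [1..<length w + 1])"

definition uv_expansion :: "nat \<Rightarrow> 'k::field ambient \<Rightarrow> ((bool \<times> int) list \<Rightarrow>\<^sub>0 'k)" where
  "uv_expansion s f = (THE c. (\<forall>w\<in>Poly_Mapping.keys c. length w = s) \<and>
     f = (\<Sum>w\<in>Poly_Mapping.keys c. scale_ambient (Poly_Mapping.lookup c w) (uv_monomial w)))"

text \<open>\<open>nu f I\<close> is the value of \<open>\<nu>\<^sub>s(f)\<close> at \<open>\<lambda>\<^sub>I\<close>, where \<open>s\<close> is the length of \<open>I\<close>.\<close>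

definition nu :: "'k::field ambient \<Rightarrow> (bool \<times> nat) list \<Rightarrow> 'k" where
  "nu f I =
     (-1) ^ ((\<Sum>(e, i)\<leftarrow>I. i) + card {(l, k). l < k \<and> k < length I \<and> fst (I ! l) \<and> fst (I ! k)}) *
     Poly_Mapping.lookup (uv_expansion (length I) f)
       (map (\<lambda>(e, i). (e, (int CARD('k) - 1) * int i - of_bool e)) I)"

definition B_singer ::
  "('m \<Rightarrow> 'm) \<Rightarrow> (nat \<Rightarrow> 'm \<Rightarrow> 'm) \<Rightarrow> nat \<Rightarrow> ('k::field ambient, 'm::ab_group_add) tensor set" where
  "B_singer bock P s =
     module.span scale_tensor {act f (singer bock P s m) | f m. f \<in> B_even s}"

definition pairing ::
  "('m \<Rightarrow> 'm) \<Rightarrow> (nat \<Rightarrow> 'm \<Rightarrow> 'm) \<Rightarrow> (bool \<times> nat) list \<Rightarrow> ('m \<Rightarrow> 'k::field) \<Rightarrow>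
     ('k ambient, 'm::ab_group_add) tensor \<Rightarrow> 'k" where
  "pairing bock P I l = (THE \<psi>.
     linear_on scale_tensor (*) (B_singer bock P (length I)) \<psi> \<and>
     (\<forall>z. z \<notin> B_singer bock P (length I) \<longrightarrow> \<psi> z = 0) \<and>
     (\<forall>f\<in>B_even (length I). \<forall>m. \<psi> (act f (singer bock P (length I) m)) = nu f I * l m))"

text \<open>The functional on \<open>\<R>\<^sub>sM\<close> that is represented by \<open>Q\<^sup>I \<otimes> l\<close>.\<close>

definition represented ::
  "('m \<Rightarrow> 'm) \<Rightarrow> (nat \<Rightarrow> 'm \<Rightarrow> 'm) \<Rightarrow> (int \<Rightarrow> 'm set) \<Rightarrow> (bool \<times> nat) list \<Rightarrow> ('m \<Rightarrow> 'k::field) \<Rightarrow>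
     ('k ambient, 'm::ab_group_add) tensor \<Rightarrow> 'k" where
  "represented bock P M I l =
     (\<lambda>z. if z \<in> singer_module bock P M (length I) then pairing bock P I l z else 0)"

definition scale_R_tensor ::
  "'k::field \<Rightarrow> ('k dyer_lashof, 'n::ab_group_add) tensor \<Rightarrow> ('k dyer_lashof, 'n) tensor" where
  "scale_R_tensor c z = act (dyer_lashof_const c) z"

text \<open>\<open>R_tensor s D\<close> is \<open>R\<^sub>s \<otimes> D\<close> for a space \<open>D\<close> of functionals.\<close>

definition R_tensor ::
  "nat \<Rightarrow> ('m \<Rightarrow> 'k::field) set \<Rightarrow> ('k dyer_lashof, 'm \<Rightarrow> 'k) tensor set" where
  "R_tensor s D = module.span scale_R_tensor
     {tens (Q_monomial I) l | I l. length I = s \<and> lambda_sequence I \<and> l \<in> D}"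

text \<open>
  \<open>\<rho>\<close> is the linear map by which the dual of \<open>\<R>\<^sub>sM\<close> is regarded as a quotient of \<open>R\<^sub>s \<otimes> D\<close>. It is unique
  on \<open>R_tensor s D\<close>; it exists because the functionals \<open>\<nu>\<^sub>s(f)\<close> factor through \<open>R\<^sub>s\<close>.
\<close>

definition identification ::
  "('m \<Rightarrow> 'm) \<Rightarrow> (nat \<Rightarrow> 'm \<Rightarrow> 'm) \<Rightarrow> (int \<Rightarrow> 'm set) \<Rightarrow> nat \<Rightarrow> ('m \<Rightarrow> 'k::field) set \<Rightarrow>
     (('k dyer_lashof, 'm \<Rightarrow> 'k) tensor \<Rightarrow> ('k ambient, 'm::ab_group_add) tensor \<Rightarrow> 'k) \<Rightarrow> bool" where
  "identification bock P M s D \<rho> \<longleftrightarrow>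
     linear_on scale_R_tensor scale_fun (R_tensor s D) \<rho> \<and>
     (\<forall>I. length I = s \<longrightarrow> lambda_sequence I \<longrightarrow>
        (\<forall>l\<in>D. \<rho> (tens (Q_monomial I) l) = represented bock P M I l))"

end

theory Submission
  imports Defs "HOL-Number_Theory.Residues"
begin

text \<open>
  The Dickson and Mui invariants are written in terms of a dual basis \<open>\<Theta>\<close> of the Frobenius vectors
  \<open>(y\<^sub>1^(p^j), \<dots>, y\<^sub>s^(p^j))\<close>, so that up to sign \<open>M\<^bsub>s;J\<^esub> = L\<^sub>s \<Prod>\<^bsub>j\<in>J\<^esub> \<Theta>\<^sub>j\<close>. Then \<open>\<R>\<^sub>sM\<close> is spanned by the elements
  \<open>b \<sqdot> S\<^sub>s(m)\<close>, \<open>m\<close> of degree \<open>n\<close>, where \<open>b\<close> runs over the monomials in the \<open>\<Theta>\<^sub>j\<close> and the \<open>q\<^bsub>s,i\<^esub>\<close> in which the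
  exponent \<open>a\<^sub>0\<close> of \<open>q\<^bsub>s,0\<^esub>\<close> satisfies \<open>2 a\<^sub>0 \<ge> n + |J|\<close>. Order the monomials in \<open>u\<^sub>i, v\<^sub>i\<close> lexicographically, with
  \<open>v\<^sub>s\<close> most significant. The leading monomials of these \<open>b\<close> are exactly the monomials dual to the
  admissible sequences of excess at least \<open>n\<close>. So the functional represented by \<open>Q\<^sup>I \<otimes> \<ell>\<close> sends
  \<open>b\<^bsub>I'\<^esub> \<sqdot> S\<^sub>s(m)\<close> to \<open>\<nu>\<^sub>s(b\<^bsub>I'\<^esub>)(\<lambda>\<^sub>I) \<ell>(m)\<close>, where the matrix \<open>\<nu>\<^sub>s(b\<^bsub>I'\<^esub>)(\<lambda>\<^sub>I)\<close> is triangular with units on the diagonal.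
\<close>

subsection \<open>Scalars\<close>

text \<open>The functional of Q^I \<otimes> l is prescribed on the products f S_s(m), which satisfy
  relations, so its existence is part of the problem. It comes from maps E, linear over the whole
  exterior algebra, with E(f S_s(m)) = l(m) f; its value at z is nu_s(E(z))(lambda_I). Such an E
  exists because S_s(m) is 1 \<otimes> m up to terms with operations of positive degree. Composition
  with these lowers the degree of l, and M vanishes in negative degrees, so induction applies. The
  dual is graded by P_s \<otimes> M, where S_s(m) alone need not lie. Instability makes
  L_s^((p-1)n/2) S_s(m) polynomial, and 2 a_0 \<ge> n + |J| is the condition under which this power
  of L_s splits off from b and leaves an element of the coefficient module for the parity of n. The
  exponents come from three identities: L_s is the product of the v_k^(p^(s-k)), q_{s,0} =
  L_s^(p-1), and the last vector of the dual basis is u_s/V_s up to sign. Solved for a_i, the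
  leading exponents give the slack in the admissibility inequality for i \<ge> 1 and (e(I) + |J|)/2
  for i = 0.\<close>

lemma rconst_0 [simp]: "rconst 0 = 0"
  and rconst_1 [simp]: "rconst 1 = 1"
  and rconst_add: "rconst (a + b) = rconst a + rconst b"
  and rconst_mult: "rconst (a * b) = rconst a * rconst b"
  by (simp_all add: rconst_def single_add mult_single fract_collapse)

lemma rconst_uminus: "rconst (- a) = - rconst a"
  using rconst_add[of a "- a"] by (simp add: eq_neg_iff_add_eq_0 add.commute)

lemma rconst_of_nat: "rconst (of_nat n) = of_nat n"
  by (induction n) (simp_all add: rconst_add)

lemma rconst_eq_0_iff [simp]: "rconst a = 0 \<longleftrightarrow> a = 0"
  by (simp add: rconst_def Zero_fract_def eq_fract) (metis lookup_single_eq lookup_zero single_zero)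

locale odd_prime_field =
  fixes field_type :: "'k::field itself"
  assumes prime_card: "prime CARD('k)" and odd_card: "odd CARD('k)"
begin

lemma char_field: "CHAR('k) = CARD('k)"
proof -
  have "CHAR('k) dvd CARD('k)" by (rule CHAR_dvd_CARD)
  moreover have "CHAR('k) \<noteq> 1" by simp
  ultimately show ?thesis using prime_card by (auto simp: prime_nat_iff)
qed

text \<open>The residues of 0, ..., p - 1 are distinct because the characteristic is p, so they fill
  the field. Additive maps are therefore linear; \<open>hfun_component\<close> obtains compatibility
  with scalars in this way.\<close>

lemma surj_of_nat: "\<exists>j. (c :: 'k) = of_nat j"
proof -
  have fin: "finite (UNIV :: 'k set)"
    using prime_card by (metis card_eq_0_iff not_prime_0)
  have "inj_on (of_nat :: nat \<Rightarrow> 'k) {..<CARD('k)}"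
  proof (rule inj_onI)
    fix x y :: nat assume "x \<in> {..<CARD('k)}" "y \<in> {..<CARD('k)}" "of_nat x = (of_nat y :: 'k)"
    then show "x = y"
      by (metis char_field cong_def lessThan_iff mod_less of_nat_eq_iff_cong_CHAR)
  qed
  then have "card ((of_nat :: nat \<Rightarrow> 'k) ` {..<CARD('k)}) = CARD('k)"
    by (simp add: card_image)
  then have "(of_nat :: nat \<Rightarrow> 'k) ` {..<CARD('k)} = UNIV"
    using fin by (simp add: card_subset_eq)
  then show ?thesis by (metis UNIV_I imageE)
qed

lemma char_ratfun: "CHAR('k ratfun) = CARD('k)"
proof -
  have "of_nat n = (0 :: 'k ratfun) \<longleftrightarrow> of_nat n = (0 :: 'k)" for n
    by (simp flip: rconst_of_nat)
  then have "CHAR('k ratfun) dvd n \<longleftrightarrow> CHAR('k) dvd n" for n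
    by (simp add: of_nat_eq_0_iff_char_dvd)
  then have "CHAR('k ratfun) = CHAR('k)"
    by (meson dvd_antisym dvd_refl)
  then show ?thesis by (simp add: char_field)
qed

lemma frob_sum: "(\<Sum>i\<in>A. f i :: 'k ratfun) ^ (CARD('k) ^ n) = (\<Sum>i\<in>A. f i ^ (CARD('k) ^ n))"
  using freshmans_dream_sum'[where 'a = "'k ratfun", of "CARD('k) ^ n" n f A] prime_card
  by (simp add: char_ratfun)

lemma card_ge_3: "CARD('k) \<ge> 3"
  using prime_card odd_card prime_ge_2_nat[OF prime_card]
  by (metis One_nat_def Suc_1 Suc_leI le_neq_implies_less numeral_3_eq_3 even_numeral)

end

subsection \<open>The exterior algebra\<close>

lift_definition xmono :: "nat fset \<Rightarrow> 'a::comm_ring_1 \<Rightarrow> 'a ext" is "\<lambda>A c. Poly_Mapping.single A c" .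
lift_definition ecoef :: "'a::comm_ring_1 ext \<Rightarrow> nat fset \<Rightarrow> 'a" is "Poly_Mapping.lookup" .

lemma ext_const_eq: "ext_const c = xmono {||} c" by transfer rule
lemma ext_gen_eq: "ext_gen i = xmono {|i|} 1" by transfer rule
lemma xmono_mult: "xmono A a * xmono B b =
    (if A |\<inter>| B = {||} then xmono (A |\<union>| B) (ext_sign A B * a * b) else 0)"
  by transfer (simp add: ext_mult_single)
lemma ext_eqI: "(\<And>A. ecoef f A = ecoef g A) \<Longrightarrow> f = g"
  by transfer (simp add: poly_mapping_eqI)

lemma ecoef_0 [simp]: "ecoef 0 A = 0" by transfer simp
lemma ecoef_add: "ecoef (f + g) A = ecoef f A + ecoef g A" by transfer (simp add: lookup_add)
lemma ecoef_uminus: "ecoef (- f) A = - ecoef f A" by transfer simp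
lemma ecoef_xmono: "ecoef (xmono A c) B = (if A = B then c else 0)"
  by transfer (simp add: lookup_single when_def)
lemma ecoef_sum: "ecoef (sum f S) A = (\<Sum>i\<in>S. ecoef (f i) A)"
  by (induction S rule: infinite_finite_induct) (simp_all add: ecoef_add)

lemma finite_ecoef: "finite {A. ecoef f A \<noteq> 0}"
  by transfer (simp add: finite_lookup)

lemma ext_as_sum: "f = (\<Sum>A | ecoef f A \<noteq> 0. xmono A (ecoef f A))"
proof (rule ext_eqI)
  fix B
  show "ecoef f B = ecoef (\<Sum>A | ecoef f A \<noteq> 0. xmono A (ecoef f A)) B"
    by (simp add: ecoef_sum ecoef_xmono finite_ecoef)
qed

lemma ext_const_0 [simp]: "ext_const 0 = 0"
  and ext_const_1 [simp]: "ext_const 1 = 1"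
  and ext_const_add: "ext_const (a + b) = ext_const a + ext_const b"
  and ext_const_mult: "ext_const (a * b) = ext_const a * ext_const b"
  and ext_const_uminus: "ext_const (- a) = - ext_const a"
  by (transfer; simp add: single_add ext_mult_single single_uminus)+

lemma ext_const_sum: "ext_const (sum f S) = (\<Sum>i\<in>S. ext_const (f i))"
  by (induction S rule: infinite_finite_induct) (simp_all add: ext_const_add)

lemma ext_const_power: "ext_const (a ^ n) = ext_const a ^ n"
  by (induction n) (simp_all add: ext_const_mult)

lemma ext_const_xmono: "ext_const c * xmono A a = xmono A (c * a)"
  by (simp add: ext_const_eq xmono_mult)

lemma ext_const_comm: "f * ext_const c = ext_const c * f"
proof -
  have "xmono A a * ext_const c = ext_const c * xmono A a" for A a
    by (simp add: ext_const_eq xmono_mult mult.commute)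
  then show ?thesis
    by (subst (1 2) ext_as_sum[of f]) (simp add: sum_distrib_left sum_distrib_right)
qed

lemma ext_const_left_comm: "f * (ext_const c * g) = ext_const c * (f * g)"
  by (metis ext_const_comm mult.assoc)

lemma ecoef_ext_const_mult: "ecoef (ext_const c * f) A = c * ecoef f A"
  by (subst (1) ext_as_sum[of f])
    (simp add: sum_distrib_left ext_const_xmono ecoef_sum ecoef_xmono finite_ecoef)

lemma ext_const_inverse: "a \<noteq> 0 \<Longrightarrow> ext_const (a :: 'a::field) * ext_const (inverse a) = 1"
  by (simp flip: ext_const_mult)

text \<open>A sign whose value is left open. Reordering odd factors costs signs throughout, but
  triangularity only asks for units on the diagonal.\<close>

definition is_sign :: "'a::ring_1 \<Rightarrow> bool" where "is_sign x \<longleftrightarrow> x = 1 \<or> x = -1"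

lemma is_sign_1 [simp]: "is_sign 1" by (simp add: is_sign_def)
lemma is_sign_minus: "is_sign x \<Longrightarrow> is_sign (- x)" by (auto simp: is_sign_def)
lemma is_sign_mult: "is_sign x \<Longrightarrow> is_sign y \<Longrightarrow> is_sign (x * y)" by (auto simp: is_sign_def)
lemma is_sign_power: "is_sign x \<Longrightarrow> is_sign (x ^ n)" by (induction n) (auto simp: is_sign_mult)
lemma is_sign_minus_1: "is_sign ((-1) ^ n)" by (rule is_sign_power) (simp add: is_sign_def)
lemma is_sign_comm: "is_sign x \<Longrightarrow> x * f = f * x" by (auto simp: is_sign_def)
lemma is_sign_sq: "is_sign x \<Longrightarrow> x * x = 1" by (auto simp: is_sign_def)
lemma is_sign_nz: "is_sign x \<Longrightarrow> x \<noteq> (0 :: 'a :: ring_1)" by (auto simp: is_sign_def)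
lemma is_sign_ext_const: "is_sign x \<Longrightarrow> is_sign (ext_const x)"
  by (auto simp: is_sign_def ext_const_uminus)
subsection \<open>Products of anticommuting elements\<close>

text \<open>Instances are the generators x_a, the dual forms \<Theta>_{s,j} and the u_k, so that all
  three kinds of odd monomials are formed by the same ordered product.\<close>

locale anticommuting =
  fixes z :: "nat \<Rightarrow> 'a::ring_1"
  assumes anti: "z i * z j = - (z j * z i)" and square: "z i * z i = 0"
begin

definition oprod :: "nat set \<Rightarrow> 'a" where
  "oprod E = prod_list (map z (sorted_list_of_set E))"

lemma oprod_empty [simp]: "oprod {} = 1" by (simp add: oprod_def)
lemma oprod_single [simp]: "oprod {i} = z i" by (simp add: oprod_def)

lemma mult_list_member:
  "i \<in> set xs \<Longrightarrow> z i * prod_list (map z xs) = 0"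
proof (induction xs)
  case (Cons x xs)
  show ?case
  proof (cases "i = x")
    case True then show ?thesis by (simp add: square flip: mult.assoc)
  next
    case False
    then have "z i * prod_list (map z xs) = 0" using Cons by simp
    then show ?thesis by (simp add: anti[of i x] mult.assoc flip: mult.assoc[of "z i"])
  qed
qed simp

lemma mult_list_insort:
  "\<exists>c. is_sign c \<and> z i * prod_list (map z xs) = c * prod_list (map z (insort i xs))"
proof (induction xs)
  case Nil show ?case by (intro exI[of _ 1]) simp
next
  case (Cons x xs)
  then obtain c where c: "is_sign c" "z i * prod_list (map z xs) = c * prod_list (map z (insort i xs))"
    by blast
  show ?case
  proof (cases "i \<le> x")
    case True then show ?thesis by (intro exI[of _ 1]) simp
  next
    case False
    have "z i * prod_list (map z (x # xs)) = - (z x * (z i * prod_list (map z xs)))"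
      by (simp add: anti[of i x] flip: mult.assoc)
    also have "\<dots> = - c * prod_list (map z (insort i (x # xs)))"
      using False c is_sign_comm[OF c(1), of "z x"]
      by (metis (no_types, lifting) insort_key.simps(2) list.simps(9) minus_mult_left mult.assoc
          prod_list.Cons)
    finally show ?thesis using is_sign_minus[OF c(1)] by blast
  qed
qed

lemma mult_oprod_member: "finite F \<Longrightarrow> i \<in> F \<Longrightarrow> z i * oprod F = 0"
  unfolding oprod_def by (rule mult_list_member) simp

lemma mult_oprod_insert:
  "finite F \<Longrightarrow> i \<notin> F \<Longrightarrow> \<exists>c. is_sign c \<and> z i * oprod F = c * oprod (insert i F)"
  unfolding oprod_def using mult_list_insort[of i "sorted_list_of_set F"] by simp

lemma oprod_insert_min:
  assumes "finite F" "\<And>x. x \<in> F \<Longrightarrow> i < x"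
  shows "oprod (insert i F) = z i * oprod F"
proof -
  have "insort i (sorted_list_of_set F) = i # sorted_list_of_set F"
    using assms by (cases "sorted_list_of_set F") (auto simp: less_imp_le dest!: arg_cong[of _ _ set])
  then show ?thesis
    using assms unfolding oprod_def
    by (subst sorted_list_of_set.sorted_key_list_of_set_insert) auto
qed

lemma oprod_mult_disjoint:
  assumes "finite E" "finite F" "E \<inter> F = {}"
  shows "\<exists>c. is_sign c \<and> oprod E * oprod F = c * oprod (E \<union> F)"
  using assms(1,3)
proof (induction rule: finite_linorder_min_induct)
  case empty show ?case by (intro exI[of _ 1]) simp
next
  case (insert i E)
  then obtain c where c: "is_sign c" "oprod E * oprod F = c * oprod (E \<union> F)" by auto
  obtain d where d: "is_sign d" "z i * oprod (E \<union> F) = d * oprod (insert i (E \<union> F))"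
    using mult_oprod_insert[of "E \<union> F" i] insert assms by auto
  have "oprod (insert i E) * oprod F = z i * (c * oprod (E \<union> F))"
    using insert by (simp add: oprod_insert_min mult.assoc c)
  also have "\<dots> = c * (z i * oprod (E \<union> F))"
    using is_sign_comm[OF c(1)] by (metis mult.assoc)
  also have "\<dots> = (c * d) * oprod (insert i E \<union> F)" by (simp add: d mult.assoc)
  finally show ?case using is_sign_mult[OF c(1) d(1)] by blast
qed

lemma oprod_mult_overlap:
  assumes "finite E" "finite F" "E \<inter> F \<noteq> {}"
  shows "oprod E * oprod F = 0"
  using assms(1,3)
proof (induction rule: finite_linorder_min_induct)
  case (insert i E)
  show ?case
  proof (cases "E \<inter> F = {}")
    case False
    then show ?thesis using insert by (simp add: oprod_insert_min mult.assoc)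
  next
    case True
    then obtain c where c: "is_sign c" "oprod E * oprod F = c * oprod (E \<union> F)"
      using oprod_mult_disjoint[OF insert.hyps(1) assms(2)] by blast
    have "i \<in> E \<union> F" using True insert.prems by auto
    then have "z i * (c * oprod (E \<union> F)) = 0"
      using mult_oprod_member[of "E \<union> F" i] insert assms is_sign_comm[OF c(1), of "z i"]
      by (metis finite_UnI mult.assoc mult_zero_right)
    then show ?thesis using insert by (simp add: oprod_insert_min mult.assoc c)
  qed
qed simp

lemma oprod_insert_max:
  assumes "finite F" "\<And>x. x \<in> F \<Longrightarrow> x < i"
  shows "oprod (insert i F) = oprod F * z i"
  using assms
proof (induction rule: finite_linorder_min_induct)
  case (insert j F)
  have "oprod (insert i (insert j F)) = z j * oprod (insert i F)"
    by (subst insert_commute, rule oprod_insert_min) (use insert in auto)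
  then show ?case using insert by (simp add: oprod_insert_min mult.assoc)
qed simp

end

section \<open>Linear forms in the exterior generators\<close>

inductive_set linforms :: "'a::comm_ring_1 ext set" where
  zero: "0 \<in> linforms"
| step: "f \<in> linforms \<Longrightarrow> f + ext_const c * ext_gen a \<in> linforms"

lemma linforms_gen: "ext_const c * ext_gen a \<in> linforms"
  using linforms.step[OF linforms.zero, of c a] by simp

lemma linforms_add: "g \<in> linforms \<Longrightarrow> f \<in> linforms \<Longrightarrow> f + g \<in> linforms"
  by (induction rule: linforms.induct) (auto simp flip: add.assoc intro: linforms.step)

lemma linforms_scale: "f \<in> linforms \<Longrightarrow> ext_const c * f \<in> linforms"
proof (induction rule: linforms.induct)
  case (step f d a)
  have "ext_const c * (f + ext_const d * ext_gen a) = ext_const c * f + ext_const (c * d) * ext_gen a"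
    by (simp add: distrib_left ext_const_mult mult.assoc)
  then show ?case using linforms.step[OF step.IH, of "c * d" a] by simp
qed (simp add: linforms.zero)

lemma linforms_uminus: "f \<in> linforms \<Longrightarrow> - f \<in> linforms"
  using linforms_scale[of f "-1"] by (simp add: ext_const_uminus)

lemma linforms_sum: "(\<And>i. i \<in> S \<Longrightarrow> f i \<in> linforms) \<Longrightarrow> sum f S \<in> linforms"
  by (induction S rule: infinite_finite_induct) (auto intro: linforms_add linforms.zero)

lemma ext_gen_anti: "ext_gen a * ext_gen b = - (ext_gen b * ext_gen a :: 'a::comm_ring_1 ext)"
  and ext_gen_square: "ext_gen a * ext_gen a = (0 :: 'a ext)"
proof -
  show "ext_gen a * ext_gen a = (0 :: 'a ext)"
    by (simp add: ext_gen_eq xmono_mult)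
  have sgn: "ext_sign {|a|} {|b|} = (if b < a then -1 else 1 :: 'a)" for a b
  proof -
    have "{(x, y). x |\<in>| {|a|} \<and> y |\<in>| {|b|} \<and> y < x} = (if b < a then {(a, b)} else {})"
      by auto
    then show ?thesis by (simp add: ext_sign_def)
  qed
  show "ext_gen a * ext_gen b = - (ext_gen b * ext_gen a :: 'a::comm_ring_1 ext)"
  proof (cases "a = b")
    case False
    have "{|b, a|} = {|a, b|}" by auto
    with False show ?thesis
      by (intro ext_eqI) (simp add: ext_gen_eq xmono_mult sgn ecoef_xmono ecoef_uminus)
  qed (simp add: ext_gen_eq xmono_mult)
qed

lemma linforms_anti_gen:
  assumes "f \<in> linforms"
  shows "f * ext_gen b = - (ext_gen b * f)"
  using assms
proof (induction rule: linforms.induct)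
  case (step f c a)
  then show ?case
    by (simp add: distrib_left distrib_right mult.assoc ext_gen_anti[of a b]
        ext_const_left_comm[of "ext_gen b"])
qed simp

lemma linforms_anti:
  assumes "f \<in> linforms" "g \<in> linforms"
  shows "f * g = - (g * f)"
  using assms(2)
proof (induction rule: linforms.induct)
  case (step g c a)
  then show ?case
    by (simp add: distrib_left distrib_right mult.assoc linforms_anti_gen[OF assms(1)]
        ext_const_left_comm[of f])
qed simp

lemma linforms_square:
  assumes "f \<in> linforms"
  shows "f * f = 0"
  using assms
proof (induction rule: linforms.induct)
  case (step f c a)
  have "(f + ext_const c * ext_gen a) * (f + ext_const c * ext_gen a) =
      f * f + ext_const c * (f * ext_gen a + ext_gen a * f)
      + ext_const c * (ext_const c * (ext_gen a * ext_gen a))"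
    by (simp add: distrib_left distrib_right mult.assoc ext_const_left_comm[of f]
        ext_const_left_comm[of "ext_gen a"])
  then show ?case using step by (simp add: linforms_anti_gen ext_gen_square)
qed simp

lemma anticommuting_linforms: "(\<And>i. z i \<in> linforms) \<Longrightarrow> anticommuting z"
  by unfold_locales (auto intro: linforms_anti linforms_square)

interpretation xs: anticommuting "ext_gen :: nat \<Rightarrow> 'a::comm_ring_1 ext"
  by unfold_locales (auto intro: ext_gen_anti ext_gen_square)

text \<open>An element below all others of A stands in front without inversions, so no sign arises
  and the ordered product is the basis element x_A itself.\<close>

lemma xs_oprod: "finite A \<Longrightarrow> xs.oprod A = xmono (Abs_fset A) 1"
proof (induction rule: finite_linorder_min_induct)
  case empty
  show ?case by (simp add: bot_fset_def flip: ext_const_1) (simp add: ext_const_eq bot_fset_def)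
next
  case (insert b A)
  have "{(x, y). x |\<in>| {|b|} \<and> y |\<in>| Abs_fset A \<and> y < x} = {}"
    using insert by (auto simp: Abs_fset_inverse)
  then have "ext_sign {|b|} (Abs_fset A) = (1 :: 'a)" by (simp only: ext_sign_def card.empty power_0)
  moreover have "{|b|} |\<inter>| Abs_fset A = {||}"
    using insert by (auto simp: fset_eq_iff Abs_fset_inverse)
  moreover have "finsert b (Abs_fset A) = Abs_fset (insert b A)"
    using insert by (metis (no_types, lifting) Abs_fset_inverse finite_insert fset_inverse finsert.rep_eq mem_Collect_eq)
  ultimately show ?case
    using insert by (simp add: xs.oprod_insert_min ext_gen_eq[of b] xmono_mult)
qed

subsection \<open>Vector spaces\<close>

interpretation amb: vector_space "scale_ambient :: 'k::field \<Rightarrow> 'k ambient \<Rightarrow> 'k ambient"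
  by unfold_locales
    (simp_all add: scale_ambient_def rconst_add rconst_mult ext_const_add ext_const_mult
      distrib_left distrib_right mult.assoc)

interpretation fs: vector_space "scale_fun :: 'k::field \<Rightarrow> ('v \<Rightarrow> 'k) \<Rightarrow> 'v \<Rightarrow> 'k"
  by unfold_locales (auto simp: scale_fun_def fun_eq_iff algebra_simps)

subsection \<open>A valuation on the rational functions\<close>

text \<open>Exponent vectors carry the lexicographic order of finitely supported functions, in which
  the smallest index decides first.\<close>

definition poly_lead :: "((nat \<Rightarrow>\<^sub>0 nat) \<Rightarrow>\<^sub>0 'k::field) \<Rightarrow> (nat \<Rightarrow>\<^sub>0 nat) \<Rightarrow> bool" where
  "poly_lead f m \<longleftrightarrow> Poly_Mapping.lookup f m \<noteq> 0 \<and> (\<forall>k\<in>Poly_Mapping.keys f. k \<le> m)"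

lemma poly_lead_nonzero: "poly_lead f m \<Longrightarrow> f \<noteq> 0"
  by (auto simp: poly_lead_def)

lemma poly_lead_single: "c \<noteq> 0 \<Longrightarrow> poly_lead (Poly_Mapping.single m c) m"
  by (simp add: poly_lead_def)

lemma poly_lead_add:
  assumes "poly_lead f m" "\<And>k. k \<in> Poly_Mapping.keys g \<Longrightarrow> k < m"
  shows "poly_lead (f + g) m"
proof -
  have "m \<notin> Poly_Mapping.keys g" using assms(2) by blast
  then have "Poly_Mapping.lookup g m = 0" by (simp add: in_keys_iff)
  then show ?thesis
    using assms Poly_Mapping.keys_add[of f g]
    unfolding poly_lead_def by (auto simp: lookup_add dest!: subsetD less_imp_le)
qed

lemma poly_lead_split:
  assumes "poly_lead f m"
  obtains c g where "c \<noteq> 0" "f = Poly_Mapping.single m c + g" "\<And>k. k \<in> Poly_Mapping.keys g \<Longrightarrow> k < m"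
proof
  let ?c = "Poly_Mapping.lookup f m"
  let ?g = "f - Poly_Mapping.single m ?c"
  show "?c \<noteq> 0" using assms by (simp add: poly_lead_def)
  show "f = Poly_Mapping.single m ?c + ?g" by simp
  fix k assume "k \<in> Poly_Mapping.keys ?g"
  then have "k \<noteq> m" "k \<in> Poly_Mapping.keys f"
    by (cases "k = m"; simp add: in_keys_iff lookup_minus lookup_single)+
  then show "k < m" using assms by (auto simp: poly_lead_def less_le)
qed

text \<open>Leading exponents add because the order is compatible with addition, and the product of
  the two leading coefficients is nonzero in a field.\<close>

lemma poly_lead_mult:
  assumes "poly_lead f m" "poly_lead g n"
  shows "poly_lead (f * g) (m + n)"
proof -
  obtain c f' where f: "c \<noteq> 0" "f = Poly_Mapping.single m c + f'" "\<And>k. k \<in> Poly_Mapping.keys f' \<Longrightarrow> k < m"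
    using poly_lead_split[OF assms(1)] by blast
  obtain d g' where g: "d \<noteq> 0" "g = Poly_Mapping.single n d + g'" "\<And>k. k \<in> Poly_Mapping.keys g' \<Longrightarrow> k < n"
    using poly_lead_split[OF assms(2)] by blast
  have "k < m + n" if "k \<in> Poly_Mapping.keys (Poly_Mapping.single m c * g' + f' * g)" for k
  proof -
    have "k \<in> Poly_Mapping.keys (Poly_Mapping.single m c * g') \<or> k \<in> Poly_Mapping.keys (f' * g)"
      using subsetD[OF Poly_Mapping.keys_add that] by simp
    then show ?thesis
    proof
      assume k: "k \<in> Poly_Mapping.keys (Poly_Mapping.single m c * g')"
      obtain b where "k = m + b" "b \<in> Poly_Mapping.keys g'"
        using subsetD[OF keys_mult k] \<open>c \<noteq> 0\<close> by auto
      then show ?thesis using g(3) by simp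
    next
      assume k: "k \<in> Poly_Mapping.keys (f' * g)"
      obtain a b where "k = a + b" "a \<in> Poly_Mapping.keys f'" "b \<in> Poly_Mapping.keys g"
        using subsetD[OF keys_mult k] by auto
      then show ?thesis
        using f(3)[of a] assms(2) unfolding poly_lead_def by (simp add: add_less_le_mono)
    qed
  qed
  moreover have "f * g = Poly_Mapping.single (m + n) (c * d) + (Poly_Mapping.single m c * g' + f' * g)"
  proof -
    have "Poly_Mapping.single m c * g = Poly_Mapping.single (m + n) (c * d) + Poly_Mapping.single m c * g'"
      unfolding g(2) distrib_left mult_single ..
    then show ?thesis
      by (subst f(2)) (simp only: distrib_right add.assoc)
  qed
  ultimately show ?thesis
    using poly_lead_add[OF poly_lead_single, of "c * d"] f(1) g(1) by simp
qed

text \<open>\<open>has_val f e\<close>: the lexicographically leading exponent of \<open>f\<close>, with \<open>y\<^sub>1\<close> as the most significant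
  variable, is \<open>e\<close>.\<close>

definition has_val :: "'k::field ratfun \<Rightarrow> (nat \<Rightarrow> int) \<Rightarrow> bool" where
  "has_val f e \<longleftrightarrow> (\<exists>a b m n. f = Fract a b \<and> poly_lead a m \<and> poly_lead b n \<and>
     (\<forall>k. e k = int (Poly_Mapping.lookup m k) - int (Poly_Mapping.lookup n k)))"

lemma has_val_nonzero: "has_val f e \<Longrightarrow> f \<noteq> 0"
proof -
  assume "has_val f e"
  then obtain a b m n where "f = Fract a b" "poly_lead a m" "poly_lead b n"
    unfolding has_val_def by blast
  then show "f \<noteq> 0"
    using poly_lead_nonzero[of a m] poly_lead_nonzero[of b n] by (simp add: Zero_fract_def eq_fract)
qed

lemma has_val_finite: "has_val f e \<Longrightarrow> finite {k. e k \<noteq> 0}"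
proof -
  assume "has_val f e"
  then obtain m n :: "nat \<Rightarrow>\<^sub>0 nat" where "\<And>k. e k = int (Poly_Mapping.lookup m k) - int (Poly_Mapping.lookup n k)"
    unfolding has_val_def by blast
  then have "{k. e k \<noteq> 0} \<subseteq> Poly_Mapping.keys m \<union> Poly_Mapping.keys n"
    by (auto simp: in_keys_iff)
  then show ?thesis by (rule finite_subset) simp
qed

lemma has_val_mult:
  assumes "has_val f d" "has_val g e"
  shows "has_val (f * g) (\<lambda>k. d k + e k)"
proof -
  obtain a b m n where 1: "f = Fract a b" "poly_lead a m" "poly_lead b n"
     "\<And>k. d k = int (Poly_Mapping.lookup m k) - int (Poly_Mapping.lookup n k)"
    using assms(1) unfolding has_val_def by blast
  obtain a' b' m' n' where 2: "g = Fract a' b'" "poly_lead a' m'" "poly_lead b' n'"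
     "\<And>k. e k = int (Poly_Mapping.lookup m' k) - int (Poly_Mapping.lookup n' k)"
    using assms(2) unfolding has_val_def by blast
  have "f * g = Fract (a * a') (b * b')" by (simp add: 1 2)
  moreover have "d k + e k = int (Poly_Mapping.lookup (m + m') k) - int (Poly_Mapping.lookup (n + n') k)" for k
    by (simp add: 1(4) 2(4) lookup_add)
  ultimately show ?thesis
    unfolding has_val_def using poly_lead_mult[OF 1(2) 2(2)] poly_lead_mult[OF 1(3) 2(3)] by blast
qed

lemma has_val_inverse: "has_val f d \<Longrightarrow> has_val (inverse f) (\<lambda>k. - d k)"
  unfolding has_val_def by (metis inverse_fract minus_diff_eq)

lemma has_val_1: "has_val 1 (\<lambda>k. 0)"
  unfolding has_val_def One_fract_def using poly_lead_single[of 1 0]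
  by (intro exI conjI) auto

lemma has_val_rconst: "c \<noteq> 0 \<Longrightarrow> has_val (rconst c) (\<lambda>k. 0)"
  unfolding has_val_def rconst_def using poly_lead_single[of c 0] poly_lead_single[of 1 0]
  by (intro exI[of _ "Poly_Mapping.single 0 c"] exI[of _ 1] exI[of _ 0]) auto

lemma has_val_yvar: "has_val (yvar i :: 'k::field ratfun) (\<lambda>k. if k = i then 1 else 0)"
  unfolding has_val_def yvar_def
  using poly_lead_single[of 1 "Poly_Mapping.single i 1"] poly_lead_single[of 1 0]
  by (intro exI[of _ "Poly_Mapping.single (Poly_Mapping.single i 1) 1"] exI[of _ 1] exI[of _ 0]
      exI[of _ "Poly_Mapping.single i 1"])
    (auto simp: lookup_single)

lemma has_val_power: "has_val f d \<Longrightarrow> has_val (f ^ n) (\<lambda>k. int n * d k)"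
proof (induction n)
  case (Suc n)
  then show ?case using has_val_mult[of f d "f ^ n" "\<lambda>k. int n * d k"]
    by (simp add: distrib_right)
qed (simp add: has_val_1)

lemma has_val_powi:
  assumes "has_val f d"
  shows "has_val (f powi n) (\<lambda>k. n * d k)"
proof (cases "n \<ge> 0")
  case True
  then show ?thesis using has_val_power[OF assms, of "nat n"] by (simp add: power_int_def)
next
  case False
  then show ?thesis using has_val_power[OF has_val_inverse[OF assms], of "nat (- n)"]
    by (simp add: power_int_def)
qed

lemma has_val_prod:
  "(\<And>i. i \<in> S \<Longrightarrow> has_val (f i) (e i)) \<Longrightarrow> has_val (\<Prod>i\<in>S. f i) (\<lambda>k. \<Sum>i\<in>S. e i k)"
  by (induction S rule: infinite_finite_induct) (auto intro: has_val_1 has_val_mult)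

lemma has_val_uminus: "has_val f d \<Longrightarrow> has_val (- f) d"
  using has_val_mult[OF has_val_rconst[of "-1"], of f d] by (simp add: rconst_uminus)

lemma has_val_sign: "is_sign c \<Longrightarrow> has_val f d \<Longrightarrow> has_val (c * f) d"
  by (auto simp: is_sign_def has_val_uminus)

lemma has_val_add:
  assumes "has_val f d" "g = 0 \<or> has_val g e \<and> less_fun e d"
  shows "has_val (f + g) d"
proof (cases "g = 0")
  case False
  then have "has_val g e" and less: "less_fun e d" using assms by auto
  obtain a b m n where 1: "f = Fract a b" "poly_lead a m" "poly_lead b n"
     "\<And>k. d k = int (Poly_Mapping.lookup m k) - int (Poly_Mapping.lookup n k)"
    using assms(1) unfolding has_val_def by blast
  obtain a' b' m' n' where 2: "g = Fract a' b'" "poly_lead a' m'" "poly_lead b' n'"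
     "\<And>k. e k = int (Poly_Mapping.lookup m' k) - int (Poly_Mapping.lookup n' k)"
    using \<open>has_val g e\<close> unfolding has_val_def by blast
  have "f + g = Fract (a * b' + a' * b) (b * b')"
    using poly_lead_nonzero[OF 1(3)] poly_lead_nonzero[OF 2(3)] by (simp add: 1(1) 2(1))
  \<comment> \<open>Over the common denominator the comparison of the integral exponents e and d
    becomes one of natural exponents in the numerators.\<close>
  moreover have lt: "m' + n < m + n'"
  proof -
    from less obtain k where k: "e k < d k" "\<And>j. j < k \<Longrightarrow> e j = d j"
      unfolding less_fun_def by blast
    have "less_fun (Poly_Mapping.lookup (m' + n)) (Poly_Mapping.lookup (m + n'))"
      unfolding less_fun_def
    proof (intro exI[of _ k] conjI allI impI)
      show "Poly_Mapping.lookup (m' + n) k < Poly_Mapping.lookup (m + n') k"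
        using k(1) unfolding 1(4) 2(4) lookup_add by linarith
      fix j assume "j < k"
      from k(2)[OF this] show "Poly_Mapping.lookup (m' + n) j = Poly_Mapping.lookup (m + n') j"
        unfolding 1(4) 2(4) lookup_add by linarith
    qed
    then show ?thesis by (simp add: less_poly_mapping.rep_eq)
  qed
  have "poly_lead (a * b' + a' * b) (m + n')"
    using poly_lead_add[OF poly_lead_mult[OF 1(2) 2(3)]] poly_lead_mult[OF 2(2) 1(3)] lt
    unfolding poly_lead_def by (meson le_less_trans)
  moreover have "d k = int (Poly_Mapping.lookup (m + n') k) - int (Poly_Mapping.lookup (n + n') k)" for k
    by (simp add: 1(4) lookup_add)
  ultimately show ?thesis
    unfolding has_val_def using poly_lead_mult[OF 1(3) 2(3)] by blast
qed (use assms in simp)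

lemma has_val_add_sum:
  assumes "has_val f d" "finite S" "\<And>i. i \<in> S \<Longrightarrow> g i = 0 \<or> has_val (g i) (e i) \<and> less_fun (e i) d"
  shows "has_val (f + sum g S) d"
  using assms(2,3)
proof (induction S rule: finite_induct)
  case (insert i S)
  have "has_val (f + sum g S + g i) d"
    using has_val_add insert by (metis insertCI)
  then show ?case using insert by (simp add: algebra_simps)
qed (use assms in simp)

text \<open>The summand of largest valuation cannot be cancelled. Valuations have finite support,
  which makes any two distinct ones comparable.\<close>

lemma sum_distinct_vals_nonzero:
  assumes "finite S" "S \<noteq> {}" "\<And>i. i \<in> S \<Longrightarrow> has_val (f i) (e i)" "inj_on e S"
  shows "sum f S \<noteq> 0"
proof -
  have "\<exists>i\<in>S. has_val (sum f S) (e i) \<and> (\<forall>j\<in>S. j \<noteq> i \<longrightarrow> less_fun (e j) (e i))"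
    using assms
  proof (induction S rule: finite_ne_induct)
    case (singleton x) then show ?case by simp
  next
    case (insert x S)
    then have "\<exists>i\<in>S. has_val (sum f S) (e i) \<and> (\<forall>j\<in>S. j \<noteq> i \<longrightarrow> less_fun (e j) (e i))"
      by (meson inj_on_subset subset_insertI insertI2)
    then obtain i where i: "i \<in> S" "has_val (sum f S) (e i)"
        "\<And>j. j \<in> S \<Longrightarrow> j \<noteq> i \<Longrightarrow> less_fun (e j) (e i)"
      by blast
    have x: "has_val (f x) (e x)" using insert by simp
    have "{k. e x k \<noteq> e i k} \<subseteq> {k. e x k \<noteq> 0} \<union> {k. e i k \<noteq> 0}" by auto
    then have "finite {k. e x k \<noteq> e i k}"
      using has_val_finite[OF x] has_val_finite[OF i(2)] finite_subset by blast
    moreover have "e x \<noteq> e i" using insert i(1) by (auto simp: inj_on_def)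
    ultimately consider "less_fun (e x) (e i)" | "less_fun (e i) (e x)"
      using less_fun_trichotomy by blast
    then show ?case
    proof cases
      case 1
      have "has_val (sum f S + f x) (e i)" using has_val_add[OF i(2)] x 1 by blast
      then show ?thesis using 1 i insert by (intro bexI[of _ i]) (auto simp: add.commute)
    next
      case 2
      have "has_val (f x + sum f S) (e x)" using has_val_add[OF x] i(2) 2 by blast
      then show ?thesis using 2 i insert less_fun_trans[OF _ 2] by (intro bexI[of _ x]) auto
    qed
  qed
  then show ?thesis using has_val_nonzero by blast
qed

subsection \<open>The Dickson invariants by recursion\<close>

text \<open>The recursion q_{s+1,i} = q_{s,i-1}^p + q_{s,i} V_{s+1}^(p-1), matched with the
  quotients of determinants in \<open>dickson_q_eq\<close>. The inner sum is V_{s+1} written out,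
  since \<open>dV\<close> is itself defined through \<open>dQ\<close>.\<close>

fun dQ :: "nat \<Rightarrow> nat \<Rightarrow> 'k::field ratfun" where
  "dQ 0 i = (if i = 0 then 1 else 0)"
| "dQ (Suc s) i = (if i = 0 then 0 else dQ s (i - 1) ^ CARD('k)) +
     dQ s i * (\<Sum>j\<le>s. (-1) ^ (s - j) * dQ s j * yvar (Suc s) ^ (CARD('k) ^ j)) ^ (CARD('k) - 1)"

text \<open>Classically the product of X - v over all v in the F_p-span of y_1, ..., y_s. Its
  vanishing at the y_a is derived from the recursion in \<open>dickson_poly_root\<close>.\<close>

definition dickson_poly :: "nat \<Rightarrow> 'k::field ratfun \<Rightarrow> 'k ratfun" where
  "dickson_poly s X = (\<Sum>j\<le>s. (-1) ^ (s - j) * dQ s j * X ^ (CARD('k) ^ j))"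

definition dV :: "nat \<Rightarrow> 'k::field ratfun" where
  "dV s = dickson_poly (s - 1) (yvar s)"

definition dL :: "nat \<Rightarrow> 'k::field ratfun" where
  "dL s = (\<Prod>k=1..s. dV k)"

text \<open>The denominator is q_{s-1,0}, by \<open>dQ_bottom\<close>.\<close>

definition dv :: "nat \<Rightarrow> 'k::field ratfun" where
  "dv s = dV s / dL (s - 1) ^ (CARD('k) - 1)"

lemma dQ_Suc: "(dQ (Suc s) i :: 'k::field ratfun) = (if i = 0 then 0 else dQ s (i - 1) ^ CARD('k)) +
    dQ s i * dV (Suc s) ^ (CARD('k) - 1)"
  by (simp add: dV_def dickson_poly_def)

declare dQ.simps(2) [simp del]

lemma dL_0 [simp]: "dL 0 = 1" by (simp add: dL_def)
lemma dL_Suc: "dL (Suc s) = dV (Suc s) * dL s" by (simp add: dL_def mult.commute)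

context odd_prime_field
begin

lemma dQ_above: "s < i \<Longrightarrow> dQ s i = (0 :: 'k ratfun)"
proof (induction s arbitrary: i)
  case (Suc s)
  then show ?case using card_ge_3 by (simp add: dQ_Suc)
qed simp

lemma dQ_diag: "dQ s s = (1 :: 'k ratfun)"
  by (induction s) (simp_all add: dQ_Suc dQ_above)

lemma dQ_bottom: "dQ s 0 = (dL s :: 'k ratfun) ^ (CARD('k) - 1)"
  by (induction s) (simp_all add: dQ_Suc dL_Suc power_mult_distrib mult.commute)

lemma minus_one_frob: "(-1 :: 'k ratfun) ^ CARD('k) = -1"
  using odd_card by simp

text \<open>Frobenius is additive, so the p-th power moves the coefficient q_{s,j}^p to X^(p^(j+1)).
  This and the term with V_{s+1}^(p-1) are the two summands of the recursion for the q_{s+1,j}; the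
  signs agree because p is odd.\<close>

lemma dickson_poly_Suc:
  "dickson_poly (Suc s) X = dickson_poly s X ^ CARD('k)
     - dV (Suc s) ^ (CARD('k) - 1) * dickson_poly s (X :: 'k ratfun)"
proof -
  let ?p = "CARD('k)"
  have "((-1) ^ n) ^ ?p = ((-1) ^ n :: 'k ratfun)" for n
    by (metis minus_one_frob power_mult mult.commute)
  moreover have "(X ^ ?p ^ j) ^ ?p = X ^ (?p ^ Suc j)" for j
    by (simp add: mult.commute flip: power_mult)
  ultimately have 1: "dickson_poly s X ^ ?p = (\<Sum>j\<le>s. (-1) ^ (s - j) * dQ s j ^ ?p * X ^ (?p ^ Suc j))"
    using frob_sum[of "\<lambda>j. (-1) ^ (s - j) * dQ s j * X ^ (?p ^ j)" "{..s}" 1]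
    by (simp add: dickson_poly_def power_mult_distrib del: power_Suc)
  have "dickson_poly (Suc s) X =
      (\<Sum>j\<le>Suc s. (-1) ^ (Suc s - j) * (if j = 0 then 0 else dQ s (j - 1) ^ ?p) * X ^ (?p ^ j)) +
      (\<Sum>j\<le>Suc s. (-1) ^ (Suc s - j) * (dQ s j * dV (Suc s) ^ (?p - 1)) * X ^ (?p ^ j))"
    by (simp add: dickson_poly_def dQ_Suc algebra_simps flip: sum.distrib)
  also have "(\<Sum>j\<le>Suc s. (-1) ^ (Suc s - j) * (if j = 0 then 0 else dQ s (j - 1) ^ ?p) * X ^ (?p ^ j))
      = dickson_poly s X ^ ?p"
    by (subst sum.atMost_Suc_shift) (simp add: 1)
  also have "(\<Sum>j\<le>Suc s. (-1) ^ (Suc s - j) * (dQ s j * dV (Suc s) ^ (?p - 1)) * X ^ (?p ^ j))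
      = - (dV (Suc s) ^ (?p - 1) * dickson_poly s X)"
    by (simp add: dQ_above dickson_poly_def sum_distrib_left Suc_diff_le mult_ac flip: sum_negf)
  finally show ?thesis by simp
qed

text \<open>At the new root y_{s+1} the previous polynomial takes the value V = V_{s+1}, and V^p -
  V^(p-1) V = 0. At the older roots both terms vanish by induction.\<close>

lemma dickson_poly_root: "a \<in> {1..s} \<Longrightarrow> dickson_poly s (yvar a) = (0 :: 'k ratfun)"
proof (induction s)
  case (Suc s)
  show ?case
  proof (cases "a = Suc s")
    case True
    then have "dickson_poly s (yvar a) = (dV (Suc s) :: 'k ratfun)" by (simp add: dV_def)
    then show ?thesis
      using prime_card by (simp add: dickson_poly_Suc prime_gt_0_nat flip: power_eq_if power_Suc2)
  next
    case False
    then have "dickson_poly s (yvar a) = (0 :: 'k ratfun)" using Suc by simp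
    then show ?thesis using card_ge_3 by (simp add: dickson_poly_Suc)
  qed
qed simp

end

section \<open>Leading exponents of the Dickson invariants in the variables y_k\<close>

definition val_q :: "nat \<Rightarrow> nat \<Rightarrow> nat \<Rightarrow> nat \<Rightarrow> int" where
  "val_q p s i k = (if 1 \<le> k \<and> k \<le> s - i then int ((p - 1) * p ^ (s - k)) else 0)"

definition val_L :: "nat \<Rightarrow> nat \<Rightarrow> nat \<Rightarrow> int" where
  "val_L p s k = (if 1 \<le> k \<and> k \<le> s then int (p ^ (s - k)) else 0)"

text \<open>Serves twice: as the leading exponents of V_s in the y_k, and later as the exact
  exponents of V_s as a monomial in the v_k (\<open>vmono_val_V\<close>). The two agree because v_k
  has leading monomial y_k.\<close>

definition val_V :: "nat \<Rightarrow> nat \<Rightarrow> nat \<Rightarrow> int" where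
  "val_V p s k = val_q p (s - 1) 0 k + (if k = s then 1 else 0)"

context odd_prime_field
begin

lemma card_gt_0: "CARD('k) > 0" using prime_card by (rule prime_gt_0_nat)

lemma val_steps:
  assumes q: "\<And>i. i \<le> s \<Longrightarrow> has_val (dQ s i :: 'k ratfun) (val_q CARD('k) s i)"
    and L: "has_val (dL s :: 'k ratfun) (val_L CARD('k) s)"
  shows "has_val (dV (Suc s) :: 'k ratfun) (val_V CARD('k) (Suc s))"
    and "has_val (dL (Suc s) :: 'k ratfun) (val_L CARD('k) (Suc s))"
    and "i \<le> Suc s \<Longrightarrow> has_val (dQ (Suc s) i :: 'k ratfun) (val_q CARD('k) (Suc s) i)"
proof -
  let ?y = "yvar (Suc s) :: 'k ratfun"
  let ?g = "\<lambda>j. (-1) ^ (s - j) * (dQ s j * ?y ^ (CARD('k) ^ j))"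
  let ?e = "\<lambda>j k. val_q CARD('k) s j k + int (CARD('k) ^ j) * (if k = Suc s then 1 else 0)"
  have e: "has_val (?g j) (?e j)" if "j \<le> s" for j
    by (intro has_val_sign is_sign_minus_1 has_val_mult q that has_val_power has_val_yvar)
  have "has_val (?g 0 + sum ?g {1..s}) (val_V CARD('k) (Suc s))"
  proof (rule has_val_add_sum)
    show "has_val (?g 0) (val_V CARD('k) (Suc s))"
      using e[of 0] by (simp add: val_V_def[abs_def])
    fix j assume j: "j \<in> {1..s}"
    \<comment> \<open>The leading exponents of q_{s,j} stop at index s - j, those of q_{s,0} go on
      to s; the first difference is therefore at s - j + 1.\<close>
    have "less_fun (?e j) (val_V CARD('k) (Suc s))"
      unfolding less_fun_def
    proof (intro exI[of _ "s - j + 1"] conjI allI impI)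
      show "?e j (s - j + 1) < val_V CARD('k) (Suc s) (s - j + 1)"
        using j card_ge_3 by (auto simp: val_q_def val_V_def)
      fix k assume "k < s - j + 1"
      then show "?e j k = val_V CARD('k) (Suc s) k"
        using j by (auto simp: val_q_def val_V_def)
    qed
    then show "?g j = 0 \<or> has_val (?g j) (?e j) \<and> less_fun (?e j) (val_V CARD('k) (Suc s))"
      using e[of j] j by simp
  qed simp
  moreover have "?g 0 + sum ?g {1..s} = dV (Suc s)"
    unfolding dV_def dickson_poly_def
    by (simp add: mult.assoc atMost_atLeast0 sum.atLeast_Suc_atMost)
  ultimately show V: "has_val (dV (Suc s) :: 'k ratfun) (val_V CARD('k) (Suc s))" by simp
  have aux: "int (CARD('k) - 1) * int (CARD('k) ^ n) + int (CARD('k) ^ n) = int (CARD('k) ^ Suc n)" for n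
    using card_gt_0 by (simp add: of_nat_diff algebra_simps)
  have "(\<lambda>k. val_V CARD('k) (Suc s) k + val_L CARD('k) s k) = val_L CARD('k) (Suc s)"
    by (rule ext) (auto simp: val_V_def val_q_def val_L_def Suc_diff_le aux[simplified])
  then show LS: "has_val (dL (Suc s) :: 'k ratfun) (val_L CARD('k) (Suc s))"
    using has_val_mult[OF V L] by (simp add: dL_Suc)
  assume i: "i \<le> Suc s"
  consider "i = 0" | "i = Suc s" | "1 \<le> i" "i \<le> s" using i by linarith
  then show "has_val (dQ (Suc s) i :: 'k ratfun) (val_q CARD('k) (Suc s) i)"
  proof cases
    case 1
    have "(\<lambda>k. int (CARD('k) - 1) * val_L CARD('k) (Suc s) k) = val_q CARD('k) (Suc s) 0"
      by (rule ext) (auto simp: val_q_def val_L_def)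
    then show ?thesis using has_val_power[OF LS, of "CARD('k) - 1"] 1 by (simp add: dQ_bottom)
  next
    case 2
    have "val_q CARD('k) (Suc s) (Suc s) = (\<lambda>k. 0)" by (rule ext) (simp add: val_q_def)
    then show ?thesis using has_val_1 2 by (simp add: dQ_diag)
  next
    case 3
    let ?h = "\<lambda>k. val_q CARD('k) s i k + int (CARD('k) - 1) * val_V CARD('k) (Suc s) k"
    have sp: "CARD('k) ^ Suc n = CARD('k) * CARD('k) ^ n" for n by simp
    have "(\<lambda>k. int CARD('k) * val_q CARD('k) s (i - 1) k) = val_q CARD('k) (Suc s) i"
    proof (rule ext)
      fix k
      have "s - (i - 1) = Suc s - i" using 3 by simp
      moreover have "Suc s - k = Suc (s - k)" if "k \<le> Suc s - i" using that 3 by simp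
      ultimately show "int CARD('k) * val_q CARD('k) s (i - 1) k = val_q CARD('k) (Suc s) i k"
        by (auto simp: val_q_def)
    qed
    then have f: "has_val (dQ s (i - 1) ^ CARD('k) :: 'k ratfun) (val_q CARD('k) (Suc s) i)"
      using has_val_power[OF q[of "i - 1"], of "CARD('k)"] 3 by simp
    have g: "has_val (dQ s i * dV (Suc s) ^ (CARD('k) - 1) :: 'k ratfun) ?h"
      by (intro has_val_mult q has_val_power V) (use 3 in auto)
    \<comment> \<open>Up to index s - i both summands of the recursion have the same exponents. At s
      - i + 1 only V_{s+1}^(p-1) contributes to the second one, which gives (p-1)^2 p^(i-1), less
      than (p-1) p^i.\<close>
    have "less_fun ?h (val_q CARD('k) (Suc s) i)"
      unfolding less_fun_def
    proof (intro exI[of _ "s - i + 1"] conjI allI impI)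
      have "?h (s - i + 1) = int (CARD('k) - 1) * (int (CARD('k) - 1) * int (CARD('k) ^ (i - 1)))"
        using 3 by (simp add: val_q_def val_V_def)
      also have "\<dots> < int (CARD('k) - 1) * (int CARD('k) * int (CARD('k) ^ (i - 1)))"
        using card_ge_3 by (intro mult_strict_left_mono mult_strict_right_mono) auto
      also have "int CARD('k) * int (CARD('k) ^ (i - 1)) = int (CARD('k) ^ i)"
        using 3 by (metis Suc_le_D diff_Suc_1 of_nat_mult sp One_nat_def)
      also have "int (CARD('k) - 1) * int (CARD('k) ^ i) = val_q CARD('k) (Suc s) i (s - i + 1)"
        using 3 by (simp add: val_q_def Suc_diff_le)
      finally show "?h (s - i + 1) < val_q CARD('k) (Suc s) i (s - i + 1)" .
      fix k assume k: "k < s - i + 1"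
      show "?h k = val_q CARD('k) (Suc s) i k"
      proof (cases "k = 0")
        case False
        have "int (CARD('k) - 1) * int (CARD('k) ^ (s - k)) + int (CARD('k) - 1) * (int (CARD('k) - 1) * int (CARD('k) ^ (s - k)))
            = int (CARD('k) - 1) * (int (CARD('k) - 1) * int (CARD('k) ^ (s - k)) + int (CARD('k) ^ (s - k)))"
          by (simp add: algebra_simps)
        also have "\<dots> = int (CARD('k) - 1) * int (CARD('k) ^ Suc (s - k))" by (simp only: aux)
        finally show ?thesis
          using k False 3 by (simp add: val_q_def val_V_def Suc_diff_le)
      qed (simp add: val_q_def val_V_def)
    qed
    then show ?thesis
      using has_val_add[OF f, of _ ?h] g 3 by (simp add: dQ_Suc)
  qed
qed

lemma has_val_dQ_dL:
  "(\<forall>i\<le>s. has_val (dQ s i :: 'k ratfun) (val_q CARD('k) s i)) \<and> has_val (dL s :: 'k ratfun) (val_L CARD('k) s)"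
proof (induction s)
  case 0
  have "val_q CARD('k) 0 0 = (\<lambda>k. 0)" "val_L CARD('k) 0 = (\<lambda>k. 0)" by (auto simp: val_q_def val_L_def)
  then show ?case by (simp add: has_val_1)
next
  case (Suc s)
  then show ?case using val_steps by blast
qed

lemma has_val_dL: "has_val (dL s :: 'k ratfun) (val_L CARD('k) s)"
  using has_val_dQ_dL by blast

lemma has_val_dV: "s \<ge> 1 \<Longrightarrow> has_val (dV s :: 'k ratfun) (val_V CARD('k) s)"
  using has_val_dQ_dL val_steps(1)[of "s - 1"] by simp

lemma dL_nonzero [simp]: "dL s \<noteq> (0 :: 'k ratfun)"
  using has_val_dL has_val_nonzero by blast

lemma dV_nonzero: "s \<ge> 1 \<Longrightarrow> dV s \<noteq> (0 :: 'k ratfun)"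
  using has_val_dV has_val_nonzero by blast

text \<open>Below index s the exponents of V_s are those of L_{s-1}^(p-1), so they cancel in v_s.
  Consequently distinct Laurent monomials in the v_k have distinct valuations.\<close>

lemma has_val_dv:
  assumes "s \<ge> 1"
  shows "has_val (dv s :: 'k ratfun) (\<lambda>k. if k = s then 1 else 0)"
proof -
  have "(\<lambda>k. val_V CARD('k) s k + - (int (CARD('k) - 1) * val_L CARD('k) (s - 1) k)) = (\<lambda>k. if k = s then 1 else 0)"
    using assms by (intro ext) (auto simp: val_V_def val_q_def val_L_def)
  then show ?thesis
    using has_val_mult[OF has_val_dV[OF assms] has_val_inverse[OF has_val_power[OF has_val_dL[of "s - 1"], of "CARD('k) - 1"]]]
    by (simp add: dv_def divide_inverse)
qed

lemma dv_nonzero: "s \<ge> 1 \<Longrightarrow> dv s \<noteq> (0 :: 'k ratfun)"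
  using has_val_dv has_val_nonzero by blast

lemma dV_eq: "dV s = dv s * (dL (s - 1) :: 'k ratfun) ^ (CARD('k) - 1)"
  by (simp add: dv_def)

lemma dL_Suc_dv: "dL (Suc s) = dv (Suc s) * (dL s :: 'k ratfun) ^ CARD('k)"
  using card_gt_0 by (simp add: dL_Suc dV_eq flip: power_Suc2)

text \<open>Iteration of L_{s+1} = v_{s+1} L_s^p. This is an identity, not only a statement about
  leading terms: L_s, V_s and their inverses are monomials in the v_k.\<close>

lemma dL_prod_dv: "dL s = (\<Prod>k=1..s. (dv k :: 'k ratfun) ^ (CARD('k) ^ (s - k)))"
proof (induction s)
  case (Suc s)
  have "(\<Prod>k=1..s. (dv k :: 'k ratfun) ^ (CARD('k) ^ (Suc s - k))) = dL s ^ CARD('k)"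
    unfolding Suc prod_power_distrib
    by (intro prod.cong) (simp_all add: Suc_diff_le mult.commute flip: power_mult)
  then show ?case by (simp add: dL_Suc_dv mult.commute)
qed simp

end

subsection \<open>The dual basis of the columns\<close>

text \<open>The linear forms \<open>\<theta>\<^bsub>s,j\<^esub>\<close> are dual to the columns \<open>(y\<^sub>a ^ CARD('k)\<^sup>j)\<^sub>a\<close>; \<open>\<tau>\<^sub>s\<close> is \<open>\<theta>\<^bsub>s,s-1\<^esub>\<close>.\<close>

fun theta :: "nat \<Rightarrow> nat \<Rightarrow> nat \<Rightarrow> 'k::field ratfun" where
  "theta 0 j a = 0"
| "theta (Suc s) j a = theta s j a + (-1) ^ (s - j) * dQ s j *
     (((if a = Suc s then 1 else 0) - (\<Sum>i<s. yvar (Suc s) ^ (CARD('k) ^ i) * theta s i a)) / dV (Suc s))"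

definition tau :: "nat \<Rightarrow> nat \<Rightarrow> 'k::field ratfun" where
  "tau s a = ((if a = s then 1 else 0) - (\<Sum>i<s - 1. yvar s ^ (CARD('k) ^ i) * theta (s - 1) i a)) / dV s"

lemma theta_Suc: "theta (Suc s) j a = theta s j a + (-1) ^ (s - j) * dQ s j * tau (Suc s) a"
  by (simp add: tau_def)

declare theta.simps(2) [simp del]

lemma theta_tau_outside: 
  "a \<notin> {1..s} \<Longrightarrow> theta s j a = (0 :: 'k::field ratfun)"
  "a \<notin> {1..s} \<Longrightarrow> s \<ge> 1 \<Longrightarrow> tau s a = (0 :: 'k::field ratfun)"
proof -
  have th: "a \<notin> {1..s} \<Longrightarrow> theta s j a = (0 :: 'k::field ratfun)" for s j
  proof (induction s arbitrary: j)
    case (Suc s)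
    then have "theta s i a = (0 :: 'k ratfun)" for i by (metis atLeastAtMost_iff le_SucI)
    moreover have "a \<noteq> Suc s" using Suc.prems by auto
    ultimately show ?case by (simp add: theta.simps(2))
  qed simp
  show "a \<notin> {1..s} \<Longrightarrow> theta s j a = (0 :: 'k::field ratfun)" by (rule th)
  show "a \<notin> {1..s} \<Longrightarrow> s \<ge> 1 \<Longrightarrow> tau s a = (0 :: 'k::field ratfun)"
    using th[of "s - 1"] by (auto simp: tau_def)
qed

context odd_prime_field
begin

lemma theta_above: "s \<le> j \<Longrightarrow> theta s j a = (0 :: 'k ratfun)"
  by (induction s) (simp_all add: theta_Suc dQ_above)

definition pair_y :: "nat \<Rightarrow> (nat \<Rightarrow> 'k ratfun) \<Rightarrow> nat \<Rightarrow> 'k ratfun" where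
  "pair_y s f i = (\<Sum>a=1..s. f a * yvar a ^ (CARD('k) ^ i))"

text \<open>The form \<tau>_{s+1} annihilates the columns below s by construction. On column s its
  numerator is the Dickson polynomial at y_{s+1}, that is V_{s+1}, which explains the division. The
  multiple of it in \<theta>_{s+1,j} cancels the value of \<theta>_{s,j} on column s. This value,
  the second conjunct, is known because the roots of the Dickson polynomial express column s by the
  preceding columns.\<close>

lemma pair_theta:
  "(\<forall>j i. j < s \<longrightarrow> i < s \<longrightarrow> pair_y s (theta s j) i = (if i = j then 1 else 0)) \<and>
   (\<forall>j < s. pair_y s (theta s j) s = - ((-1) ^ (s - j) * dQ s j))"
proof (induction s)
  case (Suc s)
  let ?y = "yvar (Suc s) :: 'k ratfun"
  have ext: "pair_y (Suc s) (theta s j) i = pair_y s (theta s j) i" for j i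
    by (simp add: pair_y_def theta_tau_outside)
  have V: "dV (Suc s) \<noteq> (0 :: 'k ratfun)" by (simp add: dV_nonzero)
  have tau: "pair_y (Suc s) (tau (Suc s)) i =
      (?y ^ (CARD('k) ^ i) - (\<Sum>j<s. ?y ^ (CARD('k) ^ j) * pair_y s (theta s j) i)) / dV (Suc s)" for i
  proof -
    have "pair_y (Suc s) (tau (Suc s)) i * dV (Suc s) =
      (\<Sum>a=1..Suc s. (if a = Suc s then 1 else 0) * yvar a ^ (CARD('k) ^ i)) -
      (\<Sum>a=1..Suc s. (\<Sum>j<s. ?y ^ (CARD('k) ^ j) * theta s j a) * yvar a ^ (CARD('k) ^ i))"
      unfolding pair_y_def sum_distrib_right sum_subtractf[symmetric]
      by (intro sum.cong refl)
        (use V in \<open>simp add: tau_def, simp add: left_diff_distrib sum_distrib_right\<close>)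
    also have "(\<Sum>a=1..Suc s. (if a = Suc s then 1 else 0) * yvar a ^ (CARD('k) ^ i)) = ?y ^ (CARD('k) ^ i)"
      by simp
    also have "(\<Sum>a=1..Suc s. (\<Sum>j<s. ?y ^ (CARD('k) ^ j) * theta s j a) * yvar a ^ (CARD('k) ^ i)) =
       (\<Sum>j<s. ?y ^ (CARD('k) ^ j) * pair_y (Suc s) (theta s j) i)"
      unfolding sum_distrib_right pair_y_def sum_distrib_left
      by (subst sum.swap) (simp add: mult.assoc)
    finally show ?thesis using V by (simp add: ext field_simps)
  qed
  have tau_lt: "pair_y (Suc s) (tau (Suc s)) i = 0" if "i < s" for i
  proof -
    have "(\<Sum>j<s. ?y ^ (CARD('k) ^ j) * pair_y s (theta s j) i) = (\<Sum>j<s. if j = i then ?y ^ (CARD('k) ^ j) else 0)"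
      by (intro sum.cong) (use Suc that in auto)
    then show ?thesis using that by (simp add: tau)
  qed
  have tau_eq: "pair_y (Suc s) (tau (Suc s)) s = 1"
  proof -
    have "(\<Sum>j<s. ?y ^ (CARD('k) ^ j) * pair_y s (theta s j) s) = - (\<Sum>j<s. (-1) ^ (s - j) * dQ s j * ?y ^ (CARD('k) ^ j))"
      unfolding sum_negf[symmetric] by (intro sum.cong) (use Suc in auto)
    moreover have "dV (Suc s) = (\<Sum>j<s. (-1) ^ (s - j) * dQ s j * ?y ^ (CARD('k) ^ j)) + ?y ^ (CARD('k) ^ s)"
      by (simp add: dV_def dickson_poly_def dQ_diag lessThan_Suc_atMost[symmetric])
    ultimately have "?y ^ (CARD('k) ^ s) - (\<Sum>j<s. ?y ^ (CARD('k) ^ j) * pair_y s (theta s j) s) = dV (Suc s)" by simp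
    then show ?thesis using V by (simp add: tau)
  qed
  have lin: "pair_y (Suc s) (theta (Suc s) j) i =
      pair_y s (theta s j) i + (-1) ^ (s - j) * dQ s j * pair_y (Suc s) (tau (Suc s)) i" for i j
    unfolding ext[symmetric] pair_y_def theta_Suc sum_distrib_left
    by (simp add: distrib_right mult.assoc theta_tau_outside flip: sum.distrib)
  have below: "pair_y (Suc s) (theta (Suc s) j) i = (if i = j then 1 else 0)" if "j < Suc s" "i < Suc s" for i j
  proof (cases "j < s")
    case True
    then show ?thesis using Suc that by (cases "i < s") (auto simp: lin tau_lt tau_eq less_Suc_eq)
  next
    case False
    then have "j = s" using that by simp
    moreover have "pair_y s (theta s s) i = 0" by (simp add: pair_y_def theta_above)
    ultimately show ?thesis
      using that by (cases "i < s") (auto simp: lin tau_lt tau_eq less_Suc_eq dQ_diag)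
  qed
  have "pair_y (Suc s) (theta (Suc s) j) (Suc s) = - ((-1) ^ (Suc s - j) * dQ (Suc s) j)" if j: "j < Suc s" for j
  proof -
    have y: "yvar a ^ (CARD('k) ^ Suc s) = - (\<Sum>m\<le>s. (-1) ^ (Suc s - m) * dQ (Suc s) m * (yvar a ^ (CARD('k) ^ m) :: 'k ratfun))"
      if "a \<in> {1..Suc s}" for a
      using dickson_poly_root[OF that]
      by (simp add: dickson_poly_def dQ_diag eq_neg_iff_add_eq_0 add.commute)
    have "pair_y (Suc s) (theta (Suc s) j) (Suc s) =
      (\<Sum>a=1..Suc s. theta (Suc s) j a * - (\<Sum>m\<le>s. (-1) ^ (Suc s - m) * dQ (Suc s) m * yvar a ^ (CARD('k) ^ m)))"
      unfolding pair_y_def by (intro sum.cong refl arg_cong2[of _ _ _ _ "(*)"] y)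
    also have "\<dots> = - (\<Sum>m\<le>s. (-1) ^ (Suc s - m) * dQ (Suc s) m * pair_y (Suc s) (theta (Suc s) j) m)"
      unfolding pair_y_def sum_distrib_left mult_minus_right sum_negf
      by (subst sum.swap) (simp add: mult_ac)
    also have "\<dots> = - (\<Sum>m\<le>s. if m = j then (-1) ^ (Suc s - m) * dQ (Suc s) m else 0)"
      by (intro arg_cong[of _ _ uminus] sum.cong) (auto simp: below j)
    also have "\<dots> = - ((-1) ^ (Suc s - j) * dQ (Suc s) j)"
      using j by simp
    finally show ?thesis .
  qed
  with below show ?case by blast
qed simp

end

subsection \<open>Determinants of lists of columns\<close>

definition cols_det :: "nat \<Rightarrow> (nat \<Rightarrow> 'a::comm_ring_1) list \<Rightarrow> 'a" where
  "cols_det s ws = det (mat s s (\<lambda>(i, j). (ws ! j) (Suc i)))"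

definition omit :: "nat \<Rightarrow> 'b list \<Rightarrow> 'b list" where
  "omit j ws = take j ws @ drop (Suc j) ws"

lemma nth_omit: "j < length ws \<Longrightarrow> omit j ws ! i = ws ! (if i < j then i else Suc i)"
  by (auto simp: omit_def nth_append)

lemma length_omit: "j < length ws \<Longrightarrow> length (omit j ws) = length ws - 1"
  by (auto simp: omit_def)

text \<open>The position r of the additional row is kept free: r = 0 is used in
  \<open>cols_relation\<close> and r = s in \<open>mui_L_Suc\<close>.\<close>

lemma laplace_cols:
  assumes A: "A = mat (Suc s) (Suc s) (\<lambda>(i, j). if i = r then f j else (ws ! j) (if i < r then Suc i else i))"
    and r: "r \<le> s" and l: "length ws = Suc s"
  shows "det A = (\<Sum>j\<le>s. (-1) ^ (r + j) * f j * cols_det s (omit j ws))"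
proof -
  have "det A = (\<Sum>j<Suc s. A $$ (r, j) * cofactor A r j)"
    by (rule laplace_expansion_row) (use A r in auto)
  also have "\<dots> = (\<Sum>j\<le>s. (-1) ^ (r + j) * f j * cols_det s (omit j ws))"
    unfolding lessThan_Suc_atMost
  proof (rule sum.cong[OF refl])
    fix j assume "j \<in> {..s}"
    then have j: "j \<le> s" by simp
    have "mat_delete A r j = mat s s (\<lambda>(i, k). (omit j ws ! k) (Suc i))"
      unfolding mat_delete_def A using r j l by (intro cong_mat) (auto simp: nth_omit)
    then show "A $$ (r, j) * cofactor A r j = (-1) ^ (r + j) * f j * cols_det s (omit j ws)"
      using r j by (simp add: cofactor_def cols_det_def A)
  qed
  finally show ?thesis .
qed

text \<open>A linear form is a combination of the \<open>s\<close> coordinates. So the determinant with the values of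
  the form on \<open>s + 1\<close> columns as an additional row vanishes.\<close>

lemma cols_relation:
  fixes ws :: "(nat \<Rightarrow> 'a::field) list"
  assumes "length ws = Suc s"
  shows "(\<Sum>j\<le>s. (-1) ^ j * (\<Sum>a=1..s. f a * (ws ! j) a) * cols_det s (omit j ws)) = 0"
proof -
  let ?A = "mat (Suc s) (Suc s) (\<lambda>(i, j). if i = 0 then (\<Sum>a=1..s. f a * (ws ! j) a)
    else (ws ! j) (if i < 0 then Suc i else i))"
  let ?v = "vec (Suc s) (\<lambda>i. if i = 0 then 1 else - f i)"
  have c: "?A \<in> carrier_mat (Suc s) (Suc s)" by simp
  \<comment> \<open>Row 0 is the combination of the other rows with coefficients f a, so (1, -f)
    lies in the kernel of the transpose.\<close>
  have "transpose_mat ?A *\<^sub>v ?v = 0\<^sub>v (Suc s)"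
  proof (rule eq_vecI)
    fix j assume "j < dim_vec (0\<^sub>v (Suc s) :: 'a vec)"
    then have j: "j < Suc s" by simp
    have "(transpose_mat ?A *\<^sub>v ?v) $ j = (\<Sum>i<Suc s. ?A $$ (i, j) * ?v $ i)"
      using j by (simp add: scalar_prod_def lessThan_atLeast0)
    also have "\<dots> = (\<Sum>a=1..s. f a * (ws ! j) a) - (\<Sum>i<s. (ws ! j) (Suc i) * f (Suc i))"
      using j by (simp add: sum.lessThan_Suc_shift sum_negf del: sum.lessThan_Suc)
    also have "(\<Sum>i<s. (ws ! j) (Suc i) * f (Suc i)) = (\<Sum>a=1..s. f a * (ws ! j) a)"
      by (simp add: sum.atLeast1_atMost_eq mult.commute)
    finally show "(transpose_mat ?A *\<^sub>v ?v) $ j = 0\<^sub>v (Suc s) $ j" using j by simp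
  qed simp
  moreover have "?v \<noteq> 0\<^sub>v (Suc s)"
  proof
    assume "?v = 0\<^sub>v (Suc s)"
    then have "?v $ 0 = 0\<^sub>v (Suc s) $ 0" by (rule arg_cong)
    then show False by simp
  qed
  ultimately have "det (transpose_mat ?A) = 0"
    by (subst det_0_iff_vec_prod_zero[of _ "Suc s"]) (auto intro!: exI[of _ ?v])
  then have "det ?A = 0" using det_transpose[OF c] by simp
  then show ?thesis using laplace_cols[OF refl, of 0 s ws] assms by simp
qed

text \<open>The Leibniz formula with the index set moved to {1..s}, where the permutations in
  \<open>mixed_bracket\<close> live.\<close>

lemma cols_det_permutations:
  "cols_det s ws = (\<Sum>\<sigma> | \<sigma> permutes {1..s}. of_int (sign \<sigma>) * (\<Prod>j<s. (ws ! j) (\<sigma> (Suc j))))"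
proof -
  let ?A = "mat s s (\<lambda>(i, j). (ws ! j) (Suc i))"
  have bij: "bij_betw Suc {0..<s} {1..s}"
    by (rule bij_betwI[of _ _ _ "\<lambda>x. x - 1"]) auto
  have bij': "bij_betw (\<lambda>x. x - 1) {1..s} {0..<s}"
    by (rule bij_betwI[of _ _ _ Suc]) auto
  have "cols_det s ws = det (transpose_mat ?A)"
    unfolding cols_det_def by (rule det_transpose[symmetric, of _ s]) simp
  also have "\<dots> = (\<Sum>q | q permutes {0..<s}. signof q * (\<Prod>i = 0..<s. transpose_mat ?A $$ (i, q i)))"
    by (rule det_def') simp
  also have "\<dots> = (\<Sum>\<sigma> | \<sigma> permutes {1..s}. of_int (sign \<sigma>) * (\<Prod>j<s. (ws ! j) (\<sigma> (Suc j))))"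
  proof (rule sum.reindex_bij_witness[of _ "map_permutation {1..s} (\<lambda>x. x - 1)" "map_permutation {0..<s} Suc"])
    fix q assume "q \<in> {q. q permutes {0..<s}}"
    then have q: "q permutes {0..<s}" by simp
    show "map_permutation {1..s} (\<lambda>x. x - 1) (map_permutation {0..<s} Suc q) = q"
      by (rule map_permutation_compose_inv[OF bij q]) simp
    show "map_permutation {0..<s} Suc q \<in> {\<sigma>. \<sigma> permutes {1..s}}"
      using map_permutation_permutes[OF bij q] by simp
    have "sign (map_permutation {0..<s} Suc q) = sign q"
      by (rule sign_map_permutation[OF _ q]) auto
    moreover have "(\<Prod>i = 0..<s. transpose_mat ?A $$ (i, q i)) =
        (\<Prod>j<s. (ws ! j) (map_permutation {0..<s} Suc q (Suc j)))"
      unfolding lessThan_atLeast0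
    proof (rule prod.cong[OF refl])
      fix i assume i: "i \<in> {0..<s}"
      then have "q i < s" using q by (metis atLeastLessThan_iff permutes_in_image)
      then show "transpose_mat ?A $$ (i, q i) = (ws ! i) (map_permutation {0..<s} Suc q (Suc i))"
        using i by (subst map_permutation_apply) auto
    qed
    ultimately show "of_int (sign (map_permutation {0..<s} Suc q)) *
        (\<Prod>j<s. (ws ! j) (map_permutation {0..<s} Suc q (Suc j))) =
        signof q * (\<Prod>i = 0..<s. transpose_mat ?A $$ (i, q i))"
      by simp
  next
    fix \<sigma> assume "\<sigma> \<in> {\<sigma>. \<sigma> permutes {1..s}}"
    then have \<sigma>: "\<sigma> permutes {1..s}" by simp
    show "map_permutation {0..<s} Suc (map_permutation {1..s} (\<lambda>x. x - 1) \<sigma>) = \<sigma>"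
      by (rule map_permutation_compose_inv[OF bij' \<sigma>]) auto
    show "map_permutation {1..s} (\<lambda>x. x - 1) \<sigma> \<in> {q. q permutes {0..<s}}"
      using map_permutation_permutes[OF bij' \<sigma>] by simp
  qed
  finally show ?thesis .
qed

section \<open>Identification of the determinants with the recursively defined invariants\<close>

definition ycol :: "nat \<Rightarrow> nat \<Rightarrow> 'k::field ratfun" where
  "ycol r a = yvar a ^ (CARD('k) ^ r)"

lemma bracket_cols: "bracket rs = cols_det (length rs) (map ycol rs)"
  unfolding bracket_def cols_det_def by (intro arg_cong[of _ _ det] cong_mat) (auto simp: ycol_def)

lemma map_omit: "map f (omit j xs) = omit j (map f xs)"
  by (simp add: omit_def take_map drop_map)

lemma omit_distinct:
  assumes "distinct xs" "j < length xs"
  shows "omit j xs = filter (\<lambda>x. x \<noteq> xs ! j) xs"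
proof -
  have xs: "xs = take j xs @ xs ! j # drop (Suc j) xs" using assms(2) by (rule id_take_nth_drop)
  then have "distinct (take j xs @ xs ! j # drop (Suc j) xs)" using assms(1) by simp
  then have "filter (\<lambda>x. x \<noteq> xs ! j) (take j xs) = take j xs"
      "filter (\<lambda>x. x \<noteq> xs ! j) (drop (Suc j) xs) = drop (Suc j) xs"
    by (auto simp: filter_id_conv)
  then show ?thesis
    unfolding omit_def by (subst (3) xs) (simp only: filter_append filter.simps simp_thms if_False)
qed

lemma filter_upt_omit: "j < n \<Longrightarrow> filter (\<lambda>i. i \<noteq> j) [0..<n] = omit j [0..<n]"
  using omit_distinct[of "[0..<n]" j] by simp

context odd_prime_field
begin

lemma mui_L_omit_cols: "i \<le> s \<Longrightarrow> mui_L_omit s i = cols_det s (omit i (map ycol [0..<Suc s]) :: (nat \<Rightarrow> 'k ratfun) list)"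
  unfolding mui_L_omit_def bracket_cols by (simp add: filter_upt_omit length_omit map_omit del: upt_Suc)

lemma mui_L_cols: "mui_L s = cols_det s (map ycol [0..<s] :: (nat \<Rightarrow> 'k ratfun) list)"
  unfolding mui_L_def by (subst mui_L_omit_cols) (auto simp: omit_def)

lemma pair_y_ycol: "pair_y s f r = (\<Sum>a=1..s. f a * ycol r a)"
  by (simp add: pair_y_def ycol_def)

text \<open>The form \<theta>_{s,i} is 1 on column i, 0 on the other columns below s, and q_{s,i} up
  to sign on column s. So in the relation between the s + 1 columns only two minors survive: the one
  without column i, and L_s.\<close>

lemma mui_L_omit_eq: "i \<le> s \<Longrightarrow> mui_L_omit s i = dQ s i * (mui_L s :: 'k ratfun)"
proof (cases "i = s")
  case True
  then show ?thesis by (simp add: mui_L_def dQ_diag)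
next
  case False
  assume "i \<le> s"
  with False have i: "i < s" by simp
  let ?ws = "map ycol [0..<Suc s] :: (nat \<Rightarrow> 'k ratfun) list"
  let ?c = "\<lambda>j. cols_det s (omit j ?ws)"
  have "(\<Sum>j\<le>s. (-1) ^ j * (\<Sum>a=1..s. theta s i a * (?ws ! j) a) * ?c j) = 0"
    by (rule cols_relation) simp
  also have "(\<Sum>j\<le>s. (-1) ^ j * (\<Sum>a=1..s. theta s i a * (?ws ! j) a) * ?c j) =
      (\<Sum>j\<le>s. (-1) ^ j * pair_y s (theta s i) j * ?c j)"
    by (intro sum.cong) (auto simp: pair_y_ycol simp del: upt_Suc)
  also have "\<dots> = (\<Sum>j<s. (-1) ^ j * pair_y s (theta s i) j * ?c j) + (-1) ^ s * pair_y s (theta s i) s * ?c s"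
    by (simp add: lessThan_Suc_atMost[symmetric] del: upt_Suc)
  also have "(\<Sum>j<s. (-1) ^ j * pair_y s (theta s i) j * ?c j) = (\<Sum>j<s. if j = i then (-1) ^ j * ?c j else 0)"
    by (intro sum.cong) (use pair_theta i in auto)
  also have "\<dots> = (-1) ^ i * ?c i" using i by simp
  also have "pair_y s (theta s i) s = - ((-1) ^ (s - i) * dQ s i)" using pair_theta i by blast
  finally have "(-1) ^ i * ?c i = (-1) ^ s * (-1) ^ (s - i) * dQ s i * ?c s" by simp
  also have "(-1) ^ s * (-1) ^ (s - i) = ((-1) ^ i :: 'k ratfun)"
  proof -
    have "s + (s - i) = i + 2 * (s - i)" using i by simp
    then show ?thesis by (metis (no_types, opaque_lifting) minus_one_power_iff even_add even_mult_iff even_numeral power_add)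
  qed
  finally have "(-1) ^ i * ?c i = (-1) ^ i * (dQ s i * ?c s)" by (simp only: mult.assoc)
  then have "?c i = dQ s i * ?c s" by simp
  then show ?thesis using i by (simp add: mui_L_omit_cols mui_L_def del: upt_Suc)
qed

text \<open>Expansion along the row of y_{s+1}. Its minors are the q_{s,j} L_s, so the signed sum is
  L_s times the Dickson polynomial at y_{s+1}, which is V_{s+1}.\<close>

lemma mui_L_Suc: "mui_L (Suc s) = dV (Suc s) * (mui_L s :: 'k ratfun)"
proof -
  let ?ws = "map ycol [0..<Suc s] :: (nat \<Rightarrow> 'k ratfun) list"
  have "mui_L (Suc s) = det (mat (Suc s) (Suc s) (\<lambda>(i, j). if i = s then ycol j (Suc s) else (?ws ! j) (if i < s then Suc i else i)))"
    unfolding mui_L_cols cols_det_def by (intro arg_cong[of _ _ det] cong_mat) (auto simp del: upt_Suc)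
  also have "\<dots> = (\<Sum>j\<le>s. (-1) ^ (s + j) * ycol j (Suc s) * cols_det s (omit j ?ws))"
    by (rule laplace_cols[OF refl]) auto
  also have "\<dots> = (\<Sum>j\<le>s. (-1) ^ (s - j) * dQ s j * yvar (Suc s) ^ (CARD('k) ^ j) * mui_L s)"
  proof (rule sum.cong[OF refl])
    fix j assume j: "j \<in> {..s}"
    have "(-1) ^ (s + j) = ((-1) ^ (s - j) :: 'k ratfun)"
      using j by (simp add: minus_one_power_iff)
    moreover have "cols_det s (omit j ?ws) = dQ s j * mui_L s"
      using j mui_L_omit_eq[of j s] by (simp add: mui_L_omit_cols del: upt_Suc)
    ultimately show "(-1) ^ (s + j) * ycol j (Suc s) * cols_det s (omit j ?ws) =
        (-1) ^ (s - j) * dQ s j * yvar (Suc s) ^ (CARD('k) ^ j) * mui_L s"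
      by (simp add: ycol_def mult_ac del: upt_Suc)
  qed
  finally show ?thesis by (simp add: dV_def dickson_poly_def sum_distrib_right)
qed

lemma mui_L_eq: "mui_L s = (dL s :: 'k ratfun)"
proof (induction s)
  case 0 then show ?case by (simp add: mui_L_cols cols_det_def)
qed (simp add: mui_L_Suc dL_Suc)

lemma dickson_q_eq: "i \<le> s \<Longrightarrow> dickson_q s i = (dQ s i :: 'k ratfun)"
  by (simp add: dickson_q_def mui_L_omit_eq) (simp add: mui_L_eq)

lemma mui_V_eq: "s \<ge> 1 \<Longrightarrow> mui_V s = (dV s :: 'k ratfun)"
  by (cases s) (simp_all add: mui_V_def mui_L_eq dL_Suc)

lemma mui_v_eq: "s \<ge> 1 \<Longrightarrow> mui_v s = (dv s :: 'k ratfun)"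
  by (simp add: mui_v_def mui_V_eq dickson_q_eq dQ_bottom dv_def)

end

subsection \<open>The mixed brackets\<close>

lemma prod_lessThan_add:
  "(\<Prod>j<k + l. f j) = (\<Prod>j<k. f j) * (\<Prod>j<l. f (k + j) :: 'a::comm_monoid_mult)" for k l :: nat
  by (induction l) (simp_all add: mult.assoc)

definition unit_col :: "nat \<Rightarrow> nat \<Rightarrow> 'a::comm_ring_1" where
  "unit_col a b = (if b = a then 1 else 0)"

text \<open>The coefficient of x_A in [k; rs] as one determinant: the k unit columns keep exactly
  those permutations whose first k values list A in increasing order.\<close>

definition mixed_coef :: "nat \<Rightarrow> nat list \<Rightarrow> nat fset \<Rightarrow> 'k::field ratfun" where
  "mixed_coef k rs A = (if fset A \<subseteq> {1..k + length rs} \<and> fcard A = k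
     then cols_det (k + length rs) (map unit_col (sorted_list_of_fset A) @ map ycol rs) else 0)"

lemma strict_mono_sorted_image:
  fixes \<sigma> :: "nat \<Rightarrow> nat"
  assumes "strict_mono_on {1..k} \<sigma>"
  shows "map \<sigma> [1..<k + 1] = sorted_list_of_set (\<sigma> ` {1..k})"
proof (rule sorted_distinct_set_unique)
  have inj: "inj_on \<sigma> {1..k}" using assms by (rule strict_mono_on_imp_inj_on)
  show "sorted (map \<sigma> [1..<k + 1])"
    using assms unfolding sorted_iff_nth_mono_less
    by (auto simp: strict_mono_on_def simp del: upt_Suc intro!: less_imp_le)
  show "distinct (map \<sigma> [1..<k + 1])"
    using inj by (simp add: distinct_map atLeastLessThanSuc_atLeastAtMost del: upt_Suc)
qed (auto simp: atLeastLessThanSuc_atLeastAtMost simp del: upt_Suc)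

lemma ecoef_mixed_bracket: "ecoef (mixed_bracket k rs :: 'k::field ambient) A = mixed_coef k rs A"
proof -
  let ?s = "k + length rs"
  let ?Y = "\<lambda>\<sigma>. \<Prod>j<length rs. (yvar (\<sigma> (k + 1 + j)) :: 'k ratfun) ^ (CARD('k) ^ (rs ! j))"
  let ?S = "{\<sigma>. \<sigma> permutes {1..?s} \<and> strict_mono_on {1..k} \<sigma>}"
  have fin: "finite {\<sigma>. \<sigma> permutes {1..?s}}" by (rule finite_permutations) simp
  then have finS: "finite ?S" by (rule rev_finite_subset) auto
  have of_int_ext: "of_int z = ext_const (of_int z :: 'k ratfun)" for z
  proof -
    have "of_nat n = ext_const (of_nat n :: 'k ratfun)" for n
      by (induction n) (simp_all add: ext_const_add)
    then show ?thesis by (cases z) (simp_all add: ext_const_uminus del: of_nat_Suc)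
  qed
  have term_eq: "of_int (sign \<sigma>) * prod_list (map (\<lambda>j. ext_gen (\<sigma> j)) [1..<k + 1]) * ext_const (?Y \<sigma>) =
      xmono (Abs_fset (\<sigma> ` {1..k})) (of_int (sign \<sigma>) * ?Y \<sigma>)" if "\<sigma> \<in> ?S" for \<sigma>
  proof -
    have "map (\<lambda>j. ext_gen (\<sigma> j) :: 'k ambient) [1..<k + 1] = map ext_gen (sorted_list_of_set (\<sigma> ` {1..k}))"
      using strict_mono_sorted_image[of k \<sigma>] that by (simp flip: map_map[unfolded comp_def] del: upt_Suc)
    then have "prod_list (map (\<lambda>j. ext_gen (\<sigma> j)) [1..<k + 1]) = xmono (Abs_fset (\<sigma> ` {1..k})) (1 :: 'k ratfun)"
      by (simp add: xs_oprod flip: xs.oprod_def del: upt_Suc)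
    then show ?thesis
      by (simp add: of_int_ext ext_const_xmono ext_const_comm[of "xmono _ _"] mult.commute mult.assoc)
  qed
  have eqv: "Abs_fset (\<sigma> ` {1..k}) = A \<longleftrightarrow> \<sigma> ` {1..k} = fset A" for \<sigma> :: "nat \<Rightarrow> nat"
  proof -
    have "fset (Abs_fset (\<sigma> ` {1..k})) = \<sigma> ` {1..k}" by (rule Abs_fset_inverse) simp
    then show ?thesis by (metis fset_inverse)
  qed
  have "ecoef (mixed_bracket k rs) A =
      (\<Sum>\<sigma>\<in>?S. if Abs_fset (\<sigma> ` {1..k}) = A then of_int (sign \<sigma>) * ?Y \<sigma> else 0)"
    unfolding mixed_bracket_def ecoef_sum
    by (intro sum.cong refl, subst term_eq) (assumption, rule ecoef_xmono)
  also have "\<dots> = (\<Sum>\<sigma> | \<sigma> \<in> ?S \<and> \<sigma> ` {1..k} = fset A. of_int (sign \<sigma>) * ?Y \<sigma>)"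
    unfolding eqv by (rule sum.inter_filter[OF finS, symmetric])
  also have "\<dots> = mixed_coef k rs A"
  proof (cases "fset A \<subseteq> {1..?s} \<and> fcard A = k")
    case False
    have "\<not> (\<sigma> \<in> ?S \<and> \<sigma> ` {1..k} = fset A)" for \<sigma>
    proof
      assume \<sigma>: "\<sigma> \<in> ?S \<and> \<sigma> ` {1..k} = fset A"
      then have p: "\<sigma> permutes {1..?s}" by simp
      have "fset A \<subseteq> {1..?s}"
        using \<sigma> permutes_image[OF p] by (metis atLeastatMost_subset_iff image_mono le_add1 order_refl)
      moreover have "fcard A = k"
        using \<sigma> permutes_inj_on[OF p] by (metis card_atLeastAtMost card_image diff_Suc_1 fcard.rep_eq)
      ultimately show False using False by blast
    qed
    then have "{\<sigma>. \<sigma> \<in> ?S \<and> \<sigma> ` {1..k} = fset A} = {}" by blast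
    then show ?thesis using False by (simp only: sum.empty mixed_coef_def if_False)
  next
    case True
    let ?as = "sorted_list_of_fset A"
    have len: "length ?as = k" using True by (simp add: fcard.rep_eq sorted_list_of_fset.rep_eq)
    let ?ws = "map unit_col ?as @ map ycol rs :: (nat \<Rightarrow> 'k ratfun) list"
    have ite: "(if C then 1 else 0) * x = (if C then x else 0)" for C and x :: "'k ratfun"
      by simp
    have prod: "(\<Prod>j<?s. (?ws ! j) (\<sigma> (Suc j))) =
        (if \<forall>j<k. \<sigma> (Suc j) = ?as ! j then ?Y \<sigma> else 0)" for \<sigma>
    proof -
      have "(\<Prod>j<?s. (?ws ! j) (\<sigma> (Suc j))) =
          (\<Prod>j<k. (?ws ! j) (\<sigma> (Suc j))) * (\<Prod>j<length rs. (?ws ! (k + j)) (\<sigma> (Suc (k + j))))"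
        by (rule prod_lessThan_add)
      also have "(\<Prod>j<length rs. (?ws ! (k + j)) (\<sigma> (Suc (k + j)))) = ?Y \<sigma>"
        by (intro prod.cong) (auto simp: nth_append len ycol_def)
      also have "(\<Prod>j<k. (?ws ! j) (\<sigma> (Suc j))) = (\<Prod>j<k. if \<sigma> (Suc j) = ?as ! j then 1 else 0)"
        by (intro prod.cong) (auto simp: nth_append len unit_col_def)
      also have "\<dots> = (if \<forall>j<k. \<sigma> (Suc j) = ?as ! j then 1 else 0)"
        by auto
      finally show ?thesis unfolding ite .
    qed
    have set: "{\<sigma>. \<sigma> \<in> ?S \<and> \<sigma> ` {1..k} = fset A} =
        {\<sigma>. \<sigma> permutes {1..?s} \<and> (\<forall>j<k. \<sigma> (Suc j) = ?as ! j)}"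
    proof (rule Set.set_eqI, rule iffI)
      fix \<sigma> assume "\<sigma> \<in> {\<sigma>. \<sigma> \<in> ?S \<and> \<sigma> ` {1..k} = fset A}"
      then have \<sigma>: "\<sigma> permutes {1..?s}" "strict_mono_on {1..k} \<sigma>" "\<sigma> ` {1..k} = fset A" by auto
      have "map \<sigma> [1..<k + 1] = ?as"
        using strict_mono_sorted_image[OF \<sigma>(2)] \<sigma>(3) by (simp add: sorted_list_of_fset.rep_eq)
      then have "\<sigma> (Suc j) = ?as ! j" if "j < k" for j
        using that nth_map[of j "[1..<k + 1]" \<sigma>] by (simp del: upt_Suc)
      with \<sigma> show "\<sigma> \<in> {\<sigma>. \<sigma> permutes {1..?s} \<and> (\<forall>j<k. \<sigma> (Suc j) = ?as ! j)}" by simp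
    next
      fix \<sigma> assume "\<sigma> \<in> {\<sigma>. \<sigma> permutes {1..?s} \<and> (\<forall>j<k. \<sigma> (Suc j) = ?as ! j)}"
      then have \<sigma>: "\<sigma> permutes {1..?s}" "\<And>j. j < k \<Longrightarrow> \<sigma> (Suc j) = ?as ! j" by auto
      have \<sigma>': "\<sigma> j = ?as ! (j - 1)" if "j \<in> {1..k}" for j
      proof -
        have "j - 1 < k" "Suc (j - 1) = j" using that by auto
        then show ?thesis using \<sigma>(2)[of "j - 1"] by simp
      qed
      have strict: "strict_mono_on {1..k} \<sigma>"
      proof (rule strict_mono_onI)
        fix i j assume ij: "i \<in> {1..k}" "j \<in> {1..k}" "i < j"
        have "sorted_wrt (<) ?as" by (simp add: sorted_list_of_fset.rep_eq)
        then have "?as ! (i - 1) < ?as ! (j - 1)"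
          by (rule sorted_wrt_nth_less) (use ij len in auto)
        then show "\<sigma> i < \<sigma> j" using ij by (simp add: \<sigma>')
      qed
      have "\<sigma> ` {1..k} = (\<lambda>j. ?as ! j) ` {..<k}"
      proof -
        have "{1..k} = Suc ` {..<k}" using image_Suc_lessThan[of k] by simp
        then show ?thesis by (auto simp: image_image \<sigma>(2))
      qed
      also have "\<dots> = set ?as" using len by (auto simp: set_conv_nth)
      finally have "\<sigma> ` {1..k} = fset A" by (simp add: sorted_list_of_fset.rep_eq)
      with strict \<sigma>(1) show "\<sigma> \<in> {\<sigma>. \<sigma> \<in> ?S \<and> \<sigma> ` {1..k} = fset A}" by simp
    qed
    have "mixed_coef k rs A = (\<Sum>\<sigma> | \<sigma> permutes {1..?s}.
        if \<forall>j<k. \<sigma> (Suc j) = ?as ! j then of_int (sign \<sigma>) * ?Y \<sigma> else 0)"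
    proof -
      have "mixed_coef k rs A = cols_det ?s ?ws" unfolding mixed_coef_def using True by (rule if_P)
      then show ?thesis
        unfolding cols_det_permutations prod by (simp only: if_distrib[of "\<lambda>x. _ * x"] mult_zero_right)
    qed
    also have "\<dots> = (\<Sum>\<sigma> | \<sigma> permutes {1..?s} \<and> (\<forall>j<k. \<sigma> (Suc j) = ?as ! j). of_int (sign \<sigma>) * ?Y \<sigma>)"
      by (subst sum.inter_filter[symmetric, OF fin]) (simp only: mem_Collect_eq)
    finally show ?thesis by (simp only: set)
  qed
  finally show ?thesis .
qed

section \<open>Products of the dual forms with mixed brackets\<close>

lemma ext_const_minus_one_power: "(-1) ^ n = (ext_const ((-1) ^ n) :: 'a::comm_ring_1 ext)"
  by (simp add: ext_const_power ext_const_uminus)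

lemma ecoef_gen_mult:
  "ecoef (ext_gen a * f) A =
     (if a |\<in>| A then ext_sign {|a|} (A |-| {|a|}) * ecoef f (A |-| {|a|}) else 0)"
proof -
  have mono: "ecoef (ext_gen a * xmono B c) A =
     (if a |\<in>| A then ext_sign {|a|} (A |-| {|a|}) * ecoef (xmono B c) (A |-| {|a|}) else 0)"
    for B and c :: 'a
  proof (cases "a |\<in>| B")
    case True
    then have "B \<noteq> A |-| {|a|}" by auto
    with True show ?thesis by (simp add: ext_gen_eq xmono_mult ecoef_xmono)
  next
    case False
    then have "finsert a B = A \<longleftrightarrow> a |\<in>| A \<and> B = A |-| {|a|}" by auto
    with False show ?thesis by (auto simp add: ext_gen_eq xmono_mult ecoef_xmono)
  qed
  show ?thesis
    by (subst (1 2) ext_as_sum[of f]) (simp add: sum_distrib_left ecoef_sum mono)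
qed

lemma sum_lessThan_add:
  "(\<Sum>j<k + l. f j) = (\<Sum>j<k. f j) + (\<Sum>j<l. f (k + j) :: 'a::comm_monoid_add)" for k l :: nat
  by (induction l) (simp_all add: add.assoc)

lemma omit_append: 
  "j < length xs \<Longrightarrow> omit j (xs @ ys) = omit j xs @ ys"
  "omit (length xs + j) (xs @ ys) = xs @ omit j ys"
  by (simp_all add: omit_def)

definition Theta :: "nat \<Rightarrow> nat \<Rightarrow> 'k::field ambient" where
  "Theta s j = (\<Sum>a=1..s. ext_const (theta s j a) * ext_gen a)"

definition Tau :: "nat \<Rightarrow> 'k::field ambient" where
  "Tau s = (\<Sum>a=1..s. ext_const (tau s a) * ext_gen a)"

lemma Theta_linform: "Theta s j \<in> linforms"
  unfolding Theta_def by (intro linforms_sum linforms_gen)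

lemma Tau_linform: "Tau s \<in> linforms"
  unfolding Tau_def by (intro linforms_sum linforms_gen)

lemma Theta_Suc: "Theta (Suc s) j = Theta s j + ext_const ((-1) ^ (s - j) * dQ s j) * Tau (Suc s)"
proof -
  have *: "Theta s j = (\<Sum>a=1..Suc s. ext_const (theta s j a) * ext_gen a)"
    by (simp add: Theta_def theta_tau_outside)
  show ?thesis
    unfolding * unfolding Theta_def Tau_def theta_Suc
    by (simp only: ext_const_add ext_const_mult distrib_right sum.distrib sum_distrib_left mult.assoc)
qed

context odd_prime_field
begin

text \<open>The relation between s + 1 columns, s = k + |rs|, is applied to the k + 1 unit columns
  of A and the columns of rs. On the unit column at a, \<Theta> gives its coefficient at x_a, so
  these terms form the coefficient of the product. On the columns of rs it gives 1 at position q and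
  0 elsewhere, which leaves the bracket without r_q.\<close>

lemma Theta_mult_mixed_bracket:
  assumes rs: "distinct rs" "\<And>r. r \<in> set rs \<Longrightarrow> r < k + length rs" and q: "q < length rs"
  shows "Theta (k + length rs) (rs ! q) * mixed_bracket k rs =
    (-1) ^ (k + q) * (mixed_bracket (Suc k) (omit q rs) :: 'k ambient)"
proof (rule ext_eqI)
  fix A
  let ?s = "k + length rs"
  let ?f = "theta ?s (rs ! q) :: nat \<Rightarrow> 'k ratfun"
  have s': "Suc k + length (omit q rs) = ?s" using q by (simp add: length_omit)
  let ?t = "\<lambda>a. ?f a * (if a |\<in>| A then ext_sign {|a|} (A |-| {|a|}) * mixed_coef k rs (A |-| {|a|}) else 0)"
  have lhs: "ecoef (Theta ?s (rs ! q) * mixed_bracket k rs) A = (\<Sum>a=1..?s. ?t a)"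
    by (simp add: Theta_def sum_distrib_right ecoef_sum mult.assoc ecoef_ext_const_mult
        ecoef_gen_mult ecoef_mixed_bracket cong: if_cong)
  have "(\<Sum>a=1..?s. ?t a) = (-1) ^ (k + q) * mixed_coef (Suc k) (omit q rs) A"
  proof (cases "fset A \<subseteq> {1..?s} \<and> fcard A = Suc k")
    case False
    have "?t a = 0" if a: "a \<in> {1..?s}" for a
    proof (cases "a |\<in>| A")
      case True
      have "\<not> (fset (A |-| {|a|}) \<subseteq> {1..?s} \<and> fcard (A |-| {|a|}) = k)"
      proof
        assume *: "fset (A |-| {|a|}) \<subseteq> {1..?s} \<and> fcard (A |-| {|a|}) = k"
        then have "fset A \<subseteq> {1..?s}" using a by auto
        moreover have "fcard A = Suc k"
          using * True by (metis fcard_Suc_fminus1)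
        ultimately show False using False by blast
      qed
      then have "mixed_coef k rs (A |-| {|a|}) = (0 :: 'k ratfun)" unfolding mixed_coef_def by (rule if_not_P)
      then show ?thesis by simp
    qed simp
    moreover have "mixed_coef (Suc k) (omit q rs) A = (0 :: 'k ratfun)"
      using False unfolding mixed_coef_def s' by (rule if_not_P)
    moreover have "(\<Sum>a=1..?s. ?t a) = 0" using calculation(1) by (intro sum.neutral) blast
    ultimately show ?thesis by (simp only: mult_zero_right)
  next
    case True
    let ?as = "sorted_list_of_fset A"
    have as: "?as = sorted_list_of_set (fset A)" by (simp add: sorted_list_of_fset.rep_eq)
    have len: "length ?as = Suc k" using True by (simp add: as fcard.rep_eq)
    have dist: "distinct ?as" by (simp add: as)
    have in_A: "?as ! i |\<in>| A" if "i \<le> k" for i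
      using that len nth_mem[of i ?as] by simp
    let ?ws = "map unit_col ?as @ map ycol rs :: (nat \<Rightarrow> 'k ratfun) list"
    let ?D = "\<lambda>j. cols_det ?s (omit j ?ws)"
    have minus: "sorted_list_of_fset (A |-| {|?as ! i|}) = omit i ?as" if "i \<le> k" for i
    proof -
      have "sorted_list_of_fset (A |-| {|?as ! i|}) = remove1 (?as ! i) ?as"
        by (simp add: sorted_list_of_fset.rep_eq sorted_list_of_set.sorted_key_list_of_set_remove)
      also have "\<dots> = filter (\<lambda>x. x \<noteq> ?as ! i) ?as"
        using dist by (simp add: distinct_remove1_removeAll removeAll_filter_not_eq eq_commute)
      also have "\<dots> = omit i ?as" using dist that len by (simp add: omit_distinct)
      finally show ?thesis .
    qed
    have sgn: "ext_sign {|?as ! i|} (A |-| {|?as ! i|}) = ((-1) ^ i :: 'k ratfun)" if i: "i \<le> k" for i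
    proof -
      have str: "sorted_wrt (<) ?as" by (simp add: as)
      have "{(a, b). a |\<in>| {|?as ! i|} \<and> b |\<in>| A |-| {|?as ! i|} \<and> b < a} =
          Pair (?as ! i) ` ((\<lambda>j. ?as ! j) ` {..<i})"
      proof (rule Set.set_eqI, rule iffI)
        fix z assume "z \<in> {(a, b). a |\<in>| {|?as ! i|} \<and> b |\<in>| A |-| {|?as ! i|} \<and> b < a}"
        then obtain b where b: "z = (?as ! i, b)" "b |\<in>| A" "b < ?as ! i" by auto
        then have "b \<in> set ?as" by simp
        then obtain j where j: "j < Suc k" "b = ?as ! j" by (metis in_set_conv_nth len)
        have "j < i"
        proof (rule ccontr)
          assume "\<not> j < i"
          then have "?as ! i \<le> ?as ! j"
            using sorted_wrt_nth_less[OF str, of i j] j len by (cases "i = j") auto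
          then show False using b j by simp
        qed
        then show "z \<in> Pair (?as ! i) ` ((\<lambda>j. ?as ! j) ` {..<i})" using b j by auto
      next
        fix z assume "z \<in> Pair (?as ! i) ` ((\<lambda>j. ?as ! j) ` {..<i})"
        then obtain j where j: "j < i" "z = (?as ! i, ?as ! j)" by auto
        have "?as ! j < ?as ! i" using sorted_wrt_nth_less[OF str, of j i] j i len by auto
        then show "z \<in> {(a, b). a |\<in>| {|?as ! i|} \<and> b |\<in>| A |-| {|?as ! i|} \<and> b < a}"
          using j in_A[of j] i by auto
      qed
      moreover have "card (Pair (?as ! i) ` ((\<lambda>j. ?as ! j) ` {..<i})) = i"
        using i len dist by (subst card_image, simp add: inj_on_def)
          (subst card_image, auto simp: inj_on_def nth_eq_iff_index_eq)
      ultimately show ?thesis by (simp only: ext_sign_def)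
    qed
    have mc: "mixed_coef k rs (A |-| {|?as ! i|}) = ?D i" if i: "i \<le> k" for i
    proof -
      have "fset (A |-| {|?as ! i|}) \<subseteq> {1..?s}" using True by auto
      moreover have "fcard (A |-| {|?as ! i|}) = k"
        using in_A[OF i] True by (metis fcard_Suc_fminus1 nat.inject)
      ultimately show ?thesis
        unfolding mixed_coef_def using i len by (simp add: minus map_omit omit_append)
    qed
    have "(\<Sum>a=1..?s. ?t a) = (\<Sum>a\<in>fset A. ?f a * (ext_sign {|a|} (A |-| {|a|}) * mixed_coef k rs (A |-| {|a|})))"
      using True by (intro sum.mono_neutral_cong_right) auto
    also have "\<dots> = (\<Sum>i<Suc k. ?f (?as ! i) * (ext_sign {|?as ! i|} (A |-| {|?as ! i|}) * mixed_coef k rs (A |-| {|?as ! i|})))"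
    proof (rule sum.reindex_bij_betw[symmetric])
      show "bij_betw ((!) ?as) {..<Suc k} (fset A)"
        using bij_betw_nth[OF dist, of "{..<Suc k}" "fset A"] len by simp
    qed
    also have "\<dots> = (\<Sum>i<Suc k. (-1) ^ i * ?f (?as ! i) * ?D i)"
      by (intro sum.cong) (simp_all add: sgn mc)
    finally have left: "(\<Sum>a=1..?s. ?t a) = (\<Sum>i<Suc k. (-1) ^ i * ?f (?as ! i) * ?D i)" .
    have "(\<Sum>j\<le>?s. (-1) ^ j * (\<Sum>a=1..?s. ?f a * (?ws ! j) a) * ?D j) = 0"
      by (rule cols_relation) (simp add: len)
    also have "{..?s} = {..<Suc k + length rs}" by auto
    also have "(\<Sum>j<Suc k + length rs. (-1) ^ j * (\<Sum>a=1..?s. ?f a * (?ws ! j) a) * ?D j) =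
       (\<Sum>j<Suc k. (-1) ^ j * (\<Sum>a=1..?s. ?f a * (?ws ! j) a) * ?D j) +
       (\<Sum>j<length rs. (-1) ^ (Suc k + j) * (\<Sum>a=1..?s. ?f a * (?ws ! (Suc k + j)) a) * ?D (Suc k + j))"
      by (rule sum_lessThan_add)
    also have "(\<Sum>j<Suc k. (-1) ^ j * (\<Sum>a=1..?s. ?f a * (?ws ! j) a) * ?D j) =
       (\<Sum>i<Suc k. (-1) ^ i * ?f (?as ! i) * ?D i)"
    proof (rule sum.cong[OF refl])
      fix i assume i: "i \<in> {..<Suc k}"
      then have "?as ! i \<in> {1..?s}" using in_A[of i] True by auto
      then have "(\<Sum>a=1..?s. ?f a * unit_col (?as ! i) a) = ?f (?as ! i)"
        by (simp add: unit_col_def if_distrib cong: if_cong)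
      moreover have "?ws ! i = unit_col (?as ! i)" using i len by (simp add: nth_append)
      ultimately show "(-1) ^ i * (\<Sum>a=1..?s. ?f a * (?ws ! i) a) * ?D i = (-1) ^ i * ?f (?as ! i) * ?D i"
        by simp
    qed
    also have "(\<Sum>j<length rs. (-1) ^ (Suc k + j) * (\<Sum>a=1..?s. ?f a * (?ws ! (Suc k + j)) a) * ?D (Suc k + j)) =
       (\<Sum>j<length rs. if j = q then (-1) ^ (Suc k + j) * ?D (Suc k + j) else 0)"
    proof (rule sum.cong[OF refl])
      fix j assume j: "j \<in> {..<length rs}"
      have "?ws ! (Suc k + j) = ycol (rs ! j)" using j len by (simp add: nth_append)
      then have "(\<Sum>a=1..?s. ?f a * (?ws ! (Suc k + j)) a) = pair_y ?s ?f (rs ! j)"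
        by (simp add: pair_y_ycol)
      also have "\<dots> = (if j = q then 1 else 0)"
        using pair_theta[of ?s] rs j q by (simp add: nth_eq_iff_index_eq)
      finally show "(-1) ^ (Suc k + j) * (\<Sum>a=1..?s. ?f a * (?ws ! (Suc k + j)) a) * ?D (Suc k + j) =
          (if j = q then (-1) ^ (Suc k + j) * ?D (Suc k + j) else 0)" by simp
    qed
    also have "\<dots> = (-1) ^ (Suc k + q) * ?D (Suc k + q)" using q by simp
    finally have "(\<Sum>i<Suc k. (-1) ^ i * ?f (?as ! i) * ?D i) = (-1) ^ (k + q) * ?D (Suc k + q)"
      by (simp add: eq_neg_iff_add_eq_0)
    moreover have "?D (Suc k + q) = mixed_coef (Suc k) (omit q rs) A"
      unfolding mixed_coef_def s' using True omit_append(2)[of "map unit_col ?as :: (nat \<Rightarrow> 'k ratfun) list" q "map ycol rs"] len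
      by (simp add: map_omit)
    ultimately show ?thesis using left by simp
  qed
  then show "ecoef (Theta ?s (rs ! q) * mixed_bracket k rs) A =
      ecoef ((-1) ^ (k + q) * (mixed_bracket (Suc k) (omit q rs) :: 'k ambient)) A"
    by (simp only: lhs ext_const_minus_one_power ecoef_ext_const_mult ecoef_mixed_bracket)
qed

lemma Theta_anticommuting: "anticommuting (Theta s :: nat \<Rightarrow> 'k ambient)"
  by (rule anticommuting_linforms) (rule Theta_linform)

lemma mui_M_empty: "mui_M s {} = ext_const (dL s :: 'k ratfun)"
proof (rule ext_eqI)
  fix A
  have "filter (\<lambda>j. j \<notin> {}) [0..<s] = [0..<s]" by simp
  then show "ecoef (mui_M s {}) A = ecoef (ext_const (dL s :: 'k ratfun)) A"
    by (auto simp: mui_M_def ecoef_mixed_bracket mixed_coef_def ext_const_eq ecoef_xmono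
        mui_L_cols[symmetric] mui_L_eq sorted_list_of_fset.rep_eq)
qed

text \<open>Multiplication by \<Theta>_b removes column b from a bracket, starting with L_s for the
  empty set. Indices are added in decreasing order, so that b goes to the front of the ordered
  product.\<close>

lemma mui_M_eq:
  assumes "J \<subseteq> {..<s}"
  shows "\<exists>c. is_sign c \<and> mui_M s J = c * (ext_const (dL s) * anticommuting.oprod (Theta s :: nat \<Rightarrow> 'k ambient) J)"
proof -
  interpret anticommuting "Theta s :: nat \<Rightarrow> 'k ambient" by (rule Theta_anticommuting)
  have "finite J" using assms by (rule finite_subset) simp
  then show ?thesis using assms
  proof (induction rule: finite_linorder_min_induct)
    case empty show ?case by (intro exI[of _ 1]) (simp add: mui_M_empty)
  next
    case (insert b J)
    then obtain c where c: "is_sign c" "mui_M s J = c * (ext_const (dL s) * oprod J)" by auto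
    let ?rs = "filter (\<lambda>j. j \<notin> J) [0..<s]"
    have J: "J \<subseteq> {..<s}" "b < s" "b \<notin> J" using insert by auto
    have "length ?rs = card ({..<s} - J)"
      by (subst distinct_card[symmetric]) (auto intro!: arg_cong[of _ _ card])
    then have len: "card J + length ?rs = s"
      using J insert.hyps(1) card_mono[of "{..<s}" J] by (simp add: card_Diff_subset)
    have "b \<in> set ?rs" using J by simp
    then obtain q where q: "q < length ?rs" "?rs ! q = b" by (metis in_set_conv_nth)
    have "omit q ?rs = filter (\<lambda>x. x \<noteq> b) ?rs" using omit_distinct[of ?rs q] q by simp
    also have "\<dots> = filter (\<lambda>j. j \<notin> insert b J) [0..<s]" by (simp add: conj_commute)
    finally have om: "omit q ?rs = filter (\<lambda>j. j \<notin> insert b J) [0..<s]" .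
    have "Theta (card J + length ?rs) (?rs ! q) * mixed_bracket (card J) ?rs =
        (-1) ^ (card J + q) * (mixed_bracket (Suc (card J)) (omit q ?rs) :: 'k ambient)"
      by (rule Theta_mult_mixed_bracket) (use q in \<open>auto simp: len\<close>)
    then have *: "Theta s b * mui_M s J = (-1) ^ (card J + q) * (mui_M s (insert b J) :: 'k ambient)"
      using card_insert_disjoint[OF insert.hyps(1) J(3)] by (simp only: len q om mui_M_def)
    have sg: "is_sign ((-1) ^ (card J + q) :: 'k ambient)" by (rule is_sign_minus_1)
    have "mui_M s (insert b J) = (-1) ^ (card J + q) * ((-1) ^ (card J + q) * (mui_M s (insert b J) :: 'k ambient))"
      by (simp only: mult.assoc[symmetric] is_sign_sq[OF sg] mult_1_left)
    also have "\<dots> = (-1) ^ (card J + q) * (Theta s b * mui_M s J)" by (simp only: *)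
    also have "Theta s b * mui_M s J = (Theta s b * c) * (ext_const (dL s) * oprod J)"
      by (simp only: c(2) mult.assoc)
    also have "\<dots> = c * (ext_const (dL s) * (Theta s b * oprod J))"
      by (simp only: is_sign_comm[OF c(1), symmetric] mult.assoc ext_const_left_comm)
    also have "Theta s b * oprod J = oprod (insert b J)"
      using insert.hyps by (simp add: oprod_insert_min)
    finally have "mui_M s (insert b J) =
        (-1) ^ (card J + q) * (c * (ext_const (dL s) * (oprod (insert b J) :: 'k ambient)))" .
    then show ?case
      by (intro exI[of _ "(-1) ^ (card J + q) * c"] conjI is_sign_mult sg c(1)) (simp only: mult.assoc)
  qed
qed

lemma Theta_Tau: "Theta (Suc s) s = (Tau (Suc s) :: 'k ambient)"
  by (simp add: Theta_Suc dQ_diag) (simp add: Theta_def theta_above)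

text \<open>Up to sign M_{i;i-1} is L_i \<tau>_i, and division by L_{i-1} leaves V_i.\<close>

lemma mui_u_eq:
  assumes "i \<ge> 1"
  shows "\<exists>c. is_sign c \<and> mui_u i = c * (ext_const (dV i) * (Tau i :: 'k ambient))"
proof -
  interpret anticommuting "Theta i :: nat \<Rightarrow> 'k ambient" by (rule Theta_anticommuting)
  obtain s where s: "i = Suc s" using assms by (cases i) auto
  obtain c where c: "is_sign c" "mui_M i {i - 1} = c * (ext_const (dL i) * oprod {i - 1})"
    using mui_M_eq[of "{i - 1}" i] assms by auto
  have "oprod {i - 1} = Theta i (i - 1)" by (rule oprod_single)
  then have "oprod {i - 1} = Tau i" by (simp add: s Theta_Tau)
  then have "mui_u i = c * (ext_const (dL i) * (ext_const (inverse (dL s)) * Tau i))"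
    unfolding mui_u_def c by (simp add: mult.assoc ext_const_comm[of "Tau (Suc s)"] mui_L_eq s)
  also have "ext_const (dL i) * (ext_const (inverse (dL s)) * Tau i) = ext_const (dV i) * (Tau i :: 'k ambient)"
  proof -
    have "dL i * inverse (dL s) = (dV i :: 'k ratfun)" by (simp add: s dL_Suc)
    moreover have "ext_const (dL i) * (ext_const (inverse (dL s)) * Tau i) =
        ext_const (dL i * inverse (dL s) :: 'k ratfun) * Tau i"
      by (simp only: ext_const_mult mult.assoc)
    ultimately show ?thesis by (simp only:)
  qed
  finally show ?thesis using c(1) by blast
qed

end

subsection \<open>The monomials in the $u_k$ and $v_k$\<close>

lemma scale_ambient_mult_left: "scale_ambient c f * g = scale_ambient c (f * g)"
  by (simp add: scale_ambient_def mult.assoc)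

lemma scale_ambient_mult_right: "f * scale_ambient c g = scale_ambient c (f * g)"
  by (simp add: scale_ambient_def ext_const_left_comm)

lemma ext_const_merge: "A * ext_const x * (m * ext_const y) = A * m * ext_const (x * y)"
  by (metis ext_const_comm ext_const_mult mult.assoc)

lemma is_sign_left_comm: "is_sign c \<Longrightarrow> f * (c * g) = c * (f * g)"
  by (auto simp: is_sign_def)

lemma amb_span_mult:
  assumes "\<And>x y. x \<in> S \<Longrightarrow> y \<in> T \<Longrightarrow> x * y \<in> amb.span R"
    and "f \<in> amb.span S" "g \<in> amb.span T"
  shows "f * g \<in> amb.span R"
  using assms(2)
proof (induction rule: amb.span_induct_alt)
  case (step c x f)
  have "x * g \<in> amb.span R"
    using assms(3)
  proof (induction rule: amb.span_induct_alt)
    case (step d y g)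
    then show ?case
      using assms(1) \<open>x \<in> S\<close>
      by (simp add: distrib_left scale_ambient_mult_right amb.span_add amb.span_scale)
  qed (simp add: amb.span_zero)
  then show ?case
    using step by (simp add: distrib_right scale_ambient_mult_left amb.span_add amb.span_scale)
qed (simp add: amb.span_zero)

lemma amb_span_sign:
  assumes "is_sign c" "f \<in> amb.span S"
  shows "c * f \<in> amb.span S"
  using assms by (auto simp: is_sign_def amb.span_neg)

text \<open>The value 0 at index 0 makes the whole family anticommuting; the monomials considered
  have indices 1, ..., s.\<close>

definition uu :: "nat \<Rightarrow> 'k::field ambient" where
  "uu k = (if k \<ge> 1 then mui_u k else 0)"

definition umono :: "nat set \<Rightarrow> 'k::field ambient" where
  "umono E = anticommuting.oprod uu E"

definition vmono :: "nat \<Rightarrow> (nat \<Rightarrow> int) \<Rightarrow> 'k::field ratfun" where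
  "vmono s b = (\<Prod>k=1..s. dv k powi b k)"

definition uvm :: "nat \<Rightarrow> nat set \<Rightarrow> (nat \<Rightarrow> int) \<Rightarrow> 'k::field ambient" where
  "uvm s E b = umono E * ext_const (vmono s b)"

definition list_u :: "(bool \<times> int) list \<Rightarrow> nat set" where
  "list_u w = {k \<in> {1..length w}. fst (w ! (k - 1))}"

definition list_v :: "(bool \<times> int) list \<Rightarrow> nat \<Rightarrow> int" where
  "list_v w k = (if k \<in> {1..length w} then snd (w ! (k - 1)) else 0)"

text \<open>Monomials are handled as pairs of the set E of indices of the u_k and the exponent
  function b of the v_k. This is the passage to the list encoding, where index k stands at position
  k - 1.\<close>

definition uv_list :: "nat \<Rightarrow> nat set \<Rightarrow> (nat \<Rightarrow> int) \<Rightarrow> (bool \<times> int) list" where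
  "uv_list s E b = map (\<lambda>k. (k \<in> E, b k)) [1..<s + 1]"

lemma length_uv_list [simp]: "length (uv_list s E b) = s"
  by (simp add: uv_list_def)

lemma uv_list_nth: "k \<in> {1..s} \<Longrightarrow> uv_list s E b ! (k - 1) = (k \<in> E, b k)"
proof -
  assume "k \<in> {1..s}"
  then have "k - 1 < s" "Suc (k - 1) = k" by auto
  then show ?thesis by (simp add: uv_list_def del: upt_Suc)
qed

lemma list_u_uv_list: "E \<subseteq> {1..s} \<Longrightarrow> list_u (uv_list s E b) = E"
  by (auto simp: list_u_def uv_list_nth[simplified])

lemma list_v_uv_list: "k \<in> {1..s} \<Longrightarrow> list_v (uv_list s E b) k = b k"
  by (auto simp: list_v_def uv_list_nth[simplified])

lemma uv_list_list: "length w = s \<Longrightarrow> uv_list s (list_u w) (list_v w) = w"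
  by (rule nth_equalityI) (auto simp: uv_list_def list_u_def list_v_def prod_eq_iff simp del: upt_Suc)

lemma vmono_cong: "(\<And>k. k \<in> {1..s} \<Longrightarrow> b k = b' k) \<Longrightarrow> vmono s b = vmono s b'"
  unfolding vmono_def by (rule prod.cong) auto

context odd_prime_field
begin

lemma uu_linform: "uu k \<in> (linforms :: 'k ambient set)"
proof (cases "k \<ge> 1")
  case True
  obtain c where c: "is_sign c" "mui_u k = c * (ext_const (dV k) * (Tau k :: 'k ambient))"
    using mui_u_eq[OF True] by blast
  then show ?thesis
    using True linforms_scale[OF Tau_linform, of "dV k" k] linforms_uminus
    by (auto simp: uu_def is_sign_def)
qed (simp add: uu_def linforms.zero)

interpretation uu: anticommuting "uu :: nat \<Rightarrow> 'k ambient"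
  by (rule anticommuting_linforms) (rule uu_linform)

lemma umono_mult:
  assumes "finite E" "finite F"
  shows "E \<inter> F = {} \<Longrightarrow> \<exists>c. is_sign c \<and> umono E * umono F = c * (umono (E \<union> F) :: 'k ambient)"
    and "E \<inter> F \<noteq> {} \<Longrightarrow> umono E * umono F = (0 :: 'k ambient)"
  unfolding umono_def using uu.oprod_mult_disjoint[OF assms] uu.oprod_mult_overlap[OF assms] by blast+

lemma umono_empty [simp]: "umono {} = (1 :: 'k ambient)"
  by (simp add: umono_def)

lemma umono_single: "k \<ge> 1 \<Longrightarrow> umono {k} = (mui_u k :: 'k ambient)"
  by (simp add: umono_def uu_def)

lemma vmono_add: "vmono s (\<lambda>k. b k + b' k) = (vmono s b * vmono s b' :: 'k ratfun)"
  unfolding vmono_def prod.distrib[symmetric]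
  by (intro prod.cong) (auto simp: power_int_add dv_nonzero)

lemma vmono_0: "vmono s (\<lambda>k. 0) = (1 :: 'k ratfun)"
  by (simp add: vmono_def)

lemma vmono_nonzero: "vmono s b \<noteq> (0 :: 'k ratfun)"
  by (auto simp: vmono_def dv_nonzero)

lemma vmono_power: "vmono s (\<lambda>k. int n * b k) = (vmono s b ^ n :: 'k ratfun)"
proof (induction n)
  case (Suc n)
  then show ?case using vmono_add[of s b "\<lambda>k. int n * b k"] by (simp add: distrib_right)
qed (simp add: vmono_0)

lemma vmono_uminus: "vmono s (\<lambda>k. - b k) = (inverse (vmono s b) :: 'k ratfun)"
  using vmono_add[of s b "\<lambda>k. - b k"] vmono_nonzero[of s b]
  by (simp add: vmono_0 field_simps)

lemma vmono_Suc: "b (Suc s) = 0 \<Longrightarrow> vmono (Suc s) b = (vmono s b :: 'k ratfun)"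
  by (simp add: vmono_def)

lemma has_val_vmono: "has_val (vmono s b :: 'k ratfun) (\<lambda>k. if k \<in> {1..s} then b k else 0)"
proof -
  have "has_val (vmono s b :: 'k ratfun) (\<lambda>k. \<Sum>i=1..s. b i * (if k = i then 1 else 0))"
    unfolding vmono_def by (intro has_val_prod has_val_powi has_val_dv) simp
  moreover have "(\<lambda>k. \<Sum>i=1..s. b i * (if k = i then 1 else 0)) = (\<lambda>k. if k \<in> {1..s} then b k else 0)"
    by (intro ext) (simp add: if_distrib cong: if_cong)
  ultimately show ?thesis by simp
qed

lemma uv_monomial_eq:
  fixes w :: "(bool \<times> int) list"
  shows "uv_monomial w = (uvm (length w) (list_u w) (list_v w) :: 'k ambient)"
proof -
  let ?P = "\<lambda>k. fst (w ! (k - 1))"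
  let ?f = "\<lambda>k. mui_u k ^ of_bool (?P k) * ext_const (mui_v k powi snd (w ! (k - 1))) :: 'k ambient"
  have "prod_list (map ?f [1..<n + 1]) = umono {k \<in> {1..n}. ?P k} * ext_const (\<Prod>k=1..n. dv k powi snd (w ! (k - 1)))" for n
  proof (induction n)
    case 0 then show ?case by simp
  next
    case (Suc n)
    have set: "{k \<in> {1..Suc n}. ?P k} = (if ?P (Suc n) then insert (Suc n) {k \<in> {1..n}. ?P k} else {k \<in> {1..n}. ?P k})"
      by (auto simp: le_Suc_eq)
    have "umono {k \<in> {1..Suc n}. ?P k} = umono {k \<in> {1..n}. ?P k} * (mui_u (Suc n) ^ of_bool (?P (Suc n)) :: 'k ambient)"
      using uu.oprod_insert_max[of "{k \<in> {1..n}. ?P k}" "Suc n"]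
      unfolding set umono_def by (cases "?P (Suc n)") (auto simp: uu_def)
    then show ?case
      using Suc by (simp add: mui_v_eq ext_const_merge mult.commute[of "dv (Suc n) powi _"])
  qed
  moreover have "vmono (length w) (list_v w) = (\<Prod>k=1..length w. (dv k :: 'k ratfun) powi snd (w ! (k - 1)))"
    unfolding vmono_def by (intro prod.cong) (auto simp: list_v_def)
  ultimately show ?thesis
    by (simp only: uv_monomial_def uvm_def list_u_def)
qed

lemma uvm_cong: "(\<And>k. k \<in> {1..s} \<Longrightarrow> b k = b' k) \<Longrightarrow> uvm s E b = (uvm s E b' :: 'k ambient)"
  unfolding uvm_def using vmono_cong[of s b b', where 'a = 'k] by simp

lemma uv_monomial_uv_list: "E \<subseteq> {1..s} \<Longrightarrow> uv_monomial (uv_list s E b) = (uvm s E b :: 'k ambient)"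
  using uvm_cong[of s "list_v (uv_list s E b)" b E]
  by (simp add: uv_monomial_eq list_u_uv_list list_v_uv_list)

text \<open>Up to sign u_{n+1} is V_{n+1} \<tau>_{n+1}, a form in which x_{n+1} has coefficient 1;
  its other terms are killed by x_1 ... x_n. The product of all the u_k therefore detects
  scalars.\<close>

lemma umono_full: "\<exists>d. d \<noteq> 0 \<and> umono {1..n} = ext_const (d :: 'k ratfun) * xs.oprod {1..n}"
proof (induction n)
  case 0 show ?case by (intro exI[of _ 1]) simp
next
  case (Suc n)
  then obtain d :: "'k ratfun" where d: "d \<noteq> 0" "umono {1..n} = ext_const d * xs.oprod {1..n}" by blast
  obtain c where c: "is_sign c" "mui_u (Suc n) = c * (ext_const (dV (Suc n)) * (Tau (Suc n) :: 'k ambient))"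
    using mui_u_eq[of "Suc n"] by auto
  have V: "dV (Suc n) \<noteq> (0 :: 'k ratfun)" by (simp add: dV_nonzero)
  have ins: "{1..Suc n} = insert (Suc n) {1..n}" by auto
  have 1: "umono {1..Suc n} = umono {1..n} * (mui_u (Suc n) :: 'k ambient)"
    unfolding umono_def ins by (subst uu.oprod_insert_max) (auto simp: uu_def)
  have z: "xs.oprod {1..n} * ext_gen a = (0 :: 'k ambient)" if "a \<in> {1..n}" for a
    using xs.oprod_mult_overlap[of "{1..n}" "{a}"] that by simp
  have tau: "tau (Suc n) (Suc n) = (inverse (dV (Suc n)) :: 'k ratfun)"
    by (simp add: tau_def theta_tau_outside divide_inverse)
  have "xs.oprod {1..n} * Tau (Suc n) = (\<Sum>a=1..Suc n. ext_const (tau (Suc n) a) * (xs.oprod {1..n} * ext_gen a) :: 'k ambient)"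
    by (simp only: Tau_def sum_distrib_left ext_const_left_comm)
  also have "\<dots> = ext_const (tau (Suc n) (Suc n)) * (xs.oprod {1..n} * ext_gen (Suc n))"
    using z by simp
  also have "xs.oprod {1..n} * ext_gen (Suc n) = (xs.oprod {1..Suc n} :: 'k ambient)"
    unfolding ins by (subst xs.oprod_insert_max) auto
  finally have T: "xs.oprod {1..n} * Tau (Suc n) = ext_const (inverse (dV (Suc n))) * (xs.oprod {1..Suc n} :: 'k ambient)"
    by (simp add: tau)
  have "umono {1..Suc n} = c * (ext_const d * (ext_const (dV (Suc n)) * (xs.oprod {1..n} * (Tau (Suc n) :: 'k ambient))))"
    unfolding 1 d(2) c(2)
    by (simp only: mult.assoc is_sign_left_comm[OF c(1)] ext_const_left_comm[of "xs.oprod _"])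
  also have "ext_const (dV (Suc n)) * (xs.oprod {1..n} * Tau (Suc n)) = (xs.oprod {1..Suc n} :: 'k ambient)"
    unfolding T using V by (simp add: ext_const_inverse flip: mult.assoc)
  finally have eq: "umono {1..Suc n} = c * (ext_const d * (xs.oprod {1..Suc n} :: 'k ambient))" .
  consider "c = 1" | "c = -1" using c(1) by (auto simp: is_sign_def)
  then show ?case
  proof cases
    case 1
    then show ?thesis using d(1) unfolding eq by (intro exI[of _ d]) (simp only: mult_1_left simp_thms)
  next
    case 2
    then show ?thesis
      using d(1) unfolding eq
      by (intro exI[of _ "- d"]) (simp only: ext_const_uminus mult_minus_left mult_1_left
          neg_equal_0_iff_equal simp_thms)
  qed
qed

text \<open>Multiplication by the missing \<open>u\<^sub>k\<close> isolates the part with a given minimal set of factors \<open>u\<^sub>k\<close>;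
  for Laurent monomials in the \<open>v\<^sub>k\<close>, the valuations are distinct.\<close>

lemma uv_monomials_independent:
  fixes c :: "(bool \<times> int) list \<Rightarrow> 'k"
  assumes W: "finite W" "\<And>w. w \<in> W \<Longrightarrow> length w = s"
    and sum: "(\<Sum>w\<in>W. scale_ambient (c w) (uv_monomial w)) = 0"
    and w: "w \<in> W"
  shows "c w = 0"
proof (rule ccontr)
  assume nz: "c w \<noteq> 0"
  define W' where "W' = {w \<in> W. c w \<noteq> 0}"
  have W': "finite W'" "w \<in> W'" "\<And>w. w \<in> W' \<Longrightarrow> length w = s" "\<And>w. w \<in> W' \<Longrightarrow> c w \<noteq> 0"
    using W w nz by (auto simp: W'_def)
  \<comment> \<open>For a set of u-factors of least size, every other set occurring in W' meets its
    complement, so that multiplication by the complementary factors kills the corresponding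
    terms.\<close>
  obtain w0 where w0: "w0 \<in> W'" and min: "\<And>w. w \<in> W' \<Longrightarrow> card (list_u w0) \<le> card (list_u w)"
    using ex_has_least_nat[of "\<lambda>w. w \<in> W'" w "\<lambda>w. card (list_u w)"] W'(2) by blast
  let ?E = "list_u w0"
  let ?F = "{1..s} - ?E"
  have sub: "list_u w \<subseteq> {1..s}" if "w \<in> W'" for w using W'(3)[OF that] by (auto simp: list_u_def)
  have fin: "finite (list_u w)" for w by (simp add: list_u_def)
  obtain d where d: "is_sign d" "umono ?E * umono ?F = d * (umono {1..s} :: 'k ambient)"
    using umono_mult(1)[of ?E ?F] fin sub[OF w0] by (auto simp: Un_absorb1)
  obtain e :: "'k ratfun" where e: "e \<noteq> 0" "umono {1..s} = ext_const e * xs.oprod {1..s}"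
    using umono_full by blast
  let ?W = "{w \<in> W'. list_u w = ?E}"
  let ?g = "\<lambda>w. rconst (c w) * vmono s (list_v w) :: 'k ratfun"
  have tm: "scale_ambient (c w) (uv_monomial w) * umono ?F =
      (if list_u w = ?E then ext_const (?g w) * (d * umono {1..s}) else 0)" if w: "w \<in> W'" for w
  proof -
    have *: "scale_ambient (c w) (uv_monomial w) * umono ?F = ext_const (?g w) * (umono (list_u w) * umono ?F)"
      by (simp only: scale_ambient_def uv_monomial_eq uvm_def W'(3)[OF w] mult.assoc ext_const_mult
          ext_const_left_comm[of "umono (list_u w)"])
    show ?thesis
    proof (cases "list_u w = ?E")
      case True
      then show ?thesis unfolding * by (simp only: True d if_True)
    next
      case False
      have "\<not> list_u w \<subseteq> ?E"
        using card_seteq[OF fin _ min[OF w]] False by blast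
      then have "list_u w \<inter> ?F \<noteq> {}" using sub[OF w] by blast
      then show ?thesis
        unfolding * using False umono_mult(2)[of "list_u w" ?F] fin by simp
    qed
  qed
  have "(\<Sum>w\<in>W. scale_ambient (c w) (uv_monomial w)) = (\<Sum>w\<in>W'. scale_ambient (c w) (uv_monomial w))"
    using W(1) unfolding W'_def by (intro sum.mono_neutral_right) auto
  then have "(\<Sum>w\<in>W'. scale_ambient (c w) (uv_monomial w)) * umono ?F = 0"
    using sum by simp
  then have "(\<Sum>w\<in>W'. if list_u w = ?E then ext_const (?g w) * (d * umono {1..s}) else 0) = (0 :: 'k ambient)"
    unfolding sum_distrib_right by (subst sum.cong[OF refl tm[symmetric]]) assumption
  then have "(\<Sum>w\<in>?W. ext_const (?g w) * (d * umono {1..s})) = (0 :: 'k ambient)"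
    by (simp only: sum.inter_filter[OF W'(1)])
  then have "ext_const (\<Sum>w\<in>?W. ?g w) * (d * umono {1..s}) = (0 :: 'k ambient)"
    by (simp only: ext_const_sum sum_distrib_right)
  then have "d * (ext_const (\<Sum>w\<in>?W. ?g w) * umono {1..s}) = (0 :: 'k ambient)"
    by (simp only: ext_const_left_comm[of d])
  then have "ext_const (\<Sum>w\<in>?W. ?g w) * umono {1..s} = (0 :: 'k ambient)"
    using d(1) by (auto simp: is_sign_def)
  then have "ecoef (ext_const ((\<Sum>w\<in>?W. ?g w) * e) * xs.oprod {1..s}) (Abs_fset {1..s}) = (0 :: 'k ratfun)"
    by (simp only: e(2) ext_const_mult mult.assoc ecoef_0)
  then have "(\<Sum>w\<in>?W. ?g w) = 0"
    using e(1) by (simp add: ecoef_ext_const_mult xs_oprod ecoef_xmono)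
  moreover have "(\<Sum>w\<in>?W. ?g w) \<noteq> 0"
  proof (rule sum_distinct_vals_nonzero)
    show "finite ?W" "?W \<noteq> {}" using W'(1) w0 by auto
    show "has_val (?g w) (\<lambda>k. 0 + (if k \<in> {1..s} then list_v w k else 0))" if "w \<in> ?W" for w
      by (intro has_val_mult has_val_rconst has_val_vmono) (use that W' in blast)
    show "inj_on (\<lambda>w k. 0 + (if k \<in> {1..s} then list_v w k else 0)) ?W"
    proof (rule inj_onI)
      fix w w' assume w: "w \<in> ?W" "w' \<in> ?W"
        and eq: "(\<lambda>k. 0 + (if k \<in> {1..s} then list_v w k else 0)) = (\<lambda>k. 0 + (if k \<in> {1..s} then list_v w' k else 0))"
      have "list_v w k = list_v w' k" for k
        using fun_cong[OF eq, of k] w W'(3)[of w] W'(3)[of w'] by (cases "k \<in> {1..s}") (auto simp: list_v_def)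
      then have "list_v w = list_v w'" by (rule ext)
      then show "w = w'"
        using w W'(3) uv_list_list[of w s] uv_list_list[of w' s] by auto
    qed
  qed
  ultimately show False by contradiction
qed

section \<open>Expansions in the monomials of the u_k and v_k and their coefficients\<close>

definition lincomb :: "((bool \<times> int) list \<Rightarrow>\<^sub>0 'k) \<Rightarrow> 'k ambient" where
  "lincomb c = (\<Sum>w\<in>Poly_Mapping.keys c. scale_ambient (Poly_Mapping.lookup c w) (uv_monomial w))"

lemma lincomb_superset:
  assumes "finite W" "Poly_Mapping.keys c \<subseteq> W"
  shows "lincomb c = (\<Sum>w\<in>W. scale_ambient (Poly_Mapping.lookup c w) (uv_monomial w))"
  unfolding lincomb_def using assms by (intro sum.mono_neutral_left) (auto simp: in_keys_iff)

lemma lincomb_add: "lincomb (c + d) = lincomb c + lincomb d"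
proof -
  let ?W = "Poly_Mapping.keys c \<union> Poly_Mapping.keys d"
  show ?thesis
    using Poly_Mapping.keys_add[of c d]
    by (subst (1 2 3) lincomb_superset[of ?W]) (auto simp: lookup_add amb.scale_left_distrib sum.distrib)
qed

lemma lincomb_single: "lincomb (Poly_Mapping.single w a) = scale_ambient a (uv_monomial w)"
  by (subst lincomb_superset[of "{w}"]) auto

lemma lincomb_scale: "lincomb (Poly_Mapping.map ((*) a) c) = scale_ambient a (lincomb c)"
proof -
  have l: "Poly_Mapping.lookup (Poly_Mapping.map ((*) a) c) w = a * Poly_Mapping.lookup c w" for w
    by (simp add: map.rep_eq when_def)
  have "Poly_Mapping.keys (Poly_Mapping.map ((*) a) c) \<subseteq> Poly_Mapping.keys c"
    by (auto simp: in_keys_iff l)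
  then show ?thesis
    by (subst lincomb_superset[of "Poly_Mapping.keys c"]) (auto simp: l lincomb_def amb.scale_sum_right)
qed

lemma lincomb_inj:
  assumes "\<forall>w\<in>Poly_Mapping.keys c. length w = s" "\<forall>w\<in>Poly_Mapping.keys d. length w = s" "lincomb c = lincomb d"
  shows "c = d"
proof (rule poly_mapping_eqI)
  fix w
  let ?W = "Poly_Mapping.keys c \<union> Poly_Mapping.keys d"
  have "(\<Sum>w\<in>?W. scale_ambient (Poly_Mapping.lookup c w - Poly_Mapping.lookup d w) (uv_monomial w)) = lincomb c - lincomb d"
    by (subst (1 2) lincomb_superset[of ?W]) (auto simp: amb.scale_left_diff_distrib sum_subtractf)
  then have "(\<Sum>w\<in>?W. scale_ambient (Poly_Mapping.lookup c w - Poly_Mapping.lookup d w) (uv_monomial w)) = 0"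
    using assms by simp
  then have "Poly_Mapping.lookup c w - Poly_Mapping.lookup d w = 0" if "w \<in> ?W"
    by (intro uv_monomials_independent[of ?W s _ w]) (use that assms in auto)
  then show "Poly_Mapping.lookup c w = Poly_Mapping.lookup d w"
    by (cases "w \<in> ?W") (auto simp: in_keys_iff)
qed

text \<open>Evaluates the \<open>THE\<close> of the definition; the independence of the monomials
  gives uniqueness.\<close>

lemma uv_expansion_lincomb:
  assumes "\<forall>w\<in>Poly_Mapping.keys c. length w = s"
  shows "uv_expansion s (lincomb c) = c"
  unfolding uv_expansion_def
proof (rule the_equality)
  show "(\<forall>w\<in>Poly_Mapping.keys c. length w = s) \<and>
      lincomb c = (\<Sum>w\<in>Poly_Mapping.keys c. scale_ambient (Poly_Mapping.lookup c w) (uv_monomial w))"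
    using assms by (simp add: lincomb_def)
next
  fix d assume "(\<forall>w\<in>Poly_Mapping.keys d. length w = s) \<and>
      lincomb c = (\<Sum>w\<in>Poly_Mapping.keys d. scale_ambient (Poly_Mapping.lookup d w) (uv_monomial w))"
  then show "d = c" using lincomb_inj[of d s c] assms by (simp add: lincomb_def)
qed

lemma span_lincomb:
  assumes "f \<in> amb.span (uv_monomial ` S)"
  shows "\<exists>c. Poly_Mapping.keys c \<subseteq> S \<and> f = lincomb c"
  using assms
proof (induction rule: amb.span_induct_alt)
  case base
  show ?case by (intro exI[of _ 0]) (simp add: lincomb_def)
next
  case (step a x f)
  then obtain w c where w: "w \<in> S" "x = uv_monomial w" and c: "Poly_Mapping.keys c \<subseteq> S" "f = lincomb c" by blast
  have "Poly_Mapping.keys (Poly_Mapping.single w a + c) \<subseteq> S"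
    using Poly_Mapping.keys_add[of "Poly_Mapping.single w a" c] w c by (auto split: if_splits)
  then show ?case
    using w c by (intro exI[of _ "Poly_Mapping.single w a + c"]) (simp add: lincomb_add lincomb_single)
qed

text \<open>The elements that possess a finite expansion. Elsewhere \<open>uv_expansion\<close> is
  an unspecified value, so linearity of \<open>uv_coeff\<close> and \<open>nu\<close> always needs
  membership here.\<close>

definition uv_space :: "nat \<Rightarrow> 'k ambient set" where
  "uv_space s = amb.span (uv_monomial ` {w. length w = s})"

definition uv_coeff :: "'k ambient \<Rightarrow> (bool \<times> int) list \<Rightarrow> 'k" where
  "uv_coeff f w = Poly_Mapping.lookup (uv_expansion (length w) f) w"

lemma uv_coeff_lincomb:
  "Poly_Mapping.keys c \<subseteq> {w. length w = s} \<Longrightarrow> length w = s \<Longrightarrow> uv_coeff (lincomb c) w = Poly_Mapping.lookup c w"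
  unfolding uv_coeff_def by (subst uv_expansion_lincomb) auto

lemma uv_coeff_add:
  assumes "f \<in> uv_space (length w)" "g \<in> uv_space (length w)"
  shows "uv_coeff (f + g) w = uv_coeff f w + uv_coeff g w"
proof -
  obtain c d where c: "Poly_Mapping.keys c \<subseteq> {v. length v = length w}" "f = lincomb c"
    and d: "Poly_Mapping.keys d \<subseteq> {v. length v = length w}" "g = lincomb d"
    using assms span_lincomb unfolding uv_space_def by blast
  have "Poly_Mapping.keys (c + d) \<subseteq> {v. length v = length w}"
    using Poly_Mapping.keys_add[of c d] c d by blast
  then show ?thesis
    using c d by (simp add: uv_coeff_lincomb lookup_add flip: lincomb_add)
qed

lemma uv_coeff_scale:
  assumes "f \<in> uv_space (length w)"
  shows "uv_coeff (scale_ambient a f) w = a * uv_coeff f w"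
proof -
  obtain c where c: "Poly_Mapping.keys c \<subseteq> {v. length v = length w}" "f = lincomb c"
    using assms span_lincomb unfolding uv_space_def by blast
  have l: "Poly_Mapping.lookup (Poly_Mapping.map ((*) a) c) w = a * Poly_Mapping.lookup c w" for w
    by (simp add: map.rep_eq when_def)
  have "Poly_Mapping.keys (Poly_Mapping.map ((*) a) c) \<subseteq> {v. length v = length w}"
    using c by (auto simp: in_keys_iff l)
  then show ?thesis
    using c by (simp add: uv_coeff_lincomb l flip: lincomb_scale)
qed

lemma uv_coeff_span:
  assumes "f \<in> amb.span (uv_monomial ` S)" "S \<subseteq> {v. length v = length w}" "w \<notin> S"
  shows "uv_coeff f w = 0"
proof -
  obtain c where c: "Poly_Mapping.keys c \<subseteq> S" "f = lincomb c"
    using span_lincomb[OF assms(1)] by blast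
  then have "uv_coeff f w = Poly_Mapping.lookup c w"
    using assms(2) by (subst c(2), subst uv_coeff_lincomb[of _ "length w"]) auto
  then show ?thesis using c assms(3) by (auto simp: in_keys_iff)
qed

lemma uv_coeff_monomial: "uv_coeff (uv_monomial w) w = 1"
  using uv_coeff_lincomb[of "Poly_Mapping.single w 1" "length w" w] by (simp add: lincomb_single)

end

subsection \<open>Leading monomials\<close>

text \<open>The u-factors take no part in the comparison: a leading monomial must strictly dominate
  all others in the exponents of the v_k alone.\<close>

definition ltv :: "nat \<Rightarrow> (nat \<Rightarrow> int) \<Rightarrow> (nat \<Rightarrow> int) \<Rightarrow> bool" where
  "ltv s b b' \<longleftrightarrow> (\<exists>k\<in>{1..s}. b k < b' k \<and> (\<forall>l\<in>{k<..s}. b l = b' l))"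

lemma ltv_irrefl: "\<not> ltv s b b" by (auto simp: ltv_def)

lemma ltv_trans: "ltv s a b \<Longrightarrow> ltv s b c \<Longrightarrow> ltv s a c"
proof -
  assume "ltv s a b" "ltv s b c"
  then obtain k l where k: "k \<in> {1..s}" "a k < b k" "\<forall>i\<in>{k<..s}. a i = b i"
    and l: "l \<in> {1..s}" "b l < c l" "\<forall>i\<in>{l<..s}. b i = c i"
    unfolding ltv_def by blast
  have "a (max k l) < c (max k l)"
  proof (cases k l rule: linorder_cases)
    case less
    then have "a l = b l" using k(3) l(1) by simp
    then show ?thesis using less l(2) by (simp add: max_def)
  next
    case greater
    then have "b k = c k" using l(3) k(1) by simp
    then show ?thesis using greater k(2) by (simp add: max_def)
  qed (use k l in simp)
  then show "ltv s a c"
    unfolding ltv_def using k l by (intro bexI[of _ "max k l"]) (auto simp: max_def split: if_splits)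
qed

lemma ltv_add: "ltv s a b \<Longrightarrow> ltv s (\<lambda>k. c k + a k) (\<lambda>k. c k + b k)"
  "ltv s a b \<Longrightarrow> ltv s (\<lambda>k. a k + c k) (\<lambda>k. b k + c k)"
  by (auto simp: ltv_def)

lemma ltv_cong: "(\<And>k. k \<in> {1..s} \<Longrightarrow> a k = a' k) \<Longrightarrow> (\<And>k. k \<in> {1..s} \<Longrightarrow> b k = b' k) \<Longrightarrow> ltv s a b = ltv s a' b'"
  by (auto simp: ltv_def)

text \<open>The degree of the monomial in P_s[1/L_s]: every u_k has degree 1 and every v_k degree
  2.\<close>

definition udeg :: "nat \<Rightarrow> nat set \<Rightarrow> (nat \<Rightarrow> int) \<Rightarrow> int" where
  "udeg s E b = int (card E) + 2 * (\<Sum>k=1..s. b k)"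

text \<open>The exponents of (L_s/L_i)^(p-1) = (V_{i+1} ... V_s)^(p-1). This is the leading monomial
  of q_{s,i}, obtained by taking the second summand of the recursion at each step down to q_{i,i} =
  1.\<close>

definition lead_q :: "nat \<Rightarrow> nat \<Rightarrow> nat \<Rightarrow> nat \<Rightarrow> int" where
  "lead_q p s i k = (int p - 1) * (int p ^ (s - k) - (if k \<le> i then int p ^ (i - k) else 0))"

definition bel :: "nat \<Rightarrow> (nat \<Rightarrow> nat) \<Rightarrow> nat set \<Rightarrow> 'k::field ambient" where
  "bel s a J = anticommuting.oprod (Theta s) J * ext_const (\<Prod>i<s. dQ s i ^ a i)"

text \<open>For every s > j the leading monomial of \<Theta>_{s,j} is that of \<tau>_{j+1}, namely
  u_{j+1}/V_{j+1}; this accounts for the first sum.\<close>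

definition bel_lead :: "nat \<Rightarrow> nat \<Rightarrow> (nat \<Rightarrow> nat) \<Rightarrow> nat set \<Rightarrow> nat \<Rightarrow> int" where
  "bel_lead p s a J k = (\<Sum>j\<in>J. - val_V p (Suc j) k) + (\<Sum>i<s. int (a i) * lead_q p s i k)"

section \<open>Spans of monomials, homogeneous elements and leading terms\<close>

context odd_prime_field
begin

text \<open>Lower-order terms, homogeneous parts and elements with bounded exponent of the top v are
  all of this shape, so that \<open>uvs_mult\<close> serves for all of them.\<close>

definition uvs :: "nat \<Rightarrow> (nat set \<Rightarrow> (nat \<Rightarrow> int) \<Rightarrow> bool) \<Rightarrow> 'k ambient set" where
  "uvs s X = amb.span (uv_monomial ` {uv_list s E b | E b. E \<subseteq> {1..s} \<and> X E b})"

lemma uvs_uvm: "E \<subseteq> {1..s} \<Longrightarrow> X E b \<Longrightarrow> uvm s E b \<in> uvs s X"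
  unfolding uvs_def by (subst uv_monomial_uv_list[symmetric]) (auto intro: amb.span_base)

lemma uvs_mono:
  assumes "f \<in> uvs s X" "\<And>E b. E \<subseteq> {1..s} \<Longrightarrow> X E b \<Longrightarrow> Y E b"
  shows "f \<in> uvs s Y"
proof -
  have "uvs s X \<subseteq> uvs s Y" unfolding uvs_def by (intro amb.span_mono image_mono) (use assms(2) in blast)
  then show ?thesis using assms(1) by blast
qed

lemma uvs_zero: "0 \<in> uvs s X" by (simp add: uvs_def amb.span_zero)
lemma uvs_add: "f \<in> uvs s X \<Longrightarrow> g \<in> uvs s X \<Longrightarrow> f + g \<in> uvs s X" by (simp add: uvs_def amb.span_add)
lemma uvs_sign: "is_sign c \<Longrightarrow> f \<in> uvs s X \<Longrightarrow> c * f \<in> uvs s X" by (simp add: uvs_def amb_span_sign)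
lemma uvm_mult:
  assumes "E \<subseteq> {1..s}" "E' \<subseteq> {1..s}"
  shows "E \<inter> E' = {} \<Longrightarrow> \<exists>c. is_sign c \<and> uvm s E b * uvm s E' b' = c * (uvm s (E \<union> E') (\<lambda>k. b k + b' k) :: 'k ambient)"
    and "E \<inter> E' \<noteq> {} \<Longrightarrow> uvm s E b * uvm s E' b' = (0 :: 'k ambient)"
proof -
  have fin: "finite E" "finite E'" using assms finite_subset by blast+
  have *: "uvm s E b * uvm s E' b' = umono E * umono E' * ext_const (vmono s (\<lambda>k. b k + b' k) :: 'k ratfun)"
    unfolding uvm_def vmono_add by (rule ext_const_merge)
  show "E \<inter> E' \<noteq> {} \<Longrightarrow> uvm s E b * uvm s E' b' = (0 :: 'k ambient)"
    unfolding * using umono_mult(2)[OF fin] by simp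
  assume "E \<inter> E' = {}"
  then obtain c where "is_sign c" "umono E * umono E' = c * (umono (E \<union> E') :: 'k ambient)"
    using umono_mult(1)[OF fin] by blast
  then show "\<exists>c. is_sign c \<and> uvm s E b * uvm s E' b' = c * (uvm s (E \<union> E') (\<lambda>k. b k + b' k) :: 'k ambient)"
    unfolding * by (intro exI[of _ c]) (simp add: uvm_def mult.assoc)
qed

lemma uvs_mult:
  assumes "f \<in> uvs s X" "g \<in> uvs s Y"
    and Z: "\<And>E b E' b'. E \<subseteq> {1..s} \<Longrightarrow> E' \<subseteq> {1..s} \<Longrightarrow> E \<inter> E' = {} \<Longrightarrow> X E b \<Longrightarrow> Y E' b' \<Longrightarrow>
      Z (E \<union> E') (\<lambda>k. b k + b' k)"
  shows "f * g \<in> uvs s Z"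
  unfolding uvs_def
proof (rule amb_span_mult[OF _ assms(1)[unfolded uvs_def] assms(2)[unfolded uvs_def]])
  fix x y :: "'k ambient"
  assume "x \<in> uv_monomial ` {uv_list s E b |E b. E \<subseteq> {1..s} \<and> X E b}"
    "y \<in> uv_monomial ` {uv_list s E b |E b. E \<subseteq> {1..s} \<and> Y E b}"
  then obtain E b E' b' where x: "x = uvm s E b" "E \<subseteq> {1..s}" "X E b"
    and y: "y = uvm s E' b'" "E' \<subseteq> {1..s}" "Y E' b'"
    using uv_monomial_uv_list by (auto simp del: atLeastAtMost_iff)
  show "x * y \<in> amb.span (uv_monomial ` {uv_list s E b |E b. E \<subseteq> {1..s} \<and> Z E b})"
    unfolding uvs_def[symmetric]
  proof (cases "E \<inter> E' = {}")
    case True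
    obtain c where c: "is_sign c" "x * y = c * (uvm s (E \<union> E') (\<lambda>k. b k + b' k) :: 'k ambient)"
      using uvm_mult(1)[OF x(2) y(2) True, of b b'] x(1) y(1) by blast
    have "(uvm s (E \<union> E') (\<lambda>k. b k + b' k) :: 'k ambient) \<in> uvs s Z"
      by (intro uvs_uvm Z x y True) (use x y in auto)
    then show "x * y \<in> uvs s Z" unfolding c(2) by (rule uvs_sign[OF c(1)])
  next
    case False
    then have "x * y = 0" using uvm_mult(2)[OF x(2) y(2) False, of b b'] x(1) y(1) by simp
    then show "x * y \<in> uvs s Z" by (simp add: uvs_zero)
  qed
qed

lemma uvm_Suc: "E \<subseteq> {1..s} \<Longrightarrow> uvm s E b = (uvm (Suc s) E (b(Suc s := 0)) :: 'k ambient)"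
proof -
  have "vmono (Suc s) (b(Suc s := 0)) = (vmono s (b(Suc s := 0)) :: 'k ratfun)" by (rule vmono_Suc) simp
  also have "\<dots> = vmono s b" by (rule vmono_cong) auto
  finally show ?thesis by (simp add: uvm_def)
qed

lemma uvs_Suc:
  assumes "f \<in> uvs s X" "\<And>E b. E \<subseteq> {1..s} \<Longrightarrow> X E b \<Longrightarrow> Y E (b(Suc s := 0))"
  shows "f \<in> uvs (Suc s) Y"
proof -
  have "uv_monomial ` {uv_list s E b | E b. E \<subseteq> {1..s} \<and> X E b}
      \<subseteq> (uv_monomial ` {uv_list (Suc s) E b | E b. E \<subseteq> {1..Suc s} \<and> Y E b} :: 'k ambient set)"
  proof
    fix x :: "'k ambient" assume "x \<in> uv_monomial ` {uv_list s E b | E b. E \<subseteq> {1..s} \<and> X E b}"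
    then obtain E b where x: "x = uv_monomial (uv_list s E b)" "E \<subseteq> {1..s}" "X E b" by blast
    have E: "E \<subseteq> {1..Suc s}" using x(2) by auto
    have "x = uv_monomial (uv_list (Suc s) E (b(Suc s := 0)))"
      unfolding x(1) uv_monomial_uv_list[OF x(2)] uv_monomial_uv_list[OF E] by (rule uvm_Suc[OF x(2)])
    then show "x \<in> uv_monomial ` {uv_list (Suc s) E b | E b. E \<subseteq> {1..Suc s} \<and> Y E b}"
      using assms(2)[OF x(2,3)] E by blast
  qed
  then show ?thesis using assms(1) amb.span_mono unfolding uvs_def by blast
qed

lemma uvs_uv_space: "f \<in> uvs s X \<Longrightarrow> f \<in> uv_space s"
  unfolding uvs_def uv_space_def by (rule subsetD[OF amb.span_mono]) auto

text \<open>Homogeneity confines the nonzero entries in a row of the matrix nu_s(b_I')(lambda_I) to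
  sequences I of one degree, which later makes the linear systems finite.\<close>

definition homog :: "nat \<Rightarrow> int \<Rightarrow> 'k ambient set" where
  "homog s d = uvs s (\<lambda>E b. udeg s E b = d)"

lemma homog_mult: "f \<in> homog s d \<Longrightarrow> g \<in> homog s e \<Longrightarrow> f * g \<in> homog s (d + e)"
  unfolding homog_def
  by (erule (1) uvs_mult) (auto simp: udeg_def card_Un_disjoint finite_subset[of _ "{1..s}"] sum.distrib)

lemma homog_1: "1 \<in> homog s 0"
  using uvs_uvm[of "{}" s "\<lambda>E b. udeg s E b = 0" "\<lambda>k. 0"]
  by (simp add: homog_def uvm_def vmono_0 udeg_def)

lemma homog_power: "f \<in> homog s d \<Longrightarrow> f ^ n \<in> homog s (int n * d)"
proof (induction n)
  case (Suc n)
  then show ?case using homog_mult[of f s d "f ^ n" "int n * d"] by (simp add: distrib_right)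
qed (simp add: homog_1)

lemma homog_Suc: "f \<in> homog s d \<Longrightarrow> f \<in> homog (Suc s) d"
  unfolding homog_def by (erule uvs_Suc) (simp add: udeg_def)

definition lead :: "nat \<Rightarrow> 'k ambient \<Rightarrow> nat set \<Rightarrow> (nat \<Rightarrow> int) \<Rightarrow> bool" where
  "lead s f E b \<longleftrightarrow> E \<subseteq> {1..s} \<and>
     (\<exists>c g. is_sign c \<and> g \<in> uvs s (\<lambda>E' b'. ltv s b' b) \<and> f = c * uvm s E b + g)"

lemma lead_uvm: "is_sign c \<Longrightarrow> E \<subseteq> {1..s} \<Longrightarrow> lead s (c * uvm s E b) E b"
  unfolding lead_def by (intro conjI exI[of _ c] exI[of _ 0]) (simp_all add: uvs_zero)

lemma lead_cong: "lead s f E b \<Longrightarrow> (\<And>k. k \<in> {1..s} \<Longrightarrow> b k = b' k) \<Longrightarrow> lead s f E b'"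
proof -
  assume l: "lead s f E b" and b: "\<And>k. k \<in> {1..s} \<Longrightarrow> b k = b' k"
  have "ltv s c b = ltv s c b'" for c by (rule ltv_cong) (use b in auto)
  moreover have "uvm s E b = (uvm s E b' :: 'k ambient)" by (rule uvm_cong) (rule b)
  ultimately show ?thesis using l unfolding lead_def by simp
qed

lemma lead_add:
  assumes "lead s f E b" "g \<in> uvs s (\<lambda>E' b'. ltv s b' b)"
  shows "lead s (f + g) E b"
proof -
  obtain c h where "is_sign c" "h \<in> uvs s (\<lambda>E' b'. ltv s b' b)" "f = c * uvm s E b + h"
    using assms(1) unfolding lead_def by blast
  then show ?thesis
    using assms uvs_add[of h s _ g] unfolding lead_def by (metis add.assoc)
qed

text \<open>Disjointness keeps the product of the two leading monomials from vanishing. For the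
  \<Theta>_j it is guaranteed because they lead with different u_{j+1}.\<close>

lemma lead_mult:
  assumes "lead s f E b" "lead s f' E' b'" "E \<inter> E' = {}"
  shows "lead s (f * f') (E \<union> E') (\<lambda>k. b k + b' k)"
proof -
  obtain c g where f: "E \<subseteq> {1..s}" "is_sign c" "g \<in> uvs s (\<lambda>E' b'. ltv s b' b)" "f = c * uvm s E b + g"
    using assms(1) unfolding lead_def by blast
  obtain c' g' where f': "E' \<subseteq> {1..s}" "is_sign c'" "g' \<in> uvs s (\<lambda>E b. ltv s b b')" "f' = c' * uvm s E' b' + g'"
    using assms(2) unfolding lead_def by blast
  obtain d where d: "is_sign d" "uvm s E b * uvm s E' b' = d * (uvm s (E \<union> E') (\<lambda>k. b k + b' k) :: 'k ambient)"
    using uvm_mult(1)[OF f(1) f'(1) assms(3)] by blast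
  let ?L = "\<lambda>E'' b''. ltv s b'' (\<lambda>k. b k + b' k)"
  have 1: "uvm s E b \<in> uvs s (\<lambda>E' b'. b' = b)" and 2: "uvm s E' b' \<in> uvs s (\<lambda>E b. b = b')"
    using f(1) f'(1) by (auto intro!: uvs_uvm)
  have "c * (uvm s E b * g') + (c' * (g * uvm s E' b') + g * g') \<in> uvs s ?L"
    by (intro uvs_add uvs_sign f(2) f'(2) uvs_mult[OF 1 f'(3)] uvs_mult[OF f(3) 2] uvs_mult[OF f(3) f'(3)])
      (auto intro: ltv_add ltv_trans[OF ltv_add(1) ltv_add(2)])
  moreover have "f * f' = (c * (c' * d)) * uvm s (E \<union> E') (\<lambda>k. b k + b' k) +
      (c * (uvm s E b * g') + (c' * (g * uvm s E' b') + g * g'))"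
    unfolding f(4) f'(4)
    by (simp only: distrib_left distrib_right mult.assoc is_sign_left_comm[OF f'(2)] d(2)[symmetric] add_ac)
  ultimately show ?thesis
    unfolding lead_def using f(1) f'(1) is_sign_mult[OF f(2) is_sign_mult[OF f'(2) d(1)]] by blast
qed

lemma lead_1: "lead s 1 {} (\<lambda>k. 0)"
  using lead_uvm[of 1 "{}" s "\<lambda>k. 0"] by (simp add: uvm_def vmono_0)

lemma lead_power:
  assumes "lead s f {} b"
  shows "lead s (f ^ n) {} (\<lambda>k. int n * b k)"
proof (induction n)
  case (Suc n)
  then show ?case using lead_mult[OF assms Suc] by (simp add: distrib_right)
qed (simp add: lead_1)

lemma lead_Suc:
  assumes "lead s f E b"
  shows "lead (Suc s) f E (b(Suc s := 0))"
proof -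
  obtain c g where f: "E \<subseteq> {1..s}" "is_sign c" "g \<in> uvs s (\<lambda>E' b'. ltv s b' b)" "f = c * uvm s E b + g"
    using assms(1) unfolding lead_def by blast
  have "g \<in> uvs (Suc s) (\<lambda>E' b'. ltv (Suc s) b' (b(Suc s := 0)))"
  proof (rule uvs_Suc[OF f(3)])
    fix E' b' assume "ltv s b' b"
    then obtain k where k: "k \<in> {1..s}" "b' k < b k" "\<forall>l\<in>{k<..s}. b' l = b l" by (auto simp: ltv_def)
    then show "ltv (Suc s) (b'(Suc s := 0)) (b(Suc s := 0))"
      unfolding ltv_def by (intro bexI[of _ k]) auto
  qed
  moreover have "E \<subseteq> {1..Suc s}" using f(1) by auto
  ultimately show ?thesis
    unfolding lead_def using f(2) f(4)[unfolded uvm_Suc[OF f(1)]] by blast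
qed

lemma uvs_below_top:
  assumes "f \<in> uvs (Suc s) (\<lambda>E b'. b' (Suc s) < b (Suc s))"
  shows "f \<in> uvs (Suc s) (\<lambda>E b'. ltv (Suc s) b' b)"
  by (rule uvs_mono[OF assms]) (auto simp: ltv_def intro!: bexI[of _ "Suc s"])

section \<open>Leading terms and degrees of the Dickson invariants and of the dual forms\<close>

lemma vmono_val_L: "k \<le> s \<Longrightarrow> vmono s (val_L CARD('k) k) = (dL k :: 'k ratfun)"
proof -
  assume k: "k \<le> s"
  have "vmono s (val_L CARD('k) k) = (\<Prod>i=1..k. (dv i :: 'k ratfun) powi val_L CARD('k) k i)"
    unfolding vmono_def using k by (intro prod.mono_neutral_right) (auto simp: val_L_def)
  also have "\<dots> = (\<Prod>i=1..k. dv i ^ (CARD('k) ^ (k - i)))"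
    by (intro prod.cong) (auto simp: val_L_def simp flip: of_nat_power)
  finally show ?thesis by (simp add: dL_prod_dv)
qed

lemma val_V_val_L: "k \<ge> 1 \<Longrightarrow> val_V q k i = (if i = k then 1 else 0) + int (q - 1) * val_L q (k - 1) i"
  by (auto simp: val_V_def val_q_def val_L_def)

lemma vmono_val_V: "k \<in> {1..s} \<Longrightarrow> vmono s (val_V CARD('k) k) = (dV k :: 'k ratfun)"
proof -
  assume k: "k \<in> {1..s}"
  have "vmono s (val_V CARD('k) k) = (vmono s (\<lambda>i. if i = k then 1 else 0) :: 'k ratfun) *
      vmono s (\<lambda>i. int (CARD('k) - 1) * val_L CARD('k) (k - 1) i)"
    unfolding vmono_add[symmetric] by (rule vmono_cong) (use k in \<open>simp add: val_V_val_L\<close>)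
  also have "vmono s (\<lambda>i. if i = k then 1 else 0) = (dv k :: 'k ratfun)"
    unfolding vmono_def using k by (simp add: if_distrib cong: if_cong)
  also have "vmono s (\<lambda>i. int (CARD('k) - 1) * val_L CARD('k) (k - 1) i) = (dL (k - 1) :: 'k ratfun) ^ (CARD('k) - 1)"
    using k by (subst vmono_power, subst vmono_val_L) auto
  finally show ?thesis by (simp add: dV_eq)
qed

text \<open>As each v_i has degree 2, this says that V_k has degree 2 p^(k-1).\<close>

lemma sum_val_V: "k \<in> {1..s} \<Longrightarrow> (\<Sum>i=1..s. val_V CARD('k) k i) = int CARD('k) ^ (k - 1)"
proof -
  have L: "int (CARD('k) - 1) * (\<Sum>i=1..n. val_L CARD('k) n i) = int CARD('k) ^ n - 1" for n
  proof (induction n)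
    case (Suc n)
    have "(\<Sum>i=1..n. val_L CARD('k) (Suc n) i) = int CARD('k) * (\<Sum>i=1..n. val_L CARD('k) n i)"
      unfolding sum_distrib_left by (intro sum.cong) (auto simp: val_L_def Suc_diff_le)
    then have "(\<Sum>i=1..Suc n. val_L CARD('k) (Suc n) i) = int CARD('k) * (\<Sum>i=1..n. val_L CARD('k) n i) + 1"
      by (simp add: val_L_def)
    then have "int (CARD('k) - 1) * (\<Sum>i=1..Suc n. val_L CARD('k) (Suc n) i) =
        int CARD('k) * (int (CARD('k) - 1) * (\<Sum>i=1..n. val_L CARD('k) n i)) + int (CARD('k) - 1)"
      by (simp add: algebra_simps)
    also have "\<dots> = int CARD('k) * (int CARD('k) ^ n - 1) + int (CARD('k) - 1)" by (simp only: Suc)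
    also have "\<dots> = int CARD('k) ^ Suc n - 1"
      using card_gt_0 by (simp add: of_nat_diff algebra_simps)
    finally show ?case .
  qed simp
  assume k: "k \<in> {1..s}"
  have "(\<Sum>i=1..s. val_V CARD('k) k i) =
      (\<Sum>i=1..s. if i = k then 1 else 0) + int (CARD('k) - 1) * (\<Sum>i=1..s. val_L CARD('k) (k - 1) i)"
    unfolding sum_distrib_left sum.distrib[symmetric] by (intro sum.cong) (use k in \<open>auto simp: val_V_val_L\<close>)
  also have "(\<Sum>i=1..s. val_L CARD('k) (k - 1) i) = (\<Sum>i=1..k - 1. val_L CARD('k) (k - 1) i)"
    using k by (intro sum.mono_neutral_right) (auto simp: val_L_def)
  finally show ?thesis using k L[of "k - 1"] by simp
qed

lemma dV_uvm: "k \<in> {1..s} \<Longrightarrow> ext_const (dV k) = (uvm s {} (val_V CARD('k) k) :: 'k ambient)"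
  by (simp add: uvm_def vmono_val_V)

text \<open>Since u_k is V_k \<tau>_k up to sign and V_k is a monomial in the v_i, the form \<tau>_k
  is itself a single monomial up to sign.\<close>

lemma Tau_uvm:
  assumes k: "k \<in> {1..s}"
  shows "\<exists>c. is_sign c \<and> Tau k = c * (uvm s {k} (\<lambda>i. - val_V CARD('k) k i) :: 'k ambient)"
proof -
  obtain c where c: "is_sign c" "mui_u k = c * (ext_const (dV k) * (Tau k :: 'k ambient))"
    using mui_u_eq[of k] k by auto
  have V: "dV k \<noteq> (0 :: 'k ratfun)" using k by (simp add: dV_nonzero)
  have "uvm s {k} (\<lambda>i. - val_V CARD('k) k i) = (mui_u k * ext_const (inverse (dV k)) :: 'k ambient)"
    using k by (simp add: uvm_def umono_single vmono_uminus vmono_val_V)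
  also have "\<dots> = c * (ext_const (inverse (dV k)) * (ext_const (dV k) * Tau k))"
    unfolding c(2) ext_const_comm by (simp only: ext_const_left_comm[of c] mult.assoc)
  also have "ext_const (inverse (dV k)) * (ext_const (dV k) * Tau k) = (Tau k :: 'k ambient)"
    using V by (simp flip: mult.assoc ext_const_mult)
  finally have "Tau k = c * (uvm s {k} (\<lambda>i. - val_V CARD('k) k i) :: 'k ambient)"
    by (metis c(1) is_sign_sq mult.assoc mult_1_left)
  then show ?thesis using c(1) by blast
qed

lemma ext_dQ_Suc: "ext_const (dQ (Suc s) i :: 'k ratfun) =
   (if i = 0 then 0 else ext_const (dQ s (i - 1)) ^ CARD('k)) + ext_const (dQ s i) * ext_const (dV (Suc s)) ^ (CARD('k) - 1)"
  by (simp add: dQ_Suc ext_const_add ext_const_mult ext_const_power)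

lemma homog_dQ: "i \<le> s \<Longrightarrow> ext_const (dQ s i) \<in> homog s (2 * (int CARD('k) ^ s - int CARD('k) ^ i))"
proof (induction s arbitrary: i)
  case 0 then show ?case by (simp add: homog_1)
next
  case (Suc s)
  let ?d = "2 * (int CARD('k) ^ Suc s - int CARD('k) ^ i)"
  have V: "ext_const (dV (Suc s) :: 'k ratfun) \<in> homog (Suc s) (2 * int CARD('k) ^ s)"
    unfolding homog_def dV_uvm[of "Suc s" "Suc s", simplified]
    by (rule uvs_uvm) (use sum_val_V[of "Suc s" "Suc s"] in \<open>auto simp: udeg_def\<close>)
  have 1: "ext_const (dQ s (i - 1)) ^ CARD('k) \<in> homog (Suc s) ?d" if "i \<noteq> 0"
  proof -
    have "int CARD('k) * (2 * (int CARD('k) ^ s - int CARD('k) ^ (i - 1))) = ?d"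
      using that by (cases i) (simp_all add: algebra_simps)
    then show ?thesis using homog_Suc[OF homog_power[OF Suc.IH[of "i - 1"], of "CARD('k)"]] Suc.prems by simp
  qed
  have 2: "ext_const (dQ s i) * ext_const (dV (Suc s)) ^ (CARD('k) - 1) \<in> homog (Suc s) ?d" if "i \<le> s"
  proof -
    have "2 * (int CARD('k) ^ s - int CARD('k) ^ i) + int (CARD('k) - 1) * (2 * int CARD('k) ^ s) = ?d"
      using card_gt_0 by (simp add: of_nat_diff algebra_simps)
    then show ?thesis using homog_mult[OF homog_Suc[OF Suc.IH[OF that]] homog_power[OF V, of "CARD('k) - 1"]] by (simp only:)
  qed
  show ?case
  proof (cases "i \<le> s")
    case True
    then show ?thesis
      unfolding ext_dQ_Suc using 1 2 uvs_add uvs_zero unfolding homog_def by auto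
  next
    case False
    then have "i = Suc s" using Suc.prems by simp
    then show ?thesis by (simp add: dQ_diag homog_1)
  qed
qed

text \<open>For i \<le> s the summand q_{s,i} V_{s+1}^(p-1) contains v_{s+1} to the power p - 1,
  whereas q_{s,i-1}^p does not involve this most significant variable. So the second summand of the
  recursion leads.\<close>

lemma lead_dQ: "i \<le> s \<Longrightarrow> lead s (ext_const (dQ s i)) {} (lead_q CARD('k) s i)"
proof (induction s arbitrary: i)
  case 0
  then show ?case using lead_cong[OF lead_1[of 0], of "lead_q CARD('k) 0 0"] by simp
next
  case (Suc s)
  show ?case
  proof (cases "i \<le> s")
    case False
    then have "i = Suc s" using Suc.prems by simp
    then show ?thesis by (auto simp: dQ_diag lead_q_def intro: lead_cong[OF lead_1])
  next
    case True
    have V: "lead (Suc s) (ext_const (dV (Suc s) :: 'k ratfun)) {} (val_V CARD('k) (Suc s))"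
      using lead_uvm[of 1 "{}" "Suc s" "val_V CARD('k) (Suc s)"] by (simp add: dV_uvm[of "Suc s" "Suc s", simplified])
    have "lead (Suc s) (ext_const (dQ s i) * ext_const (dV (Suc s)) ^ (CARD('k) - 1)) ({} \<union> {})
       (\<lambda>k. ((lead_q CARD('k) s i)(Suc s := 0)) k + int (CARD('k) - 1) * val_V CARD('k) (Suc s) k)"
      by (intro lead_mult lead_Suc lead_power V Suc.IH True) simp
    then have 1: "lead (Suc s) (ext_const (dQ s i) * ext_const (dV (Suc s)) ^ (CARD('k) - 1)) {} (lead_q CARD('k) (Suc s) i)"
      unfolding Un_empty_left
    proof (rule lead_cong)
      fix k assume k: "k \<in> {1..Suc s}"
      have p1: "int (CARD('k) - 1) = int CARD('k) - 1" using card_gt_0 by simp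
      show "((lead_q CARD('k) s i)(Suc s := 0)) k + int (CARD('k) - 1) * val_V CARD('k) (Suc s) k = lead_q CARD('k) (Suc s) i k"
      proof (cases "k = Suc s")
        case True
        then show ?thesis using \<open>i \<le> s\<close> by (simp add: lead_q_def val_V_def val_q_def p1[simplified])
      next
        case False
        then have "Suc s - k = Suc (s - k)" "k \<le> s" "1 \<le> k" using k by auto
        then show ?thesis
          by (simp add: lead_q_def val_V_def val_q_def p1[simplified]) (simp add: algebra_simps)
      qed
    qed
    have "ext_const (dQ s (i - 1)) ^ CARD('k) \<in> uvs (Suc s) (\<lambda>E b. b (Suc s) < lead_q CARD('k) (Suc s) i (Suc s))"
      if "i \<noteq> 0"
    proof (rule uvs_Suc)
      show "ext_const (dQ s (i - 1)) ^ CARD('k) \<in> uvs s (\<lambda>E b. udeg s E b =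
          int CARD('k) * (2 * (int CARD('k) ^ s - int CARD('k) ^ (i - 1))))"
        unfolding homog_def[symmetric] by (rule homog_power[OF homog_dQ]) (use True in simp)
    qed (use True card_ge_3 in \<open>simp add: lead_q_def\<close>)
    then have "i \<noteq> 0 \<Longrightarrow> ext_const (dQ s (i - 1)) ^ CARD('k) \<in> uvs (Suc s) (\<lambda>E b. ltv (Suc s) b (lead_q CARD('k) (Suc s) i))"
      by (rule uvs_below_top)
    then show ?thesis
      using lead_add[OF 1] 1 unfolding ext_dQ_Suc by (cases "i = 0") (simp_all add: add.commute)
  qed
qed

lemma lead_Tau:
  assumes "k \<in> {1..s}"
  shows "lead s (Tau k) {k} (\<lambda>i. - val_V CARD('k) k i)"
proof -
  obtain c where "is_sign c" "Tau k = c * (uvm s {k} (\<lambda>i. - val_V CARD('k) k i) :: 'k ambient)"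
    using Tau_uvm[OF assms] by blast
  then show ?thesis using lead_uvm[of c "{k}" s] assms by simp
qed

lemma homog_Tau:
  assumes "k \<in> {1..s}"
  shows "Tau k \<in> homog s (1 - 2 * int CARD('k) ^ (k - 1))"
proof -
  obtain c where c: "is_sign c" "Tau k = c * (uvm s {k} (\<lambda>i. - val_V CARD('k) k i) :: 'k ambient)"
    using Tau_uvm[OF assms] by blast
  have "udeg s {k} (\<lambda>i. - val_V CARD('k) k i) = 1 - 2 * int CARD('k) ^ (k - 1)"
    using sum_val_V[OF assms] by (simp add: udeg_def sum_negf)
  then have "uvm s {k} (\<lambda>i. - val_V CARD('k) k i) \<in> homog s (1 - 2 * int CARD('k) ^ (k - 1))"
    unfolding homog_def by (intro uvs_uvm) (use assms in auto)
  then show ?thesis unfolding c(2) homog_def by (rule uvs_sign[OF c(1)])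
qed

lemma Theta_Suc': "Theta (Suc s) j = Theta s j + ext_const ((-1) ^ (s - j)) * (ext_const (dQ s j) * (Tau (Suc s) :: 'k ambient))"
  by (simp only: Theta_Suc ext_const_mult mult.assoc)

lemma homog_Theta: "j < s \<Longrightarrow> Theta s j \<in> homog s (1 - 2 * int CARD('k) ^ j)"
proof (induction s)
  case (Suc s)
  show ?case
  proof (cases "j < s")
    case True
    have "2 * (int CARD('k) ^ s - int CARD('k) ^ j) + (1 - 2 * int CARD('k) ^ s) = 1 - 2 * int CARD('k) ^ j"
      by simp
    then have "ext_const (dQ s j) * Tau (Suc s) \<in> homog (Suc s) (1 - 2 * int CARD('k) ^ j)"
      using homog_mult[OF homog_Suc[OF homog_dQ[of j s]] homog_Tau[of "Suc s" "Suc s"]] True by simp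
    then show ?thesis
      unfolding Theta_Suc'
      using homog_Suc[OF Suc.IH[OF True]] uvs_add uvs_sign[OF is_sign_ext_const[OF is_sign_minus_1]]
      unfolding homog_def by blast
  next
    case False
    then have "j = s" using Suc.prems by simp
    then show ?thesis using homog_Tau[of "Suc s" "Suc s"] by (simp add: Theta_Tau)
  qed
qed simp

text \<open>The correction q_{s,j} \<tau>_{s+1} has exponent -1 at v_{s+1}, which does not occur in
  \<Theta>_{s,j}; the passage to s + 1 thus adds only smaller terms.\<close>

lemma lead_Theta: "j < s \<Longrightarrow> lead s (Theta s j) {Suc j} (\<lambda>i. - val_V CARD('k) (Suc j) i)"
proof (induction s)
  case (Suc s)
  show ?case
  proof (cases "j < s")
    case True
    have top: "lead (Suc s) (Theta s j) {Suc j} (\<lambda>i. - val_V CARD('k) (Suc j) i)"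
      by (rule lead_cong[OF lead_Suc[OF Suc.IH[OF True]]]) (use True in \<open>auto simp: val_V_def val_q_def\<close>)
    obtain c where c: "is_sign c" "Tau (Suc s) = c * (uvm (Suc s) {Suc s} (\<lambda>i. - val_V CARD('k) (Suc s) i) :: 'k ambient)"
      using Tau_uvm[of "Suc s" "Suc s"] by auto
    have 1: "ext_const (dQ s j) \<in> uvs (Suc s) (\<lambda>E b. b (Suc s) = 0)"
      by (rule uvs_Suc[OF homog_dQ[of j s, unfolded homog_def]]) (use True in auto)
    have 2: "Tau (Suc s) \<in> uvs (Suc s) (\<lambda>E b. b (Suc s) = -1)"
      unfolding c(2) by (intro uvs_sign c(1) uvs_uvm) (auto simp: val_V_def val_q_def)
    have "ext_const (dQ s j) * Tau (Suc s) \<in> uvs (Suc s) (\<lambda>E b. b (Suc s) < - val_V CARD('k) (Suc j) (Suc s))"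
      by (rule uvs_mult[OF 1 2]) (use True in \<open>auto simp: val_V_def val_q_def\<close>)
    then show ?thesis
      unfolding Theta_Suc'
      by (intro lead_add[OF top] uvs_sign[OF is_sign_ext_const[OF is_sign_minus_1]]) (rule uvs_below_top)
  next
    case False
    then have "j = s" using Suc.prems by simp
    then show ?thesis using lead_Tau[of "Suc s" "Suc s"] by (simp add: Theta_Tau)
  qed
qed simp

lemma lead_homog_oprod:
  assumes "J \<subseteq> {..<s}"
  shows "lead s (anticommuting.oprod (Theta s) J) (Suc ` J) (\<lambda>k. \<Sum>j\<in>J. - val_V CARD('k) (Suc j) k)"
    and "anticommuting.oprod (Theta s) J \<in> homog s (\<Sum>j\<in>J. 1 - 2 * int CARD('k) ^ j)"
proof -
  interpret anticommuting "Theta s :: nat \<Rightarrow> 'k ambient" by (rule Theta_anticommuting)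
  have "finite J" using assms by (rule finite_subset) simp
  then have "lead s (oprod J) (Suc ` J) (\<lambda>k. \<Sum>j\<in>J. - val_V CARD('k) (Suc j) k) \<and>
      oprod J \<in> homog s (\<Sum>j\<in>J. 1 - 2 * int CARD('k) ^ j)" using assms
  proof (induction rule: finite_linorder_min_induct)
    case empty
    show ?case using lead_1 homog_1 by simp
  next
    case (insert b J)
    have b: "b < s" "b \<notin> J" "J \<subseteq> {..<s}" using insert by auto
    then have d: "{Suc b} \<inter> Suc ` J = {}" by auto
    show ?case
      using lead_mult[OF lead_Theta[OF b(1)] conjunct1[OF insert.IH[OF b(3)]] d]
        homog_mult[OF homog_Theta[OF b(1)] conjunct2[OF insert.IH[OF b(3)]]] insert.hyps b
      by (simp add: oprod_insert_min)
  qed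
  then show "lead s (oprod J) (Suc ` J) (\<lambda>k. \<Sum>j\<in>J. - val_V CARD('k) (Suc j) k)"
    and "oprod J \<in> homog s (\<Sum>j\<in>J. 1 - 2 * int CARD('k) ^ j)" by blast+
qed

lemma lead_homog_dQ_prod:
  assumes "I \<subseteq> {..<s}"
  shows "lead s (ext_const (\<Prod>i\<in>I. dQ s i ^ a i)) {} (\<lambda>k. \<Sum>i\<in>I. int (a i) * lead_q CARD('k) s i k)"
    and "ext_const (\<Prod>i\<in>I. dQ s i ^ a i) \<in> homog s (\<Sum>i\<in>I. int (a i) * (2 * (int CARD('k) ^ s - int CARD('k) ^ i)))"
proof -
  have "finite I" using assms by (rule finite_subset) simp
  then have "lead s (ext_const (\<Prod>i\<in>I. dQ s i ^ a i)) {} (\<lambda>k. \<Sum>i\<in>I. int (a i) * lead_q CARD('k) s i k) \<and>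
     ext_const (\<Prod>i\<in>I. dQ s i ^ a i) \<in> homog s (\<Sum>i\<in>I. int (a i) * (2 * (int CARD('k) ^ s - int CARD('k) ^ i)))"
    using assms
  proof induction
    case empty
    show ?case using lead_1 homog_1 by simp
  next
    case (insert i I)
    then have i: "i \<le> s" and I: "I \<subseteq> {..<s}" by auto
    have "lead s (ext_const (dQ s i) ^ a i * ext_const (\<Prod>i\<in>I. dQ s i ^ a i)) ({} \<union> {})
       (\<lambda>k. int (a i) * lead_q CARD('k) s i k + (\<Sum>i\<in>I. int (a i) * lead_q CARD('k) s i k))"
      using insert.IH[OF I] by (intro lead_mult lead_power lead_dQ i) auto
    moreover have "ext_const (dQ s i) ^ a i * ext_const (\<Prod>i\<in>I. dQ s i ^ a i) \<in> homog s
       (int (a i) * (2 * (int CARD('k) ^ s - int CARD('k) ^ i)) + (\<Sum>i\<in>I. int (a i) * (2 * (int CARD('k) ^ s - int CARD('k) ^ i))))"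
      using insert.IH[OF I] by (intro homog_mult homog_power homog_dQ i) auto
    ultimately show ?case
      using insert.hyps by (simp add: ext_const_mult ext_const_power)
  qed
  then show "lead s (ext_const (\<Prod>i\<in>I. dQ s i ^ a i)) {} (\<lambda>k. \<Sum>i\<in>I. int (a i) * lead_q CARD('k) s i k)"
    and "ext_const (\<Prod>i\<in>I. dQ s i ^ a i) \<in> homog s (\<Sum>i\<in>I. int (a i) * (2 * (int CARD('k) ^ s - int CARD('k) ^ i)))"
    by blast+
qed

lemma lead_bel:
  assumes "J \<subseteq> {..<s}"
  shows "lead s (bel s a J) (Suc ` J) (bel_lead CARD('k) s a J)"
  using lead_mult[OF lead_homog_oprod(1)[OF assms] lead_homog_dQ_prod(1)[of "{..<s}" s a]]
  by (simp add: bel_def bel_lead_def[abs_def])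

lemma homog_bel:
  assumes "J \<subseteq> {..<s}"
  shows "bel s a J \<in> homog s ((\<Sum>j\<in>J. 1 - 2 * int CARD('k) ^ j) +
    (\<Sum>i<s. int (a i) * (2 * (int CARD('k) ^ s - int CARD('k) ^ i))))"
  unfolding bel_def by (intro homog_mult lead_homog_oprod(2) assms lead_homog_dQ_prod(2)) simp

text \<open>The list encoding sees exponents only at 1, ..., s, so X has to be refuted for every
  function that agrees with b there.\<close>

lemma uv_coeff_uvs:
  assumes "f \<in> uvs s X" "E \<subseteq> {1..s}"
    and "\<And>b'. (\<And>k. k \<in> {1..s} \<Longrightarrow> b' k = b k) \<Longrightarrow> \<not> X E b'"
  shows "uv_coeff f (uv_list s E b) = 0"
proof (rule uv_coeff_span[OF assms(1)[unfolded uvs_def]])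
  show "{uv_list s E b |E b. E \<subseteq> {1..s} \<and> X E b} \<subseteq> {v. length v = length (uv_list s E b)}" by auto
  show "uv_list s E b \<notin> {uv_list s E b |E b. E \<subseteq> {1..s} \<and> X E b}"
  proof
    assume "uv_list s E b \<in> {uv_list s E b |E b. E \<subseteq> {1..s} \<and> X E b}"
    then obtain E' b' where e: "uv_list s E b = uv_list s E' b'" "E' \<subseteq> {1..s}" "X E' b'" by blast
    have "E' = E" using list_u_uv_list[OF e(2), of b'] list_u_uv_list[OF assms(2), of b] e(1) by simp
    moreover have "b' k = b k" if "k \<in> {1..s}" for k
      using list_v_uv_list[OF that, of E' b'] list_v_uv_list[OF that, of E b] e(1) by simp
    ultimately show False using assms(3) e(3) by blast
  qed
qed

lemma uv_coeff_homog:
  assumes "f \<in> homog s d" "E \<subseteq> {1..s}" "udeg s E b \<noteq> d"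
  shows "uv_coeff f (uv_list s E b) = 0"
proof (rule uv_coeff_uvs[OF assms(1)[unfolded homog_def] assms(2)])
  fix b' assume "\<And>k. k \<in> {1..s} \<Longrightarrow> b' k = b k"
  then have "udeg s E b' = udeg s E b" by (simp add: udeg_def)
  then show "udeg s E b' \<noteq> d" using assms(3) by simp
qed

lemma uv_coeff_lead:
  assumes "lead s f E b"
  shows "is_sign (uv_coeff f (uv_list s E b))"
    and "E' \<subseteq> {1..s} \<Longrightarrow> uv_list s E' b' \<noteq> uv_list s E b \<Longrightarrow> \<not> ltv s b' b \<Longrightarrow> uv_coeff f (uv_list s E' b') = 0"
    and "f \<in> uv_space s"
proof -
  obtain c g where f: "E \<subseteq> {1..s}" "is_sign c" "g \<in> uvs s (\<lambda>E' b'. ltv s b' b)" "f = c * uvm s E b + g"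
    using assms(1) unfolding lead_def by blast
  obtain d :: 'k where d: "is_sign d" "c * uvm s E b = scale_ambient d (uvm s E b)"
  proof (cases "c = 1")
    case True
    then show ?thesis using that[of 1] by simp
  next
    case False
    then have "c = -1" using f(2) by (simp add: is_sign_def)
    then show ?thesis using that[of "-1"] by (simp add: is_sign_minus)
  qed
  have u: "uvm s E b \<in> uv_space s" by (rule uvs_uv_space[OF uvs_uvm[OF f(1), of "\<lambda>_ _. True"]]) simp
  have g: "g \<in> uv_space s" by (rule uvs_uv_space[OF f(3)])
  have su: "scale_ambient d (uvm s E b) \<in> uv_space s" using u by (simp add: uv_space_def amb.span_scale)
  have co: "uv_coeff f w = d * uv_coeff (uvm s E b) w + uv_coeff g w" if "length w = s" for w
    unfolding f(4) d(2) using that u g su by (simp add: uv_coeff_add uv_coeff_scale)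
  have gz: "uv_coeff g (uv_list s E' b') = 0" if "E' \<subseteq> {1..s}" "\<not> ltv s b' b" for E' b'
  proof (rule uv_coeff_uvs[OF f(3) that(1)])
    fix b'' assume "\<And>k. k \<in> {1..s} \<Longrightarrow> b'' k = b' k"
    then have "ltv s b'' b = ltv s b' b" by (intro ltv_cong) auto
    then show "\<not> ltv s b'' b" using that(2) by simp
  qed
  show "f \<in> uv_space s" unfolding f(4) d(2) using su g by (simp add: uv_space_def amb.span_add)
  have "uv_coeff (uvm s E b) (uv_list s E b) = 1"
    using uv_coeff_monomial[of "uv_list s E b"] by (simp add: uv_monomial_uv_list[OF f(1)])
  then show "is_sign (uv_coeff f (uv_list s E b))"
    using d(1) gz[OF f(1) ltv_irrefl] by (simp add: co)
  show "E' \<subseteq> {1..s} \<Longrightarrow> uv_list s E' b' \<noteq> uv_list s E b \<Longrightarrow> \<not> ltv s b' b \<Longrightarrow> uv_coeff f (uv_list s E' b') = 0"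
  proof -
    assume a: "E' \<subseteq> {1..s}" "uv_list s E' b' \<noteq> uv_list s E b" "\<not> ltv s b' b"
    have "uv_coeff (uvm s E b) (uv_list s E' b') = 0"
      unfolding uv_monomial_uv_list[OF f(1), symmetric]
      by (rule uv_coeff_span[of _ "{uv_list s E b}"]) (use a in \<open>auto intro: amb.span_base\<close>)
    then show "uv_coeff f (uv_list s E' b') = 0" using gz[OF a(1,3)] by (simp add: co)
  qed
qed

end

subsection \<open>Sequences of excess at least $n$ and leading monomials\<close>

text \<open>Counted from 0, so that j in this set corresponds to \<Theta>_j and hence to the leading
  factor u_{j+1}.\<close>

definition seq_J :: "(bool \<times> nat) list \<Rightarrow> nat set" where
  "seq_J I = {j. j < length I \<and> fst (I ! j)}"

definition seq_v :: "nat \<Rightarrow> (bool \<times> nat) list \<Rightarrow> nat \<Rightarrow> int" where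
  "seq_v p I k = (int p - 1) * int (snd (I ! (k - 1))) - of_bool (fst (I ! (k - 1)))"

text \<open>The exponent of q_{s,i}. For i \<ge> 1 it is the slack in an admissibility inequality;
  for i = 0 it turns e(I) \<ge> n into 2 a_0 \<ge> n + |J|. On admissible sequences of nonnegative
  excess \<open>nat\<close> truncates nothing, and the division by 2 is exact by
  \<open>excess_sums\<close>.\<close>

definition seq_a :: "nat \<Rightarrow> (bool \<times> nat) list \<Rightarrow> nat \<Rightarrow> nat" where
  "seq_a p I i = (if i = 0 then nat ((excess p I + int (card (seq_J I))) div 2)
     else nat (int p * int (snd (I ! i)) - of_bool (fst (I ! i)) - int (snd (I ! (i - 1)))))"

text \<open>The inverse direction: the value i_{k+1} for which (p-1) i_{k+1} - \<epsilon>_{k+1} is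
  the leading exponent of v_{k+1}; see \<open>bel_lead_Suc\<close>. It is an integer at first, and
  \<open>seq_of_lower\<close> shows when it is an index.\<close>

definition seq_of :: "nat \<Rightarrow> nat \<Rightarrow> (nat \<Rightarrow> nat) \<Rightarrow> nat set \<Rightarrow> nat \<Rightarrow> int" where
  "seq_of p s a J k = (\<Sum>i<s. int (a i) * (int p ^ (s - 1 - k) - (if k < i then int p ^ (i - 1 - k) else 0)))
     - (\<Sum>j\<in>J. if k < j then int p ^ (j - 1 - k) else 0)"

lemma bel_lead_Suc:
  assumes "J \<subseteq> {..<s}" "k < s" "p > 0"
  shows "bel_lead p s a J (Suc k) = (int p - 1) * seq_of p s a J k - of_bool (k \<in> J)"
proof -
  have fin: "finite J" using assms finite_subset by blast
  have 1: "(\<Sum>i<s. int (a i) * lead_q p s i (Suc k)) =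
      (int p - 1) * (\<Sum>i<s. int (a i) * (int p ^ (s - 1 - k) - (if k < i then int p ^ (i - 1 - k) else 0)))"
    unfolding sum_distrib_left by (intro sum.cong) (auto simp: lead_q_def Suc_le_eq)
  have "(\<Sum>j\<in>J. - val_V p (Suc j) (Suc k)) =
      (\<Sum>j\<in>J. - (if j = k then 1 else 0) - (int p - 1) * (if k < j then int p ^ (j - 1 - k) else 0))"
    using assms(3) by (intro sum.cong) (auto simp: val_V_def val_q_def of_nat_diff)
  also have "\<dots> = - of_bool (k \<in> J) - (int p - 1) * (\<Sum>j\<in>J. if k < j then int p ^ (j - 1 - k) else 0)"
    using fin by (simp add: sum_subtractf sum_negf sum_distrib_left)
  finally show ?thesis unfolding bel_lead_def seq_of_def 1 by (simp add: algebra_simps)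
qed

text \<open>From index k to k - 1 the weights of a_i and of j in J are multiplied by p, except for i
  = k and j = k, where the new term p^0 enters. These two exceptions are the right-hand side, the
  slack in the admissibility inequality.\<close>

lemma seq_of_rec:
  assumes J: "J \<subseteq> {..<s}" and k: "1 \<le> k" "k < s"
  shows "int p * seq_of p s a J k - seq_of p s a J (k - 1) = int (a k) + of_bool (k \<in> J)"
proof -
  have fin: "finite J" using J finite_subset by blast
  have pw: "int p * int p ^ (i - 1 - k) = int p ^ (i - 1 - (k - 1))" if "k < i" for i
  proof -
    have "i - 1 - (k - 1) = Suc (i - 1 - k)" using k that by simp
    then show ?thesis by (simp only: power_Suc)
  qed
  have "int p * (\<Sum>i<s. int (a i) * (int p ^ (s - 1 - k) - (if k < i then int p ^ (i - 1 - k) else 0)))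
      - (\<Sum>i<s. int (a i) * (int p ^ (s - 1 - (k - 1)) - (if k - 1 < i then int p ^ (i - 1 - (k - 1)) else 0)))
      = (\<Sum>i<s. if i = k then int (a k) else 0)"
    unfolding sum_distrib_left sum_subtractf[symmetric]
  proof (rule sum.cong[OF refl])
    fix i assume "i \<in> {..<s}"
    consider "i < k" | "i = k" | "k < i" by linarith
    then show "int p * (int (a i) * (int p ^ (s - 1 - k) - (if k < i then int p ^ (i - 1 - k) else 0))) -
        int (a i) * (int p ^ (s - 1 - (k - 1)) - (if k - 1 < i then int p ^ (i - 1 - (k - 1)) else 0)) =
        (if i = k then int (a k) else 0)"
    proof cases
      case 1
      then show ?thesis using pw[OF k(2)] k by (simp add: algebra_simps)
    next
      case 2
      then show ?thesis using pw[OF k(2)] k by (simp add: algebra_simps)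
    next
      case 3
      have "int p * (int (a i) * (int p ^ (s - 1 - k) - int p ^ (i - 1 - k))) =
          int (a i) * (int p * int p ^ (s - 1 - k) - int p * int p ^ (i - 1 - k))"
        by (simp add: algebra_simps)
      then show ?thesis using pw[OF k(2)] pw[OF 3] 3 by simp
    qed
  qed
  moreover have "int p * (\<Sum>j\<in>J. if k < j then int p ^ (j - 1 - k) else 0)
      - (\<Sum>j\<in>J. if k - 1 < j then int p ^ (j - 1 - (k - 1)) else 0) = (\<Sum>j\<in>J. if j = k then - 1 else 0)"
    unfolding sum_distrib_left sum_subtractf[symmetric]
    by (intro sum.cong) (use pw k in \<open>auto\<close>)
  moreover have "(\<Sum>i<s. if i = k then int (a k) else 0) = int (a k)" using k by simp
  moreover have "(\<Sum>j\<in>J. if j = k then - 1 else 0) = - (of_bool (k \<in> J) :: int)" using fin by simp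
  ultimately show ?thesis unfolding seq_of_def right_diff_distrib by linarith
qed

lemma seq_of_top:
  assumes "J \<subseteq> {..<s}" "s \<ge> 1"
  shows "seq_of p s a J (s - 1) = (\<Sum>i<s. int (a i))"
proof -
  have "(\<Sum>j\<in>J. if s - 1 < j then int p ^ (j - 1 - (s - 1)) else 0) = 0"
    using assms by (intro sum.neutral) auto
  moreover have "(\<Sum>i<s. int (a i) * (int p ^ (s - 1 - (s - 1)) - (if s - 1 < i then int p ^ (i - 1 - (s - 1)) else 0))) =
      (\<Sum>i<s. int (a i))"
    by (intro sum.cong) auto
  ultimately show ?thesis unfolding seq_of_def by linarith
qed

lemma telescope:
  fixes f e :: "nat \<Rightarrow> int"
  assumes "s \<ge> 1"
  shows "(\<Sum>k=1..<s. q * f k - e k - f (k - 1)) =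
    (q - 1) * (\<Sum>k=1..<s. f k) + f (s - 1) - f 0 - (\<Sum>k=1..<s. e k)"
  using assms
proof (induction s rule: nat_induct_at_least)
  case (Suc n)
  then show ?case by (simp add: algebra_simps)
qed simp

lemma sum_lessThan_1: "s \<ge> 1 \<Longrightarrow> (\<Sum>i<s. f i) = f 0 + (\<Sum>k=1..<s. f k :: int)" for s :: nat
  by (simp add: lessThan_atLeast0 sum.atLeast_Suc_lessThan)

text \<open>Adding the number of Bocksteins cancels \<epsilon>_1 and doubles the other \<epsilon>_k,
  so the sum is even.\<close>

lemma excess_sums:
  assumes "length I = s" "s \<ge> 1"
  shows "excess p I + int (card (seq_J I)) =
    2 * (int (snd (I ! 0)) - (int p - 1) * (\<Sum>k=1..<s. int (snd (I ! k))) + (\<Sum>k=1..<s. of_bool (fst (I ! k))))"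
proof -
  obtain x xs where I: "I = x # xs" using assms by (cases I) auto
  have tl: "(\<Sum>(e, i)\<leftarrow>xs. f e i) = (\<Sum>k=1..<s. f (fst (I ! k)) (snd (I ! k)))" for f :: "bool \<Rightarrow> nat \<Rightarrow> int"
  proof -
    have "(\<Sum>(e, i)\<leftarrow>xs. f e i) = (\<Sum>k=0..<length xs. f (fst (xs ! k)) (snd (xs ! k)))"
      by (simp add: sum_list_sum_nth case_prod_beta)
    also have "\<dots> = (\<Sum>k=Suc 0..<Suc (length xs). f (fst (I ! k)) (snd (I ! k)))"
      by (subst sum.shift_bounds_Suc_ivl) (simp add: I)
    also have "Suc (length xs) = s" using assms I by simp
    finally show ?thesis by (simp only: One_nat_def)
  qed
  have "int (card (seq_J I)) = (\<Sum>k<s. of_bool (fst (I ! k)))"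
    using assms by (simp add: seq_J_def of_bool_def sum.If_cases Int_def lessThan_def)
  also have "\<dots> = of_bool (fst (I ! 0)) + (\<Sum>k=1..<s. of_bool (fst (I ! k)))"
    by (rule sum_lessThan_1[OF assms(2)])
  finally have J: "int (card (seq_J I)) = of_bool (fst (I ! 0)) + (\<Sum>k=1..<s. of_bool (fst (I ! k)))" .
  have "excess p I = 2 * int (snd (I ! 0)) - of_bool (fst (I ! 0))
      - (\<Sum>k=1..<s. 2 * (int p - 1) * int (snd (I ! k))) + (\<Sum>k=1..<s. of_bool (fst (I ! k)))"
    unfolding excess_def using tl[of "\<lambda>e i. 2 * (int p - 1) * int i"] tl[of "\<lambda>e i. of_bool e"] I by simp
  then show ?thesis unfolding J by (simp add: sum_distrib_left algebra_simps)
qed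

text \<open>Both sides satisfy the same recursion, so it suffices to compare them at the last index
  and descend. There the telescoping sum of the slacks together with a_0 leaves exactly i_s.\<close>

lemma seq_of_seq_a:
  assumes I: "I \<in> admissible_sequences p s n" and n: "n \<ge> 0" and k: "k < s"
  shows "seq_of p s (seq_a p I) (seq_J I) k = int (snd (I ! k))"
proof -
  have len: "length I = s" and adm: "admissible p I" and s: "s \<ge> 1" and ex: "excess p I \<ge> n"
    using I k by (auto simp: admissible_sequences_def)
  have J: "seq_J I \<subseteq> {..<s}" using len by (auto simp: seq_J_def)
  let ?f = "\<lambda>k. int (snd (I ! k))"
  let ?e = "\<lambda>k. of_bool (fst (I ! k)) :: int"
  have a: "int (seq_a p I i) = int p * ?f i - ?e i - ?f (i - 1)" if "1 \<le> i" "i < s" for i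
  proof -
    have "i - 1 + 1 < length I" using that len by simp
    then have "int p * ?f (i - 1 + 1) - ?e (i - 1 + 1) \<ge> ?f (i - 1)"
      using adm unfolding admissible_def by blast
    then show ?thesis using that by (simp add: seq_a_def)
  qed
  have a0: "int (seq_a p I 0) = ?f 0 - (int p - 1) * (\<Sum>k=1..<s. ?f k) + (\<Sum>k=1..<s. ?e k)"
    using excess_sums[OF len s, of p] ex n by (simp add: seq_a_def)
  have "(\<Sum>i<s. int (seq_a p I i)) = int (seq_a p I 0) + (\<Sum>i=1..<s. int (seq_a p I i))"
    by (rule sum_lessThan_1[OF s])
  also have "(\<Sum>i=1..<s. int (seq_a p I i)) = (\<Sum>i=1..<s. int p * ?f i - ?e i - ?f (i - 1))"
    by (intro sum.cong a) auto
  also have "\<dots> = (int p - 1) * (\<Sum>k=1..<s. ?f k) + ?f (s - 1) - ?f 0 - (\<Sum>k=1..<s. ?e k)"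
    by (rule telescope[OF s])
  finally have top: "seq_of p s (seq_a p I) (seq_J I) (s - 1) = ?f (s - 1)"
    unfolding seq_of_top[OF J s] a0 by simp
  have "k \<le> s - 1" using k by simp
  then show ?thesis
  proof (induction k rule: inc_induct)
    case base then show ?case by (rule top)
  next
    case (step m)
    have m: "1 \<le> Suc m" "Suc m < s" using step by auto
    have "(Suc m \<in> seq_J I) = fst (I ! Suc m)" using m len by (simp add: seq_J_def)
    then have "seq_of p s (seq_a p I) (seq_J I) m = int p * ?f (Suc m) - int (seq_a p I (Suc m)) - ?e (Suc m)"
      using seq_of_rec[OF J m, of p "seq_a p I"] step.IH by simp
    then show ?case using a[OF m] by simp
  qed
qed

text \<open>Even for J = {0, ..., s-1} the sum is geometric and stays below the next power of p. It
  bounds the negative part of \<open>seq_of\<close>.\<close>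

lemma geometric_bound:
  assumes J: "J \<subseteq> {..<s}" and k: "k < s" and p: "p \<ge> 2"
  shows "(\<Sum>j\<in>J. if k < j then int p ^ (j - 1 - k) else 0) < int p ^ (s - 1 - k)"
proof -
  have geo: "(\<Sum>i<m. int p ^ i) < int p ^ m" for m
  proof (induction m)
    case (Suc m)
    have "2 * int p ^ m \<le> int p * int p ^ m" using p by (intro mult_right_mono) auto
    then show ?case using Suc by simp
  qed simp
  have "(\<Sum>j\<in>J. if k < j then int p ^ (j - 1 - k) else 0) \<le> (\<Sum>j<s. if k < j then int p ^ (j - 1 - k) else 0)"
    using J by (intro sum_mono2) auto
  also have "\<dots> = (\<Sum>j\<in>{k<..<s}. int p ^ (j - 1 - k))"
    by (intro sum.mono_neutral_cong_right) auto
  also have "\<dots> = (\<Sum>i<s - 1 - k. int p ^ i)"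
    by (rule sum.reindex_bij_witness[of _ "\<lambda>i. i + 1 + k" "\<lambda>j. j - 1 - k"]) auto
  also have "\<dots> < int p ^ (s - 1 - k)" by (rule geo)
  finally show ?thesis .
qed

text \<open>If J is nonempty the inequality forces a_0 \<ge> 1, and the weight p^(s-1-k) of a_0
  alone outweighs the contribution of J. The resulting bound 1 is needed because no generator has
  \<epsilon> = 1 and i = 0.\<close>

lemma seq_of_lower:
  assumes J: "J \<subseteq> {..<s}" and k: "k < s" and p: "p \<ge> 2" and c: "int (card J) \<le> 2 * int (a 0)"
  shows "seq_of p s a J k \<ge> (if J = {} then 0 else 1)"
proof -
  have fin: "finite J" using J finite_subset by blast
  have pos: "int p ^ (s - 1 - k) - (if k < i then int p ^ (i - 1 - k) else 0) \<ge> 0" if "i < s" for i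
    using that p by (auto intro!: power_increasing)
  have "int (a 0) * int p ^ (s - 1 - k) = (\<Sum>i\<in>{0}. int (a i) * (int p ^ (s - 1 - k) - (if k < i then int p ^ (i - 1 - k) else 0)))"
    by simp
  also have "\<dots> \<le> (\<Sum>i<s. int (a i) * (int p ^ (s - 1 - k) - (if k < i then int p ^ (i - 1 - k) else 0)))"
    by (rule sum_mono2) (use k pos in \<open>auto intro!: mult_nonneg_nonneg\<close>)
  finally have le: "int (a 0) * int p ^ (s - 1 - k) \<le> \<dots>" .
  show ?thesis
  proof (cases "J = {}")
    case True
    have "0 \<le> int (a 0) * int p ^ (s - 1 - k)" by simp
    from order_trans[OF this le] True show ?thesis by (simp add: seq_of_def)
  next
    case False
    then have "card J > 0" using fin by (simp add: card_gt_0_iff)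
    then have "int (a 0) \<ge> 1" using c by linarith
    then have "1 * int p ^ (s - 1 - k) \<le> int (a 0) * int p ^ (s - 1 - k)" by (intro mult_right_mono) auto
    with le geometric_bound[OF J k p] False show ?thesis unfolding seq_of_def by simp
  qed
qed

text \<open>The sequence is read off from \<open>seq_of\<close>. Admissibility is the nonnegativity
  of the a_k in the recursion, and telescoping identifies e(I) + |J| with 2 a_0.\<close>

lemma seq_exists:
  assumes J: "J \<subseteq> {..<s}" and p: "p \<ge> 2" and n: "n \<ge> 0" and c: "int (card J) + n \<le> 2 * int (a 0)"
  shows "\<exists>I \<in> admissible_sequences p s n. seq_J I = J \<and> (\<forall>i<s. seq_a p I i = a i)"
proof (cases "s = 0")
  case True
  then show ?thesis using J
    by (intro bexI[of _ "[]"]) (auto simp: admissible_sequences_def seq_J_def lambda_sequence_def admissible_def)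
next
  case False
  then have s: "s \<ge> 1" by simp
  let ?g = "seq_of p s a J"
  let ?I = "map (\<lambda>k. (k \<in> J, nat (?g k))) [0..<s]"
  have low: "?g k \<ge> (if J = {} then 0 else 1)" if "k < s" for k
    by (rule seq_of_lower[OF J that p]) (use n c in simp)
  then have g0: "?g k \<ge> 0" if "k < s" for k using that by (fastforce split: if_splits)
  have nth: "?I ! k = (k \<in> J, nat (?g k))" if "k < s" for k using that by simp
  have len: "length ?I = s" by simp
  have lam: "lambda_sequence ?I"
    unfolding lambda_sequence_def using low by (fastforce split: if_splits)
  have rec: "int p * ?g k - of_bool (k \<in> J) - ?g (k - 1) = int (a k)" if "1 \<le> k" "k < s" for k
    using seq_of_rec[OF J that, of p a] by simp
  have adm: "admissible p ?I"
    unfolding admissible_def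
  proof (intro allI impI)
    fix k assume "k + 1 < length ?I"
    then have k: "k + 1 < s" by simp
    then show "int p * int (snd (?I ! (k + 1))) - of_bool (fst (?I ! (k + 1))) \<ge> int (snd (?I ! k))"
      using rec[of "k + 1"] g0[of k] g0[of "k + 1"] by simp
  qed
  have JI: "seq_J ?I = J" using J by (auto simp: seq_J_def)
  have a: "seq_a p ?I k = a k" if "1 \<le> k" "k < s" for k
    using that rec[OF that] g0[of k] g0[of "k - 1"] by (simp add: seq_a_def)
  have sums: "(\<Sum>k=1..<s. int (snd (?I ! k))) = (\<Sum>k=1..<s. ?g k)"
     "(\<Sum>k=1..<s. of_bool (fst (?I ! k))) = (\<Sum>k=1..<s. of_bool (k \<in> J) :: int)"
     "int (snd (?I ! 0)) = ?g 0"
    using g0 s by (auto intro!: sum.cong)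
  have "excess p ?I + int (card (seq_J ?I)) =
     2 * (?g 0 - (int p - 1) * (\<Sum>k=1..<s. ?g k) + (\<Sum>k=1..<s. of_bool (k \<in> J)))"
    unfolding excess_sums[OF len s] sums ..
  also have "?g 0 - (int p - 1) * (\<Sum>k=1..<s. ?g k) + (\<Sum>k=1..<s. of_bool (k \<in> J)) = int (a 0)"
  proof -
    have "(\<Sum>k=1..<s. int (a k)) = (\<Sum>k=1..<s. int p * ?g k - of_bool (k \<in> J) - ?g (k - 1))"
      by (intro sum.cong rec[symmetric]) auto
    also have "\<dots> = (int p - 1) * (\<Sum>k=1..<s. ?g k) + ?g (s - 1) - ?g 0 - (\<Sum>k=1..<s. of_bool (k \<in> J))"
      by (rule telescope[OF s])
    finally show ?thesis using seq_of_top[OF J s, of p a] sum_lessThan_1[OF s, of "\<lambda>i. int (a i)"] by simp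
  qed
  finally have ex: "excess p ?I + int (card (seq_J ?I)) = 2 * int (a 0)" .
  then have "seq_a p ?I 0 = a 0" by (simp add: seq_a_def)
  then have "seq_a p ?I i = a i" if "i < s" for i using a that by (cases "i = 0") auto
  moreover have "excess p ?I \<ge> n" using ex c unfolding JI by simp
  ultimately show ?thesis
    using lam adm len JI by (intro bexI[of _ ?I]) (auto simp: admissible_sequences_def)
qed

lemma seq_card_le:
  assumes "I \<in> admissible_sequences p s n" "n \<ge> 0" "s \<ge> 1"
  shows "seq_J I \<subseteq> {..<s}" "int (card (seq_J I)) + n \<le> 2 * int (seq_a p I 0)"
proof -
  have len: "length I = s" and ex: "excess p I \<ge> n" using assms by (auto simp: admissible_sequences_def)
  show "seq_J I \<subseteq> {..<s}" using len by (auto simp: seq_J_def)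
  show "int (card (seq_J I)) + n \<le> 2 * int (seq_a p I 0)"
    using excess_sums[OF len assms(3), of p] ex assms(2) by (simp add: seq_a_def)
qed

section \<open>The basis element attached to an admissible sequence\<close>

definition seq_bel :: "nat \<Rightarrow> (bool \<times> nat) list \<Rightarrow> 'k::field ambient" where
  "seq_bel p I = bel (length I) (seq_a p I) (seq_J I)"

definition bel_set :: "nat \<Rightarrow> int \<Rightarrow> 'k::field ambient set" where
  "bel_set s n = {bel s a J | a J. J \<subseteq> {..<s} \<and> int (card J) + n \<le> 2 * int (a 0)}"

lemma bel_cong: "(\<And>i. i < s \<Longrightarrow> a i = a' i) \<Longrightarrow> bel s a J = (bel s a' J :: 'a::field ambient)"
proof -
  assume "\<And>i. i < s \<Longrightarrow> a i = a' i"
  then have "(\<Prod>i<s. dQ s i ^ a i) = (\<Prod>i<s. dQ s i ^ a' i :: 'a ratfun)" by (intro prod.cong) auto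
  then show ?thesis unfolding bel_def by (simp only:)
qed

definition seq_monomial :: "nat \<Rightarrow> (bool \<times> nat) list \<Rightarrow> (bool \<times> int) list" where
  "seq_monomial p I = map (\<lambda>(e, i). (e, (int p - 1) * int i - of_bool e)) I"

text \<open>The degree of the dual monomial; by \<open>seq_deg_alt\<close> it is the degree of
  \<lambda>_I.\<close>

definition seq_deg :: "nat \<Rightarrow> (bool \<times> nat) list \<Rightarrow> int" where
  "seq_deg p I = udeg (length I) (Suc ` seq_J I) (seq_v p I)"

lemma Suc_seq_J: "Suc ` seq_J I \<subseteq> {1..length I}"
  by (auto simp: seq_J_def)

lemma seq_monomial_eq: "seq_monomial p I = uv_list (length I) (Suc ` seq_J I) (seq_v p I)"
  by (rule nth_equalityI)
    (auto simp: seq_monomial_def uv_list_def seq_J_def seq_v_def case_prod_beta nth_append simp del: upt_Suc)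

lemma seq_monomial_inj:
  assumes "p \<ge> 2" "seq_monomial p I = seq_monomial p I'"
  shows "I = I'"
proof (rule nth_equalityI)
  show len: "length I = length I'" using arg_cong[OF assms(2), of length] by (simp add: seq_monomial_def)
  fix k assume k: "k < length I"
  then have "seq_monomial p I ! k = seq_monomial p I' ! k" using assms(2) by simp
  then show "I ! k = I' ! k"
    using k len assms(1) by (auto simp: seq_monomial_def case_prod_beta prod_eq_iff)
qed

context odd_prime_field
begin

lemma seq_bel_in: "I \<in> admissible_sequences CARD('k) s n \<Longrightarrow> n \<ge> 0 \<Longrightarrow> (seq_bel CARD('k) I :: 'k ambient) \<in> bel_set s n"
proof (cases "s \<ge> 1")
  case True
  assume I: "I \<in> admissible_sequences CARD('k) s n" "n \<ge> 0"
  then have "length I = s" by (simp add: admissible_sequences_def)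
  then show ?thesis using seq_card_le[OF I True] unfolding seq_bel_def bel_set_def by blast
next
  case False
  assume I: "I \<in> admissible_sequences CARD('k) s n" "n \<ge> 0"
  then have "length I = 0" "s = 0" using False by (auto simp: admissible_sequences_def)
  then have "I = []" "s = 0" by auto
  \<comment> \<open>For s = 0 the exponent a_0 does not occur in the element, so it may be chosen to
    satisfy the inequality in \<open>bel_set\<close>.\<close>
  moreover have "bel 0 a {} = (bel 0 (\<lambda>i. nat n) {} :: 'k ambient)" for a by (rule bel_cong) simp
  ultimately show ?thesis using I(2) unfolding seq_bel_def bel_set_def
    by (auto simp: seq_J_def intro!: exI[of _ "\<lambda>i. nat n"] exI[of _ "{}"])
qed

lemma bel_set_eq:
  assumes "n \<ge> 0"
  shows "bel_set s n = (seq_bel CARD('k) ` admissible_sequences CARD('k) s n :: 'k ambient set)"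
proof
  show "(seq_bel CARD('k) ` admissible_sequences CARD('k) s n :: 'k ambient set) \<subseteq> bel_set s n"
    using seq_bel_in assms by blast
  show "bel_set s n \<subseteq> (seq_bel CARD('k) ` admissible_sequences CARD('k) s n :: 'k ambient set)"
  proof
    fix x :: "'k ambient" assume "x \<in> bel_set s n"
    then obtain a J where x: "x = bel s a J" "J \<subseteq> {..<s}" "int (card J) + n \<le> 2 * int (a 0)"
      unfolding bel_set_def by blast
    obtain I where I: "I \<in> admissible_sequences CARD('k) s n" "seq_J I = J" "\<forall>i<s. seq_a CARD('k) I i = a i"
      using seq_exists[of J s "CARD('k)" n a] x assms card_ge_3 by auto
    then have "length I = s" by (simp add: admissible_sequences_def)
    then have "x = seq_bel CARD('k) I"
      unfolding x(1) seq_bel_def using I(2,3) bel_cong[of s a "seq_a CARD('k) I" J] by simp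
    then show "x \<in> seq_bel CARD('k) ` admissible_sequences CARD('k) s n" using I(1) by blast
  qed
qed

lemma lead_seq_bel:
  assumes I: "I \<in> admissible_sequences CARD('k) s n" "n \<ge> 0"
  shows "lead s (seq_bel CARD('k) I) (Suc ` seq_J I) (seq_v CARD('k) I)"
proof -
  have len: "length I = s" using I by (simp add: admissible_sequences_def)
  have J: "seq_J I \<subseteq> {..<s}" using len by (auto simp: seq_J_def)
  show ?thesis
    unfolding seq_bel_def len
  proof (rule lead_cong[OF lead_bel[OF J]])
    fix k assume "k \<in> {1..s}"
    then obtain j where k: "k = Suc j" "j < s" by (cases k) auto
    show "bel_lead CARD('k) s (seq_a CARD('k) I) (seq_J I) k = seq_v CARD('k) I k"
      unfolding k(1) bel_lead_Suc[OF J k(2) card_gt_0] seq_of_seq_a[OF I k(2)]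
      using k(2) len by (simp add: seq_v_def seq_J_def)
  qed
qed

lemma nu_uv_coeff: "nu f I = (-1) ^ ((\<Sum>(e, i)\<leftarrow>I. i) + card {(l, k). l < k \<and> k < length I \<and> fst (I ! l) \<and> fst (I ! k)}) *
     (uv_coeff f (seq_monomial CARD('k) I) :: 'k)"
  by (simp add: nu_def uv_coeff_def seq_monomial_def)

lemma length_seq_monomial [simp]: "length (seq_monomial q I) = length I"
  by (simp add: seq_monomial_def)

lemma nu_add: "f \<in> uv_space (length I) \<Longrightarrow> g \<in> uv_space (length I) \<Longrightarrow> nu (f + g) I = nu f I + (nu g I :: 'k)"
  by (simp add: nu_uv_coeff uv_coeff_add distrib_left)

lemma nu_scale: "f \<in> uv_space (length I) \<Longrightarrow> nu (scale_ambient c f) I = c * (nu f I :: 'k)"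
  by (simp add: nu_uv_coeff uv_coeff_scale mult.left_commute)

lemma nu_seq_bel_diag:
  assumes I: "I \<in> admissible_sequences CARD('k) s n" "n \<ge> 0"
  shows "nu (seq_bel CARD('k) I) I \<noteq> (0 :: 'k)"
proof -
  have "length I = s" using I by (simp add: admissible_sequences_def)
  then have "is_sign (uv_coeff (seq_bel CARD('k) I) (seq_monomial CARD('k) I) :: 'k)"
    using uv_coeff_lead(1)[OF lead_seq_bel[OF I]] by (simp add: seq_monomial_eq)
  then show ?thesis unfolding nu_uv_coeff by (auto dest: is_sign_nz)
qed

text \<open>A nonzero entry means that the monomial of I occurs in b_I'. It is then the leading
  monomial or smaller, and it has the degree of the homogeneous element b_I'.\<close>

lemma nu_seq_bel_lower:
  assumes I: "I' \<in> admissible_sequences CARD('k) s n" "n \<ge> 0" and len: "length I = s"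
    and nz: "nu (seq_bel CARD('k) I') I \<noteq> (0 :: 'k)"
  shows "I = I' \<or> ltv s (seq_v CARD('k) I) (seq_v CARD('k) I')" and "seq_deg CARD('k) I = seq_deg CARD('k) I'"
proof -
  have len': "length I' = s" using I by (simp add: admissible_sequences_def)
  have nz': "uv_coeff (seq_bel CARD('k) I') (seq_monomial CARD('k) I) \<noteq> 0" using nz by (simp add: nu_uv_coeff)
  show "I = I' \<or> ltv s (seq_v CARD('k) I) (seq_v CARD('k) I')"
  proof (rule ccontr)
    assume "\<not> ?thesis"
    then have "seq_monomial CARD('k) I \<noteq> seq_monomial CARD('k) I'" "\<not> ltv s (seq_v CARD('k) I) (seq_v CARD('k) I')"
      using seq_monomial_inj[of "CARD('k)" I I'] card_ge_3 by auto
    then have "uv_coeff (seq_bel CARD('k) I') (seq_monomial CARD('k) I) = 0"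
      using uv_coeff_lead(2)[OF lead_seq_bel[OF I], of "Suc ` seq_J I" "seq_v CARD('k) I"] Suc_seq_J[of I] len len'
      by (simp add: seq_monomial_eq)
    with nz' show False by contradiction
  qed
  obtain d where d: "seq_bel CARD('k) I' \<in> homog s d"
    unfolding seq_bel_def len' using homog_bel[of "seq_J I'" s] len' by (auto simp: seq_J_def)
  have "udeg s (Suc ` seq_J I) (seq_v CARD('k) I) = d"
    using uv_coeff_homog[OF d, of "Suc ` seq_J I" "seq_v CARD('k) I"] nz' Suc_seq_J[of I] len by (auto simp: seq_monomial_eq)
  moreover have "udeg s (Suc ` seq_J I') (seq_v CARD('k) I') = d"
    using uv_coeff_homog[OF d, of "Suc ` seq_J I'" "seq_v CARD('k) I'"] nu_seq_bel_diag[OF I] Suc_seq_J[of I'] len'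
    by (auto simp: seq_monomial_eq nu_uv_coeff)
  ultimately show "seq_deg CARD('k) I = seq_deg CARD('k) I'" by (simp add: seq_deg_def len len')
qed

lemma seq_bel_uv_space: "I \<in> admissible_sequences CARD('k) s n \<Longrightarrow> n \<ge> 0 \<Longrightarrow> seq_bel CARD('k) I \<in> uv_space s"
  by (rule uv_coeff_lead(3)[OF lead_seq_bel])

end

subsection \<open>The Dickson modules in terms of the basis elements\<close>

text \<open>Both families of generators under one name; the flag is later tied to the parity of the
  degree N of the element that is acted on.\<close>

definition B_gen :: "bool \<Rightarrow> nat \<Rightarrow> nat set \<Rightarrow> 'k::field ambient" where
  "B_gen odd_degree s J = (if odd_degree
     then (if J = {} then ext_const (mui_L s ^ ((CARD('k) - 1) div 2))
       else mui_M s J * ext_const (mui_L s ^ ((CARD('k) - 3) div 2 + (CARD('k) - 1) * (card J div 2))))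
     else (if J = {} then 1 else mui_M s J *
       ext_const (mui_L s ^ (CARD('k) - 2 + (CARD('k) - 1) * ((card J - 1) div 2)))))"

definition B_mod :: "bool \<Rightarrow> nat \<Rightarrow> 'k::field ambient set" where
  "B_mod odd_degree s = Dickson_span s (B_gen odd_degree s)"

lemma B_even_eq: "B_even s = B_mod False s" and B_odd_eq: "B_odd s = B_mod True s"
  by (simp_all add: B_even_def B_odd_def B_mod_def B_gen_def[abs_def])

definition dmono :: "nat \<Rightarrow> (nat \<Rightarrow> nat) \<Rightarrow> 'k::field ratfun" where
  "dmono s a = (\<Prod>i<s. dQ s i ^ a i)"

lemma dmono_mult: "dmono s (\<lambda>i. a i + b i) = dmono s a * dmono s b"
  by (simp add: dmono_def power_add prod.distrib)

lemma dmono_0: "dmono s (\<lambda>i. 0) = 1"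
  by (simp add: dmono_def)

lemma dmono_single: "i < s \<Longrightarrow> dmono s (\<lambda>j. if j = i then n else 0) = dQ s i ^ n"
  by (simp add: dmono_def if_distrib[of "\<lambda>n. dQ s _ ^ n"] cong: if_cong)

context odd_prime_field
begin

lemma Dickson_span_dmono:
  assumes "f \<in> Dickson s"
  shows "ext_const f \<in> amb.span (range (\<lambda>a. ext_const (dmono s a)) :: 'k ambient set)"
  using assms
proof (induction rule: Dickson.induct)
  case (const c)
  have "ext_const (rconst c) = scale_ambient c (ext_const (dmono s (\<lambda>i. 0)))"
    by (simp add: scale_ambient_def dmono_0)
  then show ?case by (simp add: amb.span_scale amb.span_base)
next
  case (q i)
  have "ext_const (dickson_q s i) = (ext_const (dmono s (\<lambda>j. if j = i then 1 else 0)) :: 'k ambient)"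
    using dmono_single[OF q, of 1, where 'a = 'k] q by (simp add: dickson_q_eq)
  then show ?case by (metis amb.span_base rangeI)
next
  case (add f g)
  then show ?case by (simp add: ext_const_add amb.span_add)
next
  case (mult f g)
  show ?case
    unfolding ext_const_mult
  proof (rule amb_span_mult[OF _ mult.IH])
    fix x y :: "'k ambient"
    assume "x \<in> range (\<lambda>a. ext_const (dmono s a))" "y \<in> range (\<lambda>a. ext_const (dmono s a))"
    then obtain a b where "x = ext_const (dmono s a)" "y = ext_const (dmono s b)" by blast
    then have "x * y = ext_const (dmono s (\<lambda>i. a i + b i))" by (simp add: dmono_mult ext_const_mult)
    then show "x * y \<in> amb.span (range (\<lambda>a. ext_const (dmono s a)))"
      by (auto intro!: amb.span_base)
  qed
qed

lemma Dickson_power: "f \<in> Dickson s \<Longrightarrow> f ^ n \<in> (Dickson s :: 'k ratfun set)"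
  using Dickson.const[of "1 :: 'k" s] by (induction n) (auto intro: Dickson.mult)

lemma dmono_Dickson: "dmono s a \<in> (Dickson s :: 'k ratfun set)"
proof -
  have "(\<Prod>i\<in>I. dQ s i ^ a i) \<in> (Dickson s :: 'k ratfun set)" if "I \<subseteq> {..<s}" "finite I" for I
    using that(2,1)
  proof induction
    case empty
    show ?case using Dickson.const[of "1 :: 'k" s] by simp
  next
    case (insert i I)
    then have "dickson_q s i \<in> (Dickson s :: 'k ratfun set)" by (intro Dickson.q) simp
    then have "dQ s i \<in> (Dickson s :: 'k ratfun set)" using insert.prems by (simp add: dickson_q_eq)
    then show ?case using insert by (simp add: Dickson.mult Dickson_power)
  qed
  then show ?thesis unfolding dmono_def by simp
qed

lemma half_card: obtains h where "CARD('k) = 2 * h + 1" "h \<ge> 1" "(CARD('k) - 1) div 2 = h"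
proof -
  obtain h where h: "CARD('k) = 2 * h + 1" using odd_card by (elim oddE)
  then show ?thesis using that[of h] card_ge_3 by simp
qed

text \<open>The peculiar exponents of L_s are chosen for this identity: with the one factor L_s
  hidden in M_{s;J} and the power L_s^((p-1)N/2) from St_s, the total is p - 1 times the least
  integer c with 2c \<ge> N + |J|. As q_{s,0} = L_s^(p-1), this is the origin of the bound on
  a_0.\<close>

lemma B_gen_form:
  assumes J: "J \<subseteq> {..<s}" and e: "e = odd N"
  shows "\<exists>m. B_gen e s J = (if J = {} then 1 else mui_M s J) * (ext_const (dL s ^ m) :: 'k ambient) \<and>
    of_bool (J \<noteq> {}) + m + (CARD('k) - 1) div 2 * N = (CARD('k) - 1) * ((N + card J + 1) div 2)"
proof -
  obtain h where h: "CARD('k) = 2 * h + 1" "h \<ge> 1" "(CARD('k) - 1) div 2 = h" by (rule half_card)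
  have h': "CARD('k) - 1 = 2 * h" "(CARD('k) - 3) div 2 = h - 1" using h by auto
  show ?thesis
  proof (cases "J = {}")
    case True
    show ?thesis
    proof (cases "odd N")
      case True
      then have "h + h * N = 2 * h * ((N + 1) div 2)" by (elim oddE) (simp add: algebra_simps)
      then show ?thesis using True \<open>J = {}\<close> e h(3) h'
        by (intro exI[of _ h]) (simp add: B_gen_def mui_L_eq)
    next
      case False
      then obtain t where t: "N = 2 * t" by (auto elim!: evenE)
      then have "h * N = 2 * h * ((N + 1) div 2)" by simp
      then show ?thesis using False \<open>J = {}\<close> e h(3) h'
        by (intro exI[of _ 0]) (simp add: B_gen_def)
    qed
  next
    case False
    have fin: "finite J" using J finite_subset by blast
    then have k: "card J \<ge> 1" using False by (simp add: Suc_le_eq card_gt_0_iff)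
    show ?thesis
    proof (cases "odd N")
      case True
      obtain t where t: "N = 2 * t + 1" using True by (elim oddE)
      have c: "(N + card J + 1) div 2 = t + 1 + card J div 2" using t by simp
      have "1 + (h - 1 + 2 * h * (card J div 2)) + h * N = 2 * h * ((N + card J + 1) div 2)"
        unfolding c using h(2) t by (simp add: algebra_simps)
      then show ?thesis
        using True False e h(3) h' by (intro exI[of _ "h - 1 + 2 * h * (card J div 2)"]) (simp add: B_gen_def mui_L_eq)
    next
      case even: False
      then obtain t where t: "N = 2 * t" by (auto elim!: evenE)
      have c: "(N + card J + 1) div 2 = t + 1 + (card J - 1) div 2" using t k by simp
      have "1 + (CARD('k) - 2 + 2 * h * ((card J - 1) div 2)) + h * N = 2 * h * ((N + card J + 1) div 2)"
        unfolding c using h(1,2) t by (simp add: algebra_simps)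
      then show ?thesis
        using even False e h(3) h'
        by (intro exI[of _ "CARD('k) - 2 + 2 * h * ((card J - 1) div 2)"]) (simp add: B_gen_def mui_L_eq)
    qed
  qed
qed

lemma B_gen_eq:
  assumes J: "J \<subseteq> {..<s}" and e: "e = odd N"
  shows "\<exists>c. is_sign c \<and> B_gen e s J * ext_const (dL s ^ ((CARD('k) - 1) div 2 * N)) =
    c * (anticommuting.oprod (Theta s) J * (ext_const (dQ s 0 ^ ((N + card J + 1) div 2)) :: 'k ambient))"
proof -
  interpret anticommuting "Theta s :: nat \<Rightarrow> 'k ambient" by (rule Theta_anticommuting)
  let ?h = "(CARD('k) - 1) div 2"
  let ?c = "(N + card J + 1) div 2"
  have dQ0: "dQ s 0 ^ n = (dL s :: 'k ratfun) ^ ((CARD('k) - 1) * n)" for n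
    by (simp add: dQ_bottom power_mult)
  obtain m where m: "B_gen e s J = (if J = {} then 1 else mui_M s J) * (ext_const (dL s ^ m) :: 'k ambient)"
    "of_bool (J \<noteq> {}) + m + ?h * N = (CARD('k) - 1) * ?c"
    using B_gen_form[OF J e] by blast
  have split: "ext_const (dL s ^ of_bool (J \<noteq> {})) * (ext_const (dL s ^ m) * ext_const (dL s ^ (?h * N))) =
      (ext_const (dQ s 0 ^ ?c) :: 'k ambient)"
    unfolding dQ0 m(2)[symmetric] power_add ext_const_mult mult.assoc ..
  show ?thesis
  proof (cases "J = {}")
    case True
    then have "B_gen e s J * ext_const (dL s ^ (?h * N)) = (ext_const (dQ s 0 ^ ?c) :: 'k ambient)"
      using split m(1) by simp
    then show ?thesis using True by (intro exI[of _ 1]) simp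
  next
    case False
    obtain c where c: "is_sign c" "mui_M s J = c * (ext_const (dL s) * (oprod J :: 'k ambient))"
      using mui_M_eq[OF J] by blast
    have "B_gen e s J * ext_const (dL s ^ (?h * N)) =
        c * (oprod J * (ext_const (dL s) * (ext_const (dL s ^ m) * ext_const (dL s ^ (?h * N)))))"
      unfolding m(1) if_not_P[OF False] c(2) by (simp only: mult.assoc ext_const_left_comm[of "oprod J"])
    also have "ext_const (dL s) * (ext_const (dL s ^ m) * ext_const (dL s ^ (?h * N))) =
        (ext_const (dQ s 0 ^ ?c) :: 'k ambient)"
      using split False by simp
    finally show ?thesis using c(1) by blast
  qed
qed

text \<open>Absorbs a power of q_{s,0} into the exponents. For s = 0 there is no such exponent and
  q_{0,0} = 1, so a' 0 may take any prescribed value b.\<close>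

lemma dmono_dQ0:
  assumes "J \<subseteq> {..<s}"
  shows "\<exists>a'. dmono s a' = dmono s a * (dQ s 0 :: 'k ratfun) ^ c \<and> (s \<ge> 1 \<longrightarrow> a' 0 = a 0 + c) \<and> (s = 0 \<longrightarrow> a' 0 = b)"
proof (cases "s \<ge> 1")
  case True
  have "dmono s (\<lambda>i. a i + (if i = 0 then c else 0)) = dmono s a * (dQ s 0 :: 'k ratfun) ^ c"
    unfolding dmono_mult using dmono_single[of 0 s c, where 'a = 'k] True by simp
  then show ?thesis using True by (intro exI[of _ "\<lambda>i. a i + (if i = 0 then c else 0)"]) auto
next
  case False
  then have "s = 0" by simp
  then show ?thesis by (intro exI[of _ "\<lambda>i. b"]) (simp add: dmono_def)
qed

text \<open>Each generator times the power of L_s is \<Theta>_J q_{s,0}^c up to sign with 2c \<ge> N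
  + |J|. Dickson coefficients can only raise the exponent of q_{s,0}, so the bound persists.\<close>

lemma B_mod_bel_span:
  assumes f: "f \<in> B_mod e s" and e: "e = odd N"
  shows "f * ext_const (dL s ^ ((CARD('k) - 1) div 2 * N)) \<in> amb.span (bel_set s (int N) :: 'k ambient set)"
proof -
  interpret anticommuting "Theta s :: nat \<Rightarrow> 'k ambient" by (rule Theta_anticommuting)
  obtain d where d: "f = (\<Sum>J\<in>Pow {..<s}. ext_const (d J) * B_gen e s J)" "\<And>J. d J \<in> Dickson s"
    using f unfolding B_mod_def Dickson_span_def by blast
  let ?L = "ext_const (dL s ^ ((CARD('k) - 1) div 2 * N)) :: 'k ambient"
  have "ext_const (d J) * (B_gen e s J * ?L) \<in> amb.span (bel_set s (int N))" if "J \<in> Pow {..<s}" for J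
  proof -
    have J: "J \<subseteq> {..<s}" using that by simp
    let ?c = "(N + card J + 1) div 2"
    obtain c where c: "is_sign c" "B_gen e s J * ?L = c * (oprod J * ext_const (dQ s 0 ^ ?c))"
      using B_gen_eq[OF J e] by blast
    have "ext_const (d J) * (oprod J * ext_const (dQ s 0 ^ ?c)) \<in> amb.span (bel_set s (int N))"
    proof (rule amb_span_mult[OF _ Dickson_span_dmono[OF d(2)[of J]], of "{oprod J * ext_const (dQ s 0 ^ ?c)}"])
      fix x y :: "'k ambient"
      assume "x \<in> range (\<lambda>a. ext_const (dmono s a))" "y \<in> {oprod J * ext_const (dQ s 0 ^ ?c)}"
      then obtain a where a: "x = ext_const (dmono s a)" "y = oprod J * ext_const (dQ s 0 ^ ?c)" by blast
      obtain a' where a': "dmono s a' = dmono s a * (dQ s 0 :: 'k ratfun) ^ ?c" "s \<ge> 1 \<longrightarrow> a' 0 = a 0 + ?c" "s = 0 \<longrightarrow> a' 0 = N"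
        using dmono_dQ0[OF J, of a ?c N] by blast
      have "x * y = bel s a' J"
        unfolding bel_def dmono_def[symmetric] a'(1) a by (simp only: ext_const_left_comm[of "oprod J"] ext_const_mult)
      moreover have "int (card J) + int N \<le> 2 * int (a' 0)"
      proof (cases "s \<ge> 1")
        case True
        have "card J + N \<le> 2 * ?c" by simp
        then show ?thesis using a'(2) True by simp
      next
        case False
        then have "s = 0" by simp
        then show ?thesis using a'(3) J by simp
      qed
      ultimately have "x * y \<in> bel_set s (int N)" using J unfolding bel_set_def by blast
      then show "x * y \<in> amb.span (bel_set s (int N))" by (rule amb.span_base)
    qed (simp add: amb.span_base)
    from amb_span_sign[OF c(1) this] show ?thesis
      unfolding c(2) is_sign_left_comm[OF c(1), of "ext_const (d J)"] .
  qed
  then show ?thesis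
    unfolding d(1) sum_distrib_right mult.assoc by (intro amb.span_sum) blast
qed

end

subsection \<open>Polynomial elements and their degrees\<close>

lemma P_degree_alt: "P_degree s d = amb.span {xs.oprod A * ext_const (\<Prod>i=1..s. yvar i ^ e i) | A e.
        A \<subseteq> {1..s} \<and> int (card A) + 2 * int (\<Sum>i=1..s. e i) = d}"
  by (simp add: P_degree_def xs.oprod_def)

lemma P_degree_mult:
  fixes f :: "'k::field ambient"
  assumes "f \<in> P_degree s d" "g \<in> P_degree s e"
  shows "f * g \<in> P_degree s (d + e)"
  unfolding P_degree_alt
proof (rule amb_span_mult[OF _ assms[unfolded P_degree_alt]])
  fix x y :: "'k ambient"
  assume "x \<in> {xs.oprod A * ext_const (\<Prod>i=1..s. yvar i ^ e i) | A e.
        A \<subseteq> {1..s} \<and> int (card A) + 2 * int (\<Sum>i=1..s. e i) = d}"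
    "y \<in> {xs.oprod A * ext_const (\<Prod>i=1..s. yvar i ^ f i) | A f.
        A \<subseteq> {1..s} \<and> int (card A) + 2 * int (\<Sum>i=1..s. f i) = e}"
  then obtain A a B b where x: "x = xs.oprod A * ext_const (\<Prod>i=1..s. yvar i ^ a i)" "A \<subseteq> {1..s}"
      "int (card A) + 2 * int (\<Sum>i=1..s. a i) = d"
    and y: "y = xs.oprod B * ext_const (\<Prod>i=1..s. yvar i ^ b i)" "B \<subseteq> {1..s}"
      "int (card B) + 2 * int (\<Sum>i=1..s. b i) = e"
    by blast
  have fin: "finite A" "finite B" using x(2) y(2) finite_subset by blast+
  have xy: "x * y = xs.oprod A * xs.oprod B * ext_const (\<Prod>i=1..s. yvar i ^ (a i + b i))"
    unfolding x(1) y(1) ext_const_merge by (simp add: power_add prod.distrib)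
  show "x * y \<in> amb.span {xs.oprod A * ext_const (\<Prod>i=1..s. yvar i ^ a i) | A a.
        A \<subseteq> {1..s} \<and> int (card A) + 2 * int (\<Sum>i=1..s. a i) = d + e}"
  proof (cases "A \<inter> B = {}")
    case True
    obtain c where c: "is_sign c" "xs.oprod A * xs.oprod B = c * (xs.oprod (A \<union> B) :: 'k ambient)"
      using xs.oprod_mult_disjoint[OF fin True] by blast
    have "int (card (A \<union> B)) + 2 * int (\<Sum>i=1..s. a i + b i) = d + e"
      using x(3) y(3) fin True by (simp add: card_Un_disjoint sum.distrib)
    moreover have "A \<union> B \<subseteq> {1..s}" using x(2) y(2) by blast
    ultimately show ?thesis
      unfolding xy c(2) mult.assoc
      by (intro amb_span_sign[OF c(1)] amb.span_base CollectI exI[of _ "A \<union> B"]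
          exI[of _ "\<lambda>i. a i + b i"] conjI refl)
  next
    case False
    then have "xs.oprod A * xs.oprod B = (0 :: 'k ambient)" by (rule xs.oprod_mult_overlap[OF fin])
    then show ?thesis unfolding xy by (simp add: amb.span_zero)
  qed
qed

lemma P_degree_gen: "A \<subseteq> {1..s} \<Longrightarrow> int (card A) + 2 * int (\<Sum>i=1..s. e i) = d \<Longrightarrow>
    xs.oprod A * ext_const (\<Prod>i=1..s. yvar i ^ e i) \<in> P_degree s d"
  unfolding P_degree_alt by (rule amb.span_base) blast

lemma P_degree_1: "1 \<in> P_degree s 0"
  using P_degree_gen[of "{}" s "\<lambda>i. 0" 0] by simp

lemma P_degree_yvar: "i \<in> {1..s} \<Longrightarrow> ext_const (yvar i) \<in> P_degree s 2"
proof -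
  assume i: "i \<in> {1..s}"
  have "(\<Prod>j=1..s. yvar j ^ (if j = i then 1 else 0)) = (yvar i :: 'a::field ratfun)"
    using i by (simp add: if_distrib[of "\<lambda>n. yvar _ ^ n"] cong: if_cong)
  then show ?thesis
    using P_degree_gen[of "{}" s "\<lambda>j. if j = i then 1 else 0" 2, where 'a = 'a] i by simp
qed

lemma P_degree_ext_gen: "i \<in> {1..s} \<Longrightarrow> ext_gen i \<in> P_degree s 1"
  using P_degree_gen[of "{i}" s "\<lambda>j. 0" 1] by simp

lemma P_degree_sum: "(\<And>i. i \<in> I \<Longrightarrow> f i \<in> P_degree s d) \<Longrightarrow> sum f I \<in> P_degree s d"
  unfolding P_degree_alt by (rule amb.span_sum)

lemma P_degree_add: "f \<in> P_degree s d \<Longrightarrow> g \<in> P_degree s d \<Longrightarrow> f + g \<in> P_degree s d"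
  unfolding P_degree_alt by (rule amb.span_add)

lemma P_degree_zero: "0 \<in> P_degree s d"
  unfolding P_degree_alt by (rule amb.span_zero)

lemma P_degree_sign: "is_sign c \<Longrightarrow> f \<in> P_degree s d \<Longrightarrow> c * f \<in> P_degree s d"
  unfolding P_degree_alt by (rule amb_span_sign)

lemma P_degree_scale: "f \<in> P_degree s d \<Longrightarrow> scale_ambient c f \<in> P_degree s d"
  unfolding P_degree_alt by (rule amb.span_scale)

lemma P_degree_power: "f \<in> P_degree s d \<Longrightarrow> f ^ n \<in> P_degree s (int n * d)"
proof (induction n)
  case (Suc n)
  then show ?case using P_degree_mult[of f s d "f ^ n" "int n * d"] by (simp add: distrib_right)
qed (simp add: P_degree_1)

lemma P_degree_Suc: "(f :: 'a::field ambient) \<in> P_degree s d \<Longrightarrow> f \<in> P_degree (Suc s) d"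
proof -
  have "{xs.oprod A * ext_const (\<Prod>i=1..s. yvar i ^ e i :: 'a::field ratfun) | A e.
        A \<subseteq> {1..s} \<and> int (card A) + 2 * int (\<Sum>i=1..s. e i) = d} \<subseteq>
      {xs.oprod A * ext_const (\<Prod>i=1..Suc s. yvar i ^ e i) | A e.
        A \<subseteq> {1..Suc s} \<and> int (card A) + 2 * int (\<Sum>i=1..Suc s. e i) = (d :: int)}" (is "?L \<subseteq> ?R")
  proof
    fix x :: "'a::field ambient" assume "x \<in> ?L"
    then obtain A e where x: "x = xs.oprod A * ext_const (\<Prod>i=1..s. yvar i ^ e i)" "A \<subseteq> {1..s}"
      "int (card A) + 2 * int (\<Sum>i=1..s. e i) = d" by blast
    let ?e = "e(Suc s := 0)"
    have "(\<Prod>i=1..Suc s. yvar i ^ ?e i) = (\<Prod>i=1..s. yvar i ^ e i :: 'a ratfun)"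
      "(\<Sum>i=1..Suc s. ?e i) = (\<Sum>i=1..s. e i)" by (auto intro!: prod.cong sum.cong)
    moreover have "A \<subseteq> {1..Suc s}" using x(2) by auto
    ultimately show "x \<in> ?R" using x by (intro CollectI exI[of _ A] exI[of _ ?e]) simp
  qed
  from amb.span_mono[OF this] show "f \<in> P_degree s d \<Longrightarrow> f \<in> P_degree (Suc s) d"
    unfolding P_degree_alt by (rule subsetD)
qed

lemma P_degree_ext_prod:
  "finite I \<Longrightarrow> (\<And>i. i \<in> I \<Longrightarrow> ext_const (f i) \<in> P_degree s (d i)) \<Longrightarrow>
   ext_const (\<Prod>i\<in>I. f i) \<in> P_degree s (\<Sum>i\<in>I. d i)"
  by (induction I rule: finite_induct) (simp_all add: P_degree_1 P_degree_mult ext_const_mult)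

lemma P_degree_ext_gens:
  "(\<And>i. i \<in> set xs \<Longrightarrow> f i \<in> {1..s}) \<Longrightarrow>
    (prod_list (map (\<lambda>i. ext_gen (f i)) xs) :: 'k::field ambient) \<in> P_degree s (int (length xs))"
proof (induction xs)
  case (Cons x xs)
  have "ext_gen (f x) * (prod_list (map (\<lambda>i. ext_gen (f i)) xs) :: 'k ambient) \<in> P_degree s (1 + int (length xs))"
    by (intro P_degree_mult P_degree_ext_gen Cons.IH) (use Cons.prems in auto)
  then show ?case by simp
qed (simp add: P_degree_1)

lemma P_degree_mixed_bracket:
  "(mixed_bracket k rs :: 'k::field ambient) \<in>
    P_degree (k + length rs) (int k + 2 * (\<Sum>j<length rs. int CARD('k) ^ (rs ! j)))"
  unfolding mixed_bracket_def
proof (rule P_degree_sum)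
  fix \<sigma> assume "\<sigma> \<in> {\<sigma>. \<sigma> permutes {1..k + length rs} \<and> strict_mono_on {1..k} \<sigma>}"
  then have \<sigma>: "\<sigma> i \<in> {1..k + length rs} \<longleftrightarrow> i \<in> {1..k + length rs}" for i
    using permutes_in_image[of \<sigma> "{1..k + length rs}"] by simp
  let ?s = "k + length rs"
  have 1: "prod_list (map (\<lambda>j. ext_gen (\<sigma> j) :: 'k ambient) [1..<k + 1]) \<in> P_degree ?s (int k)"
  proof -
    have "prod_list (map (\<lambda>j. ext_gen (\<sigma> j) :: 'k ambient) [1..<k + 1]) \<in> P_degree ?s (int (length [1..<k + 1]))"
      by (rule P_degree_ext_gens, subst \<sigma>) auto
    then show ?thesis by (simp del: upt_Suc)
  qed
  have y: "ext_const ((yvar (\<sigma> (k + 1 + j)) :: 'k ratfun) ^ (CARD('k) ^ (rs ! j))) \<in> P_degree ?s (2 * int CARD('k) ^ (rs ! j))"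
    if "j < length rs" for j
  proof -
    have "(ext_const (yvar (\<sigma> (k + 1 + j))) :: 'k ambient) \<in> P_degree ?s 2"
      by (rule P_degree_yvar, subst \<sigma>) (use that in simp)
    from P_degree_power[OF this, of "CARD('k) ^ (rs ! j)"] show ?thesis
      by (simp add: ext_const_power mult.commute)
  qed
  have 2: "ext_const (\<Prod>j<length rs. (yvar (\<sigma> (k + 1 + j)) :: 'k ratfun) ^ (CARD('k) ^ (rs ! j)))
      \<in> P_degree ?s (\<Sum>j<length rs. 2 * int CARD('k) ^ (rs ! j))"
    by (rule P_degree_ext_prod) (use y in auto)
  have sg: "is_sign (of_int (sign \<sigma>) :: 'k ambient)" by (simp add: sign_def is_sign_def)
  show "of_int (sign \<sigma>) * prod_list (map (\<lambda>j. ext_gen (\<sigma> j)) [1..<k + 1]) *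
       ext_const (\<Prod>j<length rs. yvar (\<sigma> (k + 1 + j)) ^ (CARD('k) ^ (rs ! j)))
     \<in> (P_degree ?s (int k + 2 * (\<Sum>j<length rs. int CARD('k) ^ (rs ! j))) :: 'k ambient set)"
    unfolding mult.assoc sum_distrib_left by (intro P_degree_sign[OF sg] P_degree_mult 1 2)
qed

context odd_prime_field
begin

lemma P_degree_dQ_dV:
  "(\<forall>i\<le>s. ext_const (dQ s i :: 'k ratfun) \<in> P_degree s (2 * (int CARD('k) ^ s - int CARD('k) ^ i))) \<and>
   ext_const (dV (Suc s) :: 'k ratfun) \<in> P_degree (Suc s) (2 * int CARD('k) ^ s)"
proof -
  have V: "ext_const (dV (Suc s) :: 'k ratfun) \<in> P_degree (Suc s) (2 * int CARD('k) ^ s)"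
    if Q: "\<And>i. i \<le> s \<Longrightarrow> ext_const (dQ s i :: 'k ratfun) \<in> P_degree s (2 * (int CARD('k) ^ s - int CARD('k) ^ i))" for s
  proof -
    have "ext_const ((-1) ^ (s - j) * dQ s j * yvar (Suc s) ^ (CARD('k) ^ j)) \<in> (P_degree (Suc s) (2 * int CARD('k) ^ s) :: 'k ambient set)"
      if "j \<le> s" for j
    proof -
      have "ext_const (yvar (Suc s) :: 'k ratfun) ^ (CARD('k) ^ j) \<in> P_degree (Suc s) (int (CARD('k) ^ j) * 2)"
        by (intro P_degree_power P_degree_yvar) simp
      from P_degree_mult[OF P_degree_Suc[OF Q[OF that]] this]
      have "ext_const (dQ s j) * ext_const (yvar (Suc s) :: 'k ratfun) ^ (CARD('k) ^ j) \<in> P_degree (Suc s) (2 * int CARD('k) ^ s)"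
        by (simp add: algebra_simps)
      then show ?thesis
        unfolding ext_const_mult ext_const_power[of _ "CARD('k) ^ j"] mult.assoc
        by (rule P_degree_sign[OF is_sign_ext_const[OF is_sign_minus_1]])
    qed
    then show ?thesis
      unfolding dV_def dickson_poly_def ext_const_sum by (intro P_degree_sum) auto
  qed
  have Q: "i \<le> s \<Longrightarrow> ext_const (dQ s i :: 'k ratfun) \<in> P_degree s (2 * (int CARD('k) ^ s - int CARD('k) ^ i))" for i
  proof (induction s arbitrary: i)
    case 0 then show ?case by (simp add: P_degree_1)
  next
    case (Suc s)
    let ?d = "2 * (int CARD('k) ^ Suc s - int CARD('k) ^ i)"
    have 1: "ext_const (dQ s (i - 1) :: 'k ratfun) ^ CARD('k) \<in> P_degree (Suc s) ?d" if "i \<noteq> 0"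
    proof -
      have "int CARD('k) * (2 * (int CARD('k) ^ s - int CARD('k) ^ (i - 1))) = ?d"
        using that by (cases i) (simp_all add: algebra_simps)
      then show ?thesis using P_degree_Suc[OF P_degree_power[OF Suc.IH[of "i - 1"], of "CARD('k)"]] Suc.prems by simp
    qed
    have 2: "ext_const (dQ s i :: 'k ratfun) * ext_const (dV (Suc s)) ^ (CARD('k) - 1) \<in> P_degree (Suc s) ?d" if "i \<le> s"
    proof -
      have "2 * (int CARD('k) ^ s - int CARD('k) ^ i) + int (CARD('k) - 1) * (2 * int CARD('k) ^ s) = ?d"
        using card_gt_0 by (simp add: of_nat_diff algebra_simps)
      then show ?thesis
        using P_degree_mult[OF P_degree_Suc[OF Suc.IH[OF that]] P_degree_power[OF V[OF Suc.IH], of "CARD('k) - 1"]]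
        by (simp only:)
    qed
    show ?case
    proof (cases "i \<le> s")
      case True
      then show ?thesis
        unfolding ext_dQ_Suc using 1 2 by (auto intro: P_degree_add)
    next
      case False
      then have "i = Suc s" using Suc.prems by simp
      then show ?thesis by (simp add: dQ_diag P_degree_1)
    qed
  qed
  then show ?thesis using V by blast
qed

lemma P_degree_dL: "ext_const (dL s :: 'k ratfun) \<in> P_degree s (2 * (\<Sum>k<s. int CARD('k) ^ k))"
proof (induction s)
  case (Suc s)
  from P_degree_mult[OF conjunct2[OF P_degree_dQ_dV] P_degree_Suc[OF Suc]]
  show ?case unfolding dL_Suc ext_const_mult by (simp add: distrib_left add.commute)
qed (simp add: P_degree_1)

lemma P_degree_mui_M:
  assumes J: "J \<subseteq> {..<s}"
  shows "(mui_M s J :: 'k ambient) \<in> P_degree s (int (card J) + 2 * (\<Sum>j\<in>{..<s} - J. int CARD('k) ^ j))"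
proof -
  let ?rs = "filter (\<lambda>j. j \<notin> J) [0..<s]"
  have set: "set ?rs = {..<s} - J" by auto
  have "length ?rs = card ({..<s} - J)"
    unfolding set[symmetric] by (rule distinct_card[symmetric]) simp
  moreover have "card J + card ({..<s} - J) = s"
    using J card_mono[of "{..<s}" J] finite_subset[OF J] by (simp add: card_Diff_subset)
  ultimately have len: "card J + length ?rs = s" by simp
  have "(\<Sum>j<length ?rs. int CARD('k) ^ (?rs ! j)) = sum_list (map (\<lambda>r. int CARD('k) ^ r) ?rs)"
    by (simp add: sum_list_sum_nth lessThan_atLeast0)
  also have "\<dots> = (\<Sum>j\<in>{..<s} - J. int CARD('k) ^ j)"
    unfolding set[symmetric] by (rule sum_list_distinct_conv_sum_set) simp
  finally show ?thesis
    using P_degree_mixed_bracket[of "card J" ?rs, where 'k = 'k] unfolding mui_M_def len by simp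
qed

lemma P_degree_mui_M_top: "(mui_M (Suc s) {s} :: 'k ambient) \<in> P_degree (Suc s) (1 + 2 * (\<Sum>k<s. int CARD('k) ^ k))"
proof -
  have "filter (\<lambda>j. j \<notin> {s}) [0..<Suc s] = [0..<s]" by (simp add: filter_id_conv)
  then show ?thesis
    using P_degree_mixed_bracket[of 1 "[0..<s]", where 'k = 'k] by (simp add: mui_M_def del: upt_Suc)
qed

lemma P_degree_dmono: "ext_const (dmono s a :: 'k ratfun) \<in>
    P_degree s (\<Sum>i<s. int (a i) * (2 * (int CARD('k) ^ s - int CARD('k) ^ i)))"
proof -
  have "ext_const (dQ s i ^ a i :: 'k ratfun) \<in> P_degree s (int (a i) * (2 * (int CARD('k) ^ s - int CARD('k) ^ i)))"
    if "i \<in> {..<s}" for i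
    unfolding ext_const_power using P_degree_dQ_dV[of s] that by (intro P_degree_power) auto
  then show ?thesis unfolding dmono_def by (rule P_degree_ext_prod[OF finite_lessThan])
qed

lemma geometric_sum: "(int CARD('k) - 1) * (\<Sum>k<s. int CARD('k) ^ k) = int CARD('k) ^ s - 1"
  by (induction s) (simp_all add: algebra_simps)

text \<open>The degree is that of \<Theta>_J q_{s,0}^c less that of L_s^((p-1)N/2), but \<Theta>_J
  is not polynomial. Membership in P_s is therefore obtained from M_{s;J} and the remaining power of
  L_s.\<close>

lemma P_degree_B_gen:
  assumes J: "J \<subseteq> {..<s}" and e: "e = odd N"
  shows "(B_gen e s J :: 'k ambient) \<in> P_degree s ((\<Sum>j\<in>J. 1 - 2 * int CARD('k) ^ j) +
    (2 * int ((N + card J + 1) div 2) - int N) * (int CARD('k) ^ s - 1))"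
proof -
  let ?S = "\<Sum>k<s. int CARD('k) ^ k"
  let ?c = "(N + card J + 1) div 2"
  obtain h where h: "CARD('k) = 2 * h + 1" "h \<ge> 1" "(CARD('k) - 1) div 2 = h" by (rule half_card)
  obtain m where m: "B_gen e s J = (if J = {} then 1 else mui_M s J) * (ext_const (dL s ^ m) :: 'k ambient)"
    "of_bool (J \<noteq> {}) + m + h * N = 2 * h * ?c"
    using B_gen_form[OF J e] h by auto
  have fin: "finite J" using J finite_subset by blast
  have L: "ext_const (dL s ^ m :: 'k ratfun) \<in> P_degree s (int m * (2 * ?S))"
    unfolding ext_const_power by (rule P_degree_power[OF P_degree_dL])
  have geo: "2 * int h * ?S = int CARD('k) ^ s - 1"
    using geometric_sum[of s] h(1) by simp
  have "int (of_bool (J \<noteq> {}) + m + h * N) = int (2 * h * ?c)" by (simp only: m(2))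
  then have "(of_bool (J \<noteq> {}) + int m) = int h * (2 * int ?c - int N)"
    by (simp add: algebra_simps)
  then have "2 * (of_bool (J \<noteq> {}) + int m) * ?S = 2 * (int h * (2 * int ?c - int N)) * ?S" by simp
  also have "\<dots> = (2 * int ?c - int N) * (2 * int h * ?S)" by (simp add: algebra_simps)
  finally have tot: "2 * (of_bool (J \<noteq> {}) + int m) * ?S = (2 * int ?c - int N) * (int CARD('k) ^ s - 1)"
    unfolding geo .
  show ?thesis
  proof (cases "J = {}")
    case True
    then have "int m * (2 * ?S) = (2 * int ?c - int N) * (int CARD('k) ^ s - 1)" using tot by simp
    then show ?thesis using L True m(1) by simp
  next
    case False
    have "(\<Sum>j\<in>{..<s} - J. int CARD('k) ^ j) = ?S - (\<Sum>j\<in>J. int CARD('k) ^ j)"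
      using J by (simp add: sum_diff)
    then have "int (card J) + 2 * (\<Sum>j\<in>{..<s} - J. int CARD('k) ^ j) + int m * (2 * ?S) =
        (\<Sum>j\<in>J. 1 - 2 * int CARD('k) ^ j) + 2 * (of_bool (J \<noteq> {}) + int m) * ?S"
      using False by (simp add: sum_subtractf algebra_simps flip: sum_distrib_left)
    then show ?thesis
      using P_degree_mult[OF P_degree_mui_M[OF J] L] m(1) False unfolding tot by simp
  qed
qed

text \<open>The argument t carries the type \<open>'k\<close>, through which the prime p
  enters.\<close>

definition bel_deg :: "nat \<Rightarrow> (nat \<Rightarrow> nat) \<Rightarrow> nat set \<Rightarrow> 'k itself \<Rightarrow> int" where
  "bel_deg s a J t = (\<Sum>j\<in>J. 1 - 2 * int CARD('k) ^ j) + (\<Sum>i<s. int (a i) * (2 * (int CARD('k) ^ s - int CARD('k) ^ i)))"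

text \<open>Converse of \<open>B_mod_bel_span\<close>: the bound gives a_0 \<ge> c, so q_{s,0}^c can
  be combined with \<Theta>_J to a generator times L_s^((p-1)N/2), and q_{s,0}^(a_0 - c) remains as
  a Dickson coefficient.\<close>

lemma bel_B_mod:
  assumes J: "J \<subseteq> {..<s}" and ge: "int (card J) + int N \<le> 2 * int (a 0)" and e: "e = odd N"
  shows "\<exists>f\<in>B_mod e s. f \<in> P_degree s (bel_deg s a J TYPE('k) - int N * (int CARD('k) ^ s - 1)) \<and>
    (bel s a J :: 'k ambient) = f * ext_const (dL s ^ ((CARD('k) - 1) div 2 * N))"
proof -
  interpret anticommuting "Theta s :: nat \<Rightarrow> 'k ambient" by (rule Theta_anticommuting)
  let ?L = "ext_const (dL s ^ ((CARD('k) - 1) div 2 * N)) :: 'k ambient"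
  let ?c = "(N + card J + 1) div 2"
  have fin: "finite J" using J finite_subset by blast
  obtain c where c: "is_sign c" "B_gen e s J * ?L = c * (oprod J * ext_const (dQ s 0 ^ ?c))"
    using B_gen_eq[OF J e] by blast
  have le: "?c \<le> a 0" using ge by linarith
  let ?q = "int CARD('k)"
  have "\<exists>a'. dmono s a = dmono s a' * (dQ s 0 :: 'k ratfun) ^ ?c \<and>
      (\<Sum>i<s. int (a i) * (2 * (?q ^ s - ?q ^ i))) = (\<Sum>i<s. int (a' i) * (2 * (?q ^ s - ?q ^ i))) + int ?c * (2 * (?q ^ s - 1))"
  proof (cases "s \<ge> 1")
    case True
    let ?a = "a(0 := a 0 - ?c)"
    have a: "(\<lambda>i. ?a i + (if i = 0 then ?c else 0)) = a" using le by auto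
    with dmono_mult[of s ?a "\<lambda>i. if i = 0 then ?c else 0", where 'a = 'k]
    have "dmono s a = (dmono s ?a * dmono s (\<lambda>i. if i = 0 then ?c else 0) :: 'k ratfun)"
      by (simp only:)
    moreover have "(\<Sum>i<s. int (a i) * (2 * (?q ^ s - ?q ^ i))) =
        (\<Sum>i<s. int (?a i) * (2 * (?q ^ s - ?q ^ i)) + (if i = 0 then int ?c * (2 * (?q ^ s - 1)) else 0))"
      using le by (intro sum.cong) (auto simp: of_nat_diff algebra_simps)
    moreover have "\<dots> = (\<Sum>i<s. int (?a i) * (2 * (?q ^ s - ?q ^ i))) + int ?c * (2 * (?q ^ s - 1))"
      using True by (simp add: sum.distrib)
    ultimately show ?thesis using dmono_single[of 0 s ?c, where 'a = 'k] True by (intro exI[of _ ?a]) simp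
  next
    case False
    then have "s = 0" by simp
    then show ?thesis by (simp add: dmono_def)
  qed
  then obtain a' where a': "dmono s a = dmono s a' * (dQ s 0 :: 'k ratfun) ^ ?c"
      "(\<Sum>i<s. int (a i) * (2 * (?q ^ s - ?q ^ i))) = (\<Sum>i<s. int (a' i) * (2 * (?q ^ s - ?q ^ i))) + int ?c * (2 * (?q ^ s - 1))"
    by blast
  \<comment> \<open>A sign of the exterior algebra is rewritten as a constant of F_p, so that it can
    be absorbed into the Dickson coefficient.\<close>
  obtain c' :: "'k ratfun" where c': "is_sign c'" "c = ext_const c'" "rconst (if c = 1 then 1 else -1) = c'"
  proof (cases "c = 1")
    case True
    then show ?thesis using that[of 1] by simp
  next
    case False
    then have "c = - 1" using c(1) by (simp add: is_sign_def)
    then show ?thesis using that[of "- 1"] False by (simp add: ext_const_uminus is_sign_minus rconst_uminus)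
  qed
  let ?f = "ext_const (c' * dmono s a') * B_gen e s J"
  have "bel s a J = ext_const (dmono s a') * (oprod J * ext_const (dQ s 0 ^ ?c))"
    unfolding bel_def dmono_def[symmetric] a'(1) by (simp only: ext_const_left_comm[of "oprod J"] ext_const_mult)
  also have "oprod J * ext_const (dQ s 0 ^ ?c) = c * (B_gen e s J * ?L)"
    unfolding c(2) using is_sign_sq[OF c(1)] by (simp flip: mult.assoc)
  finally have eq: "bel s a J = ?f * ?L"
    unfolding c'(2) by (simp only: ext_const_mult mult.assoc ext_const_left_comm[of "ext_const (dmono s a')"])
  have D: "c' * dmono s a' \<in> Dickson s"
    using Dickson.mult[OF Dickson.const dmono_Dickson, of "if c = 1 then 1 else -1" s a'] c'(3) by simp
  have "?f \<in> B_mod e s"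
    unfolding B_mod_def Dickson_span_def
  proof (intro CollectI exI conjI allI)
    let ?d = "\<lambda>K. if K = J then c' * dmono s a' else 0"
    show "?d K \<in> Dickson s" for K using D Dickson.const[of "0 :: 'k" s] by auto
    have "(\<Sum>K\<in>Pow {..<s}. ext_const (?d K) * B_gen e s K) = (\<Sum>K\<in>Pow {..<s}. if K = J then ?f else 0)"
      by (intro sum.cong) auto
    also have "\<dots> = ?f" using J by simp
    finally show "?f = (\<Sum>K\<in>Pow {..<s}. ext_const (?d K) * B_gen e s K)" by simp
  qed
  moreover have "?f \<in> P_degree s (bel_deg s a J TYPE('k) - int N * (?q ^ s - 1))"
  proof -
    have "?f \<in> P_degree s ((\<Sum>i<s. int (a' i) * (2 * (?q ^ s - ?q ^ i))) + ((\<Sum>j\<in>J. 1 - 2 * ?q ^ j) +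
        (2 * int ?c - int N) * (?q ^ s - 1)))"
      unfolding ext_const_mult
      by (intro P_degree_mult P_degree_sign[OF is_sign_ext_const[OF c'(1)]] P_degree_dmono P_degree_B_gen J e)
    also have "(\<Sum>i<s. int (a' i) * (2 * (?q ^ s - ?q ^ i))) + ((\<Sum>j\<in>J. 1 - 2 * ?q ^ j) +
        (2 * int ?c - int N) * (?q ^ s - 1)) = bel_deg s a J TYPE('k) - int N * (?q ^ s - 1)"
      unfolding bel_deg_def a'(2) by (simp only: algebra_simps)
    finally show ?thesis .
  qed
  ultimately show ?thesis using eq by blast
qed

end

subsection \<open>The coefficients of the Singer construction\<close>

definition singer_coef :: "nat \<Rightarrow> (bool \<times> nat) list \<Rightarrow> 'k::field ambient" where
  "singer_coef s I = (-1) ^ (\<Sum>(e, i)\<leftarrow>I. of_bool e + i) *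
     prod_list (map (\<lambda>k. mui_u k ^ of_bool (fst (I ! (k - 1)))) (rev [1..<s + 1])) *
     ext_const (\<Prod>k=1..s. mui_v k powi
       (- (int CARD('k) - 1) * int (snd (I ! (k - 1))) - of_bool (fst (I ! (k - 1)))))"

definition word_deg :: "nat \<Rightarrow> (bool \<times> nat) list \<Rightarrow> int" where
  "word_deg p I = (\<Sum>(e, i)\<leftarrow>I. of_bool e + 2 * int i * (int p - 1))"

lemma steenrod_word_snoc: "steenrod_word bock P (I @ [x]) m = steenrod_word bock P I (steenrod_letter bock P x m)"
  by (simp add: steenrod_word_def)

lemma steenrod_word_Nil: "steenrod_word bock P [] m = m"
  by (simp add: steenrod_word_def)

locale unstable_setup = unstable_module scale M bock P + odd_prime_field "TYPE('k)"
  for scale :: "'k::field \<Rightarrow> 'm::ab_group_add \<Rightarrow> 'm" and M bock P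
begin

lemma letter_linear: "Vector_Spaces.linear scale scale (steenrod_letter bock P x)"
proof (cases x)
  case (Pair e i)
  then show ?thesis
    using Vector_Spaces.linear_compose[OF P_linear[of i] bock_linear] P_linear[of i]
    by (cases e) (simp_all add: steenrod_letter_def comp_def)
qed

lemma word_linear: "Vector_Spaces.linear scale scale (steenrod_word bock P I)"
proof (induction I rule: rev_induct)
  case Nil
  show ?case using linear_ident by (simp add: steenrod_word_def id_def)
next
  case (snoc x I)
  have "steenrod_word bock P (I @ [x]) = steenrod_word bock P I \<circ> steenrod_letter bock P x"
    by (rule ext) (simp add: steenrod_word_snoc)
  then show ?case using Vector_Spaces.linear_compose[OF letter_linear snoc] by (simp only:)
qed

lemma word_0: "steenrod_word bock P I 0 = 0"
  using word_linear by (rule Vector_Spaces.linear.axioms(3)[THEN module_hom.zero, unfolded module_hom_iff_linear])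

lemma word_add: "steenrod_word bock P I (x + y) = steenrod_word bock P I x + steenrod_word bock P I y"
  using word_linear by (rule Vector_Spaces.linear.axioms(3)[THEN module_hom.add, unfolded module_hom_iff_linear])

lemma letter_degree: "x \<in> M n \<Longrightarrow> steenrod_letter bock P (e, i) x \<in> M (n + (of_bool e + 2 * int i * (int CARD('k) - 1)))"
  using P_degree[of x n i] bock_degree[of "P i x"]
  by (cases e) (force simp: steenrod_letter_def algebra_simps)+

lemma word_degree: "x \<in> M n \<Longrightarrow> steenrod_word bock P I x \<in> M (n + word_deg CARD('k) I)"
proof (induction I arbitrary: x n rule: rev_induct)
  case Nil then show ?case by (simp add: steenrod_word_Nil word_deg_def)
next
  case (snoc y I)
  obtain e i where y: "y = (e, i)" by (cases y)
  show ?case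
    using snoc.IH[OF letter_degree[OF snoc.prems, of e i]]
    by (simp add: steenrod_word_snoc y word_deg_def add_ac)
qed

text \<open>Instability of P^0, which is the identity.\<close>

lemma M_negative: "x \<in> M n \<Longrightarrow> n < 0 \<Longrightarrow> x = 0"
  using unstable[of x n False 0] P_0 by (simp add: steenrod_letter_def)

text \<open>Induction on s splits off the last letter: it acts on x before the others, and it
  carries u_{s+1} and v_{s+1}.\<close>

lemma singer_coef_snoc:
  assumes "length I = s"
  shows "\<exists>c. is_sign c \<and> singer_coef (Suc s) (I @ [(e, i)]) =
    c * (mui_u (Suc s) ^ of_bool e * (ext_const (dv (Suc s) powi (- (int CARD('k) - 1) * int i - of_bool e)) * (singer_coef s I :: 'k ambient)))"
proof -
  let ?J = "I @ [(e, i)]"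
  have nth: "?J ! (k - 1) = I ! (k - 1)" if "k \<in> {1..s}" for k
    using that assms by (auto simp: nth_append)
  have l: "prod_list (map (\<lambda>k. mui_u k ^ of_bool (fst (?J ! (k - 1))) :: 'k ambient) (rev [1..<Suc s + 1])) =
     mui_u (Suc s) ^ of_bool e * prod_list (map (\<lambda>k. mui_u k ^ of_bool (fst (I ! (k - 1)))) (rev [1..<s + 1]))"
  proof -
    have "map (\<lambda>k. mui_u k ^ of_bool (fst (?J ! (k - 1))) :: 'k ambient) (rev [1..<s + 1]) =
       map (\<lambda>k. mui_u k ^ of_bool (fst (I ! (k - 1)))) (rev [1..<s + 1])"
      by (rule map_cong) (use nth in \<open>auto simp del: upt_Suc\<close>)
    moreover have "rev [1..<Suc s + 1] = Suc s # rev [1..<s + 1]" by simp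
    ultimately show ?thesis using assms by (simp only: list.map prod_list.Cons) (simp add: nth_append)
  qed
  have v: "(\<Prod>k=1..Suc s. mui_v k powi (- (int CARD('k) - 1) * int (snd (?J ! (k - 1))) - of_bool (fst (?J ! (k - 1))))) =
     (\<Prod>k=1..s. mui_v k powi (- (int CARD('k) - 1) * int (snd (I ! (k - 1))) - of_bool (fst (I ! (k - 1))))) *
     (dv (Suc s) :: 'k ratfun) powi (- (int CARD('k) - 1) * int i - of_bool e)"
  proof -
    let ?F = "\<lambda>k. (mui_v k :: 'k ratfun) powi (- (int CARD('k) - 1) * int (snd (?J ! (k - 1))) - of_bool (fst (?J ! (k - 1))))"
    have "prod ?F {1..Suc s} = prod ?F {1..s} * ?F (Suc s)" by (subst prod.nat_ivl_Suc') (simp, rule mult.commute)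
    also have "prod ?F {1..s} = (\<Prod>k=1..s. mui_v k powi (- (int CARD('k) - 1) * int (snd (I ! (k - 1))) - of_bool (fst (I ! (k - 1)))))"
      by (rule prod.cong[OF refl]) (simp only: nth)
    also have "?F (Suc s) = dv (Suc s) powi (- (int CARD('k) - 1) * int i - of_bool e)"
      using assms by (simp add: mui_v_eq nth_append)
    finally show ?thesis .
  qed
  have sg: "is_sign ((-1) ^ (of_bool e + i) :: 'k ambient)" by (rule is_sign_minus_1)
  show ?thesis
  proof (intro exI[of _ "(-1) ^ (of_bool e + i)"] conjI sg)
    have pw: "(-1) ^ (\<Sum>(e, i)\<leftarrow>?J. of_bool e + i) =
      ((-1) ^ (of_bool e + i) * (-1) ^ (\<Sum>(e, i)\<leftarrow>I. of_bool e + i) :: 'k ambient)"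
      by (simp add: power_add mult_ac flip: power_add) (simp add: power_add power_commutes mult.assoc add_ac)
    have sI: "is_sign ((-1) ^ (\<Sum>(e, i)\<leftarrow>I. of_bool e + i) :: 'k ambient)" by (rule is_sign_minus_1)
    show "singer_coef (Suc s) ?J = (-1) ^ (of_bool e + i) *
      (mui_u (Suc s) ^ of_bool e * (ext_const (dv (Suc s) powi (- (int CARD('k) - 1) * int i - of_bool e)) * (singer_coef s I :: 'k ambient)))"
      unfolding singer_coef_def l v pw ext_const_mult
      by (simp only: mult.assoc is_sign_left_comm[OF sI, of "mui_u (Suc s) ^ _"] is_sign_left_comm[OF sI, of "ext_const _"]
          ext_const_left_comm[of "prod_list _"] ext_const_comm[of "ext_const _" "dv (Suc s) powi _"])
  qed
qed

text \<open>With p - 1 = 2h, v_{t+1} = V_{t+1}/L_t^(2h) and L_{t+1} = V_{t+1} L_t, the last letter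
  contributes V_{t+1} to the power h(n - 2i) - \<epsilon>. The powers of L_t add up to h n' + h
  \<epsilon>, where n' is the degree after applying this letter: h n' is what the induction needs,
  and h \<epsilon> clears the denominator of u_{t+1}.\<close>

lemma singer_coef_polynomial:
  assumes "length I = s" "x \<in> M n" "steenrod_word bock P I x \<noteq> 0"
  shows "ext_const (dL s powi (int ((CARD('k) - 1) div 2) * n)) * (singer_coef s I :: 'k ambient)
    \<in> P_degree s (n * int CARD('k) ^ s - n - word_deg CARD('k) I)"
  using assms
proof (induction I arbitrary: s x n rule: rev_induct)
  case Nil
  then show ?case by (simp add: singer_coef_def word_deg_def P_degree_1)
next
  case (snoc y I)
  obtain e i where y: "y = (e, i)" by (cases y)
  obtain t where s: "s = Suc t" "length I = t" using snoc.prems(1) by auto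
  obtain h where h: "CARD('k) = 2 * h + 1" "h \<ge> 1" "(CARD('k) - 1) div 2 = h" by (rule half_card)
  define x' where "x' = steenrod_letter bock P (e, i) x"
  define n' where "n' = n + (of_bool e + 2 * int i * (int CARD('k) - 1))"
  have x': "x' \<in> M n'" unfolding x'_def n'_def by (rule letter_degree[OF snoc.prems(2)])
  have w: "steenrod_word bock P I x' \<noteq> 0" using snoc.prems(3) by (simp add: y x'_def steenrod_word_snoc)
  then have "x' \<noteq> 0" using word_0 by metis
  then have un: "of_bool e + 2 * int i \<le> n"
    using unstable[OF snoc.prems(2), of e i] unfolding x'_def by (meson not_le)
  have n0: "n \<ge> 0"
  proof -
    have "0 \<le> of_bool e + 2 * int i" by simp
    then show ?thesis using un by (rule order_trans)
  qed
  let ?q = "int CARD('k)"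
  have q: "?q = 2 * int h + 1" using h(1) by simp
  have IH: "ext_const (dL t powi (int h * n')) * (singer_coef t I :: 'k ambient)
      \<in> P_degree t (n' * ?q ^ t - n' - word_deg CARD('k) I)"
    using snoc.IH[OF s(2) x' w] h(3) by simp
  obtain c where c: "is_sign c" "singer_coef (Suc t) (I @ [(e, i)]) =
    c * (mui_u (Suc t) ^ of_bool e * (ext_const (dv (Suc t) powi (- (?q - 1) * int i - of_bool e)) * (singer_coef t I :: 'k ambient)))"
    using singer_coef_snoc[OF s(2)] by blast
  \<comment> \<open>The exponent of V_{t+1}. It is nonnegative by instability: for \<epsilon> = 1
    one has n - 2i \<ge> 1 and h \<ge> 1.\<close>
  define mV where "mV = nat (int h * (n - 2 * int i) - of_bool e)"
  have le: "int h * (n - 2 * int i) - of_bool e \<ge> 0"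
  proof (cases e)
    case True
    then have "n - 2 * int i \<ge> 1" using un by simp
    then have "1 * 1 \<le> int h * (n - 2 * int i)" using h(2) by (intro mult_mono) auto
    then show ?thesis using True by simp
  qed (use un in simp)
  then have mV: "int mV = int h * (n - 2 * int i) - of_bool e" by (simp add: mV_def)
  let ?sum = "\<Sum>k<t. ?q ^ k"
  have geo: "2 * int h * ?sum = ?q ^ t - 1"
  proof (induction t)
    case (Suc t)
    then show ?case using q by (simp add: algebra_simps)
  qed simp
  \<comment> \<open>This is L_t^(h \<epsilon>) u_{t+1}^\<epsilon>: one factor L_t is spent on the
    denominator of u_{t+1}.\<close>
  define U where "U = (if e then ext_const (dL t ^ (h - 1)) * mui_M (Suc t) {t} else 1 :: 'k ambient)"
  have U: "U \<in> P_degree (Suc t) (of_bool e * ?q ^ t)"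
  proof (cases e)
    case True
    have "int (h - 1) * (2 * ?sum) + (1 + 2 * ?sum) = 1 + 2 * int h * ?sum"
      using h(2) by (simp add: of_nat_diff algebra_simps)
    then have "int (h - 1) * (2 * ?sum) + (1 + 2 * ?sum) = ?q ^ t" using geo by simp
    then show ?thesis
      using True P_degree_mult[OF P_degree_Suc[OF P_degree_power[OF P_degree_dL[of t], of "h - 1"]] P_degree_mui_M_top[of t]]
      by (simp add: U_def ext_const_power)
  qed (simp add: U_def P_degree_1)
  have V: "ext_const (dV (Suc t) :: 'k ratfun) ^ mV \<in> P_degree (Suc t) (int mV * (2 * ?q ^ t))"
    using P_degree_power[OF conjunct2[OF P_degree_dQ_dV[of t]]] .
  have nz: "dL t \<noteq> (0 :: 'k ratfun)" "dV (Suc t) \<noteq> (0 :: 'k ratfun)" by (simp_all add: dV_nonzero)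
  have uU: "ext_const (dL t powi (int h * of_bool e)) * mui_u (Suc t) ^ of_bool e = U"
  proof (cases e)
    case True
    have "dL t powi int h * inverse (dL t) = (dL t :: 'k ratfun) ^ (h - 1)"
      unfolding power_int_of_nat using nz(1) h(2) by (cases h) simp_all
    moreover have "mui_u (Suc t) = mui_M (Suc t) {t} * (ext_const (inverse (dL t)) :: 'k ambient)"
      by (simp add: mui_u_def mui_L_eq)
    ultimately show ?thesis
      using True by (simp add: U_def ext_const_comm[of "mui_M _ _"] flip: mult.assoc ext_const_mult)
  qed (simp add: U_def)
  have scal: "dL (Suc t) powi (int h * n) * dv (Suc t) powi (- (?q - 1) * int i - of_bool e) =
      dV (Suc t) ^ mV * (dL t powi (int h * n') * (dL t :: 'k ratfun) powi (int h * of_bool e))"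
  proof -
    have f1: "(dv (Suc t) :: 'k ratfun) powi (- (?q - 1) * int i - of_bool e) =
        dV (Suc t) powi (- (?q - 1) * int i - of_bool e) * dL t powi (- (2 * int h * (- (?q - 1) * int i - of_bool e)) :: int)"
    proof -
      have "dL t powi (2 * int h) = (dL t :: 'k ratfun) ^ (2 * h)"
        using power_int_of_nat[of "dL t :: 'k ratfun" "2 * h"] by simp
      then have "dv (Suc t) = dV (Suc t) * (dL t :: 'k ratfun) powi (- (2 * int h))"
        using h(1) by (simp add: dv_def power_int_minus divide_inverse)
      moreover have "- (2 * int h * z) = - (2 * int h) * z" for z by simp
      ultimately show ?thesis by (simp only: power_int_mult_distrib power_int_mult)
    qed
    have f2: "dL (Suc t) powi (int h * n) = dV (Suc t) powi (int h * n) * (dL t :: 'k ratfun) powi (int h * n)"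
      by (simp add: dL_Suc power_int_mult_distrib)
    have f3: "dV (Suc t) powi (int h * n) * dV (Suc t) powi (- (?q - 1) * int i - of_bool e) = (dV (Suc t) :: 'k ratfun) ^ mV"
    proof -
      have "int h * n + (- (?q - 1) * int i - of_bool e) = int mV" by (simp add: mV q algebra_simps)
      then show ?thesis using nz(2) by (simp flip: power_int_add power_int_of_nat)
    qed
    have f4: "dL t powi (int h * n) * dL t powi (- (2 * int h * (- (?q - 1) * int i - of_bool e))) =
        dL t powi (int h * n') * (dL t :: 'k ratfun) powi (int h * of_bool e)"
    proof -
      have "int h * n + - (2 * int h * (- (?q - 1) * int i - of_bool e)) = int h * n' + int h * of_bool e"
        by (simp add: n'_def q algebra_simps)
      then show ?thesis using nz(1) by (simp flip: power_int_add)
    qed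
    show ?thesis unfolding f1 f2 f3[symmetric] f4[symmetric] by (simp only: mult_ac)
  qed
  have "ext_const (dL (Suc t) powi (int h * n)) * singer_coef (Suc t) (I @ [(e, i)]) =
      c * (ext_const (dL (Suc t) powi (int h * n) * dv (Suc t) powi (- (?q - 1) * int i - of_bool e)) *
        (mui_u (Suc t) ^ of_bool e * (singer_coef t I :: 'k ambient)))"
    unfolding c(2) is_sign_left_comm[OF c(1)] ext_const_mult
    by (simp only: mult.assoc ext_const_left_comm[of "mui_u (Suc t) ^ _"])
  also have "\<dots> = c * (ext_const (dV (Suc t)) ^ mV * (U * (ext_const (dL t powi (int h * n')) * singer_coef t I)))"
    unfolding scal uU[symmetric] ext_const_mult ext_const_power
    by (simp only: mult.assoc ext_const_left_comm[of "mui_u (Suc t) ^ _"])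
      (simp only: ext_const_left_comm[of "ext_const (dL t powi (int h * of_bool e))"])
  also have "\<dots> \<in> P_degree (Suc t) (int mV * (2 * ?q ^ t) + (of_bool e * ?q ^ t + (n' * ?q ^ t - n' - word_deg CARD('k) I)))"
    by (intro P_degree_sign[OF c(1)] P_degree_mult V U P_degree_Suc[OF IH])
  also have "int mV * (2 * ?q ^ t) + (of_bool e * ?q ^ t + (n' * ?q ^ t - n' - word_deg CARD('k) I)) =
      n * ?q ^ Suc t - n - word_deg CARD('k) (I @ [(e, i)])"
  proof -
    have "int mV * 2 + of_bool e + n' = n * ?q" by (simp add: mV n'_def q algebra_simps)
    then have "(int mV * 2 + of_bool e + n') * ?q ^ t = n * ?q * ?q ^ t" by simp
    moreover have "n' + word_deg CARD('k) I = n + word_deg CARD('k) (I @ [(e, i)])"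
      by (simp add: n'_def word_deg_def)
    ultimately show ?thesis by (simp add: algebra_simps)
  qed
  finally show ?case unfolding s(1) y h(3) .
qed

end

subsection \<open>Tensor products\<close>

lemma tens_add_left: "tens (a + a') b = tens a b + tens a' b"
  by transfer (metis diff_diff_eq tensor_relations.left)

lemma tens_add_right: "tens a (b + b') = tens a b + tens a b'"
  by transfer (metis diff_diff_eq tensor_relations.right)

lemma tens_0_right [simp]: "tens a 0 = 0"
  using tens_add_right[of a 0 0] by simp

lemma tensor_induct [case_names zero tens diff]:
  assumes "P 0" "\<And>a b. P (tens a b)" "\<And>x y. P x \<Longrightarrow> P y \<Longrightarrow> P (x - y)"
  shows "P z"
proof -
  have "P (abs_tensor x)" for x
  proof (induction x rule: frag_induction[OF subset_UNIV])
    case 1 show ?case using assms(1) by (simp add: zero_tensor_def)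
  next
    case (2 x)
    show ?case using assms(2)[of "fst x" "snd x"] by (simp add: tens.abs_eq)
  next
    case (3 a b)
    have "abs_tensor (a - b) = abs_tensor a - abs_tensor b" by (rule minus_tensor.abs_eq[symmetric])
    with assms(3)[OF 3] show ?case by simp
  qed
  from this[of "rep_tensor z"] show ?thesis
    by (simp add: Quotient3_abs_rep[OF Quotient3_tensor])
qed

lemma act_tens [simp]: "act r (tens a b) = tens (r * a) b"
  by transfer (simp add: frag_extend_of tensor_relations.zero)

lemma act_diff: "act r (x - y) = act r x - act r y"
  by transfer (simp add: frag_extend_diff tensor_relations.zero)

lemma act_0_right [simp]: "act r 0 = 0"
  using act_diff[of r 0 0] by simp

lemma act_add: "act r (x + y) = act r x + act r y"
  using act_diff[of r x "- y"] act_diff[of r 0 y] by simp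

lemma act_sum: "act r (sum f I) = (\<Sum>i\<in>I. act r (f i))"
  by (induction I rule: infinite_finite_induct) (simp_all add: act_add)

lemma act_add_left: "act (r + r') z = act r z + act r' z"
  by (induction z rule: tensor_induct) (simp_all add: distrib_right tens_add_left act_diff)

lemma act_act: "act r (act r' z) = act (r * r') z"
  by (induction z rule: tensor_induct) (simp_all add: mult.assoc act_diff)

lemma act_1 [simp]: "act (1 :: 'r::ring_1) z = z"
  by (induction z rule: tensor_induct) (simp_all add: act_diff)

interpretation tv: vector_space "scale_tensor :: 'k::field \<Rightarrow> ('k ambient, 'm::ab_group_add) tensor \<Rightarrow> _"
  by unfold_locales
    (simp_all add: scale_tensor_def act_add act_add_left act_act rconst_add rconst_mult ext_const_add ext_const_mult)

lemma act_0_left [simp]: "act 0 z = 0"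
  using act_add_left[of 0 0 z] by simp

lemma act_scale: "act (scale_ambient c f) z = scale_tensor c (act f z)"
  by (simp add: scale_ambient_def scale_tensor_def act_act)

lemma act_scale_tensor: "act f (scale_tensor c z) = scale_tensor c (act f z)"
  by (simp add: scale_tensor_def act_act ext_const_comm)

text \<open>A biadditive map kills the relations, so it factors through the quotient. The ring
  structure of the target supplies integer multiples through \<open>of_int\<close>.\<close>

lemma tensor_extend:
  fixes g :: "'a::ab_group_add \<Rightarrow> 'b::ab_group_add \<Rightarrow> 'c::ring_1"
  assumes l: "\<And>a a' b. g (a + a') b = g a b + g a' b" and r: "\<And>a b b'. g a (b + b') = g a b + g a b'"
  shows "\<exists>K. (\<forall>x y. K (x - y) = K x - K y) \<and> (\<forall>a b. K (tens a b) = g a b)"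
proof -
  define raw :: "(('a \<times> 'b) \<Rightarrow>\<^sub>0 int) \<Rightarrow> 'c" where
    "raw x = (\<Sum>k\<in>Poly_Mapping.keys x. of_int (Poly_Mapping.lookup x k) * g (fst k) (snd k))" for x
  have sup: "raw x = (\<Sum>k\<in>S. of_int (Poly_Mapping.lookup x k) * g (fst k) (snd k))"
    if "finite S" "Poly_Mapping.keys x \<subseteq> S" for x S
    unfolding raw_def using that by (intro sum.mono_neutral_left) (auto simp: in_keys_iff)
  have diff: "raw (x - y) = raw x - raw y" for x y
  proof -
    let ?S = "Poly_Mapping.keys x \<union> Poly_Mapping.keys y"
    have "Poly_Mapping.keys (x - y) \<subseteq> ?S" by (auto simp: in_keys_iff lookup_minus)
    then show ?thesis
      by (subst (1 2 3) sup[of ?S]) (auto simp: lookup_minus left_diff_distrib sum_subtractf)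
  qed
  have of: "raw (frag_of (a, b)) = g a b" for a b
    by (subst sup[of "{(a, b)}"]) auto
  have rel: "raw x = 0" if "x \<in> tensor_relations" for x
    using that
  proof induction
    case zero show ?case by (simp add: raw_def)
  qed (simp_all add: diff of l r)
  define K where "K z = raw (rep_tensor z)" for z
  have abs: "K (abs_tensor x) = raw x" for x
  proof -
    have "rep_tensor (abs_tensor x) - x \<in> tensor_relations"
      by (rule Quotient3_rep_abs[OF Quotient3_tensor]) (simp add: tensor_relations.zero)
    then have "raw (rep_tensor (abs_tensor x) - x) = 0" by (rule rel)
    then show ?thesis by (simp add: K_def diff)
  qed
  have "K (x - y) = K x - K y" for x y
  proof -
    have "abs_tensor (rep_tensor x - rep_tensor y) = abs_tensor (rep_tensor x) - abs_tensor (rep_tensor y)"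
      by (rule minus_tensor.abs_eq[symmetric])
    then have "x - y = abs_tensor (rep_tensor x - rep_tensor y)"
      by (simp only: Quotient3_abs_rep[OF Quotient3_tensor])
    then have "K (x - y) = raw (rep_tensor x - rep_tensor y)" by (simp only: abs)
    then show ?thesis by (simp only: diff K_def)
  qed
  moreover have "K (tens a b) = g a b" for a b
    by (simp add: tens.abs_eq abs of)
  ultimately show ?thesis by blast
qed

text \<open>The contraction id \<otimes> l. Its existence depends on l being additive, hence the
  choice operator.\<close>

definition kappa :: "('m \<Rightarrow> 'k) \<Rightarrow> ('k::field ambient, 'm::ab_group_add) tensor \<Rightarrow> 'k ambient" where
  "kappa l = (SOME K. (\<forall>x y. K (x - y) = K x - K y) \<and> (\<forall>a b. K (tens a b) = scale_ambient (l b) a))"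

lemma
  assumes l: "\<And>x y. l (x + y) = l x + l y"
  shows kappa_diff: "kappa l (x - y) = kappa l x - kappa l y"
    and kappa_tens: "kappa l (tens a b) = scale_ambient (l b) a"
proof -
  have "\<exists>K. (\<forall>x y. K (x - y) = K x - K y) \<and> (\<forall>a b. K (tens a b) = scale_ambient (l b) a)"
    by (rule tensor_extend) (simp_all add: l amb.scale_left_distrib amb.scale_right_distrib)
  from someI_ex[OF this] have k: "(\<forall>x y. kappa l (x - y) = kappa l x - kappa l y) \<and>
      (\<forall>a b. kappa l (tens a b) = scale_ambient (l b) a)"
    unfolding kappa_def .
  show "kappa l (x - y) = kappa l x - kappa l y" "kappa l (tens a b) = scale_ambient (l b) a"
    using k by blast+
qed

text \<open>Additivity is stated with differences to match \<open>tensor_induct\<close>; the second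
  condition is linearity over the whole exterior algebra, not only over the field.\<close>

definition amb_linear :: "(('k::field ambient, 'm::ab_group_add) tensor \<Rightarrow> 'k ambient) \<Rightarrow> bool" where
  "amb_linear E \<longleftrightarrow> (\<forall>x y. E (x - y) = E x - E y) \<and> (\<forall>r z. E (act r z) = r * E z)"

lemma amb_linear_0: "amb_linear E \<Longrightarrow> E 0 = 0"
  unfolding amb_linear_def by (metis diff_self)

lemma amb_linear_add: "amb_linear E \<Longrightarrow> E (x + y) = E x + E y"
  using amb_linear_0[of E] unfolding amb_linear_def
  by (metis add.right_neutral add_diff_cancel_left' diff_add_cancel)

lemma amb_linear_sum: "amb_linear E \<Longrightarrow> E (sum f I) = (\<Sum>i\<in>I. E (f i))"
  by (induction I rule: infinite_finite_induct) (simp_all add: amb_linear_0 amb_linear_add)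

lemma amb_linear_scale: "amb_linear E \<Longrightarrow> E (scale_tensor c z) = scale_ambient c (E z)"
  unfolding amb_linear_def scale_tensor_def scale_ambient_def by simp

lemma amb_linear_kappa:
  assumes l: "\<And>x y. l (x + y) = l x + l y"
  shows "amb_linear (kappa l)"
proof -
  have "kappa l (act r z) = r * kappa l z" for r z
  proof (induction z rule: tensor_induct)
    case zero
    show ?case using kappa_diff[OF l, of 0 0] by simp
  qed (simp_all add: kappa_tens[OF l] kappa_diff[OF l] act_diff scale_ambient_mult_right right_diff_distrib)
  then show ?thesis unfolding amb_linear_def using kappa_diff[OF l] by blast
qed

lemma linear_on_add: "linear_on sc1 sc2 W f \<Longrightarrow> x \<in> W \<Longrightarrow> y \<in> W \<Longrightarrow> f (x + y) = f x + f y"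
  and linear_on_scale: "linear_on sc1 sc2 W f \<Longrightarrow> x \<in> W \<Longrightarrow> f (sc1 c x) = sc2 c (f x)"
  by (auto simp: linear_on_def)

lemma linear_on_unique:
  assumes "linear_on scale_tensor (*) (tv.span G) f" "linear_on scale_tensor (*) (tv.span G) g"
    and "\<And>z. z \<in> G \<Longrightarrow> f z = g z" and z: "z \<in> tv.span G"
  shows "f z = g z"
proof -
  have 0: "f 0 = 0" "g 0 = 0"
    using linear_on_scale[OF assms(1) tv.span_zero, of 0] linear_on_scale[OF assms(2) tv.span_zero, of 0] by simp_all
  have "z \<in> tv.span G \<and> f z = g z"
    using z
  proof (induction rule: tv.span_induct_alt)
    case base then show ?case using 0 tv.span_zero by simp
  next
    case (step c x y)
    then have x: "x \<in> tv.span G" by (simp add: tv.span_base)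
    then show ?case
      using step assms(3)[of x] tv.span_scale[OF x, of c]
      by (simp add: linear_on_add[OF assms(1)] linear_on_add[OF assms(2)] linear_on_scale[OF assms(1)]
          linear_on_scale[OF assms(2)] tv.span_add)
  qed
  then show ?thesis ..
qed

lemma act_span:
  assumes "f \<in> amb.span X" "\<And>x. x \<in> X \<Longrightarrow> act x z \<in> tv.span Y"
  shows "act f z \<in> tv.span Y"
  using assms(1)
  by (induction rule: amb.span_induct_alt)
    (simp_all add: tv.span_zero act_add_left act_scale tv.span_add tv.span_scale assms(2))

subsection \<open>The functionals represented by $Q^I \otimes l$\<close>

context unstable_setup
begin

lemma M_induct [case_names zero homogeneous add]:
  assumes "Q 0" "\<And>n x. x \<in> M n \<Longrightarrow> Q x" "\<And>x y. Q x \<Longrightarrow> Q y \<Longrightarrow> Q (x + y)"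
  shows "Q x"
proof -
  obtain c :: "int \<Rightarrow>\<^sub>0 'm" where c: "\<And>n. Poly_Mapping.lookup c n \<in> M n"
      "x = (\<Sum>n\<in>Poly_Mapping.keys c. Poly_Mapping.lookup c n)"
    using direct_sum[of x] by blast
  have "Q (\<Sum>n\<in>S. Poly_Mapping.lookup c n)" if "finite S" for S
    using that
  proof induction
    case (insert n S)
    then show ?case using assms(3)[OF assms(2)[OF c(1)[of n]] insert.IH] by simp
  qed (simp add: assms(1))
  then show ?thesis using c(2) by simp
qed

text \<open>Instability bounds the last letter, which acts first, by \<epsilon> + 2i \<le> n; the
  others follow by induction. So the sum defining S_s(x) is finite.\<close>

lemma finite_words_homogeneous: "x \<in> M n \<Longrightarrow> finite {I. length I = s \<and> steenrod_word bock P I x \<noteq> 0}"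
proof (induction s arbitrary: x n)
  case 0
  have "{I :: (bool \<times> nat) list. length I = 0 \<and> steenrod_word bock P I x \<noteq> 0} \<subseteq> {[]}" by auto
  then show ?case by (rule finite_subset) simp
next
  case (Suc s)
  let ?L = "UNIV \<times> {..nat n} :: (bool \<times> nat) set"
  have sub: "{I. length I = Suc s \<and> steenrod_word bock P I x \<noteq> 0} \<subseteq>
    (\<Union>y\<in>?L. (\<lambda>I. I @ [y]) ` {I. length I = s \<and> steenrod_word bock P I (steenrod_letter bock P y x) \<noteq> 0})"
  proof
    fix I assume "I \<in> {I. length I = Suc s \<and> steenrod_word bock P I x \<noteq> 0}"
    then have I: "length I = Suc s" "steenrod_word bock P I x \<noteq> 0" by auto
    then obtain I' y where y: "I = I' @ [y]" "length I' = s" by (cases I rule: rev_cases) auto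
    obtain e i where ei: "y = (e, i)" by (cases y)
    have w: "steenrod_word bock P I' (steenrod_letter bock P y x) \<noteq> 0" using I y by (simp add: steenrod_word_snoc)
    then have "steenrod_letter bock P (e, i) x \<noteq> 0" using word_0 ei by metis
    then have "of_bool e + 2 * int i \<le> n" using unstable[OF Suc.prems, of e i] by (meson not_le)
    moreover have "0 \<le> (of_bool e :: int)" by simp
    ultimately have "int i \<le> n" by linarith
    then have "y \<in> ?L" unfolding ei by simp
    then show "I \<in> (\<Union>y\<in>?L. (\<lambda>I. I @ [y]) ` {I. length I = s \<and> steenrod_word bock P I (steenrod_letter bock P y x) \<noteq> 0})"
      using y w by blast
  qed
  have fin: "finite {I. length I = s \<and> steenrod_word bock P I (steenrod_letter bock P y x) \<noteq> 0}" for y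
    using Suc.IH[OF letter_degree[OF Suc.prems, of "fst y" "snd y"]] by simp
  show ?case by (rule finite_subset[OF sub]) (intro finite_UN_I finite_imageI fin, simp)
qed

lemma finite_words: "finite {I. length I = s \<and> steenrod_word bock P I x \<noteq> 0}"
proof (induction x rule: M_induct)
  case zero
  then show ?case by (simp add: word_0)
next
  case (homogeneous n x)
  then show ?case by (rule finite_words_homogeneous)
next
  case (add x y)
  have "{I. length I = s \<and> steenrod_word bock P I (x + y) \<noteq> 0} \<subseteq>
    {I. length I = s \<and> steenrod_word bock P I x \<noteq> 0} \<union> {I. length I = s \<and> steenrod_word bock P I y \<noteq> 0}"
    by (auto simp: word_add)
  then show ?case using add finite_subset by blast
qed

lemma singer_superset:
  assumes "finite S" "S \<subseteq> {I. length I = s}" "{I. length I = s \<and> steenrod_word bock P I x \<noteq> 0} \<subseteq> S"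
  shows "singer bock P s x = (\<Sum>I\<in>S. tens (singer_coef s I :: 'k ambient) (steenrod_word bock P I x))"
  unfolding singer_def singer_coef_def
  using assms by (intro sum.mono_neutral_left) auto

lemma singer_add: "singer bock P s (x + y) = (singer bock P s x + singer bock P s y :: ('k ambient, 'm) tensor)"
proof -
  let ?S = "{I. length I = s \<and> steenrod_word bock P I x \<noteq> 0} \<union> {I. length I = s \<and> steenrod_word bock P I y \<noteq> 0}"
  have S: "finite ?S" by (simp add: finite_words)
  show ?thesis
    by (subst (1 2 3) singer_superset[OF S]) (auto simp: word_add tens_add_right sum.distrib)
qed

lemma singer_0 [simp]: "singer bock P s 0 = (0 :: ('k ambient, 'm) tensor)"
  using singer_add[of s 0 0] by simp

text \<open>Functionals of degree n, as in \<open>dual_degree\<close>; the finiteness condition of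
  \<open>graded_dual\<close> is automatic for them.\<close>

definition hfun :: "int \<Rightarrow> ('m \<Rightarrow> 'k) \<Rightarrow> bool" where
  "hfun n l \<longleftrightarrow> linear_on scale (*) UNIV l \<and> (\<forall>j. j \<noteq> n \<longrightarrow> (\<forall>x\<in>M j. l x = 0))"

lemma hfun_add: "hfun n l \<Longrightarrow> l (x + y) = l x + l y"
  and hfun_scale: "hfun n l \<Longrightarrow> l (scale c x) = c * l x"
  by (auto simp: hfun_def linear_on_def)

lemma hfun_0: "hfun n l \<Longrightarrow> l 0 = 0"
  using hfun_scale[of n l 0 0] by simp

lemma word_deg_bound: "(e, i) \<in> set I \<Longrightarrow> of_bool e + int i \<le> word_deg CARD('k) I"
proof -
  assume m: "(e, i) \<in> set I"
  have "0 \<le> int CARD('k) - 1" using card_gt_0 by simp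
  then have nn: "0 \<le> of_bool e + 2 * int i * (int CARD('k) - 1)" for e i by simp
  have "of_bool e + 2 * int i * (int CARD('k) - 1) \<le> word_deg CARD('k) I"
    unfolding word_deg_def using m nn
    by (intro member_le_sum_list) (auto simp: image_iff intro!: bexI[of _ "(e, i)"])
  moreover have "int i * 1 \<le> int i * (2 * (int CARD('k) - 1))"
    using card_ge_3 by (intro mult_left_mono) auto
  moreover have "int i * (2 * (int CARD('k) - 1)) = 2 * int i * (int CARD('k) - 1)" by simp
  ultimately show ?thesis by linarith
qed

lemma finite_word_deg: "finite {I. length I = s \<and> word_deg CARD('k) I \<le> n}"
proof (rule finite_subset)
  show "{I. length I = s \<and> word_deg CARD('k) I \<le> n} \<subseteq> {I. set I \<subseteq> (UNIV :: bool set) \<times> {..nat n} \<and> length I = s}"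
  proof
    fix I assume I: "I \<in> {I. length I = s \<and> word_deg CARD('k) I \<le> n}"
    have "(e, i) \<in> UNIV \<times> {..nat n}" if "(e, i) \<in> set I" for e i
    proof -
      have "0 \<le> (of_bool e :: int)" by simp
      moreover have "word_deg CARD('k) I \<le> n" using I by simp
      ultimately have "int i \<le> n" using word_deg_bound[OF that] by linarith
      then show ?thesis by simp
    qed
    then show "I \<in> {I. set I \<subseteq> (UNIV :: bool set) \<times> {..nat n} \<and> length I = s}" using I by auto
  qed
  show "finite {I. set I \<subseteq> (UNIV :: bool set) \<times> {..nat n} \<and> length I = s}"
    by (rule finite_lists_length_eq) simp
qed

text \<open>Only the word of operations P^0 has degree at most 0. It acts as the identity and has
  coefficient 1, so it contributes the main term of S_s(x).\<close>

lemma trivial_word: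
  "word_deg CARD('k) (replicate s (False, 0)) = 0" 
  "singer_coef s (replicate s (False, 0)) = (1 :: 'k ambient)"
  "steenrod_word bock P (replicate s (False, 0)) x = x"
  "length I = s \<Longrightarrow> word_deg CARD('k) I \<le> 0 \<Longrightarrow> I = replicate s (False, 0)"
proof -
  show "word_deg CARD('k) (replicate s (False, 0)) = 0"
    by (induction s) (simp_all add: word_deg_def)
  have "(\<Sum>(e, i)\<leftarrow>replicate s (False, 0). of_bool e + i) = (0 :: nat)" by (induction s) simp_all
  moreover have "map (\<lambda>k. mui_u k ^ of_bool (fst (replicate s (False, 0 :: nat) ! (k - 1))) :: 'k ambient) (rev [1..<s + 1])
     = map (\<lambda>k. 1) (rev [1..<s + 1])"
    by (rule map_cong) auto
  moreover have "prod_list (map (\<lambda>k. 1 :: 'k ambient) xs) = 1" for xs :: "nat list" by (induction xs) auto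
  moreover have "(\<Prod>k=1..s. (mui_v k :: 'k ratfun) powi (- (int CARD('k) - 1) * int (snd (replicate s (False, 0 :: nat) ! (k - 1)))
      - of_bool (fst (replicate s (False, 0 :: nat) ! (k - 1))))) = 1"
    by (rule prod.neutral) auto
  ultimately show "singer_coef s (replicate s (False, 0)) = (1 :: 'k ambient)"
    unfolding singer_coef_def by (simp only: power_0 mult_1_left ext_const_1)
  show "steenrod_word bock P (replicate s (False, 0)) x = x"
    by (induction s) (simp_all add: steenrod_word_def steenrod_letter_def P_0)
  assume I: "length I = s" "word_deg CARD('k) I \<le> 0"
  have "y = (False, 0)" if "y \<in> set I" for y
  proof (cases y)
    case (Pair e i)
    have "0 \<le> (of_bool e :: int)" by simp
    then show ?thesis using word_deg_bound[of e i I] that I(2) Pair by (cases e) auto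
  qed
  then show "I = replicate s (False, 0)" using I(1) by (intro replicate_eqI) auto
qed

text \<open>\<open>E\<close> is constructed by induction on \<open>n\<close>: it is \<open>kappa l\<close>, corrected by the maps for the compositions of \<open>l\<close>
  with words of positive degree, which have smaller degree than \<open>l\<close>.\<close>

lemma coordinate_map:
  assumes "hfun n l"
  shows "\<exists>E. amb_linear E \<and> (\<forall>f x. E (act f (singer bock P s x)) = scale_ambient (l x) (f :: 'k ambient)) \<and>
    (\<forall>z. (\<forall>n' l'. hfun n' l' \<longrightarrow> kappa l' z = 0) \<longrightarrow> E z = 0)"
  using assms
proof (induction "nat (n + 1)" arbitrary: n l rule: less_induct)
  case less
  note l = less.prems
  let ?t = "replicate s (False, 0) :: (bool \<times> nat) list"
  show ?case
  proof (cases "n < 0")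
    case True
    have "l x = 0" for x
    proof (induction x rule: M_induct)
      case (homogeneous j x)
      then show ?case using l M_negative[of x j] True hfun_0[OF l] unfolding hfun_def by (cases "j = n") auto
    qed (simp_all add: hfun_0[OF l] hfun_add[OF l])
    then show ?thesis
      by (intro exI[of _ "\<lambda>z. 0"]) (simp add: amb_linear_def)
  next
    case False
    define F where "F = {I. length I = s \<and> word_deg CARD('k) I \<le> n} - {?t}"
    have fin: "finite F" unfolding F_def using finite_word_deg by simp
    have "\<exists>E. amb_linear E \<and> (\<forall>f x. E (act f (singer bock P s x)) = scale_ambient (l (steenrod_word bock P I x)) (f :: 'k ambient)) \<and>
      (\<forall>z. (\<forall>n' l'. hfun n' l' \<longrightarrow> kappa l' z = 0) \<longrightarrow> E z = 0)" if I: "I \<in> F" for I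
    proof -
      have pos: "word_deg CARD('k) I > 0"
        using trivial_word(4)[of I s] I unfolding F_def by (auto simp: not_le[symmetric])
      have "hfun (n - word_deg CARD('k) I) (\<lambda>x. l (steenrod_word bock P I x))"
        unfolding hfun_def
      proof (intro conjI allI impI ballI)
        have sc: "steenrod_word bock P I (scale c x) = scale c (steenrod_word bock P I x)" for c x
          using word_linear by (rule Vector_Spaces.linear.axioms(3)[THEN module_hom.scale, unfolded module_hom_iff_linear])
        show "linear_on scale (*) UNIV (\<lambda>x. l (steenrod_word bock P I x))"
          unfolding linear_on_def by (simp add: word_add sc hfun_add[OF l] hfun_scale[OF l])
        fix j x assume j: "j \<noteq> n - word_deg CARD('k) I" and x: "x \<in> M j"
        have "j + word_deg CARD('k) I \<noteq> n" using j by simp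
        then show "l (steenrod_word bock P I x) = 0"
          using word_degree[OF x, of I] l unfolding hfun_def by blast
      qed
      moreover have "nat (n - word_deg CARD('k) I + 1) < nat (n + 1)" using pos False by simp
      ultimately show ?thesis by (rule less.hyps[rotated])
    qed
    then obtain E where E: "\<And>I. I \<in> F \<Longrightarrow> amb_linear (E I)"
       "\<And>I f x. I \<in> F \<Longrightarrow> E I (act f (singer bock P s x)) = scale_ambient (l (steenrod_word bock P I x)) (f :: 'k ambient)"
       "\<And>I z. I \<in> F \<Longrightarrow> (\<And>n' l'. hfun n' l' \<Longrightarrow> kappa l' z = 0) \<Longrightarrow> E I z = 0"
      by metis
    have K: "amb_linear (kappa l)" by (rule amb_linear_kappa) (rule hfun_add[OF l])
    \<comment> \<open>The contraction of f S_s(x) is the sum of l(w x) f c_w over all words w, with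
      c_w the coefficient of w in S_s. By the inductive maps, the words in F contribute exactly the
      subtracted terms, and l(x) f remains. The coefficients stand on the right, which preserves
      left linearity.\<close>
    define E0 where "E0 z = kappa l z - (\<Sum>I\<in>F. E I z * singer_coef s I)" for z
    have "amb_linear E0"
      unfolding amb_linear_def
    proof (intro conjI allI)
      show "E0 (x - y) = E0 x - E0 y" for x y
        using K E(1) unfolding E0_def amb_linear_def
        by (simp add: left_diff_distrib sum_subtractf cong: sum.cong)
      show "E0 (act r z) = r * E0 z" for r z
        using K E(1) unfolding E0_def amb_linear_def
        by (simp add: right_diff_distrib sum_distrib_left mult.assoc cong: sum.cong)
    qed
    moreover have "E0 z = 0" if "\<And>n' l'. hfun n' l' \<Longrightarrow> kappa l' z = 0" for z
      using E(3) that l unfolding E0_def by simp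
    moreover have "E0 (act f (singer bock P s x)) = scale_ambient (l x) f" for f x
    proof -
      \<comment> \<open>Words of degree above n cannot reach degree n from the nonnegative degrees
        of M, so F omits nothing.\<close>
      have high: "l (steenrod_word bock P I x) = 0" if "word_deg CARD('k) I > n" for I
      proof (induction x rule: M_induct)
        case (homogeneous j x)
        show ?case
        proof (cases "j < 0")
          case True
          then show ?thesis using M_negative[OF homogeneous] by (simp add: word_0 hfun_0[OF l])
        next
          case False
          then have "j + word_deg CARD('k) I \<noteq> n" using that by simp
          then show ?thesis using word_degree[OF homogeneous, of I] l unfolding hfun_def by blast
        qed
      qed (simp_all add: word_0 word_add hfun_0[OF l] hfun_add[OF l])
      let ?S = "insert ?t F \<union> {I. length I = s \<and> steenrod_word bock P I x \<noteq> 0}"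
      have S: "finite ?S" "?S \<subseteq> {I. length I = s}" using fin finite_words by (auto simp: F_def)
      have sing: "singer bock P s x = (\<Sum>I\<in>?S. tens (singer_coef s I :: 'k ambient) (steenrod_word bock P I x))"
        by (rule singer_superset[OF S]) blast
      have "kappa l (act f (singer bock P s x)) =
          (\<Sum>I\<in>?S. scale_ambient (l (steenrod_word bock P I x)) (f * singer_coef s I))"
        unfolding sing act_sum act_tens amb_linear_sum[OF K]
        by (intro sum.cong refl kappa_tens hfun_add[OF l])
      also have "\<dots> = (\<Sum>I\<in>insert ?t F. scale_ambient (l (steenrod_word bock P I x)) (f * singer_coef s I))"
      proof (rule sum.mono_neutral_right[OF S(1)])
        show "\<forall>I\<in>?S - insert ?t F. scale_ambient (l (steenrod_word bock P I x)) (f * singer_coef s I) = 0"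
        proof
          fix I assume "I \<in> ?S - insert ?t F"
          then have "length I = s" "I \<notin> F" "I \<noteq> ?t" by auto
          then have "word_deg CARD('k) I > n" unfolding F_def by auto
          then show "scale_ambient (l (steenrod_word bock P I x)) (f * singer_coef s I) = 0"
            by (simp add: high)
        qed
      qed auto
      also have "\<dots> = scale_ambient (l x) f + (\<Sum>I\<in>F. scale_ambient (l (steenrod_word bock P I x)) (f * singer_coef s I))"
        using fin by (subst sum.insert) (auto simp: F_def trivial_word)
      finally show ?thesis
        unfolding E0_def by (simp add: E(2) scale_ambient_mult_left cong: sum.cong)
    qed
    ultimately show ?thesis by blast
  qed
qed

end

subsection \<open>Independence of the homogeneous parts\<close>

text \<open>D is a set so that the sum of all degrees other than d is covered by the complement of
  {d}.\<close>

definition polynomial_part :: "nat \<Rightarrow> int set \<Rightarrow> 'k::field ambient set" where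
  "polynomial_part s D = {f. \<forall>A. \<exists>g. ecoef f A = Fract g 1 \<and>
     (\<forall>m\<in>Poly_Mapping.keys g. int (fcard A) + 2 * int (\<Sum>i=1..s. Poly_Mapping.lookup m i) \<in> D)}"

lemma polynomial_part_subspace: "amb.subspace (polynomial_part s D :: 'k::field ambient set)"
proof (rule amb.subspaceI)
  show "(0 :: 'k ambient) \<in> polynomial_part s D"
    unfolding polynomial_part_def by (auto intro!: exI[of _ 0] simp: Zero_fract_def)
next
  fix f g :: "'k ambient" assume f: "f \<in> polynomial_part s D" and g: "g \<in> polynomial_part s D"
  show "f + g \<in> polynomial_part s D"
    unfolding polynomial_part_def
  proof (intro CollectI allI)
    fix A
    obtain a b where a: "ecoef f A = Fract a 1"
        "\<forall>m\<in>Poly_Mapping.keys a. int (fcard A) + 2 * int (\<Sum>i=1..s. Poly_Mapping.lookup m i) \<in> D"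
      and b: "ecoef g A = Fract b 1"
        "\<forall>m\<in>Poly_Mapping.keys b. int (fcard A) + 2 * int (\<Sum>i=1..s. Poly_Mapping.lookup m i) \<in> D"
      using f g unfolding polynomial_part_def by blast
    show "\<exists>c. ecoef (f + g) A = Fract c 1 \<and>
      (\<forall>m\<in>Poly_Mapping.keys c. int (fcard A) + 2 * int (\<Sum>i=1..s. Poly_Mapping.lookup m i) \<in> D)"
      using a b Poly_Mapping.keys_add[of a b] by (intro exI[of _ "a + b"]) (auto simp: ecoef_add)
  qed
next
  fix c :: 'k and f :: "'k ambient" assume f: "f \<in> polynomial_part s D"
  show "scale_ambient c f \<in> polynomial_part s D"
    unfolding polynomial_part_def
  proof (intro CollectI allI)
    fix A
    obtain a where a: "ecoef f A = Fract a 1"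
        "\<forall>m\<in>Poly_Mapping.keys a. int (fcard A) + 2 * int (\<Sum>i=1..s. Poly_Mapping.lookup m i) \<in> D"
      using f unfolding polynomial_part_def by blast
    have "Poly_Mapping.keys (Poly_Mapping.single 0 c * a) \<subseteq> Poly_Mapping.keys a"
      using Poly_Mapping.keys_mult[of "Poly_Mapping.single 0 c" a] by (auto split: if_splits)
    then show "\<exists>b. ecoef (scale_ambient c f) A = Fract b 1 \<and>
      (\<forall>m\<in>Poly_Mapping.keys b. int (fcard A) + 2 * int (\<Sum>i=1..s. Poly_Mapping.lookup m i) \<in> D)"
      using a by (intro exI[of _ "Poly_Mapping.single 0 c * a"])
        (auto simp: scale_ambient_def ecoef_ext_const_mult rconst_def)
  qed
qed

lemma yvar_power: "yvar i ^ n = (Fract (Poly_Mapping.single (Poly_Mapping.single i n) 1) 1 :: 'k::field ratfun)"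
  by (induction n) (simp_all add: yvar_def One_fract_def mult_single flip: single_add)

lemma yvar_monomial: "finite X \<Longrightarrow> (\<Prod>i\<in>X. yvar i ^ e i) =
    (Fract (Poly_Mapping.single (\<Sum>i\<in>X. Poly_Mapping.single i (e i)) 1) 1 :: 'k::field ratfun)"
  by (induction rule: finite_induct) (simp_all add: One_fract_def yvar_power mult_single)

lemma P_degree_polynomial_part: "P_degree s d \<subseteq> (polynomial_part s {d} :: 'k::field ambient set)"
  unfolding P_degree_alt
proof (rule amb.span_minimal[OF _ polynomial_part_subspace], rule subsetI)
  fix x :: "'k ambient" assume "x \<in> {xs.oprod A * ext_const (\<Prod>i=1..s. yvar i ^ e i) | A e.
        A \<subseteq> {1..s} \<and> int (card A) + 2 * int (\<Sum>i=1..s. e i) = d}"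
  then obtain A e where x: "x = xs.oprod A * ext_const (\<Prod>i=1..s. yvar i ^ e i)" "A \<subseteq> {1..s}"
      and d: "int (card A) + 2 * int (\<Sum>i=1..s. e i) = d" by blast
  have fin: "finite A" using x(2) finite_subset by blast
  define m where "m = (\<Sum>i=1..s. Poly_Mapping.single i (e i))"
  have lk: "Poly_Mapping.lookup m i = e i" if "i \<in> {1..s}" for i
    using that by (simp add: m_def lookup_sum lookup_single when_def)
  have "x = ext_const (\<Prod>i=1..s. yvar i ^ e i) * xmono (Abs_fset A) 1"
    unfolding x(1) xs_oprod[OF fin] by (rule ext_const_comm)
  then have "x = xmono (Abs_fset A) (Fract (Poly_Mapping.single m 1) 1)"
    by (simp add: ext_const_xmono yvar_monomial m_def)
  moreover have "fcard (Abs_fset A) = card A" using fin by (simp add: fcard.rep_eq Abs_fset_inverse)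
  moreover have "(\<Sum>i=1..s. Poly_Mapping.lookup m i) = (\<Sum>i=1..s. e i)" by (rule sum.cong) (simp_all add: lk)
  ultimately have x': "x = xmono (Abs_fset A) (Fract (Poly_Mapping.single m 1) 1)"
    and deg: "int (fcard (Abs_fset A)) + 2 * int (\<Sum>i=1..s. Poly_Mapping.lookup m i) = d"
    using d by (simp_all only:)
  show "x \<in> polynomial_part s {d}"
    unfolding polynomial_part_def
  proof (intro CollectI allI)
    fix C
    show "\<exists>g. ecoef x C = Fract g 1 \<and>
      (\<forall>m\<in>Poly_Mapping.keys g. int (fcard C) + 2 * int (\<Sum>i=1..s. Poly_Mapping.lookup m i) \<in> {d})"
    proof (cases "C = Abs_fset A")
      case True
      then show ?thesis
        using deg unfolding x' by (intro exI[of _ "Poly_Mapping.single m 1"]) (simp add: ecoef_xmono)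
    next
      case False
      then show ?thesis unfolding x' by (intro exI[of _ 0]) (simp add: ecoef_xmono Zero_fract_def)
    qed
  qed
qed

text \<open>The polynomial representing a coefficient is unique; all its monomials have total degree
  d and also total degree different from d, so there are none.\<close>

lemma P_degree_independent:
  fixes f :: "'k::field ambient"
  assumes "f \<in> P_degree s d" "f \<in> amb.span (\<Union>b\<in>- {d}. P_degree s b)"
  shows "f = 0"
proof (rule ext_eqI)
  fix A
  have "polynomial_part s {b} \<subseteq> (polynomial_part s (- {d}) :: 'k ambient set)" if "b \<noteq> d" for b
    unfolding polynomial_part_def using that by fastforce
  then have "(\<Union>b\<in>- {d}. P_degree s b) \<subseteq> (polynomial_part s (- {d}) :: 'k ambient set)"
    using P_degree_polynomial_part by blast
  then have "f \<in> polynomial_part s (- {d})"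
    using assms(2) amb.span_minimal[OF _ polynomial_part_subspace] by blast
  moreover have "f \<in> polynomial_part s {d}" using assms(1) P_degree_polynomial_part by blast
  ultimately obtain a b where a: "ecoef f A = Fract a 1"
      "\<forall>m\<in>Poly_Mapping.keys a. int (fcard A) + 2 * int (\<Sum>i=1..s. Poly_Mapping.lookup m i) \<in> {d}"
    and b: "ecoef f A = Fract b 1"
      "\<forall>m\<in>Poly_Mapping.keys b. int (fcard A) + 2 * int (\<Sum>i=1..s. Poly_Mapping.lookup m i) \<in> - {d}"
    unfolding polynomial_part_def by blast
  have "a = b" using a(1) b(1) by (simp add: eq_fract)
  then have "Poly_Mapping.keys a = {}" using a(2) b(2) by blast
  then show "ecoef f A = ecoef 0 A" using a(1) by (simp add: Zero_fract_def)
qed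

subsection \<open>Generators of the Singer construction\<close>

context unstable_setup
begin

definition singer_gens :: "nat \<Rightarrow> ('k ambient, 'm) tensor set" where
  "singer_gens s = {act (seq_bel CARD('k) I) (singer bock P s x) | I x n.
     n \<ge> 0 \<and> I \<in> admissible_sequences CARD('k) s n \<and> x \<in> M n}"

lemma St_scale:
  "\<exists>c. c * c = 1 \<and> (St bock P s (int N) x :: ('k ambient, 'm) tensor) =
     scale_tensor c (act (ext_const (dL s ^ ((CARD('k) - 1) div 2 * N))) (singer bock P s x))"
proof -
  define c :: 'k where "c = (if even (int s * (int N div 2)) then 1 else - 1)"
  have "((-1) powi (int s * (int N div 2)) :: 'k ratfun) = rconst c"
    unfolding c_def by (simp add: power_int_minus_left rconst_uminus)
  moreover have "(mui_L s :: 'k ratfun) powi (int ((CARD('k) - 1) div 2) * int N) = dL s ^ ((CARD('k) - 1) div 2 * N)"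
    unfolding mui_L_eq by (simp only: of_nat_mult[symmetric] power_int_of_nat)
  ultimately have "(St bock P s (int N) x :: ('k ambient, 'm) tensor) =
     scale_tensor c (act (ext_const (dL s ^ ((CARD('k) - 1) div 2 * N))) (singer bock P s x))"
    unfolding St_def scale_tensor_def act_act by (simp only: ext_const_mult)
  moreover have "c * c = 1" by (simp add: c_def)
  ultimately show ?thesis by blast
qed

lemma bel_set_cases:
  assumes "(b :: 'k ambient) \<in> bel_set s (int N)"
  obtains a J where "b = bel s a J" "J \<subseteq> {..<s}" "int (card J) + int N \<le> 2 * int (a 0)"
  using assms unfolding bel_set_def by blast

lemma act_St_in_span:
  assumes f: "f \<in> B_mod (odd n) s" and x: "x \<in> M n"
  shows "act f (St bock P s n x) \<in> tv.span (singer_gens s)"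
proof (cases "n < 0")
  case True
  then have "x = 0" using M_negative x by blast
  then show ?thesis by (simp add: St_def tv.span_zero)
next
  case False
  then obtain N where n: "n = int N" using nonneg_int_cases by (metis not_less)
  obtain c where c: "(St bock P s (int N) x :: ('k ambient, 'm) tensor) =
     scale_tensor c (act (ext_const (dL s ^ ((CARD('k) - 1) div 2 * N))) (singer bock P s x))"
    using St_scale by blast
  have "f * ext_const (dL s ^ ((CARD('k) - 1) div 2 * N)) \<in> amb.span (bel_set s (int N) :: 'k ambient set)"
    using f by (rule B_mod_bel_span) (simp add: n)
  then have "act (f * ext_const (dL s ^ ((CARD('k) - 1) div 2 * N))) (singer bock P s x) \<in> tv.span (singer_gens s)"
  proof (rule act_span)
    fix b :: "'k ambient" assume "b \<in> bel_set s (int N)"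
    then obtain I where "b = seq_bel CARD('k) I" "I \<in> admissible_sequences CARD('k) s (int N)"
      unfolding bel_set_eq[OF of_nat_0_le_iff] by blast
    then show "act b (singer bock P s x) \<in> tv.span (singer_gens s)"
      using x n unfolding singer_gens_def by (intro tv.span_base) (use of_nat_0_le_iff in blast)
  qed
  then show ?thesis
    unfolding n c act_scale_tensor act_act by (rule tv.span_scale)
qed

lemma act_bel_in_St_span:
  assumes b: "(b :: 'k ambient) \<in> bel_set s (int N)" and x: "x \<in> M (int N)"
  shows "\<exists>c. \<exists>f\<in>B_mod (odd N) s. act b (singer bock P s x) = scale_tensor c (act f (St bock P s (int N) x))"
proof -
  obtain a J where aJ: "b = bel s a J" "J \<subseteq> {..<s}" "int (card J) + int N \<le> 2 * int (a 0)"
    using b by (rule bel_set_cases)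
  obtain f where f: "f \<in> B_mod (odd N) s" "b = f * ext_const (dL s ^ ((CARD('k) - 1) div 2 * N))"
    using bel_B_mod[of J s N a "odd N", OF aJ(2,3) refl] unfolding aJ(1) by blast
  obtain c where c: "c * c = 1" "(St bock P s (int N) x :: ('k ambient, 'm) tensor) =
     scale_tensor c (act (ext_const (dL s ^ ((CARD('k) - 1) div 2 * N))) (singer bock P s x))"
    using St_scale by blast
  have "scale_tensor c (act f (St bock P s (int N) x)) = act b (singer bock P s x)"
    unfolding c(2) act_scale_tensor tv.scale_scale c(1) f(2) act_act by simp
  then show ?thesis using f(1) by metis
qed

text \<open>For m of degree n, f St_s(m) is (f L_s^((p-1)n/2)) S_s(m) up to sign. The elements f
  L_s^((p-1)n/2), with f in the module for the parity of n, span the same space as the b_I with e(I)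
  \<ge> n.\<close>

lemma singer_module_eq: "(singer_module bock P M s :: ('k ambient, 'm) tensor set) = tv.span (singer_gens s)"
proof -
  let ?X = "{act f (St bock P s n m) | f n m. f \<in> B_even s \<and> even n \<and> m \<in> M n} :: ('k ambient, 'm) tensor set"
  let ?Y = "{act f (St bock P s n m) | f n m. f \<in> B_odd s \<and> odd n \<and> m \<in> M n} :: ('k ambient, 'm) tensor set"
  have "singer_module bock P M s = tv.span (?X \<union> ?Y)"
    unfolding singer_module_def tv.span_Un by auto
  also have "\<dots> = tv.span (singer_gens s)"
    unfolding tv.span_eq
  proof (intro conjI subsetI)
    fix z assume "z \<in> ?X \<union> ?Y"
    then show "z \<in> tv.span (singer_gens s)"
    proof
      assume "z \<in> ?X"
      then obtain f n m where f: "f \<in> B_mod False s" "even n" "m \<in> M n" and z: "z = act f (St bock P s n m)"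
        unfolding B_even_eq by blast
      show ?thesis using act_St_in_span[of f n s m] f unfolding z by simp
    next
      assume "z \<in> ?Y"
      then obtain f n m where f: "f \<in> B_mod True s" "odd n" "m \<in> M n" and z: "z = act f (St bock P s n m)"
        unfolding B_odd_eq by blast
      show ?thesis using act_St_in_span[of f n s m] f unfolding z by simp
    qed
  next
    fix z assume "z \<in> singer_gens s"
    then obtain I x n where z: "z = act (seq_bel CARD('k) I) (singer bock P s x)" and n: "n \<ge> 0"
      and I: "I \<in> admissible_sequences CARD('k) s n" and x: "x \<in> M n"
      unfolding singer_gens_def by blast
    obtain N where N: "n = int N" using n nonneg_int_cases by metis
    obtain c f where f: "f \<in> B_mod (odd N) s" "z = scale_tensor c (act f (St bock P s (int N) x))"
      using act_bel_in_St_span[OF seq_bel_in[OF I n, unfolded N] x[unfolded N]] z by blast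
    have "act f (St bock P s (int N) x) \<in> ?X \<union> ?Y"
    proof (cases "odd N")
      case True
      then have "act f (St bock P s (int N) x) \<in> ?Y"
        using f(1) x unfolding N B_odd_eq by (intro CollectI exI[of _ f] exI[of _ "int N"] exI[of _ x]) simp
      then show ?thesis by (rule UnI2)
    next
      case False
      then have "act f (St bock P s (int N) x) \<in> ?X"
        using f(1) x unfolding N B_even_eq by (intro CollectI exI[of _ f] exI[of _ "int N"] exI[of _ x]) simp
      then show ?thesis by (rule UnI1)
    qed
    then show "z \<in> tv.span (?X \<union> ?Y)" unfolding f(2) by (intro tv.span_scale tv.span_base)
  qed
  finally show ?thesis .
qed

text \<open>The bound for n \<ge> 0 implies the bound for 0, which describes the even module. Thus
  \<open>singer_module\<close> lies in \<open>B_singer\<close>, where the pairing is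
  defined.\<close>

lemma bel_set_B_even: "(b :: 'k ambient) \<in> bel_set s n \<Longrightarrow> n \<ge> 0 \<Longrightarrow> b \<in> B_even s"
proof -
  assume "b \<in> bel_set s n" "n \<ge> 0"
  then have "b \<in> bel_set s (int 0)" unfolding bel_set_def by force
  then obtain a J where aJ: "b = bel s a J" "J \<subseteq> {..<s}" "int (card J) + int 0 \<le> 2 * int (a 0)"
    by (rule bel_set_cases)
  show "b \<in> B_even s" using bel_B_mod[of J s 0 a False, OF aJ(2,3)] aJ(1) unfolding B_even_eq by auto
qed

lemma B_even_uv_space: "B_even s \<subseteq> (uv_space s :: 'k ambient set)"
proof
  fix f :: "'k ambient" assume "f \<in> B_even s"
  then have "f \<in> amb.span (bel_set s 0)"
    using B_mod_bel_span[of f False s 0] unfolding B_even_eq by simp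
  moreover have "bel_set s 0 \<subseteq> (uv_space s :: 'k ambient set)"
    unfolding bel_set_eq[OF order_refl] using seq_bel_uv_space by blast
  ultimately show "f \<in> uv_space s"
    unfolding uv_space_def using amb.span_minimal[OF _ amb.subspace_span] by blast
qed

lemma singer_gens_B_singer: "singer_gens s \<subseteq> B_singer bock P s"
proof
  fix z assume "z \<in> singer_gens s"
  then obtain I x n where z: "z = act (seq_bel CARD('k) I) (singer bock P s x)" and n: "n \<ge> 0"
    and I: "I \<in> admissible_sequences CARD('k) s n"
    unfolding singer_gens_def by blast
  show "z \<in> B_singer bock P s"
    unfolding B_singer_def z using bel_set_B_even[OF seq_bel_in[OF I n] n] by (intro tv.span_base) blast
qed

lemma singer_module_B_singer: "singer_module bock P M s \<subseteq> (B_singer bock P s :: ('k ambient, 'm) tensor set)"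
proof -
  have "tv.span (singer_gens s) \<subseteq> B_singer bock P s"
    using tv.span_minimal[OF singer_gens_B_singer[unfolded B_singer_def] tv.subspace_span] unfolding B_singer_def .
  then show ?thesis by (simp only: singer_module_eq)
qed

lemma coordinate_uv_space:
  assumes E: "amb_linear E" "\<And>f x. E (act f (singer bock P s x)) = scale_ambient (l x) (f :: 'k ambient)"
    and z: "z \<in> B_singer bock P s"
  shows "E z \<in> uv_space s"
  using z unfolding B_singer_def
proof (induction rule: tv.span_induct_alt)
  case base
  show ?case by (simp add: amb_linear_0[OF E(1)] uv_space_def amb.span_zero)
next
  case (step c x y)
  then obtain f m where f: "f \<in> B_even s" "x = act f (singer bock P s m)" by blast
  have "f \<in> uv_space s" using f(1) B_even_uv_space by blast
  then have "E x \<in> uv_space s" unfolding f(2) E(2) uv_space_def by (rule amb.span_scale)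
  then show ?case
    using step by (simp add: amb_linear_add[OF E(1)] amb_linear_scale[OF E(1)] uv_space_def amb.span_add amb.span_scale)
qed

text \<open>Evaluates the \<open>THE\<close>: the coordinate map E provides a functional with the
  prescribed values, and these determine it because the products f S_s(m) span.\<close>

lemma pairing_eq:
  assumes I: "length I = s"
    and E: "amb_linear E" "\<And>f x. E (act f (singer bock P s x)) = scale_ambient (l x) (f :: 'k ambient)"
    and z: "z \<in> B_singer bock P s"
  shows "pairing bock P I l z = nu (E z) I"
proof -
  define \<psi>0 where "\<psi>0 z = (if z \<in> B_singer bock P s then nu (E z) I else 0)" for z :: "('k ambient, 'm) tensor"
  have uv: "E z \<in> uv_space (length I)" if "z \<in> B_singer bock P s" for z
    using coordinate_uv_space[OF E that] I by simp
  have lin: "linear_on scale_tensor (*) (B_singer bock P s) \<psi>0"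
    unfolding linear_on_def
  proof (intro conjI ballI allI)
    fix x y :: "('k ambient, 'm) tensor" assume xy: "x \<in> B_singer bock P s" "y \<in> B_singer bock P s"
    then have "x + y \<in> B_singer bock P s" unfolding B_singer_def by (rule tv.span_add)
    then show "\<psi>0 (x + y) = \<psi>0 x + \<psi>0 y" using xy by (simp add: \<psi>0_def amb_linear_add[OF E(1)] nu_add uv)
  next
    fix c :: 'k and x :: "('k ambient, 'm) tensor" assume x: "x \<in> B_singer bock P s"
    then have "scale_tensor c x \<in> B_singer bock P s" unfolding B_singer_def by (rule tv.span_scale)
    then show "\<psi>0 (scale_tensor c x) = c * \<psi>0 x" using x by (simp add: \<psi>0_def amb_linear_scale[OF E(1)] nu_scale uv)
  qed
  have val: "\<psi>0 (act f (singer bock P s x)) = nu f I * l x" if "f \<in> B_even s" for f x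
  proof -
    have "act f (singer bock P s x) \<in> B_singer bock P s"
      unfolding B_singer_def using that by (intro tv.span_base) blast
    moreover have "f \<in> uv_space (length I)" using that B_even_uv_space I by blast
    ultimately show ?thesis by (simp add: \<psi>0_def E(2) nu_scale)
  qed
  have "pairing bock P I l = \<psi>0"
    unfolding pairing_def I
  proof (rule the_equality)
    show "linear_on scale_tensor (*) (B_singer bock P s) \<psi>0 \<and> (\<forall>z. z \<notin> B_singer bock P s \<longrightarrow> \<psi>0 z = 0) \<and>
        (\<forall>f\<in>B_even s. \<forall>m. \<psi>0 (act f (singer bock P s m)) = nu f I * l m)"
      using lin val by (auto simp: \<psi>0_def)
  next
    fix \<psi> :: "('k ambient, 'm) tensor \<Rightarrow> 'k"
    assume a: "linear_on scale_tensor (*) (B_singer bock P s) \<psi> \<and> (\<forall>z. z \<notin> B_singer bock P s \<longrightarrow> \<psi> z = 0) \<and>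
        (\<forall>f\<in>B_even s. \<forall>m. \<psi> (act f (singer bock P s m)) = nu f I * l m)"
    show "\<psi> = \<psi>0"
    proof
      fix z
      show "\<psi> z = \<psi>0 z"
      proof (cases "z \<in> B_singer bock P s")
        case True
        let ?G = "{act f (singer bock P s m) | f m. f \<in> B_even s} :: ('k ambient, 'm) tensor set"
        have B: "B_singer bock P s = tv.span ?G" by (simp only: B_singer_def)
        show ?thesis
        proof (rule linear_on_unique[of ?G])
          show "linear_on scale_tensor (*) (tv.span ?G) \<psi>" using a unfolding B by (rule conjunct1)
          show "linear_on scale_tensor (*) (tv.span ?G) \<psi>0" using lin unfolding B .
          show "z \<in> tv.span ?G" using True unfolding B .
          fix y assume "y \<in> ?G"
          then obtain f m where f: "f \<in> B_even s" and y: "y = act f (singer bock P s m)" by blast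
          from a have "\<psi> y = nu f I * l m" unfolding y using f by blast
          then show "\<psi> y = \<psi>0 y" unfolding y using val[OF f] by simp
        qed
      next
        case False
        then show ?thesis using a by (simp add: \<psi>0_def)
      qed
    qed
  qed
  then show ?thesis using z by (simp add: \<psi>0_def)
qed

end

section \<open>Triangular systems and independent families of functionals\<close>

lemma sum_apply: "(\<Sum>i\<in>I. f i) x = (\<Sum>i\<in>I. f i x :: 'b::comm_monoid_add)"
  by (induction I rule: infinite_finite_induct) (simp_all add: zero_fun_def)

lemma ltv_minimal_element:
  assumes "finite A" "A \<noteq> {}"
  shows "\<exists>m\<in>A. \<forall>x\<in>A. \<not> ltv s (f x) (f m)" and "\<exists>m\<in>A. \<forall>x\<in>A. \<not> ltv s (f m) (f x)"
proof -
  have as: "asymp_on A (\<lambda>x y. ltv s (f x) (f y))"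
    using ltv_trans[of s] ltv_irrefl[of s] by (intro asymp_onI) blast
  have tr: "transp_on A (\<lambda>x y. ltv s (f x) (f y))"
    using ltv_trans[of s] by (intro transp_onI) blast
  show "\<exists>m\<in>A. \<forall>x\<in>A. \<not> ltv s (f x) (f m)"
    using Finite_Set.bex_min_element[OF assms(1) as tr assms(2)] ltv_irrefl[of s] by metis
  show "\<exists>m\<in>A. \<forall>x\<in>A. \<not> ltv s (f m) (f x)"
    using Finite_Set.bex_max_element[OF assms(1) as tr assms(2)] ltv_irrefl[of s] by metis
qed

text \<open>The unknowns h and the right-hand sides g are vectors of V. For a maximal index m,
  column m is zero outside row m, so the system without m is solved first and row m then determines
  h m.\<close>

lemma triangular_solve:
  fixes A :: "'i \<Rightarrow> 'i \<Rightarrow> 'k::field" and g :: "'i \<Rightarrow> 'v \<Rightarrow> 'k"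
  assumes V: "fs.subspace V"
    and X: "finite X" "\<And>i. i \<in> X \<Longrightarrow> g i \<in> V" "\<And>i. i \<in> X \<Longrightarrow> A i i \<noteq> 0"
      "\<And>i j. i \<in> X \<Longrightarrow> j \<in> X \<Longrightarrow> A i j \<noteq> 0 \<Longrightarrow> j = i \<or> ltv s (v j) (v i)"
  shows "\<exists>h. (\<forall>i. h i \<in> V) \<and> (\<forall>i\<in>X. (\<Sum>j\<in>X. scale_fun (A i j) (h j)) = g i)"
  using X
proof (induction "card X" arbitrary: X)
  case 0
  then show ?case using fs.subspace_0[OF V] by (intro exI[of _ "\<lambda>_. 0"]) (simp add: zero_fun_def)
next
  case (Suc n)
  then obtain m where m: "m \<in> X" "\<forall>x\<in>X. \<not> ltv s (v m) (v x)"
    using ltv_minimal_element(2)[of X s v] by force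
  have "\<exists>h. (\<forall>i. h i \<in> V) \<and> (\<forall>i\<in>X - {m}. (\<Sum>j\<in>X - {m}. scale_fun (A i j) (h j)) = g i)"
    by (rule Suc.hyps(1)) (use Suc.prems Suc.hyps(2) m(1) in auto)
  then obtain h where h: "\<And>i. h i \<in> V" "\<And>i. i \<in> X - {m} \<Longrightarrow> (\<Sum>j\<in>X - {m}. scale_fun (A i j) (h j)) = g i"
    by blast
  define hm where "hm = scale_fun (inverse (A m m)) (g m - (\<Sum>j\<in>X - {m}. scale_fun (A m j) (h j)))"
  have hm: "hm \<in> V"
    unfolding hm_def
    by (intro fs.subspace_scale[OF V] fs.subspace_diff[OF V] fs.subspace_sum[OF V] h(1) Suc.prems(2) m(1))
  have sum: "(\<Sum>j\<in>X. scale_fun (A i j) ((h(m := hm)) j)) =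
      scale_fun (A i m) hm + (\<Sum>j\<in>X - {m}. scale_fun (A i j) (h j))" for i
  proof -
    have "(\<Sum>j\<in>X. scale_fun (A i j) ((h(m := hm)) j)) =
      scale_fun (A i m) hm + (\<Sum>j\<in>X - {m}. scale_fun (A i j) ((h(m := hm)) j))"
      using sum.remove[OF Suc.prems(1) m(1), of "\<lambda>j. scale_fun (A i j) ((h(m := hm)) j)"] by simp
    also have "(\<Sum>j\<in>X - {m}. scale_fun (A i j) ((h(m := hm)) j)) = (\<Sum>j\<in>X - {m}. scale_fun (A i j) (h j))"
      by (rule sum.cong) auto
    finally show ?thesis .
  qed
  have "(\<Sum>j\<in>X. scale_fun (A i j) ((h(m := hm)) j)) = g i" if i: "i \<in> X" for i
  proof (cases "i = m")
    case True
    have "scale_fun (A m m) hm = g m - (\<Sum>j\<in>X - {m}. scale_fun (A m j) (h j))"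
      using Suc.prems(3)[OF m(1)] unfolding hm_def by simp
    then show ?thesis unfolding sum True by simp
  next
    case False
    then have "A i m = 0" using Suc.prems(4)[OF i m(1)] m(2) i by blast
    then show ?thesis unfolding sum using h(2) False i by simp
  qed
  moreover have "\<forall>i. (h(m := hm)) i \<in> V" using h(1) hm by simp
  ultimately show ?case by blast
qed

lemma family_independent:
  fixes f :: "'i \<Rightarrow> 'v \<Rightarrow> 'k::field"
  assumes "\<And>T c t. finite T \<Longrightarrow> T \<subseteq> S \<Longrightarrow> (\<Sum>t\<in>T. scale_fun (c t) (f t)) = 0 \<Longrightarrow> t \<in> T \<Longrightarrow> c t = 0"
  shows "inj_on f S" and "\<not> fs.dependent (f ` S)"
proof -
  show inj: "inj_on f S"
  proof (rule inj_onI, rule ccontr)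
    fix t t' assume t: "t \<in> S" "t' \<in> S" "f t = f t'" "t \<noteq> t'"
    have "(\<Sum>i\<in>{t, t'}. scale_fun ((\<lambda>i. if i = t then 1 else - 1) i) (f i)) = 0"
      using t(3,4) by (simp add: fs.scale_minus_left)
    then show False
      using assms[of "{t, t'}" "\<lambda>i. if i = t then 1 else - 1" t] t(1,2) by simp
  qed
  show "\<not> fs.dependent (f ` S)"
  proof
    assume "fs.dependent (f ` S)"
    then obtain U u where U: "finite U" "U \<subseteq> f ` S" "(\<Sum>v\<in>U. scale_fun (u v) v) = 0" "\<exists>v\<in>U. u v \<noteq> 0"
      unfolding fs.dependent_explicit by blast
    obtain T where T: "T \<subseteq> S" "finite T" "U = f ` T" using finite_subset_image[OF U(1,2)] by blast
    have "(\<Sum>t\<in>T. scale_fun (u (f t)) (f t)) = 0"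
      using U(3) unfolding T(3) by (subst (asm) sum.reindex) (use inj T(1) inj_on_subset in \<open>auto simp: o_def\<close>)
    then have "u (f t) = 0" if "t \<in> T" for t using assms[OF T(2,1), of "\<lambda>t. u (f t)"] that by blast
    then show False using U(4) T(3) by blast
  qed
qed

lemma graded_dual_subspace: "fs.subspace (graded_dual sc W C)"
proof (rule fs.subspaceI)
  show "0 \<in> graded_dual sc W C" by (simp add: graded_dual_def linear_on_def)
next
  fix f g assume f: "f \<in> graded_dual sc W C" and g: "g \<in> graded_dual sc W C"
  have "{n. \<exists>z\<in>W \<inter> C n. (f + g) z \<noteq> 0} \<subseteq>
    {n. \<exists>z\<in>W \<inter> C n. f z \<noteq> 0} \<union> {n. \<exists>z\<in>W \<inter> C n. g z \<noteq> 0}" by force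
  then show "f + g \<in> graded_dual sc W C"
    using f g finite_subset unfolding graded_dual_def linear_on_def by (auto simp: algebra_simps)
next
  fix c and f assume f: "f \<in> graded_dual sc W C"
  have "{n. \<exists>z\<in>W \<inter> C n. scale_fun c f z \<noteq> 0} \<subseteq> {n. \<exists>z\<in>W \<inter> C n. f z \<noteq> 0}" by (auto simp: scale_fun_def)
  then show "scale_fun c f \<in> graded_dual sc W C"
    using f finite_subset unfolding graded_dual_def linear_on_def by (auto simp: algebra_simps scale_fun_def)
qed

context unstable_setup
begin

subsection \<open>Degrees\<close>

text \<open>The element is homogeneous of degree \<open>bel_deg\<close>, and the monomial of I, of
  degree \<open>seq_deg\<close>, occurs in it with nonzero coefficient.\<close>

lemma seq_deg_bel_deg:
  assumes I: "I \<in> admissible_sequences CARD('k) s n" "n \<ge> 0"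
    and b: "(seq_bel CARD('k) I :: 'k ambient) = bel s a J" "J \<subseteq> {..<s}"
  shows "bel_deg s a J TYPE('k) = seq_deg CARD('k) I"
proof (rule ccontr)
  assume ne: "bel_deg s a J TYPE('k) \<noteq> seq_deg CARD('k) I"
  have len: "length I = s" using I by (simp add: admissible_sequences_def)
  have "(seq_bel CARD('k) I :: 'k ambient) \<in> homog s (bel_deg s a J TYPE('k))"
    unfolding b(1) bel_deg_def by (rule homog_bel[OF b(2)])
  then have "uv_coeff (seq_bel CARD('k) I :: 'k ambient) (seq_monomial CARD('k) I) = 0"
    unfolding seq_monomial_eq len
  proof (rule uv_coeff_homog)
    show "Suc ` seq_J I \<subseteq> {1..s}" using Suc_seq_J[of I] len by simp
    show "udeg s (Suc ` seq_J I) (seq_v CARD('k) I) \<noteq> bel_deg s a J TYPE('k)"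
      using ne unfolding seq_deg_def len by simp
  qed
  then have "nu (seq_bel CARD('k) I) I = (0 :: 'k)" unfolding nu_uv_coeff by simp
  then show False using nu_seq_bel_diag[OF I] by blast
qed

text \<open>The element b is f L_s^((p-1)N/2) with f polynomial, and this power makes each
  coefficient of S_s(x) polynomial. The degree of the word acting on x cancels against that of its
  coefficient.\<close>

lemma tensor_degree_bel:
  assumes J: "J \<subseteq> {..<s}" "int (card J) + int N \<le> 2 * int (a 0)" and x: "x \<in> M (int N)"
  shows "act (bel s a J :: 'k ambient) (singer bock P s x) \<in> tensor_degree M s (bel_deg s a J TYPE('k) + int N)"
proof -
  obtain f :: "'k ambient" where f: "f \<in> P_degree s (bel_deg s a J TYPE('k) - int N * (int CARD('k) ^ s - 1))"
      "bel s a J = f * ext_const (dL s ^ ((CARD('k) - 1) div 2 * N))"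
    using bel_B_mod[of J s N a "odd N", OF J refl] by blast
  have "act (bel s a J :: 'k ambient) (singer bock P s x) =
      (\<Sum>I\<in>{I. length I = s \<and> steenrod_word bock P I x \<noteq> 0}.
         tens (bel s a J * singer_coef s I) (steenrod_word bock P I x))"
    by (subst singer_superset[OF finite_words]) (auto simp: act_sum)
  also have "\<dots> \<in> tensor_degree M s (bel_deg s a J TYPE('k) + int N)"
    unfolding tensor_degree_def
  proof (rule tv.span_sum, rule tv.span_base)
    fix I assume "I \<in> {I. length I = s \<and> steenrod_word bock P I x \<noteq> 0}"
    then have I: "length I = s" "steenrod_word bock P I x \<noteq> 0" by auto
    have pw: "(dL s :: 'k ratfun) powi (int ((CARD('k) - 1) div 2) * int N) = dL s ^ ((CARD('k) - 1) div 2 * N)"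
      by (simp only: of_nat_mult[symmetric] power_int_of_nat)
    have "ext_const (dL s ^ ((CARD('k) - 1) div 2 * N)) * (singer_coef s I :: 'k ambient)
        \<in> P_degree s (int N * int CARD('k) ^ s - int N - word_deg CARD('k) I)"
      using singer_coef_polynomial[OF I(1) x I(2)] unfolding pw .
    from P_degree_mult[OF f(1) this]
    have "f * (ext_const (dL s ^ ((CARD('k) - 1) div 2 * N)) * singer_coef s I)
        \<in> P_degree s (bel_deg s a J TYPE('k) - word_deg CARD('k) I)"
      by (rule back_subst[of "\<lambda>d. _ \<in> P_degree s d"]) (simp add: algebra_simps)
    then have "bel s a J * (singer_coef s I :: 'k ambient) \<in> P_degree s (bel_deg s a J TYPE('k) - word_deg CARD('k) I)"
      unfolding f(2) mult.assoc .
    moreover have "steenrod_word bock P I x \<in> M (int N + word_deg CARD('k) I)" using word_degree[OF x] .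
    ultimately show "tens (bel s a J * singer_coef s I :: 'k ambient) (steenrod_word bock P I x)
      \<in> {tens f m | f m c d. f \<in> P_degree s c \<and> m \<in> M d \<and> c + d = bel_deg s a J TYPE('k) + int N}"
      by - (rule CollectI, rule exI[of _ "bel s a J * singer_coef s I :: 'k ambient"], rule exI[of _ "steenrod_word bock P I x"],
          rule exI[of _ "bel_deg s a J TYPE('k) - word_deg CARD('k) I"], rule exI[of _ "int N + word_deg CARD('k) I"], simp)
  qed
  finally show ?thesis .
qed

lemma tensor_degree_gen:
  assumes I: "I \<in> admissible_sequences CARD('k) s n" "n \<ge> 0" and x: "x \<in> M n"
  shows "act (seq_bel CARD('k) I :: 'k ambient) (singer bock P s x) \<in> tensor_degree M s (seq_deg CARD('k) I + n)"
proof -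
  obtain N where N: "n = int N" using I(2) nonneg_int_cases by metis
  obtain a J where b: "(seq_bel CARD('k) I :: 'k ambient) = bel s a J" "J \<subseteq> {..<s}" "int (card J) + int N \<le> 2 * int (a 0)"
    using seq_bel_in[OF I, unfolded N] by (rule bel_set_cases)
  show ?thesis
    using tensor_degree_bel[of J s N a x, OF b(2,3)] x seq_deg_bel_deg[OF I b(1,2)] unfolding N b(1) by simp
qed

lemma kappa_degree:
  assumes l: "hfun n l" and z: "z \<in> tensor_degree M s N"
  shows "kappa l z \<in> P_degree s (N - n)"
proof -
  have K: "amb_linear (kappa l)" by (rule amb_linear_kappa) (rule hfun_add[OF l])
  show ?thesis
    using z unfolding tensor_degree_def
  proof (induction rule: tv.span_induct_alt)
    case base
    show ?case by (simp add: amb_linear_0[OF K] P_degree_zero)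
  next
    case (step c x y)
    then obtain f m a b where x: "x = tens f m" "f \<in> P_degree s a" "m \<in> M b" "a + b = N" by blast
    have kx: "kappa l x = scale_ambient (l m) f" unfolding x(1) by (rule kappa_tens) (rule hfun_add[OF l])
    have "kappa l x \<in> P_degree s (N - n)"
    proof (cases "b = n")
      case True
      then have "N - n = a" using x(4) by simp
      then show ?thesis unfolding kx using x(2) by (simp add: P_degree_scale)
    next
      case False
      then have "l m = 0" using l x(3) unfolding hfun_def by blast
      then show ?thesis unfolding kx by (simp add: P_degree_zero)
    qed
    then show ?case
      using step by (simp add: amb_linear_add[OF K] amb_linear_scale[OF K] P_degree_add P_degree_scale)
  qed
qed

subsection \<open>The represented functionals\<close>

lemma obtain_coordinate:
  assumes "hfun n l"
  obtains E :: "('k ambient, 'm) tensor \<Rightarrow> 'k ambient" where "amb_linear E"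
    "\<And>f x. E (act f (singer bock P s x)) = scale_ambient (l x) f"
    "\<And>z. (\<And>n' l'. hfun n' l' \<Longrightarrow> kappa l' z = 0) \<Longrightarrow> E z = 0"
  using coordinate_map[OF assms, of s] by blast

lemma represented_coordinate:
  assumes I: "length I = s"
    and E: "amb_linear E" "\<And>f x. E (act f (singer bock P s x)) = scale_ambient (l x) (f :: 'k ambient)"
    and z: "z \<in> singer_module bock P M s"
  shows "represented bock P M I l z = nu (E z) I" "E z \<in> uv_space s"
  using z singer_module_B_singer[of s] pairing_eq[OF I E, of z] coordinate_uv_space[OF E, of z]
  unfolding represented_def I by auto

lemma represented_linear:
  assumes l: "hfun n l" and I: "length I = s"
  shows "linear_on scale_tensor (*) (singer_module bock P M s) (represented bock P M I l)"
proof -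
  obtain E :: "('k ambient, 'm) tensor \<Rightarrow> 'k ambient" where E: "amb_linear E"
    "\<And>f x. E (act f (singer bock P s x)) = scale_ambient (l x) f" using obtain_coordinate[OF l] by metis
  note r = represented_coordinate[OF I E]
  have uv: "E z \<in> uv_space (length I)" if "z \<in> singer_module bock P M s" for z using r(2)[OF that] I by simp
  show ?thesis
    unfolding linear_on_def
  proof (intro conjI ballI allI)
    fix x y :: "('k ambient, 'm) tensor" assume xy: "x \<in> singer_module bock P M s" "y \<in> singer_module bock P M s"
    then have "x + y \<in> singer_module bock P M s" unfolding singer_module_eq by (rule tv.span_add)
    then show "represented bock P M I l (x + y) = represented bock P M I l x + represented bock P M I l y"
      using xy by (simp add: r(1) amb_linear_add[OF E(1)] nu_add uv)
  next
    fix c :: 'k and x :: "('k ambient, 'm) tensor" assume x: "x \<in> singer_module bock P M s"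
    then have "scale_tensor c x \<in> singer_module bock P M s" unfolding singer_module_eq by (rule tv.span_scale)
    then show "represented bock P M I l (scale_tensor c x) = c * represented bock P M I l x"
      using x by (simp add: r(1) amb_linear_scale[OF E(1)] nu_scale uv)
  qed
qed

lemma represented_gen:
  assumes l: "hfun n l" and I: "length I = s"
    and I': "I' \<in> admissible_sequences CARD('k) s n'" "n' \<ge> 0" "x \<in> M n'"
  shows "represented bock P M I l (act (seq_bel CARD('k) I') (singer bock P s x)) = l x * nu (seq_bel CARD('k) I') I"
proof -
  obtain E :: "('k ambient, 'm) tensor \<Rightarrow> 'k ambient" where E: "amb_linear E"
    "\<And>f x. E (act f (singer bock P s x)) = scale_ambient (l x) f" using obtain_coordinate[OF l] by metis
  have "act (seq_bel CARD('k) I') (singer bock P s x) \<in> (singer_module bock P M s :: ('k ambient, 'm) tensor set)"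
    unfolding singer_module_eq singer_gens_def using I' by (intro tv.span_base) blast
  from represented_coordinate(1)[OF I E this] show ?thesis
    using seq_bel_uv_space[OF I'(1,2)] I by (simp add: E(2) nu_scale)
qed

lemma singer_gensE:
  assumes "z \<in> singer_gens s"
  obtains I x n where "z = act (seq_bel CARD('k) I) (singer bock P s x)" "n \<ge> 0"
    "I \<in> admissible_sequences CARD('k) s n" "x \<in> M n"
  using assms unfolding singer_gens_def by blast

text \<open>The generators used to express z may have mixed degrees. Those of the wrong degree are
  killed by homogeneity of the entries nu_s(b_I')(lambda_I) and are collected in z1; it remains to
  see that the part z0 in degree |Q^I| + |l| contributes 0 as well.\<close>

lemma represented_degree:
  assumes l: "hfun n l" and I: "length I = s"
    and z: "z \<in> singer_module bock P M s" "z \<in> tensor_degree M s N" and N: "N \<noteq> seq_deg CARD('k) I + n"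
  shows "represented bock P M I l z = 0"
proof -
  let ?N = "seq_deg CARD('k) I + n"
  let ?C = "tensor_degree M s :: int \<Rightarrow> ('k ambient, 'm) tensor set"
  let ?W = "singer_module bock P M s :: ('k ambient, 'm) tensor set"
  obtain E :: "('k ambient, 'm) tensor \<Rightarrow> 'k ambient" where E: "amb_linear E"
    "\<And>f x. E (act f (singer bock P s x)) = scale_ambient (l x) f"
    "\<And>z. (\<And>n' l'. hfun n' l' \<Longrightarrow> kappa l' z = 0) \<Longrightarrow> E z = 0" using obtain_coordinate[OF l] by metis
  note lin = represented_linear[OF l I]
  have rep0: "represented bock P M I l 0 = 0"
    using linear_on_scale[OF lin[unfolded singer_module_eq] tv.span_zero, of 0] by simp
  have "\<exists>z0 z1. z = z0 + z1 \<and> z0 \<in> ?W \<and> z1 \<in> ?W \<and> z0 \<in> ?C ?N \<and> z1 \<in> tv.span (\<Union>b\<in>- {?N}. ?C b) \<and>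
      represented bock P M I l z1 = 0"
    using z(1) unfolding singer_module_eq
  proof (induction rule: tv.span_induct_alt)
    case base
    show ?case
      using rep0 by (intro exI[of _ 0]) (auto simp: tv.span_zero tensor_degree_def)
  next
    case (step c x y)
    obtain y0 y1 where y: "y = y0 + y1" "y0 \<in> tv.span (singer_gens s)" "y1 \<in> tv.span (singer_gens s)" "y0 \<in> ?C ?N"
      "y1 \<in> tv.span (\<Union>b\<in>- {?N}. ?C b)" "represented bock P M I l y1 = 0" using step(2) by blast
    obtain I' m n' where x: "x = act (seq_bel CARD('k) I') (singer bock P s m)" "n' \<ge> 0"
      "I' \<in> admissible_sequences CARD('k) s n'" "m \<in> M n'" using singer_gensE[OF step(1)] by metis
    have xd: "x \<in> ?C (seq_deg CARD('k) I' + n')" unfolding x(1) by (rule tensor_degree_gen[OF x(3,2,4)])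
    have xW: "x \<in> tv.span (singer_gens s)" using step(1) by (rule tv.span_base)
    show ?case
    proof (cases "seq_deg CARD('k) I' + n' = ?N")
      case True
      have "scale_tensor c x + y0 \<in> ?C ?N"
        using xd y(4) unfolding True tensor_degree_def by (intro tv.span_add tv.span_scale)
      moreover have "scale_tensor c x + y0 \<in> tv.span (singer_gens s)" using xW y(2) by (intro tv.span_add tv.span_scale)
      ultimately show ?thesis using y(1,3,5,6) by (intro exI[of _ "scale_tensor c x + y0"] exI[of _ y1]) (simp add: add.assoc)
    next
      case False
      have "represented bock P M I l x = l m * nu (seq_bel CARD('k) I') I"
        unfolding x(1) by (rule represented_gen[OF l I x(3,2,4)])
      also have "\<dots> = 0"
      proof (rule ccontr)
        assume "l m * nu (seq_bel CARD('k) I') I \<noteq> 0"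
        then have "l m \<noteq> 0" "nu (seq_bel CARD('k) I') I \<noteq> (0 :: 'k)" by auto
        then have "n' = n" "seq_deg CARD('k) I = seq_deg CARD('k) I'"
          using l x(4) nu_seq_bel_lower(2)[OF x(3,2) I] unfolding hfun_def by blast+
        then show False using False by simp
      qed
      finally have rx: "represented bock P M I l x = 0" .
      have sx: "scale_tensor c x \<in> tv.span (singer_gens s)" using xW by (rule tv.span_scale)
      have "represented bock P M I l (scale_tensor c x + y1) = 0"
        using linear_on_add[OF lin, unfolded singer_module_eq, OF sx y(3)]
          linear_on_scale[OF lin, unfolded singer_module_eq, OF xW, of c] rx y(6) by simp
      moreover have "scale_tensor c x + y1 \<in> tv.span (\<Union>b\<in>- {?N}. ?C b)"
        using xd False by (intro tv.span_add[OF tv.span_scale[OF tv.span_base] y(5)]) blast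
      moreover have "scale_tensor c x + y1 \<in> tv.span (singer_gens s)" using sx y(3) by (rule tv.span_add)
      ultimately show ?thesis
        using y(1,2,4) by (intro exI[of _ y0] exI[of _ "scale_tensor c x + y1"]) (simp add: ac_simps)
    qed
  qed
  then obtain z0 z1 where zz: "z = z0 + z1" "z0 \<in> ?W" "z1 \<in> ?W" "z0 \<in> ?C ?N" "z1 \<in> tv.span (\<Union>b\<in>- {?N}. ?C b)"
      "represented bock P M I l z1 = 0" by blast
  \<comment> \<open>The part z0 lies in degree ?N, and as z - z1 also in the span of the other
    degrees. The comparison takes place after contraction, where the degrees of P_s are known to be
    independent.\<close>
  have "kappa l' z0 = 0" if l': "hfun n' l'" for n' l'
  proof (rule P_degree_independent)
    have K: "amb_linear (kappa l')" by (rule amb_linear_kappa) (rule hfun_add[OF l'])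
    show "kappa l' z0 \<in> P_degree s (?N - n')" by (rule kappa_degree[OF l' zz(4)])
    let ?Q = "\<Union>b\<in>- {?N - n'}. P_degree s b :: 'k ambient set"
    have hom: "kappa l' x \<in> amb.span ?Q" if "x \<in> ?C b" "b \<noteq> ?N" for x b
      using kappa_degree[OF l' that(1)] that(2) by (intro amb.span_base UN_I[of "b - n'"]) auto
    have "kappa l' z1 \<in> amb.span ?Q"
      using zz(5)
    proof (induction rule: tv.span_induct_alt)
      case base
      show ?case by (simp add: amb_linear_0[OF K] amb.span_zero)
    next
      case (step c x y)
      then have "kappa l' x \<in> amb.span ?Q" using hom by blast
      then show ?case
        using step(2) by (simp add: amb_linear_add[OF K] amb_linear_scale[OF K] amb.span_add amb.span_scale)
    qed
    moreover have "kappa l' z \<in> amb.span ?Q" by (rule hom[OF z(2) N])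
    moreover have "kappa l' z0 = kappa l' z - kappa l' z1" unfolding zz(1) by (simp add: amb_linear_add[OF K])
    ultimately show "kappa l' z0 \<in> amb.span ?Q" by (simp add: amb.span_diff)
  qed
  then have "E z0 = 0" by (rule E(3))
  then have "represented bock P M I l z0 = 0"
    using represented_coordinate(1)[OF I E(1,2) zz(2)] represented_coordinate(1)[OF I E(1,2), of 0] rep0
    unfolding singer_module_eq by (simp add: amb_linear_0[OF E(1)] tv.span_zero)
  then show ?thesis
    using linear_on_add[OF lin zz(2,3)] zz(6) unfolding zz(1) by simp
qed

lemma represented_in_singer_dual:
  assumes l: "hfun n l" and I: "length I = s"
  shows "represented bock P M I l \<in> singer_dual bock P M s"
proof -
  have "{N. \<exists>z\<in>singer_module bock P M s \<inter> tensor_degree M s N. represented bock P M I l z \<noteq> 0} \<subseteq> {seq_deg CARD('k) I + n}"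
    using represented_degree[OF l I] by blast
  then have "finite {N. \<exists>z\<in>singer_module bock P M s \<inter> tensor_degree M s N. represented bock P M I l z \<noteq> 0}"
    by (rule finite_subset) simp
  moreover have "represented bock P M I l z = 0" if "z \<notin> singer_module bock P M s" for z
    using that by (simp add: represented_def I)
  ultimately show ?thesis
    unfolding singer_dual_def graded_dual_def using represented_linear[OF l I] by blast
qed

lemma hfun_subspace: "fs.subspace {l. hfun n l}"
  by (rule fs.subspaceI) (auto simp: hfun_def linear_on_def scale_fun_def algebra_simps)

lemma represented_combination:
  assumes l: "hfun n l" "hfun n l'" and I: "length I = s"
  shows "represented bock P M I (scale_fun c l + l') = scale_fun c (represented bock P M I l) + represented bock P M I l'"
proof
  fix z
  have h: "hfun n (scale_fun c l + l')"
    using fs.subspace_add[OF hfun_subspace fs.subspace_scale[OF hfun_subspace]] l by blast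
  show "represented bock P M I (scale_fun c l + l') z =
      (scale_fun c (represented bock P M I l) + represented bock P M I l') z"
  proof (cases "z \<in> singer_module bock P M s")
    case True
    let ?f = "represented bock P M I (scale_fun c l + l')"
    let ?g = "scale_fun c (represented bock P M I l) + represented bock P M I l'"
    have lf: "linear_on scale_tensor (*) (tv.span (singer_gens s)) ?f"
      using represented_linear[OF h I] unfolding singer_module_eq .
    have lg: "linear_on scale_tensor (*) (tv.span (singer_gens s)) ?g"
      using represented_linear[OF l(1) I] represented_linear[OF l(2) I] unfolding singer_module_eq
      by (simp add: linear_on_def scale_fun_def algebra_simps)
    show ?thesis
    proof (rule linear_on_unique[OF lf lg])
      show "z \<in> tv.span (singer_gens s)" using True unfolding singer_module_eq .
      fix y assume "y \<in> singer_gens s"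
      then obtain I' m n' where y: "y = act (seq_bel CARD('k) I') (singer bock P s m)" "n' \<ge> 0"
        "I' \<in> admissible_sequences CARD('k) s n'" "m \<in> M n'" by (rule singer_gensE)
      show "?f y = ?g y"
        unfolding y(1) plus_fun_apply scale_fun_def represented_gen[OF l(1) I y(3,2,4)] represented_gen[OF l(2) I y(3,2,4)]
          represented_gen[OF h[unfolded scale_fun_def] I y(3,2,4)]
        by (simp add: algebra_simps)
    qed
  next
    case False
    then show ?thesis by (simp add: represented_def I scale_fun_def)
  qed
qed

end

context unstable_setup
begin

subsection \<open>Linear independence\<close>

text \<open>Let I0 be minimal among the sequences that occur. By triangularity, evaluation on b_{I0}
  S_s(x) kills all terms with I different from I0, and a relation between the functionals paired
  with I0 remains; these are independent as elements of B.\<close>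

lemma represented_independent:
  assumes B: "\<not> fs.dependent B"
    and S: "\<And>I l. (I, l) \<in> S \<Longrightarrow> l \<in> B \<and> (\<exists>n\<ge>0. hfun n l \<and> I \<in> admissible_sequences CARD('k) s n)"
    and T: "finite T" "T \<subseteq> S" and sum: "(\<Sum>t\<in>T. scale_fun (c t) (case t of (I, l) \<Rightarrow> represented bock P M I l)) = 0"
    and t: "t \<in> T"
  shows "c t = 0"
proof (rule ccontr)
  assume ct: "c t \<noteq> 0"
  define T' where "T' = {t \<in> T. c t \<noteq> 0}"
  have "t \<in> T'" using t ct by (simp add: T'_def)
  then have T': "finite T'" "T' \<noteq> {}" using T(1) unfolding T'_def by (simp, blast)
  obtain t0 where t0: "t0 \<in> T'" "\<forall>t\<in>T'. \<not> ltv s (seq_v CARD('k) (fst t)) (seq_v CARD('k) (fst t0))"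
    using ltv_minimal_element(1)[OF T', of s "\<lambda>t. seq_v CARD('k) (fst t)"] by blast
  obtain I0 l0 where I0: "t0 = (I0, l0)" by (cases t0)
  have S': "l \<in> B \<and> (\<exists>n\<ge>0. hfun n l \<and> I \<in> admissible_sequences CARD('k) s n)" if "(I, l) \<in> T'" for I l
    using S[of I l] T(2) that unfolding T'_def by blast
  obtain n0 where n0: "n0 \<ge> 0" "I0 \<in> admissible_sequences CARD('k) s n0"
    using S'[of I0 l0] t0(1) I0 by blast
  define L where "L = {l. (I0, l) \<in> T'}"
  have finL: "finite L"
  proof -
    have "L \<subseteq> snd ` T'" unfolding L_def by force
    then show ?thesis using T'(1) finite_subset by blast
  qed
  have hom: "(\<Sum>l\<in>L. c (I0, l) * l x) = 0" if x: "x \<in> M n" for n x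
  proof (cases "n \<ge> 0 \<and> I0 \<in> admissible_sequences CARD('k) s n")
    case True
    let ?z = "act (seq_bel CARD('k) I0) (singer bock P s x) :: ('k ambient, 'm) tensor"
    have val: "c t * (case t of (I, l) \<Rightarrow> represented bock P M I l) ?z
        = (if t \<in> T' \<and> fst t = I0 then c t * snd t x * nu (seq_bel CARD('k) I0) I0 else 0)" if t: "t \<in> T" for t
    proof (cases "c t = 0")
      case True
      then show ?thesis by (simp add: T'_def)
    next
      case False
      then have tT: "t \<in> T'" using t by (simp add: T'_def)
      obtain I l where Il: "t = (I, l)" by (cases t)
      obtain m where m: "hfun m l" "I \<in> admissible_sequences CARD('k) s m" using S'[of I l] tT Il by blast
      have len: "length I = s" using m(2) by (simp add: admissible_sequences_def)
      have r: "represented bock P M I l ?z = l x * nu (seq_bel CARD('k) I0) I"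
        using represented_gen[OF m(1) len, of I0 n x] True x by blast
      have "nu (seq_bel CARD('k) I0) I = (0 :: 'k)" if "I \<noteq> I0"
        using nu_seq_bel_lower(1)[of I0 s n I] True len t0(2) tT Il I0 that by fastforce
      then show ?thesis using tT Il r by auto
    qed
    have "0 = (\<Sum>t\<in>T. scale_fun (c t) (case t of (I, l) \<Rightarrow> represented bock P M I l)) ?z"
      using sum by simp
    also have "\<dots> = (\<Sum>t\<in>T. c t * (case t of (I, l) \<Rightarrow> represented bock P M I l) ?z)"
      by (simp add: sum_apply scale_fun_def)
    also have "\<dots> = (\<Sum>t\<in>T. if t \<in> T' \<and> fst t = I0 then c t * snd t x * nu (seq_bel CARD('k) I0) I0 else 0)"
      by (rule sum.cong[OF refl val])
    also have "\<dots> = (\<Sum>t\<in>Pair I0 ` L. c t * snd t x * nu (seq_bel CARD('k) I0) I0)"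
      using T(1) by (intro sum.mono_neutral_cong_right) (auto simp: L_def T'_def)
    also have "\<dots> = (\<Sum>l\<in>L. c (I0, l) * l x) * nu (seq_bel CARD('k) I0) I0"
      by (subst sum.reindex) (auto simp: inj_on_def sum_distrib_right)
    finally show ?thesis using nu_seq_bel_diag[OF n0(2,1)] by simp
  next
    case False
    \<comment> \<open>Here b_{I0} S_s(x) need not lie in \<R>_sM. But I0 has excess at least the
      degree of every l in L, so n is not this degree and l vanishes on x.\<close>
    have "l x = 0" if l: "l \<in> L" for l
    proof -
      obtain m where m: "m \<ge> 0" "hfun m l" "I0 \<in> admissible_sequences CARD('k) s m"
        using S'[of I0 l] l unfolding L_def by blast
      then have "n \<noteq> m" using False by blast
      then show ?thesis using m(2) x unfolding hfun_def by blast
    qed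
    then show ?thesis by (intro sum.neutral) simp
  qed
  have hL: "\<exists>n. hfun n l" if "l \<in> L" for l using S'[of I0 l] that unfolding L_def by blast
  have zero: "(\<Sum>l\<in>L. c (I0, l) * l x) = 0" for x
  proof (induction x rule: M_induct)
    case zero
    have "l 0 = 0" if "l \<in> L" for l using hL[OF that] hfun_0 by blast
    then show ?case by (intro sum.neutral) simp
  next
    case (homogeneous n x)
    then show ?case by (rule hom)
  next
    case (add x y)
    have hadd: "l (x + y) = l x + l y" if "l \<in> L" for l using hL[OF that] hfun_add by blast
    have "(\<Sum>l\<in>L. c (I0, l) * l (x + y)) = (\<Sum>l\<in>L. c (I0, l) * l x + c (I0, l) * l y)"
      by (rule sum.cong[OF refl]) (subst hadd; simp add: distrib_left)
    then show ?case using add by (simp add: sum.distrib)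
  qed
  have "(\<Sum>l\<in>L. scale_fun (c (I0, l)) l) = 0"
    by (rule ext) (simp add: sum_apply scale_fun_def zero)
  moreover have "L \<subseteq> B" using S' unfolding L_def by blast
  moreover have "l0 \<in> L" using t0(1) I0 by (simp add: L_def)
  ultimately have "c (I0, l0) = 0"
    using fs.independentD[OF B finL, of "\<lambda>l. c (I0, l)" l0] by blast
  then show False using t0(1) I0 by (simp add: T'_def)
qed

subsection \<open>Spanning\<close>

definition components :: "'m \<Rightarrow> int \<Rightarrow>\<^sub>0 'm" where
  "components x = (THE c. (\<forall>n. Poly_Mapping.lookup c n \<in> M n) \<and>
     x = (\<Sum>n\<in>Poly_Mapping.keys c. Poly_Mapping.lookup c n))"

lemma components: "Poly_Mapping.lookup (components x) n \<in> M n"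
    "x = (\<Sum>n\<in>Poly_Mapping.keys (components x). Poly_Mapping.lookup (components x) n)"
  using theI'[OF direct_sum[of x]] unfolding components_def by blast+

lemma components_unique: "(\<And>n. Poly_Mapping.lookup c n \<in> M n) \<Longrightarrow>
    x = (\<Sum>n\<in>Poly_Mapping.keys c. Poly_Mapping.lookup c n) \<Longrightarrow> components x = c"
  unfolding components_def using direct_sum[of x] by (intro the1_equality) auto

lemma components_add: "components (x + y) = components x + components y"
proof (rule components_unique)
  show "Poly_Mapping.lookup (components x + components y) n \<in> M n" for n
    unfolding lookup_add by (intro subspace_add homogeneous_subspace components)
  let ?S = "Poly_Mapping.keys (components x) \<union> Poly_Mapping.keys (components y)"
  have sup: "(\<Sum>n\<in>Poly_Mapping.keys c. Poly_Mapping.lookup c n) = (\<Sum>n\<in>?S. Poly_Mapping.lookup c n)"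
    if "Poly_Mapping.keys c \<subseteq> ?S" for c :: "int \<Rightarrow>\<^sub>0 'm"
    using that by (intro sum.mono_neutral_left) (auto simp: in_keys_iff)
  have "x + y = (\<Sum>n\<in>?S. Poly_Mapping.lookup (components x) n) + (\<Sum>n\<in>?S. Poly_Mapping.lookup (components y) n)"
    using components(2)[of x] components(2)[of y] sup[of "components x"] sup[of "components y"] by simp
  also have "\<dots> = (\<Sum>n\<in>?S. Poly_Mapping.lookup (components x + components y) n)"
    by (simp add: lookup_add sum.distrib)
  also have "\<dots> = (\<Sum>n\<in>Poly_Mapping.keys (components x + components y). Poly_Mapping.lookup (components x + components y) n)"
    by (rule sup[symmetric]) (rule Poly_Mapping.keys_add)
  finally show "x + y = (\<Sum>n\<in>Poly_Mapping.keys (components x + components y). Poly_Mapping.lookup (components x + components y) n)" .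
qed

lemma components_homogeneous: "x \<in> M n \<Longrightarrow> components x = Poly_Mapping.single n x"
  using subspace_0[OF homogeneous_subspace] by (intro components_unique) (auto simp: lookup_single when_def)

text \<open>A function additive on M n is extended by 0 to the other degrees. Scalars are multiples
  of 1, so additivity implies linearity.\<close>

lemma hfun_component:
  assumes "\<And>x y. x \<in> M n \<Longrightarrow> y \<in> M n \<Longrightarrow> l (x + y) = l x + (l y :: 'k)"
  shows "hfun n (\<lambda>x. l (Poly_Mapping.lookup (components x) n))"
proof -
  let ?h = "\<lambda>x. l (Poly_Mapping.lookup (components x) n)"
  have "l (0 + 0) = l 0 + l 0" using subspace_0[OF homogeneous_subspace[of n]] by (intro assms)
  then have "l 0 + 0 = l 0 + l 0" by (simp only: add_0_right)
  then have 0: "l 0 = 0" by (simp only: add_left_cancel)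
  have c0: "components 0 = 0"
    using components_unique[of 0 0] subspace_0[OF homogeneous_subspace] by simp
  have add: "?h (x + y) = ?h x + ?h y" for x y
    by (simp add: components_add lookup_add assms components(1))
  have "?h (scale c x) = c * ?h x" for c x
  proof -
    obtain j where c: "c = of_nat j" using surj_of_nat by blast
    show ?thesis unfolding c by (induction j) (simp_all add: scale_left_distrib add distrib_right c0 0)
  qed
  moreover have "?h x = 0" if "j \<noteq> n" "x \<in> M j" for j x
    using that by (simp add: components_homogeneous lookup_single when_def 0)
  ultimately show ?thesis unfolding hfun_def linear_on_def using add by simp
qed

section \<open>Finiteness of the set of sequences of bounded degree\<close>

lemma seq_deg_alt: "length I = s \<Longrightarrow>
  seq_deg CARD('k) I = (\<Sum>k<s. 2 * (int CARD('k) - 1) * int (snd (I ! k)) - of_bool (fst (I ! k)))"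
proof -
  assume len: "length I = s"
  have c: "int (card (seq_J I)) = (\<Sum>k<s. of_bool (fst (I ! k)))"
  proof -
    have "seq_J I = {k \<in> {..<s}. fst (I ! k)}" using len by (auto simp: seq_J_def)
    then show ?thesis by (simp add: of_bool_def sum.If_cases Int_def)
  qed
  have v: "(\<Sum>k=1..s. seq_v CARD('k) I k) = (\<Sum>k<s. (int CARD('k) - 1) * int (snd (I ! k)) - of_bool (fst (I ! k)))"
    by (rule sum.reindex_bij_witness[of _ Suc "\<lambda>k. k - 1"]) (auto simp: seq_v_def)
  have "card (Suc ` seq_J I) = card (seq_J I)" by (simp add: card_image)
  then show ?thesis
    unfolding seq_deg_def udeg_def len v
    by (simp only: c sum_distrib_left flip: sum.distrib) (rule sum.cong, auto simp: algebra_simps)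
qed

text \<open>A letter with \<epsilon> = 1 has i \<ge> 1, so every summand of the degree is at least i
  and none is negative.\<close>

lemma seq_deg_bound:
  assumes I: "length I = s" "lambda_sequence I" and k: "k < s"
  shows "int (snd (I ! k)) \<le> seq_deg CARD('k) I"
proof -
  have le: "int (snd (I ! j)) \<le> 2 * (int CARD('k) - 1) * int (snd (I ! j)) - of_bool (fst (I ! j))" if "j < s" for j
  proof -
    have m: "I ! j \<in> set I" using that I(1) by simp
    have "fst (I ! j) \<Longrightarrow> snd (I ! j) \<ge> 1" using I(2) m unfolding lambda_sequence_def by (cases "I ! j") fastforce
    then have e: "(of_bool (fst (I ! j)) :: int) \<le> int (snd (I ! j))" by (cases "fst (I ! j)") auto
    have "2 * int (snd (I ! j)) \<le> (2 * (int CARD('k) - 1)) * int (snd (I ! j))"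
      using card_ge_3 by (intro mult_right_mono) auto
    then show ?thesis using e by linarith
  qed
  have "int (snd (I ! k)) \<le> 2 * (int CARD('k) - 1) * int (snd (I ! k)) - of_bool (fst (I ! k))" by (rule le[OF k])
  also have "\<dots> \<le> (\<Sum>k<s. 2 * (int CARD('k) - 1) * int (snd (I ! k)) - of_bool (fst (I ! k)))"
    using k order_trans[OF of_nat_0_le_iff le] by (intro member_le_sum) auto
  finally show ?thesis using seq_deg_alt[OF I(1)] by simp
qed

lemma seq_deg_nonneg: "length I = s \<Longrightarrow> lambda_sequence I \<Longrightarrow> seq_deg CARD('k) I \<ge> 0"
proof (cases "s = 0")
  case True
  assume "length I = s"
  then show ?thesis using seq_deg_alt[of I s] True by simp
next
  case False
  assume "length I = s" "lambda_sequence I"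
  then show ?thesis using seq_deg_bound[of I s 0] False by force
qed

lemma finite_seq_deg: "finite {I. length I = s \<and> lambda_sequence I \<and> seq_deg CARD('k) I \<le> N}"
proof (rule finite_subset)
  show "{I. length I = s \<and> lambda_sequence I \<and> seq_deg CARD('k) I \<le> N} \<subseteq>
    {I. set I \<subseteq> (UNIV :: bool set) \<times> {..nat N} \<and> length I = s}"
  proof
    fix I assume I: "I \<in> {I. length I = s \<and> lambda_sequence I \<and> seq_deg CARD('k) I \<le> N}"
    have "y \<in> UNIV \<times> {..nat N}" if y: "y \<in> set I" for y
    proof -
      obtain k where k: "k < s" "y = I ! k" using y I by (auto simp: in_set_conv_nth)
      have "int (snd y) \<le> N" using seq_deg_bound[of I s k] I k by force
      then show ?thesis by (cases y) simp
    qed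
    then show "I \<in> {I. set I \<subseteq> (UNIV :: bool set) \<times> {..nat N} \<and> length I = s}" using I by auto
  qed
  show "finite {I. set I \<subseteq> (UNIV :: bool set) \<times> {..nat N} \<and> length I = s}"
    by (rule finite_lists_length_eq) simp
qed

text \<open>Elements of other degrees may be dropped from an expansion of h: they vanish on M n, and
  in the remaining degrees h and the retained elements vanish.\<close>

lemma hfun_span:
  assumes B: "homogeneous_basis scale M B" and h: "hfun n h"
  shows "h \<in> fs.span (B \<inter> {l. hfun n l})"
proof -
  have span: "fs.span B = graded_dual scale UNIV M" using B unfolding homogeneous_basis_def is_basis_def by blast
  have "{j. \<exists>z\<in>UNIV \<inter> M j. h z \<noteq> 0} \<subseteq> {n}" using h unfolding hfun_def by blast
  then have "finite {j. \<exists>z\<in>UNIV \<inter> M j. h z \<noteq> 0}" by (rule finite_subset) simp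
  then have "h \<in> fs.span B" unfolding span graded_dual_def using h by (simp add: hfun_def)
  then obtain T c where T: "finite T" "T \<subseteq> B" "h = (\<Sum>l\<in>T. scale_fun (c l) l)"
    unfolding fs.span_explicit by blast
  have hB: "\<exists>j. hfun j l" if "l \<in> T" for l
    using B T(2) that unfolding homogeneous_basis_def dual_degree_def graded_dual_def hfun_def by fastforce
  have hx: "h x = (\<Sum>l\<in>T. c l * l x)" for x unfolding T(3) by (simp add: sum_apply scale_fun_def)
  have "h x = (\<Sum>l\<in>T \<inter> {l. hfun n l}. c l * l x)" for x
  proof (induction x rule: M_induct)
    case zero
    have "l 0 = 0" if "l \<in> T" for l using hB[OF that] hfun_0 by blast
    then have "(\<Sum>l\<in>T \<inter> {l. hfun n l}. c l * l 0) = 0" by (intro sum.neutral) simp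
    then show ?case using hfun_0[OF h] by simp
  next
    case (homogeneous j x)
    show ?case
    proof (cases "j = n")
      case True
      have "l x = 0" if lT: "l \<in> T - {l. hfun n l}" for l
      proof -
        obtain j' where j': "hfun j' l" using hB[of l] lT by blast
        then have "n \<noteq> j'" using lT by blast
        then show ?thesis using j' homogeneous True unfolding hfun_def by blast
      qed
      then show ?thesis unfolding hx using T(1) by (intro sum.mono_neutral_right) auto
    next
      case False
      then have "h x = 0" "\<And>l. hfun n l \<Longrightarrow> l x = 0" using h homogeneous unfolding hfun_def by blast+
      moreover have "(\<Sum>l\<in>T \<inter> {l. hfun n l}. c l * l x) = 0"
        using calculation(2) by (intro sum.neutral) simp
      ultimately show ?thesis by simp
    qed
  next
    case (add x y)
    have hadd: "l (x + y) = l x + l y" if "l \<in> T" for l using hB[OF that] hfun_add by blast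
    have "(\<Sum>l\<in>T \<inter> {l. hfun n l}. c l * l (x + y)) = (\<Sum>l\<in>T \<inter> {l. hfun n l}. c l * l x + c l * l y)"
      by (rule sum.cong[OF refl]) (subst hadd; simp add: distrib_left)
    then show ?case using add by (simp add: hfun_add[OF h] sum.distrib)
  qed
  then have "h = (\<Sum>l\<in>T \<inter> {l. hfun n l}. scale_fun (c l) l)"
    by (intro ext) (simp add: sum_apply scale_fun_def)
  also have "\<dots> \<in> fs.span (B \<inter> {l. hfun n l})"
    using T(2) by (intro fs.span_sum fs.span_scale fs.span_base) blast
  finally show ?thesis .
qed

lemma represented_span:
  assumes h: "h \<in> fs.span Y" and Y: "\<And>l. l \<in> Y \<Longrightarrow> hfun n l" and I: "length I = s"
  shows "represented bock P M I h \<in> fs.span (represented bock P M I ` Y)"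
proof -
  have "hfun n h \<and> represented bock P M I h \<in> fs.span (represented bock P M I ` Y)"
    using h
  proof (induction rule: fs.span_induct_alt)
    case base
    have 0: "hfun n 0" using fs.subspace_0[OF hfun_subspace] by blast
    have "represented bock P M I (0 :: 'm \<Rightarrow> 'k) = 0"
      using represented_combination[OF 0 0 I, of "- 1"] by (simp add: fs.scale_minus_left)
    then show ?case using 0 by (auto simp only: intro: fs.span_zero)
  next
    case (step c x y)
    have hx: "hfun n x" and hy: "hfun n y" using Y step by auto
    have "hfun n (scale_fun c x + y)"
      using fs.subspace_add[OF hfun_subspace fs.subspace_scale[OF hfun_subspace]] hx hy by blast
    then show ?case
      unfolding represented_combination[OF hx hy I]
      using fs.span_add[OF fs.span_scale[OF fs.span_base[OF imageI[OF step(1)]]] conjunct2[OF step(2)]] 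
      by (intro conjI) blast+
  qed
  then show ?thesis ..
qed

text \<open>For each n, functionals h_I of degree n are sought with \<Sum> nu_s(b_I')(lambda_I) h_I
  equal to x \<mapsto> \<phi>(b_I' S_s(x)). Since \<phi> lives in finitely many degrees, only
  finitely many n and I matter, and the system is triangular. Its unknowns are functionals, so it is
  finite even if M n has infinite dimension.\<close>

lemma singer_dual_span:
  assumes B: "homogeneous_basis scale M B" and \<phi>: "\<phi> \<in> singer_dual bock P M s"
    and S: "\<And>I l n. l \<in> B \<Longrightarrow> hfun n l \<Longrightarrow> I \<in> admissible_sequences CARD('k) s n \<Longrightarrow> (I, l) \<in> S"
  shows "\<phi> \<in> fs.span ((\<lambda>(I, l). represented bock P M I l) ` S)"
proof -
  let ?W = "singer_module bock P M s :: ('k ambient, 'm) tensor set"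
  let ?gen = "\<lambda>I x. act (seq_bel CARD('k) I) (singer bock P s x) :: ('k ambient, 'm) tensor"
  define F where "F = {N. \<exists>z\<in>?W \<inter> tensor_degree M s N. \<phi> z \<noteq> 0}"
  have lin: "linear_on scale_tensor (*) ?W \<phi>" and out: "\<And>z. z \<notin> ?W \<Longrightarrow> \<phi> z = 0" and fin: "finite F"
    using \<phi> unfolding singer_dual_def graded_dual_def F_def by blast+
  \<comment> \<open>The element 0 keeps the maximum defined when F is empty.\<close>
  define Nmax where "Nmax = Max (insert 0 F)"
  have Nmax: "N \<le> Nmax" if "N \<in> F" for N unfolding Nmax_def using fin that by simp
  define X where "X n = {I \<in> admissible_sequences CARD('k) s n. seq_deg CARD('k) I + n \<in> F}" for n
  have genW: "?gen I x \<in> ?W" if "I \<in> admissible_sequences CARD('k) s n" "n \<ge> 0" "x \<in> M n" for I x n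
    using that unfolding singer_module_eq singer_gens_def by (intro tv.span_base) blast
  have len: "length I = s" if "I \<in> admissible_sequences CARD('k) s n" for I n
    using that by (simp add: admissible_sequences_def)
  have finX: "finite (X n)" if "n \<ge> 0" for n
  proof (rule finite_subset[OF _ finite_seq_deg[of s Nmax]])
    show "X n \<subseteq> {I. length I = s \<and> lambda_sequence I \<and> seq_deg CARD('k) I \<le> Nmax}"
      using Nmax that unfolding X_def admissible_sequences_def by fastforce
  qed
  have X0: "X n = {}" if "n > Nmax" for n
  proof -
    have "\<not> seq_deg CARD('k) I + n \<in> F" if I: "I \<in> admissible_sequences CARD('k) s n" for I
    proof
      assume "seq_deg CARD('k) I + n \<in> F"
      then have "seq_deg CARD('k) I + n \<le> Nmax" by (rule Nmax)
      moreover have "seq_deg CARD('k) I \<ge> 0" using seq_deg_nonneg[of I s] I by (simp add: admissible_sequences_def)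
      ultimately show False using \<open>n > Nmax\<close> by simp
    qed
    then show ?thesis unfolding X_def by blast
  qed
  \<comment> \<open>The right-hand side of the system, composed with the projection to degree n so
    that it is a functional on all of M.\<close>
  define g where "g n I x = \<phi> (?gen I (Poly_Mapping.lookup (components x) n))" for n I x
  have g: "hfun n (g n I)" if I: "I \<in> admissible_sequences CARD('k) s n" "n \<ge> 0" for n I
    unfolding g_def
  proof (rule hfun_component)
    fix x y assume xy: "x \<in> M n" "y \<in> M n"
    show "\<phi> (?gen I (x + y)) = \<phi> (?gen I x) + \<phi> (?gen I y)"
      unfolding singer_add act_add by (rule linear_on_add[OF lin genW[OF I xy(1)] genW[OF I xy(2)]])
  qed
  have "\<exists>h. (\<forall>I. hfun n (h I)) \<and> (\<forall>I\<in>X n. (\<Sum>I'\<in>X n. scale_fun (nu (seq_bel CARD('k) I) I') (h I')) = g n I)"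
    if n: "n \<ge> 0" for n
  proof -
    have "\<exists>h. (\<forall>I. h I \<in> {l. hfun n l}) \<and>
        (\<forall>I\<in>X n. (\<Sum>I'\<in>X n. scale_fun (nu (seq_bel CARD('k) I) I') (h I')) = g n I)"
    proof (rule triangular_solve[OF hfun_subspace finX[OF n], where v = "seq_v CARD('k)" and s = s])
      show "g n I \<in> {l. hfun n l}" if "I \<in> X n" for I using g that n unfolding X_def by blast
      show "nu (seq_bel CARD('k) I) I \<noteq> (0 :: 'k)" if "I \<in> X n" for I
        using nu_seq_bel_diag[of I s n] that n unfolding X_def by blast
      show "I' = I \<or> ltv s (seq_v CARD('k) I') (seq_v CARD('k) I)"
        if "I \<in> X n" "I' \<in> X n" "nu (seq_bel CARD('k) I) I' \<noteq> (0 :: 'k)" for I I'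
        using nu_seq_bel_lower(1)[of I s n I'] that n len unfolding X_def by blast
    qed
    then show ?thesis by simp
  qed
  then obtain h where h: "\<And>n I. n \<ge> 0 \<Longrightarrow> hfun n (h n I)"
      "\<And>n I. n \<ge> 0 \<Longrightarrow> I \<in> X n \<Longrightarrow> (\<Sum>I'\<in>X n. scale_fun (nu (seq_bel CARD('k) I) I') (h n I')) = g n I"
    by metis
  define \<Phi> where "\<Phi> = (\<Sum>n\<in>{0..Nmax}. \<Sum>I\<in>X n. represented bock P M I (h n I))"
  have \<Phi>_span: "\<Phi> \<in> fs.span ((\<lambda>(I, l). represented bock P M I l) ` S)"
    unfolding \<Phi>_def
  proof (intro fs.span_sum)
    fix n I assume n: "n \<in> {0..Nmax}" and I: "I \<in> X n"
    have hn: "hfun n (h n I)" using h(1) n by simp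
    have Iadm: "I \<in> admissible_sequences CARD('k) s n" using I by (simp add: X_def)
    have "represented bock P M I (h n I) \<in> fs.span (represented bock P M I ` (B \<inter> {l. hfun n l}))"
      by (rule represented_span[OF hfun_span[OF B hn] _ len[OF Iadm]]) blast
    moreover have "represented bock P M I ` (B \<inter> {l. hfun n l}) \<subseteq> (\<lambda>(I, l). represented bock P M I l) ` S"
      using S[OF _ _ Iadm] by force
    ultimately show "represented bock P M I (h n I) \<in> fs.span ((\<lambda>(I, l). represented bock P M I l) ` S)"
      using fs.span_mono by blast
  qed
  have \<Phi>_dual: "\<Phi> \<in> singer_dual bock P M s"
    unfolding \<Phi>_def singer_dual_def
  proof (intro fs.subspace_sum[OF graded_dual_subspace])
    fix n I assume n: "n \<in> {0..Nmax}" and I: "I \<in> X n"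
    then have "hfun n (h n I)" "length I = s" using h(1) len by (auto simp: X_def)
    then show "represented bock P M I (h n I) \<in>
        graded_dual scale_tensor (singer_module bock P M s) (tensor_degree M s)"
      using represented_in_singer_dual unfolding singer_dual_def by blast
  qed
  have gen: "\<Phi> (?gen I' x) = \<phi> (?gen I' x)" if I': "I' \<in> admissible_sequences CARD('k) s n'" "n' \<ge> 0" "x \<in> M n'" for I' x n'
  proof -
    have "\<Phi> (?gen I' x) = (\<Sum>n\<in>{0..Nmax}. \<Sum>I\<in>X n. represented bock P M I (h n I) (?gen I' x))"
      unfolding \<Phi>_def by (simp add: sum_apply)
    also have "\<dots> = (\<Sum>n\<in>{0..Nmax}. \<Sum>I\<in>X n. h n I x * nu (seq_bel CARD('k) I') I)"
    proof (intro sum.cong refl)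
      fix n I assume n: "n \<in> {0..Nmax}" and I: "I \<in> X n"
      have "hfun n (h n I)" "length I = s" using h(1) n I len by (auto simp: X_def)
      then show "represented bock P M I (h n I) (?gen I' x) = h n I x * nu (seq_bel CARD('k) I') I"
        using represented_gen I' by blast
    qed
    also have "\<dots> = (\<Sum>n\<in>{0..Nmax}. if n = n' then \<Sum>I\<in>X n. h n I x * nu (seq_bel CARD('k) I') I else 0)"
    proof (intro sum.cong refl)
      fix n assume n: "n \<in> {0..Nmax}"
      show "(\<Sum>I\<in>X n. h n I x * nu (seq_bel CARD('k) I') I) =
          (if n = n' then \<Sum>I\<in>X n. h n I x * nu (seq_bel CARD('k) I') I else 0)"
      proof (cases "n = n'")
        case False
        have "hfun n (h n I)" for I using h(1) n by simp
        then have "h n I x = 0" for I using I'(3) False unfolding hfun_def by metis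
        then show ?thesis using False by simp
      qed simp
    qed
    also have "\<dots> = (\<Sum>I\<in>X n'. h n' I x * nu (seq_bel CARD('k) I') I)"
      using X0[of n'] I'(2) by (cases "n' \<le> Nmax") (auto simp: sum.delta)
    also have "\<dots> = \<phi> (?gen I' x)"
    proof (cases "I' \<in> X n'")
      case True
      have "(\<Sum>I\<in>X n'. h n' I x * nu (seq_bel CARD('k) I') I) =
          (\<Sum>I\<in>X n'. scale_fun (nu (seq_bel CARD('k) I') I) (h n' I)) x"
        by (simp add: sum_apply scale_fun_def mult.commute)
      also have "\<dots> = g n' I' x" using h(2)[OF I'(2) True] by simp
      also have "\<dots> = \<phi> (?gen I' x)" unfolding g_def using I'(3) by (simp add: components_homogeneous)
      finally show ?thesis .
    next
      case False
      \<comment> \<open>Outside the degrees in F both sides vanish: \<phi> by the choice of F, and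
        the sum because a nonzero entry would give I the degree of I'.\<close>
      then have nF: "seq_deg CARD('k) I' + n' \<notin> F" using I'(1) by (simp add: X_def)
      have "nu (seq_bel CARD('k) I') I = (0 :: 'k)" if I: "I \<in> X n'" for I
      proof (rule ccontr)
        assume "nu (seq_bel CARD('k) I') I \<noteq> (0 :: 'k)"
        then have "seq_deg CARD('k) I = seq_deg CARD('k) I'"
          using nu_seq_bel_lower(2)[OF I'(1,2), of I] len I unfolding X_def by blast
        then show False using I nF by (simp add: X_def)
      qed
      moreover have "\<phi> (?gen I' x) = 0"
        using nF genW[OF I'] tensor_degree_gen[OF I'] unfolding F_def by blast
      ultimately show ?thesis by simp
    qed
    finally show ?thesis .
  qed
  have "\<Phi> = \<phi>"
  proof
    fix z
    have lin': "linear_on scale_tensor (*) ?W \<Phi>" and out': "z \<notin> ?W \<Longrightarrow> \<Phi> z = 0"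
      using \<Phi>_dual unfolding singer_dual_def graded_dual_def by blast+
    show "\<Phi> z = \<phi> z"
    proof (cases "z \<in> ?W")
      case True
      show ?thesis
      proof (rule linear_on_unique[OF lin'[unfolded singer_module_eq] lin[unfolded singer_module_eq]])
        show "z \<in> tv.span (singer_gens s)" using True unfolding singer_module_eq .
        show "\<Phi> y = \<phi> y" if "y \<in> singer_gens s" for y
          using that gen by (elim singer_gensE) simp
      qed
    next
      case False
      then show ?thesis using out out' by simp
    qed
  qed
  then show ?thesis using \<Phi>_span by simp
qed

end

theorem proposition4p8:
  fixes p s :: nat
    and scale :: "'k::field \<Rightarrow> 'm::ab_group_add \<Rightarrow> 'm"
    and M :: "int \<Rightarrow> 'm set"
    and bock :: "'m \<Rightarrow> 'm" and P :: "nat \<Rightarrow> 'm \<Rightarrow> 'm"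
    and B :: "('m \<Rightarrow> 'k) set"
  assumes "prime p" and "odd p" and "CARD('k) = p"
    and "unstable_module scale M bock P"
    and "homogeneous_basis scale M B"
  shows "let M_dual = graded_dual scale UNIV M;
             S = {(I, l). \<exists>n. l \<in> B \<inter> dual_degree M_dual M n \<and> I \<in> admissible_sequences p s n}
         in inj_on (\<lambda>(I, l). represented bock P M I l) S \<and>
            is_basis scale_fun (singer_dual bock P M s) ((\<lambda>(I, l). represented bock P M I l) ` S) \<and>
            (\<forall>\<rho>. identification bock P M s M_dual \<rho> \<longrightarrow>
               inj_on \<rho> ((\<lambda>(I, l). tens (Q_monomial I) l) ` S) \<and>
               is_basis scale_fun (singer_dual bock P M s)
                 (\<rho> ` (\<lambda>(I, l). tens (Q_monomial I) l) ` S))"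
proof -
  interpret unstable_setup scale M bock P
    using assms(1-4) by (auto simp: unstable_setup_def odd_prime_field_def)
  define D where "D = graded_dual scale UNIV M"
  define S where "S = {(I, l). \<exists>n. l \<in> B \<inter> dual_degree D M n \<and> I \<in> admissible_sequences p s n}"
  let ?r = "\<lambda>(I, l). represented bock P M I l"
  have indep: "\<not> fs.dependent B" using assms(5) unfolding homogeneous_basis_def is_basis_def by blast
  have BD: "B \<subseteq> D"
    using assms(5) fs.span_superset[of B] unfolding homogeneous_basis_def is_basis_def D_def by blast
  have deg: "l \<in> dual_degree D M n \<longleftrightarrow> hfun n l" if "l \<in> B" for l n
    using that BD unfolding dual_degree_def hfun_def D_def graded_dual_def by blast
  have S: "l \<in> B \<and> (\<exists>n\<ge>0. hfun n l \<and> I \<in> admissible_sequences CARD('k) s n)" if Il: "(I, l) \<in> S" for I l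
  proof -
    obtain n where n: "l \<in> B" "hfun n l" "I \<in> admissible_sequences CARD('k) s n"
      using Il deg unfolding S_def assms(3) by blast
    \<comment> \<open>As M vanishes in negative degrees, a functional of negative degree is 0 and
      cannot belong to a basis. The correspondence between the b_I and the sequences of excess at
      least n was established for n \<ge> 0.\<close>
    have "n \<ge> 0"
    proof (rule ccontr)
      assume neg: "\<not> n \<ge> 0"
      have "l x = 0" for x
      proof (induction x rule: M_induct)
        case (homogeneous j x)
        show ?case
        proof (cases "j = n")
          case True
          then show ?thesis using M_negative[OF homogeneous] neg hfun_0[OF n(2)] by simp
        next
          case False
          then show ?thesis using n(2) homogeneous unfolding hfun_def by blast
        qed
      qed (simp_all add: hfun_0[OF n(2)] hfun_add[OF n(2)])
      then have "l = 0" by (intro ext) simp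
      then show False using n(1) indep fs.dependent_zero by blast
    qed
    then show ?thesis using n by blast
  qed
  have ind: "c t = 0" if "finite T" "T \<subseteq> S" "(\<Sum>t\<in>T. scale_fun (c t) (?r t)) = 0" "t \<in> T" for T c t
    by (rule represented_independent[OF indep S that])
  have fam: "inj_on ?r S" "\<not> fs.dependent (?r ` S)"
    by (rule family_independent, rule ind, assumption+)+
  have sub: "?r ` S \<subseteq> singer_dual bock P M s"
  proof
    fix \<phi> :: "('k ambient, 'm) tensor \<Rightarrow> 'k" assume "\<phi> \<in> ?r ` S"
    then obtain I l where Il: "(I, l) \<in> S" "\<phi> = represented bock P M I l" by auto
    then obtain n where "hfun n l" "I \<in> admissible_sequences CARD('k) s n" using S by blast
    then show "\<phi> \<in> singer_dual bock P M s"
      using represented_in_singer_dual[of n l I s] Il(2) by (simp add: admissible_sequences_def)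
  qed
  have "fs.span (?r ` S) = singer_dual bock P M s"
  proof
    show "fs.span (?r ` S) \<subseteq> singer_dual bock P M s"
      using sub unfolding singer_dual_def by (rule fs.span_minimal[OF _ graded_dual_subspace])
    show "singer_dual bock P M s \<subseteq> fs.span (?r ` S)"
    proof
      fix \<phi> :: "('k ambient, 'm) tensor \<Rightarrow> 'k" assume \<phi>: "\<phi> \<in> singer_dual bock P M s"
      show "\<phi> \<in> fs.span (?r ` S)"
        by (rule singer_dual_span[OF assms(5) \<phi>]) (use deg assms(3) in \<open>auto simp: S_def\<close>)
    qed
  qed
  then have basis: "is_basis scale_fun (singer_dual bock P M s) (?r ` S)"
    using fam(2) unfolding is_basis_def by blast
  have "inj_on \<rho> ((\<lambda>(I, l). tens (Q_monomial I) l) ` S) \<and>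
      is_basis scale_fun (singer_dual bock P M s) (\<rho> ` (\<lambda>(I, l). tens (Q_monomial I) l) ` S)"
    if \<rho>: "identification bock P M s D \<rho>" for \<rho>
  proof -
    have eq: "\<rho> (tens (Q_monomial I) l) = represented bock P M I l" if Il: "(I, l) \<in> S" for I l
    proof -
      have "length I = s" "lambda_sequence I" "l \<in> D"
        using Il BD unfolding S_def admissible_sequences_def by auto
      then show ?thesis using \<rho> unfolding identification_def by blast
    qed
    have "\<rho> ` (\<lambda>(I, l). tens (Q_monomial I) l) ` S = ?r ` S"
      unfolding image_image by (rule image_cong[OF refl]) (auto simp: eq)
    moreover have "inj_on \<rho> ((\<lambda>(I, l). tens (Q_monomial I) l) ` S)"
    proof (rule inj_onI)
      fix a b assume "a \<in> (\<lambda>(I, l). tens (Q_monomial I) l) ` S" "b \<in> (\<lambda>(I, l). tens (Q_monomial I) l) ` S" "\<rho> a = \<rho> b"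
      then obtain t u where t: "t \<in> S" "a = (\<lambda>(I, l). tens (Q_monomial I) l) t" and u: "u \<in> S" "b = (\<lambda>(I, l). tens (Q_monomial I) l) u"
        and ab: "\<rho> a = \<rho> b" by blast
      have "?r t = ?r u" using t u ab eq by (cases t; cases u) auto
      then have "t = u" using fam(1) t(1) u(1) unfolding inj_on_def by blast
      then show "a = b" using t u by simp
    qed
    ultimately show ?thesis using basis by simp
  qed
  then show ?thesis
    using fam(1) basis unfolding Let_def D_def[symmetric] S_def[symmetric] by blast
qed

end
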